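(* Let $\mathcal F$ be a family of meromorphic functions in a domain $D\subset\mathbb{C}$. Let $a$ and $b$ be two complex numbers with $b\neq 0$, let $n\geq 0$ be an integer, and let $k\geq 1$, $n_1,\dots,n_k\geq 1$, $t_1,\dots,t_k\geq 1$ be integers. Suppose that for every $f\in\mathcal F$, $$f^{n+n_1+\dots+n_k}=a \iff f^n(f^{n_1})^{(t_1)}\cdots(f^{n_k})^{(t_k)}=b ,$$ i.e. the two equations have the same set of solutions in $D$ (ignoring multiplicity). (i) If $n_j\geq t_j$ for all $j=1,\dots,k$ and $n+\sum_{j=1}^{k}n_j\geq \sum_{j=1}^{k}t_j+3$, then $\mathcal F$ is a normal family in $D$. (ii) If $\mathcal F$ is a family of holomorphic functions in $D$, then $\mathcal F$ is a normal family in $D$ when the condition in (i) is replaced by one of the following conditions: - $k=1$, $n=0$, $n_1\geq t_1+1$; - ($n\geq 1$ or $k\geq 2$), $n_j\geq t_j$ for all $j=1,\dots,k$, and $n+\sum_{j=1}^{k}n_j\geq \sum_{j=1}^{k}t_j+2$.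
   Context: $(f^{m})^{(t)}$ denotes the $t$-th derivative of the power $f^m$. A family $\mathcal F$ of meromorphic functions in a domain $D\subset\mathbb{C}$ is normal in $D$ (in the sense of Montel) if every sequence $\{f_v\}\subset\mathcal F$ has a subsequence that converges spherically locally uniformly in $D$ (i.e. locally uniformly with respect to the spherical metric) to a meromorphic function or to $\infty$. *)

theory Defs
  imports "HOL-Complex_Analysis.Complex_Analysis"
begin

text \<open>
  The Riemann sphere is represented by \<^typ>\<open>complex option\<close>, with \<^const>\<open>None\<close> as the point at
  infinity. It is identified with the unit sphere of \<^typ>\<open>complex \<times> real\<close> by inverse stereographic
  projection from the north pole.
\<close>

type_synonym riemann_sphere = "complex option"

fun inv_stereographic :: "riemann_sphere \<Rightarrow> complex \<times> real" where
  "inv_stereographic None = (0, 1)"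
| "inv_stereographic (Some z) =
     (2 * z / of_real (1 + (cmod z)\<^sup>2), ((cmod z)\<^sup>2 - 1) / (1 + (cmod z)\<^sup>2))"

lemma norm_inv_stereographic [simp]: "norm (inv_stereographic p) = 1"
proof (cases p)
  case (Some z)
  define s where "s = (cmod z)\<^sup>2"
  have "s \<ge> 0"
    by (simp add: s_def)
  then have "cmod (of_real (1 + s)) = 1 + s"
    by (subst norm_of_real) simp
  then have "(cmod (2 * z / of_real (1 + s)))\<^sup>2 = 4 * s / (1 + s)\<^sup>2"
    by (simp add: norm_divide norm_mult power_divide power_mult_distrib s_def)
  moreover have "4 * s / (1 + s)\<^sup>2 + ((s - 1) / (1 + s))\<^sup>2 = 1"
    using \<open>s \<ge> 0\<close> by (simp add: power_divide divide_simps) (simp add: power2_eq_square algebra_simps)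
  ultimately show ?thesis
    using Some by (simp add: norm_Pair power_divide s_def)
qed (simp add: norm_Pair)

text \<open>
  Great-circle distance on the unit sphere, that is, the distance of the length element
  \<open>2 |dz| / (1 + |z|^2)\<close>.
\<close>

definition spherical_dist :: "riemann_sphere \<Rightarrow> riemann_sphere \<Rightarrow> real" where
  "spherical_dist p q = arccos (inv_stereographic p \<bullet> inv_stereographic q)"

text \<open>
  A meromorphic function is represented by a function that is \<open>nicely_meromorphic_on\<close> its domain:
  it is analytic away from its poles, and its value at a pole is the dummy value 0. The following
  function restores the value infinity at the poles.
\<close>

definition sphere_map :: "(complex \<Rightarrow> complex) \<Rightarrow> complex \<Rightarrow> riemann_sphere" where
  "sphere_map f z = (if is_pole f z then None else Some (f z))"

definition spherically_locally_uniform_limit ::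
    "complex set \<Rightarrow> (nat \<Rightarrow> complex \<Rightarrow> riemann_sphere) \<Rightarrow> (complex \<Rightarrow> riemann_sphere) \<Rightarrow> bool" where
  "spherically_locally_uniform_limit D f g \<longleftrightarrow>
     (\<forall>z\<in>D. \<exists>U. open U \<and> z \<in> U \<and> U \<subseteq> D \<and>
       (\<forall>e>0. \<forall>\<^sub>F v in sequentially. \<forall>w\<in>U. spherical_dist (f v w) (g w) < e))"

definition normal_family_on :: "(complex \<Rightarrow> complex) set \<Rightarrow> complex set \<Rightarrow> bool" where
  "normal_family_on \<F> D \<longleftrightarrow>
     (\<forall>f :: nat \<Rightarrow> complex \<Rightarrow> complex. range f \<subseteq> \<F> \<longrightarrow>
       (\<exists>r :: nat \<Rightarrow> nat. strict_mono r \<and>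
         ((\<exists>g. g nicely_meromorphic_on D \<and>
             spherically_locally_uniform_limit D (\<lambda>v. sphere_map (f (r v))) (sphere_map g)) \<or>
          spherically_locally_uniform_limit D (\<lambda>v. sphere_map (f (r v))) (\<lambda>_. None))))"

text \<open>
  The solutions in \<open>D\<close> of the equation \<open>g = c\<close>, where \<open>c\<close> is finite. The dummy value of \<open>g\<close>
  at a pole must not be counted.
\<close>

definition solutions :: "complex set \<Rightarrow> (complex \<Rightarrow> complex) \<Rightarrow> complex \<Rightarrow> complex set" where
  "solutions D g c = {z \<in> D. \<not> is_pole g z \<and> g z = c}"

end

theory Submission imports Defs begin

text \<open>
  Write \<open>P f = f^n (f^n_1)^(t_1) ... (f^n_k)^(t_k)\<close>, \<open>N = n + n_1 + ... + n_k\<close>, \<open>T = t_1 + ... + t_k\<close> and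
  \<open>\<alpha> = T / N\<close>. If the family is not normal, Zalcman's rescaling \<open>\<rho>^(-\<alpha>) f (z + \<rho> w)\<close> produces a
  nonconstant limit \<open>g\<close> on the whole plane all of whose translates are uniformly tame; since \<open>P\<close> is
  invariant under this rescaling and \<open>f^N = a\<close> wherever \<open>P f = b\<close>, while \<open>\<rho>^(-T) a\<close> is either 0 or
  tends to infinity, Hurwitz' theorem shows that \<open>P g\<close> omits \<open>b\<close>.

  Such a \<open>g\<close> does not exist. If \<open>g\<close> is entire, then it is of exponential type (Clunie--Hayman), so
  \<open>P g = b + e^(c z + d)\<close>, which is excluded by comparing zeros and growth. If \<open>g\<close> has poles, put
  \<open>U = (P g)' / (P g - b)\<close>. Since \<open>N - T \<ge> 3\<close>, the functions \<open>V1 = U / g\<close> and \<open>V2 = U / g^2\<close> are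
  entire. The logarithm of \<open>\<Theta> = |P g - b| / (1 + |g|^2)^((N+T)/2)\<close> is bounded above and has Laplacian
  bounded below, so \<open>\<Theta>\<close> cannot be too small on a whole disc of fixed radius; this bounds the
  logarithmic derivative \<open>U\<close> on suitable circles, and \<open>V1\<close>, \<open>V2\<close> turn out to be polynomials. Hence
  \<open>g = V1 / V2\<close> is rational, and the behaviour of \<open>U\<close> at infinity forces \<open>V1 = 0\<close>.
\<close>

section \<open>Zero-free functions\<close>

text \<open>\<open>P\<close> has degree \<open>N\<close> in the function and \<open>T\<close> in the
  differentiations, so \<open>T / N\<close> is the exponent that leaves it invariant; it is below 1
  because N > T. All that is known about the limit g is one radius d such that around every point g
  or 1/g is bounded by 2.

  The obstacle is the poles. Where g is finite, P g - b has no zeros; near a pole it is g^(N+T)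
  times a factor \<open>Y2\<close> that vanishes at a multiple pole, so the logarithmic derivative
  of \<open>Y2\<close> has no pointwise bound. It has one on circles avoiding the zeros, once their
  number is controlled by the size of \<open>Y2\<close> at one nearby point, which is what the lower
  bound for \<Theta> supplies. The maximum principle for the entire functions V1, V2 carries the
  estimate to the centre.

  The gap N - T >= 3 enters at zeros of g: (P g)' must be divisible by g^2 there.

  In the last step U = V1^2 / V2 tends to 0 at infinity, being the logarithmic derivative of a
  rational function. So deg V2 exceeds 2 deg V1, g tends to 0, and tameness of g then bounds V2,
  which is impossible for positive degree.\<close>

lemma Re_pos_schwarz_pick:
  assumes hol: "L holomorphic_on ball c r" and pos: "\<And>w. w \<in> ball c r \<Longrightarrow> 0 < Re (L w)"
    and z: "z \<in> ball c r"
  shows "norm (L z - L c) \<le> dist c z / r * norm (L z + cnj (L c))"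
proof -
  have r: "r > 0" using z by (metis ball_eq_empty empty_iff not_le)
  \<comment> \<open>The Cayley transform sending \<open>L c\<close> to 0 maps the right half-plane
    to the unit disc, so the Schwarz lemma applies to \<open>h\<close>.\<close>
  define h where "h = (\<lambda>w. (L (c + of_real r * w) - L c) / (L (c + of_real r * w) + cnj (L c)))"
  have in_ball: "c + of_real r * w \<in> ball c r" if "w \<in> ball 0 1" for w
    using that r by (auto simp: dist_norm norm_mult)
  have c: "0 < Re (L c)" using pos[of c] r by simp
  have nz: "L (c + of_real r * w) + cnj (L c) \<noteq> 0" if "w \<in> ball 0 1" for w
  proof
    assume "L (c + of_real r * w) + cnj (L c) = 0"
    then have "Re (L (c + of_real r * w)) + Re (L c) = 0"
      by (metis cnj.simps(1) plus_complex.simps(1) zero_complex.simps(1))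
    with pos[OF in_ball[OF that]] c show False by simp
  qed
  have "(\<lambda>w. L (c + of_real r * w)) holomorphic_on ball 0 1"
    using in_ball by (intro holomorphic_on_compose_gen[OF _ hol, unfolded o_def])
      (auto intro!: holomorphic_intros)
  then have holh: "h holomorphic_on ball 0 1"
    unfolding h_def using nz by (intro holomorphic_intros) auto
  have lt: "norm (h w) < 1" if "norm w < 1" for w
  proof -
    define x y where "x = L (c + of_real r * w)" and "y = L c"
    have x: "Re x > 0" and y: "Re y > 0"
      using pos[OF in_ball[of w]] that c by (auto simp: x_def y_def)
    have "(norm (x - y))\<^sup>2 < (norm (x + cnj y))\<^sup>2"
      using mult_pos_pos[OF x y] unfolding cmod_power2
      by (simp add: power2_eq_square algebra_simps)
    then have "norm (x - y) < norm (x + cnj y)"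
      by (rule power2_less_imp_less) simp
    then show ?thesis
      by (auto simp: h_def norm_divide x_def y_def divide_simps)
  qed
  define w where "w = (z - c) / of_real r"
  have w: "norm w < 1" "norm w = dist c z / r" "c + of_real r * w = z"
    using z r by (auto simp: w_def norm_divide dist_norm norm_minus_commute)
  have "norm (h w) \<le> norm w"
    by (rule Schwarz_Lemma(1)[OF holh _ lt w(1)]) (simp_all add: h_def)
  then have "norm (L z - L c) / norm (L z + cnj (L c)) \<le> dist c z / r"
    unfolding h_def w(3) norm_divide w(2) .
  moreover have "norm (L z + cnj (L c)) > 0" using nz[of w] w by auto
  ultimately show ?thesis by (simp add: pos_divide_le_eq)
qed

text \<open>Consequences of the Schwarz-Pick inequality. The sharp factor (1 - q) / (1 + q) matters
  for \<open>exponential_type\<close>, which uses it with q close to 1, where it decays only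
  linearly in 1 - q.\<close>

lemma Re_pos_harnack:
  assumes hol: "L holomorphic_on ball c r" and pos: "\<And>w. w \<in> ball c r \<Longrightarrow> 0 < Re (L w)"
    and z: "z \<in> ball c r" and q: "q = dist c z / r"
  shows "norm (L z - L c) \<le> 2 * q * Re (L c) / (1 - q)"
    and "Re (L z) \<ge> (1 - q) / (1 + q) * Re (L c)"
    and "Re (L z) \<le> (1 + q) / (1 - q) * Re (L c)"
proof -
  have r: "r > 0" using z by (metis ball_eq_empty empty_iff not_le)
  have q1: "0 \<le> q" "q < 1" using z r by (auto simp: q)
  have c: "0 < Re (L c)" using pos[of c] r by simp
  have x: "0 < Re (L z)" using pos[OF z] .
  have *: "norm (L z - L c) \<le> q * norm (L z + cnj (L c))"
    using Re_pos_schwarz_pick[OF hol pos z] by (simp add: q)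
  have "L z + cnj (L c) = (L z - L c) + 2 * of_real (Re (L c))"
    by (simp add: complex_eq_iff)
  then have "norm (L z + cnj (L c)) \<le> norm (L z - L c) + 2 * Re (L c)"
    by (metis norm_triangle_ineq norm_mult norm_numeral norm_of_real abs_of_pos c)
  with * q1 have "norm (L z - L c) \<le> q * (norm (L z - L c) + 2 * Re (L c))"
    by (meson mult_left_mono order_trans)
  then show 1: "norm (L z - L c) \<le> 2 * q * Re (L c) / (1 - q)"
    using q1 by (simp add: field_simps)
  have "Re (L z) - Re (L c) \<le> norm (L z - L c)"
    by (metis complex_Re_le_cmod minus_complex.simps(1))
  with 1 have "Re (L z) \<le> Re (L c) + 2 * q * Re (L c) / (1 - q)" by simp
  also have "\<dots> = (1 + q) / (1 - q) * Re (L c)" using q1 by (simp add: field_simps)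
  finally show "Re (L z) \<le> (1 + q) / (1 - q) * Re (L c)" .
  \<comment> \<open>The triangle inequality would lose the sharp lower factor. Squaring and dropping
    the imaginary part, allowed since q <= 1, leaves a real inequality.\<close>
  define u v where "u = Re (L z)" and "v = Re (L c)"
  define d where "d = Im (L z) - Im (L c)"
  have "(norm (L z - L c))\<^sup>2 \<le> (q * norm (L z + cnj (L c)))\<^sup>2"
    using * by (intro power_mono) auto
  then have "(u - v)\<^sup>2 + d\<^sup>2 \<le> q\<^sup>2 * ((u + v)\<^sup>2 + d\<^sup>2)"
    by (simp add: power_mult_distrib cmod_power2 u_def v_def d_def)
  moreover have "q\<^sup>2 * d\<^sup>2 \<le> 1 * d\<^sup>2"
    using q1 by (intro mult_right_mono) (auto simp: power_le_one)
  ultimately have "(u - v)\<^sup>2 \<le> (q * (u + v))\<^sup>2"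
    unfolding power_mult_distrib by (simp add: distrib_left)
  then have "\<bar>u - v\<bar> \<le> q * (u + v)"
    using q1 c x by (intro abs_le_square_iff[THEN iffD2, of "u - v" "q * (u + v)", THEN order_trans])
      (auto simp: u_def v_def abs_mult)
  then have "v - u \<le> q * (u + v)" by linarith
  then show "Re (L z) \<ge> (1 - q) / (1 + q) * Re (L c)"
    using q1 by (simp add: field_simps u_def v_def)
qed

text \<open>Subtracting a logarithm of \<open>F\<close> from ln M turns a zero-free function of
  modulus below M into one with positive real part, to which the Harnack estimates apply.\<close>

lemma zero_free_log:
  fixes F :: "complex \<Rightarrow> complex"
  assumes hol: "F holomorphic_on ball c r" and nz: "\<And>w. w \<in> ball c r \<Longrightarrow> F w \<noteq> 0"
    and le: "\<And>w. w \<in> ball c r \<Longrightarrow> norm (F w) < M"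
  obtains L where "L holomorphic_on ball c r" "\<And>w. w \<in> ball c r \<Longrightarrow> F w = of_real M * exp (- L w)"
    "\<And>w. w \<in> ball c r \<Longrightarrow> Re (L w) = ln (M / norm (F w))"
    "\<And>w. w \<in> ball c r \<Longrightarrow> Re (L w) > 0"
proof -
  obtain l where l: "l holomorphic_on ball c r" "\<And>w. w \<in> ball c r \<Longrightarrow> F w = exp (l w)"
    using contractible_imp_holomorphic_log[OF hol] nz convex_imp_contractible convex_ball by metis
  have M: "M > 0" if "w \<in> ball c r" for w using le[OF that] norm_ge_zero[of "F w"] by linarith
  define L where "L = (\<lambda>w. of_real (ln M) - l w)"
  have "L holomorphic_on ball c r" unfolding L_def using l by (intro holomorphic_intros)
  moreover have "F w = of_real M * exp (- L w)" if "w \<in> ball c r" for w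
    using M[OF that] l(2)[OF that] unfolding L_def
    by (simp add: exp_diff exp_of_real)
  moreover have R: "Re (L w) = ln (M / norm (F w))" if "w \<in> ball c r" for w
    using M[OF that] l(2)[OF that] unfolding L_def by (simp add: ln_div)
  moreover have "Re (L w) > 0" if "w \<in> ball c r" for w
    using R[OF that] le[OF that] nz[OF that] M[OF that] by (simp add: ln_gt_zero_iff divide_simps)
  ultimately show ?thesis using that by blast
qed

lemma zero_free_harnack:
  fixes F :: "complex \<Rightarrow> complex"
  assumes hol: "F holomorphic_on ball c r" and nz: "\<And>w. w \<in> ball c r \<Longrightarrow> F w \<noteq> 0"
    and le: "\<And>w. w \<in> ball c r \<Longrightarrow> norm (F w) < M"
    and z: "z \<in> ball c r" and q: "q = dist c z / r"
  shows "ln (M / norm (F z)) \<ge> (1 - q) / (1 + q) * ln (M / norm (F c))"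
    and "ln (M / norm (F z)) \<le> (1 + q) / (1 - q) * ln (M / norm (F c))"
proof -
  have r: "r > 0" using z by (metis ball_eq_empty empty_iff not_le)
  obtain L where L: "L holomorphic_on ball c r"
    "\<And>w. w \<in> ball c r \<Longrightarrow> Re (L w) = ln (M / norm (F w))"
    "\<And>w. w \<in> ball c r \<Longrightarrow> Re (L w) > 0"
    using zero_free_log[OF hol nz le] by metis
  show "ln (M / norm (F z)) \<ge> (1 - q) / (1 + q) * ln (M / norm (F c))"
    using Re_pos_harnack(2)[OF L(1,3) z q] L(2)[OF z] L(2)[of c] r by simp
  show "ln (M / norm (F z)) \<le> (1 + q) / (1 - q) * ln (M / norm (F c))"
    using Re_pos_harnack(3)[OF L(1,3) z q] L(2)[OF z] L(2)[of c] r by simp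
qed

lemma zero_free_log_deriv:
  fixes F :: "complex \<Rightarrow> complex"
  assumes hol: "F holomorphic_on ball c r" and nz: "\<And>w. w \<in> ball c r \<Longrightarrow> F w \<noteq> 0"
    and le: "\<And>w. w \<in> ball c r \<Longrightarrow> norm (F w) < M" and r: "r > 0"
  shows "norm (deriv F c) \<le> 4 / r * ln (M / norm (F c)) * norm (F c)"
proof -
  obtain L where L: "L holomorphic_on ball c r"
    "\<And>w. w \<in> ball c r \<Longrightarrow> F w = of_real M * exp (- L w)"
    "\<And>w. w \<in> ball c r \<Longrightarrow> Re (L w) = ln (M / norm (F w))"
    "\<And>w. w \<in> ball c r \<Longrightarrow> Re (L w) > 0"
    using zero_free_log[OF hol nz le] by metis
  have sub: "cball c (r/2) \<subseteq> ball c r" using r by auto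
  \<comment> \<open>Cauchy's estimate on the circle of radius r/2, where q = 1/2 and |L - L c| is at
    most 2 Re (L c): the origin of the constant 4 / r.\<close>
  have "norm ((deriv ^^ 1) (\<lambda>w. L w - L c) c) \<le> fact 1 * (2 * Re (L c)) / (r/2) ^ 1"
  proof (rule Cauchy_inequality)
    show "(\<lambda>w. L w - L c) holomorphic_on ball c (r / 2)"
      using L(1) sub by (intro holomorphic_intros holomorphic_on_subset[OF L(1)]) auto
    show "continuous_on (cball c (r / 2)) (\<lambda>w. L w - L c)"
      using sub by (intro continuous_intros holomorphic_on_imp_continuous_on holomorphic_on_subset[OF L(1)]) auto
    fix x assume x: "norm (c - x) = r / 2"
    then have xb: "x \<in> ball c r" and q: "dist c x / r = 1/2" using r by (auto simp: dist_norm)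
    have "norm (L x - L c) \<le> 2 * (1/2) * Re (L c) / (1 - 1/2)"
      using Re_pos_harnack(1)[OF L(1,4) xb q[symmetric]] .
    then show "norm (L x - L c) \<le> 2 * Re (L c)" by simp
  qed (use r in auto)
  then have "norm (deriv (\<lambda>w. L w - L c) c) \<le> 4 / r * Re (L c)" by (simp add: field_simps)
  moreover have Ld: "(L has_field_derivative deriv L c) (at c)"
    using holomorphic_derivI[OF L(1) open_ball] r by simp
  then have "((\<lambda>w. L w - L c) has_field_derivative deriv L c) (at c)"
    by (auto intro!: derivative_eq_intros)
  then have "deriv (\<lambda>w. L w - L c) c = deriv L c" by (rule DERIV_imp_deriv)
  ultimately have 1: "norm (deriv L c) \<le> 4 / r * Re (L c)" by simp
  have "((\<lambda>w. of_real M * exp (- L w)) has_field_derivative - (deriv L c * F c)) (at c)"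
    using L(2)[of c] r by (auto intro!: derivative_eq_intros Ld)
  then have "(F has_field_derivative - (deriv L c * F c)) (at c)"
    by (rule has_field_derivative_transform_within_open[where S="ball c r"]) (use L(2) r in auto)
  then have "deriv F c = - (deriv L c * F c)" by (rule DERIV_imp_deriv)
  then have "norm (deriv F c) = norm (deriv L c) * norm (F c)" by (simp add: norm_mult)
  also have "\<dots> \<le> 4 / r * Re (L c) * norm (F c)" using 1 by (intro mult_right_mono) auto
  also have "Re (L c) = ln (M / norm (F c))" using L(3)[of c] r by simp
  finally show ?thesis .
qed

lemma entire_zero_free_exponential_type:
  fixes F :: "complex \<Rightarrow> complex"
  assumes hol: "F holomorphic_on UNIV" and nz: "\<And>z. F z \<noteq> 0"
    and growth: "\<And>z. norm (F z) \<le> exp (B + K * norm z)" and "K \<ge> 0"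
  obtains \<alpha> \<beta> where "\<And>z. F z = exp (\<alpha> * z + \<beta>)"
proof -
  have bd: "norm (deriv F z / F z) \<le> 4 * K" for z
  proof -
    \<comment> \<open>The bound for the logarithmic derivative obtained from the disc of radius R
      about z. Its dependence on z disappears as R tends to infinity and 4 K remains; Liouville's
      theorem then makes F'/F constant.\<close>
    define f where "f = (\<lambda>R::real. 4 / R * (B + 1 + K * norm z + K * R - ln (norm (F z))))"
    have "norm (deriv F z / F z) \<le> f R" if R: "R > 0" for R
    proof -
      have "norm (deriv F z) \<le> 4 / R * ln (exp (B + 1 + K * norm z + K * R) / norm (F z)) * norm (F z)"
      proof (rule zero_free_log_deriv)
        show "F holomorphic_on ball z R" using hol holomorphic_on_subset by blast
        fix w assume w: "w \<in> ball z R"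
        then have "norm w \<le> norm z + R" using norm_triangle_ineq2[of w z] by (simp add: dist_norm norm_minus_commute)
        then have "K * norm w \<le> K * norm z + K * R" using \<open>K \<ge> 0\<close>
          by (metis distrib_left mult_left_mono)
        then have "exp (B + K * norm w) < exp (B + 1 + K * norm z + K * R)" by simp
        with growth[of w] show "norm (F w) < exp (B + 1 + K * norm z + K * R)" by linarith
      qed (use nz R in auto)
      then show ?thesis using nz[of z] R
        by (simp add: f_def norm_divide ln_div divide_simps)
    qed
    moreover have "(f \<longlongrightarrow> 4 * K) at_top"
    proof -
      have "((\<lambda>R::real. 4 * (B + 1 + K * norm z - ln (norm (F z))) / R + 4 * K) \<longlongrightarrow> 0 + 4 * K) at_top"
        by (intro tendsto_add tendsto_const tendsto_divide_0[OF tendsto_const] filterlim_at_top_imp_at_infinity filterlim_ident)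
      then show ?thesis
        by (rule Lim_transform_eventually[OF tendsto_eq_rhs])
          (auto simp: f_def field_simps intro!: eventually_mono[OF eventually_gt_at_top[of 0]])
    qed
    ultimately show ?thesis
      by (intro tendsto_lowerbound[of f "4*K" at_top])
        (auto intro!: eventually_mono[OF eventually_gt_at_top[of 0]])
  qed
  have "(\<lambda>z. deriv F z / F z) holomorphic_on UNIV"
    using hol nz by (intro holomorphic_intros) auto
  moreover have "bounded (range (\<lambda>z. deriv F z / F z))"
    using bd by (auto simp: bounded_iff)
  ultimately obtain \<alpha> where \<alpha>: "\<And>z. deriv F z / F z = \<alpha>"
    using Liouville_theorem by (metis constant_on_def UNIV_I)
  have dF: "(F has_field_derivative \<alpha> * F z) (at z)" for z
    using holomorphic_derivI[OF hol, of z] \<alpha>[of z] nz[of z] by (simp add: field_simps)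
  have "((\<lambda>z. F z * exp (- \<alpha> * z)) has_field_derivative 0) (at z)" for z
    by (rule derivative_eq_intros dF refl | simp add: algebra_simps)+
  then obtain c where c: "\<And>z. F z * exp (- \<alpha> * z) = c"
    using has_field_derivative_zero_constant[of UNIV "\<lambda>z. F z * exp (- \<alpha> * z)"] by auto
  have "c \<noteq> 0" using c[of 0] nz[of 0] by auto
  have "F z = exp (\<alpha> * z + Ln c)" for z
    using c[of z] \<open>c \<noteq> 0\<close> by (simp add: exp_add exp_minus field_simps)
  then show ?thesis using that by blast
qed

section \<open>Logarithmic derivatives on circles\<close>

lemma norm_prod_list_diff_ge:
  fixes z :: complex
  assumes "\<And>a. a \<in> set as \<Longrightarrow> norm (z - a) \<ge> d" "d \<ge> 0"
  shows "norm (\<Prod>a\<leftarrow>as. z - a) \<ge> d ^ length as"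
  using assms by (induction as) (auto simp: norm_mult intro!: mult_mono)

lemma norm_prod_list_diff_le:
  fixes z :: complex
  assumes "\<And>a. a \<in> set as \<Longrightarrow> norm (z - a) \<le> d" "d \<ge> 0"
  shows "norm (\<Prod>a\<leftarrow>as. z - a) \<le> d ^ length as"
  using assms by (induction as) (auto simp: norm_mult intro!: mult_mono)

lemma has_field_derivative_prod_list_diff:
  fixes z :: complex
  assumes "z \<notin> set as"
  shows "((\<lambda>w. \<Prod>a\<leftarrow>as. w - a) has_field_derivative
           (\<Prod>a\<leftarrow>as. z - a) * (\<Sum>a\<leftarrow>as. 1 / (z - a))) (at z)"
  using assms
proof (induction as)
  case (Cons a as)
  then have "z - a \<noteq> 0" by auto
  with Cons show ?case
    by (auto intro!: derivative_eq_intros simp: distrib_left)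
qed auto

lemma norm_sum_list_le:
  fixes f :: "'a \<Rightarrow> complex"
  assumes "\<And>a. a \<in> set as \<Longrightarrow> norm (f a) \<le> B"
  shows "norm (\<Sum>a\<leftarrow>as. f a) \<le> real (length as) * B"
  using assms
proof (induction as)
  case (Cons a as)
  have "norm (f a + (\<Sum>a\<leftarrow>as. f a)) \<le> norm (f a) + norm (\<Sum>a\<leftarrow>as. f a)" by (rule norm_triangle_ineq)
  also have "\<dots> \<le> B + real (length as) * B" using Cons by (intro add_mono) auto
  finally show ?case by (simp add: algebra_simps)
qed auto

text \<open>A Jensen-type count. On |w| = 15/16 each factor w - a is at least 13/16, so after n
  zeros are split off the quotient is at most (16/13)^n; at \<open>z'\<close> each factor is at most
  1/4. Hence exp (-A) <= (4/13)^n <= exp (-n), and the number of zeros is at most A. A list of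
  maximal length therefore exists, and its quotient has no zero in the small disc.\<close>

lemma factor_out_zeros:
  fixes Y :: "complex \<Rightarrow> complex"
  assumes hol: "Y holomorphic_on ball 0 1" and le: "\<And>w. w \<in> ball 0 1 \<Longrightarrow> norm (Y w) \<le> 1"
    and z': "norm z' \<le> 1/64" and ge: "norm (Y z') \<ge> exp (- A)"
  obtains as Z where "real (length as) \<le> A" "Z holomorphic_on ball 0 1"
    "\<And>w. w \<in> ball 0 1 \<Longrightarrow> Y w = (\<Prod>a\<leftarrow>as. w - a) * Z w"
    "\<And>w. w \<in> cball 0 (1/8) \<Longrightarrow> Z w \<noteq> 0"
    "\<And>w. w \<in> cball 0 (1/8) \<Longrightarrow> norm (Z w) \<le> (16/13) ^ length as"
    "norm (Z z') \<ge> exp (- A)"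
proof -
  define Q where "Q = (\<lambda>as Z. set as \<subseteq> cball 0 (1/8) \<and> Z holomorphic_on ball 0 1 \<and>
     (\<forall>w\<in>ball 0 1. Y w = (\<Prod>a\<leftarrow>as. w - a) * Z w))"
  have bound: "norm (Z w) \<le> (16/13) ^ length as" if Q: "Q as Z" and w: "w \<in> cball 0 (15/16)" for as Z w
  proof (rule maximum_modulus_frontier[where f = Z and S = "cball 0 (15/16)"])
    have holZ: "Z holomorphic_on X" if "X \<subseteq> ball 0 1" for X
      using Q that holomorphic_on_subset by (auto simp: Q_def)
    show "Z holomorphic_on interior (cball 0 (15/16))" by (rule holZ) auto
    have "continuous_on (cball 0 (15/16)) Z" by (intro holomorphic_on_imp_continuous_on holZ) auto
    then show "continuous_on (closure (cball 0 (15/16))) Z" by simp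
    fix x :: complex assume "x \<in> frontier (cball 0 (15/16))"
    then have x: "norm x = 15/16" by simp
    have "norm (x - a) \<ge> 13/16" if "a \<in> set as" for a
      using Q that x norm_triangle_ineq2[of x a] by (auto simp: Q_def subset_iff)
    then have "norm (\<Prod>a\<leftarrow>as. x - a) \<ge> (13/16) ^ length as" by (intro norm_prod_list_diff_ge) auto
    then have "(13/16) ^ length as * norm (Z x) \<le> norm (\<Prod>a\<leftarrow>as. x - a) * norm (Z x)"
      by (intro mult_right_mono) auto
    also have "\<dots> = norm (Y x)" using Q x by (auto simp: Q_def norm_mult)
    also have "\<dots> \<le> 1" using le x by auto
    finally show "norm (Z x) \<le> (16/13) ^ length as"
      by (simp add: power_divide field_simps)
  qed (use w in auto)
  have len: "real (length as) \<le> A" if Q: "Q as Z" for as Z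
  proof -
    have "norm (z' - a) \<le> 1/4" if "a \<in> set as" for a
      using Q that z' norm_triangle_ineq4[of z' a] by (auto simp: Q_def subset_iff)
    then have 1: "norm (\<Prod>a\<leftarrow>as. z' - a) \<le> (1/4) ^ length as" by (intro norm_prod_list_diff_le) auto
    have "exp (-A) \<le> norm (\<Prod>a\<leftarrow>as. z' - a) * norm (Z z')"
      using ge Q z' by (auto simp: Q_def norm_mult)
    also have "\<dots> \<le> (1/4) ^ length as * (16/13) ^ length as"
      using 1 bound[OF Q, of z'] z' by (intro mult_mono) auto
    also have "\<dots> = (4/13) ^ length as" by (simp flip: power_mult_distrib)
    also have "\<dots> \<le> exp (-1) ^ length as"
    proof (intro power_mono)
      have "exp (1::real) \<le> 13/4" using e_less_272 by simp
      then show "4/13 \<le> exp (-1::real)" by (simp add: exp_minus field_simps)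
    qed auto
    also have "\<dots> = exp (- real (length as))" by (simp flip: exp_of_nat_mult)
    finally show ?thesis by simp
  qed
  define K where "K = {n. \<exists>as Z. length as = n \<and> Q as Z}"
  have "K \<subseteq> {..nat \<lfloor>A\<rfloor>}"
  proof
    fix x assume "x \<in> K"
    then obtain as Z where "length as = x" "Q as Z" by (auto simp: K_def)
    then show "x \<in> {..nat \<lfloor>A\<rfloor>}" using len by (metis atMost_iff le_nat_floor)
  qed
  then have fin: "finite K" using finite_subset by blast
  have "0 \<in> K" using hol unfolding K_def Q_def by (auto intro!: exI[of _ "[]"] exI[of _ Y])
  then have "Max K \<in> K" using fin Max_in by blast
  then obtain as Z where as: "length as = Max K" and Q: "Q as Z" by (auto simp: K_def)
  have nz: "Z w \<noteq> 0" if w: "w \<in> cball 0 (1/8)" for w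
  proof
    assume 0: "Z w = 0"
    \<comment> \<open>A remaining zero could be split off too, giving a list longer than the
      maximum.\<close>
    define Z1 where "Z1 = (\<lambda>z. if z = w then deriv Z w else (Z z - Z w) / (z - w))"
    have "Z1 holomorphic_on ball 0 1" unfolding Z1_def
      using Q by (intro pole_lemma_open) (auto simp: Q_def)
    moreover have Z1: "Z z = (z - w) * Z1 z" for z using 0 by (auto simp: Z1_def)
    have "Y z = (\<Prod>a\<leftarrow>w # as. z - a) * Z1 z" if "z \<in> ball 0 1" for z
    proof -
      have "Y z = (\<Prod>a\<leftarrow>as. z - a) * Z z" using Q that by (auto simp: Q_def)
      also have "\<dots> = (\<Prod>a\<leftarrow>w # as. z - a) * Z1 z" by (simp only: Z1[of z] list.map prod_list.Cons mult_ac)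
      finally show ?thesis .
    qed
    ultimately have "Q (w # as) Z1" using Q w unfolding Q_def set_simps insert_subset by blast
    then have "length (w # as) \<in> K" unfolding K_def by blast
    then have "length (w # as) \<le> Max K" by (rule Max_ge[OF fin])
    then show False using as by simp
  qed
  have "norm (z' - a) \<le> 1" if "a \<in> set as" for a
    using Q that z' norm_triangle_ineq4[of z' a] by (auto simp: Q_def subset_iff)
  then have "norm (\<Prod>a\<leftarrow>as. z' - a) \<le> 1 ^ length as" by (intro norm_prod_list_diff_le) auto
  then have "norm (\<Prod>a\<leftarrow>as. z' - a) * norm (Z z') \<le> 1 * norm (Z z')" by (intro mult_right_mono) auto
  moreover have "norm (Y z') = norm (\<Prod>a\<leftarrow>as. z' - a) * norm (Z z')"
    using Q z' by (auto simp: Q_def norm_mult)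
  ultimately have "norm (Z z') \<ge> exp (-A)" using ge by simp
  moreover have "Z holomorphic_on ball 0 1" "\<And>w. w \<in> ball 0 1 \<Longrightarrow> Y w = (\<Prod>a\<leftarrow>as. w - a) * Z w"
    using Q by (auto simp: Q_def)
  moreover have "norm (Z w) \<le> (16/13) ^ length as" if "w \<in> cball 0 (1/8)" for w
    using bound[OF Q, of w] that by simp
  ultimately show ?thesis using that[OF len[OF Q], of Z] nz by blast
qed

text \<open>Pigeonhole: there is one candidate radius more than there are list entries, and the
  candidates are 2 h apart, so each entry lies within h of at most one of them.\<close>

lemma avoid_finitely_many_radii:
  fixes as :: "real list" and u l :: real
  assumes "l > 0"
  obtains s where "u \<le> s" "s \<le> u + l" "\<And>x. x \<in> set as \<Longrightarrow> \<bar>x - s\<bar> \<ge> l / (2 * (length as + 1))"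
proof -
  define n where "n = length as"
  define h where "h = l / (2 * (real n + 1))"
  define p where "p = (\<lambda>k::nat. u + (2 * real k + 1) * h)"
  have h: "h > 0" using assms by (simp add: h_def)
  have "\<exists>k\<le>n. \<forall>x\<in>set as. \<bar>x - p k\<bar> \<ge> h"
  proof (rule ccontr)
    assume "\<not> ?thesis"
    then have "\<forall>k\<in>{..n}. \<exists>x\<in>set as. \<bar>x - p k\<bar> < h" by force
    then obtain f where f: "\<And>k. k \<in> {..n} \<Longrightarrow> f k \<in> set as \<and> \<bar>f k - p k\<bar> < h" by metis
    have "inj_on f {..n}"
    proof (rule inj_onI, rule ccontr)
      fix j k assume jk: "j \<in> {..n}" "k \<in> {..n}" "f j = f k" "j \<noteq> k"
      then have "\<bar>p j - p k\<bar> < 2 * h" using f[of j] f[of k] by linarith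
      moreover have "p j - p k = (real j - real k) * (2 * h)" by (simp add: p_def algebra_simps)
      ultimately have "\<bar>real j - real k\<bar> * (2 * h) < 1 * (2 * h)" using h by (simp add: abs_mult)
      then have "\<bar>real j - real k\<bar> < 1" using h mult_less_cancel_right_pos[of "2*h"] by simp
      then show False using jk by linarith
    qed
    moreover have "f ` {..n} \<subseteq> set as" using f by auto
    ultimately have "card {..n} \<le> card (set as)" by (metis card_image card_mono List.finite_set)
    then show False using card_length[of as] by (simp add: n_def)
  qed
  then obtain k where k: "k \<le> n" "\<forall>x\<in>set as. \<bar>x - p k\<bar> \<ge> h" by blast
  have "(2 * real k + 1) * h \<le> (2 * (real n + 1)) * h" using k h by (intro mult_right_mono) auto
  also have "\<dots> = l" by (simp add: h_def)
  finally have "p k \<le> u + l" by (simp add: p_def)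
  moreover have "u \<le> p k" using h by (simp add: p_def)
  ultimately show ?thesis using that[of "p k"] k by (simp add: h_def n_def algebra_simps)
qed

text \<open>The zeros contribute at most A terms, each bounded on a circle whose radius keeps away
  from their moduli; the zero-free factor is controlled by Harnack's inequality, started at
  \<open>z'\<close>. The polynomial dependence on A is essential, since \<open>V_growth\<close> uses
  an A that grows like |c|^3.\<close>

lemma log_deriv_on_circle_unit:
  fixes Y :: "complex \<Rightarrow> complex"
  assumes hol: "Y holomorphic_on ball 0 1" and le: "\<And>w. w \<in> ball 0 1 \<Longrightarrow> norm (Y w) \<le> 1"
    and z': "norm z' \<le> 1/64" and ge: "norm (Y z') \<ge> exp (- A)"
  obtains s where "1/64 \<le> s" "s \<le> 1/32"
    "\<And>w. norm w = s \<Longrightarrow> Y w \<noteq> 0 \<and> norm (deriv Y w / Y w) \<le> 1000 * (1 + A)\<^sup>2"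
proof -
  obtain as Z where as: "real (length as) \<le> A" and Z: "Z holomorphic_on ball 0 1"
    "\<And>w. w \<in> ball 0 1 \<Longrightarrow> Y w = (\<Prod>a\<leftarrow>as. w - a) * Z w"
    "\<And>w. w \<in> cball 0 (1/8) \<Longrightarrow> Z w \<noteq> 0"
    "\<And>w. w \<in> cball 0 (1/8) \<Longrightarrow> norm (Z w) \<le> (16/13) ^ length as"
    "norm (Z z') \<ge> exp (- A)"
    using factor_out_zeros[OF assms] by metis
  define n where "n = real (length as)"
  have n: "0 \<le> n" "n \<le> A" using as by (auto simp: n_def)
  obtain s where s: "1/64 \<le> s" "s \<le> 1/64 + 1/64"
    "\<And>x. x \<in> set (map norm as) \<Longrightarrow> \<bar>x - s\<bar> \<ge> (1/64) / (2 * (length (map norm as) + 1))"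
    using avoid_finitely_many_radii[of "1/64" "1/64" "map norm as"] by auto
  have far: "norm (w - a) \<ge> 1 / (128 * (n + 1))" if "a \<in> set as" "norm w = s" for a w
    using s(3)[of "norm a"] that norm_triangle_ineq3[of w a] by (simp add: n_def abs_minus_commute algebra_simps)
  define M where "M = 2 * exp n"
  have expn: "(16/13::real) ^ length as \<le> exp n"
  proof -
    have "(16/13::real) \<le> exp 1" using exp_ge_add_one_self[of 1] by linarith
    then have "(16/13::real) ^ length as \<le> exp 1 ^ length as" by (intro power_mono) auto
    then show ?thesis by (simp add: n_def flip: exp_of_nat_mult)
  qed
  have ZM: "norm (Z w) < M" if "w \<in> cball 0 (1/8)" for w
    using Z(4)[OF that] expn exp_gt_zero[of n] unfolding M_def by linarith
  have lnz': "ln (M / norm (Z z')) \<le> 1 + 2 * A"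
  proof -
    have "M / norm (Z z') \<le> M / exp (-A)"
      using Z(5) Z(3)[of z'] z' by (intro divide_left_mono) (auto simp: M_def)
    also have "\<dots> \<le> exp 1 * exp n * exp A"
      using exp_ge_add_one_self[of 1] by (simp add: M_def exp_minus field_simps)
    also have "\<dots> \<le> exp (1 + 2 * A)" using n by (simp flip: exp_add)
    finally have "ln (M / norm (Z z')) \<le> ln (exp (1 + 2 * A))"
      using Z(3)[of z'] z' by (intro ln_mono) (auto simp: M_def)
    then show ?thesis by simp
  qed
  have "Y w \<noteq> 0 \<and> norm (deriv Y w / Y w) \<le> 1000 * (1 + A)\<^sup>2" if w: "norm w = s" for w
  proof
    have ws: "norm w \<le> 1/32" using w s by simp
    have wball: "w \<in> ball 0 1" using ws by simp
    have d: "dist z' w \<le> 3/64" using z' ws norm_triangle_ineq4[of z' w] by (simp add: dist_norm)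
    have sub1: "ball z' (7/64) \<subseteq> cball 0 (1/8)"
    proof
      fix x assume "x \<in> ball z' (7/64)"
      then show "x \<in> cball 0 (1/8)" using z' norm_triangle_ineq2[of x z'] by (auto simp: dist_norm norm_minus_commute)
    qed
    have sub2: "ball w (1/16) \<subseteq> cball 0 (1/8)"
    proof
      fix x assume "x \<in> ball w (1/16)"
      then show "x \<in> cball 0 (1/8)" using ws norm_triangle_ineq2[of x w] by (auto simp: dist_norm norm_minus_commute)
    qed
    have holsub: "Z holomorphic_on X" if "X \<subseteq> cball 0 (1/8)" for X
      using Z(1) by (rule holomorphic_on_subset) (use that in auto)
    \<comment> \<open>Points \<open>z'\<close> and w are at most 3/64 apart and the disc about
      \<open>z'\<close> has radius 7/64, so q <= 3/7 and Harnack's factor (1 + q) / (1 - q) is below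
      3.\<close>
    define q where "q = dist z' w / (7/64)"
    have q: "0 \<le> q" "q \<le> 3/7" using d by (auto simp: q_def)
    have pos: "0 \<le> ln (M / norm (Z z'))"
      using ZM[of z'] Z(3)[of z'] z' by (intro ln_ge_zero) (auto simp: field_simps)
    have "ln (M / norm (Z w)) \<le> (1 + q) / (1 - q) * ln (M / norm (Z z'))"
    proof (rule zero_free_harnack(2)[where F = Z])
      show "Z holomorphic_on ball z' (7/64)" by (rule holsub[OF sub1])
      show "w \<in> ball z' (7/64)" using d by auto
      show "\<And>w. w \<in> ball z' (7/64) \<Longrightarrow> Z w \<noteq> 0" "\<And>w. w \<in> ball z' (7/64) \<Longrightarrow> norm (Z w) < M"
        using Z(3) ZM sub1 by blast+
    qed (simp add: q_def)
    also have "\<dots> \<le> 3 * ln (M / norm (Z z'))"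
      using q pos by (intro mult_right_mono) (auto simp: field_simps)
    also have "\<dots> \<le> 3 * (1 + 2 * A)" using lnz' by simp
    finally have lnw: "ln (M / norm (Z w)) \<le> 3 * (1 + 2 * A)" .
    have Zw: "Z w \<noteq> 0" using Z(3) ws by auto
    have "norm (deriv Z w) \<le> 4 / (1/16) * ln (M / norm (Z w)) * norm (Z w)"
    proof (rule zero_free_log_deriv)
      show "Z holomorphic_on ball w (1/16)" by (rule holsub[OF sub2])
      show "\<And>x. x \<in> ball w (1/16) \<Longrightarrow> Z x \<noteq> 0" "\<And>x. x \<in> ball w (1/16) \<Longrightarrow> norm (Z x) < M"
        using Z(3) ZM sub2 by blast+
    qed simp
    then have "norm (deriv Z w / Z w) \<le> 64 * ln (M / norm (Z w))"
      using Zw by (simp add: norm_divide field_simps)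
    with lnw have 1: "norm (deriv Z w / Z w) \<le> 192 * (1 + 2 * A)" by simp
    have wn: "w \<notin> set as"
    proof
      assume "w \<in> set as"
      from far[OF this w] n show False by (simp add: field_simps)
    qed
    have P0: "(\<Prod>a\<leftarrow>as. w - a) \<noteq> 0"
      using wn by (auto simp: prod_list_zero_iff)
    show Y0: "Y w \<noteq> 0" using Z(2)[OF wball] P0 Zw by simp
    have "(Z has_field_derivative deriv Z w) (at w)"
      using holomorphic_derivI[OF Z(1) open_ball wball] .
    then have "((\<lambda>w. (\<Prod>a\<leftarrow>as. w - a) * Z w) has_field_derivative
        (\<Prod>a\<leftarrow>as. w - a) * (\<Sum>a\<leftarrow>as. 1 / (w - a)) * Z w + deriv Z w * (\<Prod>a\<leftarrow>as. w - a)) (at w)"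
      by (rule DERIV_mult[OF has_field_derivative_prod_list_diff[OF wn]])
    then have "(Y has_field_derivative
        (\<Prod>a\<leftarrow>as. w - a) * (\<Sum>a\<leftarrow>as. 1 / (w - a)) * Z w + deriv Z w * (\<Prod>a\<leftarrow>as. w - a)) (at w)"
      by (rule has_field_derivative_transform_within_open[where S="ball 0 1"]) (use wball Z(2) in auto)
    then have "deriv Y w = (\<Prod>a\<leftarrow>as. w - a) * (\<Sum>a\<leftarrow>as. 1 / (w - a)) * Z w + deriv Z w * (\<Prod>a\<leftarrow>as. w - a)"
      by (rule DERIV_imp_deriv)
    then have "deriv Y w / Y w = (\<Sum>a\<leftarrow>as. 1 / (w - a)) + deriv Z w / Z w"
      using Z(2)[OF wball] P0 Zw by (simp add: field_simps)
    then have "norm (deriv Y w / Y w) \<le> norm (\<Sum>a\<leftarrow>as. 1 / (w - a)) + norm (deriv Z w / Z w)"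
      by (metis norm_triangle_ineq)
    also have "norm (\<Sum>a\<leftarrow>as. 1 / (w - a)) \<le> real (length as) * (128 * (n + 1))"
    proof (rule norm_sum_list_le)
      fix a assume a: "a \<in> set as"
      have "0 < 1 / (128 * (n + 1))" using n by simp
      then have "inverse (norm (w - a)) \<le> inverse (1 / (128 * (n + 1)))"
        using far[OF a w] by (intro le_imp_inverse_le) auto
      then show "norm (1 / (w - a)) \<le> 128 * (n + 1)"
        by (simp add: norm_divide inverse_eq_divide)
    qed
    also have "\<dots> + norm (deriv Z w / Z w) \<le> (1 + A) * (128 * (1 + A)) + 192 * (1 + 2 * A)"
    proof (rule add_mono)
      show "real (length as) * (128 * (n + 1)) \<le> (1 + A) * (128 * (1 + A))"
        using n by (intro mult_mono) (auto simp: n_def)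
    qed (rule 1)
    also have "\<dots> \<le> 1000 * (1 + A)\<^sup>2"
      using n by (simp add: power2_eq_square algebra_simps)
    finally show "norm (deriv Y w / Y w) \<le> 1000 * (1 + A)\<^sup>2" by simp
  qed
  then show ?thesis using that[of s] s by simp
qed

lemma log_deriv_on_circle:
  fixes Y :: "complex \<Rightarrow> complex"
  assumes hol: "Y holomorphic_on ball c r" and r: "r > 0" and M: "M > 0"
    and le: "\<And>w. w \<in> ball c r \<Longrightarrow> norm (Y w) \<le> M"
    and z': "dist c z' \<le> r/64" and ge: "norm (Y z') \<ge> M * exp (- A)"
  obtains s where "r/64 \<le> s" "s \<le> r/32"
    "\<And>w. dist c w = s \<Longrightarrow> Y w \<noteq> 0 \<and> norm (deriv Y w / Y w) \<le> 1000 / r * (1 + A)\<^sup>2"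
proof -
  define Y1 where "Y1 = (\<lambda>w. Y (of_real r * w + c) / of_real M)"
  have inb: "of_real r * w + c \<in> ball c r" if "w \<in> ball 0 1" for w
    using that r by (auto simp: dist_norm norm_mult)
  have "(\<lambda>w. Y (of_real r * w + c)) holomorphic_on ball 0 1"
    using inb by (intro holomorphic_on_compose_gen[OF _ hol, unfolded o_def])
      (auto intro!: holomorphic_intros)
  then have hol1: "Y1 holomorphic_on ball 0 1" unfolding Y1_def by (intro holomorphic_intros) (use M in auto)
  define z1 where "z1 = (z' - c) / of_real r"
  have z1: "norm z1 \<le> 1/64" "of_real r * z1 + c = z'"
    using z' r by (auto simp: z1_def norm_divide dist_norm norm_minus_commute field_simps)
  have ge1: "norm (Y1 z1) \<ge> exp (-A)"
    using ge M z1 by (simp add: Y1_def norm_divide field_simps)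
  have le1: "norm (Y1 w) \<le> 1" if "w \<in> ball 0 1" for w
    using le[OF inb[OF that]] M by (simp add: Y1_def norm_divide)
  obtain s where s: "1/64 \<le> s" "s \<le> 1/32"
    "\<And>w. norm w = s \<Longrightarrow> Y1 w \<noteq> 0 \<and> norm (deriv Y1 w / Y1 w) \<le> 1000 * (1 + A)\<^sup>2"
    using log_deriv_on_circle_unit[OF hol1 le1 z1(1) ge1] by metis
  have "Y w \<noteq> 0 \<and> norm (deriv Y w / Y w) \<le> 1000 / r * (1 + A)\<^sup>2" if w: "dist c w = r * s" for w
  proof -
    define v where "v = (w - c) / of_real r"
    have v: "norm v = s" "of_real r * v + c = w"
      using w r by (auto simp: v_def norm_divide dist_norm norm_minus_commute field_simps)
    have wb: "w \<in> ball c r" using w s(2) r by (simp add: field_simps)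
    have "(Y has_field_derivative deriv Y w) (at w)"
      using holomorphic_derivI[OF hol open_ball wb] .
    then have "(Y has_field_derivative deriv Y w) (at (of_real r * v + c))" using v by simp
    then have "(Y1 has_field_derivative deriv Y w * of_real r / of_real M) (at v)"
      unfolding Y1_def
      by (intro DERIV_cdivide DERIV_chain2[where f = Y and g = "\<lambda>v. of_real r * v + c"]) (auto intro!: derivative_eq_intros)
    then have "deriv Y1 v = deriv Y w * of_real r / of_real M" by (rule DERIV_imp_deriv)
    moreover have "Y1 v = Y w / of_real M" by (simp add: Y1_def v)
    moreover have "norm (deriv Y1 v / Y1 v) \<le> 1000 * (1 + A)\<^sup>2" "Y1 v \<noteq> 0" using s(3)[OF v(1)] by auto
    ultimately have "norm (of_real r * (deriv Y w / Y w)) \<le> 1000 * (1 + A)\<^sup>2" "Y w \<noteq> 0"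
      using M by (auto simp: algebra_simps)
    then have "r * norm (deriv Y w / Y w) \<le> 1000 * (1 + A)\<^sup>2"
      using r unfolding norm_mult by simp
    then show ?thesis using r \<open>Y w \<noteq> 0\<close> by (simp add: pos_le_divide_eq mult.commute)
  qed
  then show ?thesis using that[of "r * s"] s r by (auto simp: field_simps)
qed

section \<open>Differential monomials\<close>

lemma norm_deriv_le_of_ball:
  fixes f :: "complex \<Rightarrow> complex"
  assumes hol: "f holomorphic_on ball z R" and B: "\<And>w. w \<in> ball z R \<Longrightarrow> norm (f w) \<le> B"
    and r: "r < R" and w: "w \<in> ball z r"
  shows "norm (deriv f w) \<le> 2 * B / (R - r)"
proof -
  have sub: "cball w ((R - r) / 2) \<subseteq> ball z R"
  proof
    fix x assume "x \<in> cball w ((R - r) / 2)"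
    then have "dist w x \<le> (R - r) / 2" by simp
    then have "dist z x \<le> dist z w + (R - r) / 2" using dist_triangle[of z x w] by linarith
    also have "\<dots> < R" using w r by (simp add: field_simps)
    finally show "x \<in> ball z R" by simp
  qed
  have "norm ((deriv ^^ 1) f w) \<le> fact 1 * B / ((R - r) / 2) ^ 1"
  proof (rule Cauchy_inequality)
    show "f holomorphic_on ball w ((R - r) / 2)"
      using hol sub ball_subset_cball holomorphic_on_subset by (metis order_trans)
    show "continuous_on (cball w ((R - r) / 2)) f"
      using hol sub by (meson holomorphic_on_imp_continuous_on continuous_on_subset)
    fix x assume "norm (w - x) = (R - r) / 2"
    then show "norm (f x) \<le> B" using sub B by (auto simp: dist_norm subset_iff)
  qed (use r in auto)
  then show ?thesis by (simp add: mult.commute)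
qed

text \<open>
  The holomorphic cofactors in \<open>(\<phi>^m)^(t) = \<phi>^(m-t) e\<close> and \<open>(\<phi>^(-m))^(t) = \<phi>^(-m-t) e\<close>; they are
  obtained with \<open>c i = m - i\<close> and \<open>c i = - (m + i)\<close>, respectively.
\<close>

primrec cofactor :: "(nat \<Rightarrow> complex) \<Rightarrow> nat \<Rightarrow> (complex \<Rightarrow> complex) \<Rightarrow> complex \<Rightarrow> complex" where
  "cofactor c 0 \<phi> = (\<lambda>_. 1)"
| "cofactor c (Suc t) \<phi> =
     (\<lambda>z. c t * deriv \<phi> z * cofactor c t \<phi> z + \<phi> z * deriv (cofactor c t \<phi>) z)"

lemma holomorphic_cofactor:
  assumes "\<phi> holomorphic_on S" "open S"
  shows "cofactor c t \<phi> holomorphic_on S"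
  by (induction t) (auto intro!: holomorphic_intros assms)

text \<open>The constant depends on neither \<open>\<phi>\<close> nor the centre, so that it serves
  every tame disc at once. Each differentiation consumes part of the margin R - r; the induction
  therefore leaves r arbitrary and calls its hypothesis at the midpoint of r and R.\<close>

lemma cofactor_bound:
  fixes R r :: real
  assumes "0 < r" "r < R"
  obtains C where "C \<ge> 0" "\<And>\<phi> z w. \<phi> holomorphic_on ball z R \<Longrightarrow> (\<And>v. v \<in> ball z R \<Longrightarrow> norm (\<phi> v) \<le> 2) \<Longrightarrow>
     w \<in> ball z r \<Longrightarrow> norm (cofactor c t \<phi> w) \<le> C"
proof -
  have "\<exists>C\<ge>0. \<forall>\<phi> z. \<phi> holomorphic_on ball z R \<longrightarrow> (\<forall>v\<in>ball z R. norm (\<phi> v) \<le> 2) \<longrightarrow>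
     (\<forall>w\<in>ball z r. norm (cofactor c t \<phi> w) \<le> C)"
    using assms
  proof (induction t arbitrary: r)
    case 0
    then show ?case by (intro exI[of _ 1]) auto
  next
    case (Suc t)
    define \<rho> where "\<rho> = (r + R) / 2"
    have \<rho>: "r < \<rho>" "\<rho> < R" using Suc.prems by (auto simp: \<rho>_def)
    obtain C where C: "C \<ge> 0" "\<And>\<phi> z w. \<phi> holomorphic_on ball z R \<Longrightarrow> (\<forall>v\<in>ball z R. norm (\<phi> v) \<le> 2) \<Longrightarrow>
       w\<in>ball z \<rho> \<Longrightarrow> norm (cofactor c t \<phi> w) \<le> C"
      using Suc.IH[of \<rho>] Suc.prems \<rho> by fastforce
    define C' where "C' = norm (c t) * (2 * 2 / (R - r)) * C + 2 * (2 * C / (\<rho> - r))"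
    have "norm (cofactor c (Suc t) \<phi> w) \<le> C'"
      if h: "\<phi> holomorphic_on ball z R" "\<forall>v\<in>ball z R. norm (\<phi> v) \<le> 2" "w \<in> ball z r" for \<phi> z w
    proof -
      have w: "w \<in> ball z \<rho>" "w \<in> ball z R" using h(3) \<rho> by auto
      have 1: "norm (deriv \<phi> w) \<le> 2 * 2 / (R - r)"
        by (rule norm_deriv_le_of_ball[OF h(1) _ _ h(3)]) (use h(2) Suc.prems in auto)
      have 2: "norm (cofactor c t \<phi> w) \<le> C" using C(2)[OF h(1,2) w(1)] .
      have 3: "norm (\<phi> w) \<le> 2" using h(2) w by auto
      have 4: "norm (deriv (cofactor c t \<phi>) w) \<le> 2 * C / (\<rho> - r)"
      proof (rule norm_deriv_le_of_ball[OF _ _ _ h(3)])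
        show "cofactor c t \<phi> holomorphic_on ball z \<rho>"
          using \<rho> by (intro holomorphic_cofactor holomorphic_on_subset[OF h(1)]) auto
      qed (use C(2)[OF h(1,2)] \<rho> in auto)
      have "norm (cofactor c (Suc t) \<phi> w) \<le>
        norm (c t * deriv \<phi> w * cofactor c t \<phi> w) + norm (\<phi> w * deriv (cofactor c t \<phi>) w)"
        by (simp only: cofactor.simps norm_triangle_ineq)
      also have "norm (c t * deriv \<phi> w * cofactor c t \<phi> w) \<le> norm (c t) * (2 * 2 / (R - r)) * C"
        unfolding norm_mult using 1 2 Suc.prems by (intro mult_mono mult_nonneg_nonneg) auto
      also have "norm (\<phi> w * deriv (cofactor c t \<phi>) w) \<le> 2 * (2 * C / (\<rho> - r))"
        unfolding norm_mult using 3 4 by (intro mult_mono) auto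
      finally show ?thesis unfolding C'_def by simp
    qed
    moreover have "C' \<ge> 0" using C(1) \<rho> Suc.prems unfolding C'_def by (intro add_nonneg_nonneg mult_nonneg_nonneg divide_nonneg_nonneg) auto
    ultimately show ?case by blast
  qed
  then show ?thesis using that by blast
qed

lemma higher_deriv_power_cofactor:
  fixes g :: "complex \<Rightarrow> complex"
  assumes "g holomorphic_on S" "open S" "z \<in> S" "t \<le> m"
  shows "(deriv ^^ t) (\<lambda>w. g w ^ m) z = g z ^ (m - t) * cofactor (\<lambda>i. of_nat m - of_nat i) t g z"
  using assms(3,4)
proof (induction t arbitrary: z)
  case (Suc t)
  define e where "e = cofactor (\<lambda>i. of_nat m - of_nat i) t g"
  define s where "s = m - Suc t"
  have s: "m - t = Suc s" "(of_nat m - of_nat t :: complex) = of_nat (Suc s)"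
    using Suc.prems by (auto simp: s_def of_nat_diff)
  have dg: "(g has_field_derivative deriv g z) (at z)"
    using holomorphic_derivI[OF assms(1,2) Suc.prems(1)] .
  have de: "(e has_field_derivative deriv e z) (at z)" unfolding e_def
    by (rule holomorphic_derivI[OF holomorphic_cofactor[OF assms(1,2)] assms(2) Suc.prems(1)])
  have "((\<lambda>w. g w ^ Suc s * e w) has_field_derivative
      g z ^ s * (of_nat (Suc s) * deriv g z * e z + g z * deriv e z)) (at z)"
    by (rule derivative_eq_intros dg de refl)+ (simp add: algebra_simps)
  then have "((deriv ^^ t) (\<lambda>w. g w ^ m) has_field_derivative
      g z ^ s * (of_nat (Suc s) * deriv g z * e z + g z * deriv e z)) (at z)"
    by (rule has_field_derivative_transform_within_open[OF _ assms(2) Suc.prems(1)])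
      (use Suc s in \<open>auto simp: e_def\<close>)
  then have "deriv ((deriv ^^ t) (\<lambda>w. g w ^ m)) z = g z ^ s * (of_nat (Suc s) * deriv g z * e z + g z * deriv e z)"
    by (rule DERIV_imp_deriv)
  then show ?case unfolding s(2)[symmetric] by (simp add: e_def s_def)
qed auto

lemma higher_deriv_inverse_power_cofactor:
  fixes g \<phi> :: "complex \<Rightarrow> complex"
  assumes "\<phi> holomorphic_on S" "open S" "z \<in> S" "\<phi> z \<noteq> 0" "\<And>w. w \<in> S \<Longrightarrow> g w = inverse (\<phi> w)"
  shows "(deriv ^^ t) (\<lambda>w. g w ^ m) z = g z ^ (m + t) * cofactor (\<lambda>i. - (of_nat m + of_nat i)) t \<phi> z"
  using assms(3,4)
proof (induction t arbitrary: z)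
  case (Suc t)
  define e where "e = cofactor (\<lambda>i. - (of_nat m + of_nat i)) t \<phi>"
  \<comment> \<open>\<open>g\<close> need not be differentiable at zeros of \<open>\<phi>\<close>,
    so the formula is differentiated only on the open set where \<open>\<phi>\<close> is
    nonzero.\<close>
  define S' where "S' = {w\<in>S. \<phi> w \<noteq> 0}"
  have S': "open S'" "z \<in> S'"
  proof -
    have "S' = S \<inter> \<phi> -` (- {0})" by (auto simp: S'_def)
    then show "open S'" using assms(1,2) holomorphic_on_imp_continuous_on
      by (metis continuous_open_preimage open_Compl closed_singleton)
  qed (use Suc.prems in \<open>auto simp: S'_def\<close>)
  have d\<phi>: "(\<phi> has_field_derivative deriv \<phi> z) (at z)"
    using holomorphic_derivI[OF assms(1,2) Suc.prems(1)] .
  have "((\<lambda>w. inverse (\<phi> w)) has_field_derivative - (deriv \<phi> z * inverse (\<phi> z) ^ 2)) (at z)"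
    by (rule derivative_eq_intros d\<phi> Suc.prems(2) refl)+ (simp add: power2_eq_square)
  then have dg: "(g has_field_derivative - (deriv \<phi> z * g z ^ 2)) (at z)"
    using assms(5) has_field_derivative_transform_within_open[OF _ assms(2) Suc.prems(1)]
      Suc.prems(1) by (metis (no_types, lifting))
  have de: "(e has_field_derivative deriv e z) (at z)" unfolding e_def
    by (rule holomorphic_derivI[OF holomorphic_cofactor[OF assms(1,2)] assms(2) Suc.prems(1)])
  have g1: "g z * \<phi> z = 1" using assms(5)[OF Suc.prems(1)] Suc.prems(2) by simp
  have "((\<lambda>w. g w ^ (m + t) * e w) has_field_derivative
      of_nat (m + t) * g z ^ (m + t - 1) * (- (deriv \<phi> z * g z ^ 2)) * e z + g z ^ (m + t) * deriv e z) (at z)"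
    by (rule derivative_eq_intros dg de refl)+ (simp add: algebra_simps)
  also have "of_nat (m + t) * g z ^ (m + t - 1) * (- (deriv \<phi> z * g z ^ 2)) * e z
      = - of_nat (m + t) * g z ^ Suc (m + t) * deriv \<phi> z * e z"
    by (cases "m + t") (auto simp: power2_eq_square algebra_simps)
  \<comment> \<open>Inserting g \<open>\<phi>\<close> = 1 brings both terms to the exponent m + t +
    1.\<close>
  also have "g z ^ (m + t) * deriv e z = g z ^ (m + t) * (g z * \<phi> z) * deriv e z"
    unfolding g1 by simp
  also have "- of_nat (m + t) * g z ^ Suc (m + t) * deriv \<phi> z * e z + \<dots> =
     g z ^ (Suc (m + t)) * (- (of_nat m + of_nat t) * deriv \<phi> z * e z + \<phi> z * deriv e z)"
    by (simp add: algebra_simps)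
  finally have "((deriv ^^ t) (\<lambda>w. g w ^ m) has_field_derivative \<dots>) (at z)"
    by (rule has_field_derivative_transform_within_open[OF _ S'])
      (use Suc in \<open>auto simp: e_def S'_def\<close>)
  from DERIV_imp_deriv[OF this] show ?case by (simp add: e_def)
qed auto

definition diff_monomial ::
    "nat \<Rightarrow> nat \<Rightarrow> (nat \<Rightarrow> nat) \<Rightarrow> (nat \<Rightarrow> nat) \<Rightarrow> (complex \<Rightarrow> complex) \<Rightarrow> complex \<Rightarrow> complex" where
  "diff_monomial n k m t f z = f z ^ n * (\<Prod>j=1..k. (deriv ^^ t j) (\<lambda>w. f w ^ m j) z)"

lemma holomorphic_diff_monomial:
  assumes "f holomorphic_on S" "open S"
  shows "diff_monomial n k m t f holomorphic_on S"
  unfolding diff_monomial_def by (intro holomorphic_intros assms)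

lemma meromorphic_diff_monomial:
  assumes "f meromorphic_on S"
  shows "diff_monomial n k m t f meromorphic_on S"
  unfolding diff_monomial_def by (intro meromorphic_intros assms)

text \<open>For c = \<open>\<rho>\<close> powr (- T / N) the factor in front of the monomial is 1;
  this fixes the exponent of the rescaling.\<close>

lemma diff_monomial_rescale:
  fixes f :: "complex \<Rightarrow> complex"
  assumes "f holomorphic_on S" "open S" "z + of_real \<rho> * w \<in> S"
  shows "diff_monomial n k m t (\<lambda>w. c * f (z + of_real \<rho> * w)) w =
    c ^ (n + (\<Sum>j=1..k. m j)) * of_real \<rho> ^ (\<Sum>j=1..k. t j) * diff_monomial n k m t f (z + of_real \<rho> * w)"
proof -
  define T where "T = (\<lambda>w. z + of_real \<rho> * w) -` S"
  have T: "open T" unfolding T_def by (intro open_vimage assms continuous_intros)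
  have "(deriv ^^ i) (\<lambda>w. (c * f (z + of_real \<rho> * w)) ^ q) w =
     c ^ q * of_real \<rho> ^ i * (deriv ^^ i) (\<lambda>w. f w ^ q) (z + of_real \<rho> * w)" for i q
  proof -
    have hol: "(\<lambda>w. f w ^ q) holomorphic_on S" by (intro holomorphic_intros assms)
    have hol2: "(\<lambda>w. f (of_real \<rho> * w + z) ^ q) holomorphic_on T"
      by (intro holomorphic_intros holomorphic_on_compose_gen[OF _ assms(1), unfolded o_def])
        (auto simp: T_def add.commute)
    have "(deriv ^^ i) (\<lambda>w. (c * f (z + of_real \<rho> * w)) ^ q) w =
       (deriv ^^ i) (\<lambda>w. c ^ q * f (of_real \<rho> * w + z) ^ q) w"
      by (simp add: power_mult_distrib add.commute)
    also have "\<dots> = c ^ q * (deriv ^^ i) (\<lambda>w. f (of_real \<rho> * w + z) ^ q) w"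
      by (rule higher_deriv_cmult[OF hol2 _ T]) (use assms in \<open>auto simp: T_def\<close>)
    also have "(deriv ^^ i) (\<lambda>w. f (of_real \<rho> * w + z) ^ q) w =
       of_real \<rho> ^ i * (deriv ^^ i) (\<lambda>w. f w ^ q) (of_real \<rho> * w + z)"
      by (rule higher_deriv_compose_linear'[OF hol T assms(2)])
        (use assms in \<open>auto simp: T_def add.commute\<close>)
    finally show ?thesis by (simp add: add.commute mult.assoc)
  qed
  then show ?thesis
    by (simp add: diff_monomial_def power_mult_distrib prod.distrib power_add power_sum mult_ac)
qed

lemma is_pole_diff_monomial:
  assumes "f meromorphic_on {z}" "is_pole f z" "\<And>j. j \<in> {1..k} \<Longrightarrow> m j \<ge> 1" "k \<ge> 1"
  shows "is_pole (diff_monomial n k m t f) z"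
proof -
  have pow: "is_pole (\<lambda>w. f w ^ q) z" if "q \<ge> 1" for q
    unfolding is_pole_def
    by (rule Limits.filterlim_power_at_infinity[OF assms(2)[unfolded is_pole_def]]) (use that in auto)
  have hd: "is_pole ((deriv ^^ i) h) z" if "is_pole h z" "h meromorphic_on {z}" for i h
  proof (induction i)
    case (Suc i)
    have "(deriv ^^ i) h meromorphic_on {z}" using that by (intro meromorphic_intros)
    then show ?case using is_pole_deriv_iff Suc by simp
  qed (use that in auto)
  have pj: "is_pole ((deriv ^^ t j) (\<lambda>w. f w ^ m j)) z" if "j \<in> {1..k}" for j
    using that assms by (intro hd pow meromorphic_intros) auto
  have pm: "is_pole (\<lambda>w. h w * h' w) z" if "is_pole h z" "is_pole h' z" for h h' :: "complex \<Rightarrow> complex"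
    using that unfolding is_pole_def by (rule filterlim_at_infinity_times)
  have "is_pole (\<lambda>z. \<Prod>j=1..k. (deriv ^^ t j) (\<lambda>w. f w ^ m j) z) z"
  proof -
    have "k' \<ge> 1 \<Longrightarrow> k' \<le> k \<Longrightarrow> is_pole (\<lambda>z. \<Prod>j=1..k'. (deriv ^^ t j) (\<lambda>w. f w ^ m j) z) z" for k'
    proof (induction k' rule: nat_induct_at_least[of 1, case_names 1 Suc, consumes 1])
      case 1
      then show ?case using pj[of 1] by simp
    next
      case (Suc k')
      then show ?case using pj[of "Suc k'"] by (auto intro: pm)
    qed
    then show ?thesis using assms by simp
  qed
  moreover have "is_pole (\<lambda>w. f w ^ n) z" if "n \<noteq> 0" using pow[of n] that by simp
  ultimately show ?thesis unfolding diff_monomial_def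
    by (cases "n = 0") (auto intro: pm)
qed

text \<open>Requiring this of g or of 1/g at every point, with one radius, expresses a bounded
  spherical derivative without mentioning derivatives. The bound 2 leaves room above the level 1 at
  which the two charts are exchanged.\<close>

definition tame :: "real \<Rightarrow> (complex \<Rightarrow> complex) \<Rightarrow> complex \<Rightarrow> bool" where
  "tame d g z \<longleftrightarrow> g holomorphic_on ball z d \<and> (\<forall>w\<in>ball z d. norm (g w) \<le> 2)"

locale monomial =
  fixes n k :: nat and m t :: "nat \<Rightarrow> nat"
  assumes k: "k \<ge> 1" and t: "\<And>j. j \<in> {1..k} \<Longrightarrow> 1 \<le> t j" and tm: "\<And>j. j \<in> {1..k} \<Longrightarrow> t j \<le> m j"
begin

definition N :: nat where "N = n + (\<Sum>j=1..k. m j)"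
definition T :: nat where "T = (\<Sum>j=1..k. t j)"
abbreviation P :: "(complex \<Rightarrow> complex) \<Rightarrow> complex \<Rightarrow> complex" where "P \<equiv> diff_monomial n k m t"

text \<open>\<open>E1\<close> is what is left of P g after g^(N-T) is taken out, \<open>E2\<close>
  what is left after g^(N+T) is taken out near a pole, with \<open>\<phi>\<close> = 1/g. Both are
  uniformly bounded on tame discs.\<close>

definition E1 :: "(complex \<Rightarrow> complex) \<Rightarrow> complex \<Rightarrow> complex" where
  "E1 g z = (\<Prod>j=1..k. cofactor (\<lambda>i. of_nat (m j) - of_nat i) (t j) g z)"
definition E2 :: "(complex \<Rightarrow> complex) \<Rightarrow> complex \<Rightarrow> complex" where
  "E2 \<phi> z = (\<Prod>j=1..k. cofactor (\<lambda>i. - (of_nat (m j) + of_nat i)) (t j) \<phi> z)"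

lemma T_pos: "T \<ge> 1"
proof -
  have "t 1 \<le> T" unfolding T_def using k by (intro member_le_sum) auto
  then show ?thesis using t[of 1] k by simp
qed

lemma N_minus_T: "N - T = n + (\<Sum>j=1..k. m j - t j)"
proof -
  have "(\<Sum>j=1..k. t j) \<le> (\<Sum>j=1..k. m j)" using tm by (intro sum_mono)
  moreover have "(\<Sum>j=1..k. m j - t j) = (\<Sum>j=1..k. m j) - (\<Sum>j=1..k. t j)"
    using tm by (rule sum_subtractf_nat)
  ultimately show ?thesis by (simp add: N_def T_def)
qed

lemma P_eq_E1:
  assumes "g holomorphic_on S" "open S" "z \<in> S"
  shows "P g z = g z ^ (N - T) * E1 g z"
proof -
  have "(\<Prod>j=1..k. (deriv ^^ t j) (\<lambda>w. g w ^ m j) z) =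
      (\<Prod>j=1..k. g z ^ (m j - t j) * cofactor (\<lambda>i. of_nat (m j) - of_nat i) (t j) g z)"
    by (intro prod.cong refl higher_deriv_power_cofactor[OF assms] tm)
  then show ?thesis
    by (simp add: diff_monomial_def E1_def N_minus_T power_add power_sum prod.distrib)
qed

lemma P_eq_E2:
  assumes "\<phi> holomorphic_on S" "open S" "z \<in> S" "\<phi> z \<noteq> 0" "\<And>w. w \<in> S \<Longrightarrow> g w = inverse (\<phi> w)"
  shows "P g z = g z ^ (N + T) * E2 \<phi> z"
proof -
  have "(\<Prod>j=1..k. (deriv ^^ t j) (\<lambda>w. g w ^ m j) z) =
      (\<Prod>j=1..k. g z ^ (m j + t j) * cofactor (\<lambda>i. - (of_nat (m j) + of_nat i)) (t j) \<phi> z)"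
    by (intro prod.cong refl higher_deriv_inverse_power_cofactor[OF assms])
  moreover have "N + T = n + (\<Sum>j=1..k. m j + t j)" by (simp add: N_def T_def sum.distrib)
  ultimately show ?thesis
    by (simp add: diff_monomial_def E2_def power_add power_sum prod.distrib)
qed

lemma holomorphic_E:
  assumes "\<phi> holomorphic_on S" "open S"
  shows "E1 \<phi> holomorphic_on S" "E2 \<phi> holomorphic_on S"
  unfolding E1_def E2_def by (intro holomorphic_intros holomorphic_cofactor assms)+

lemma prod_cofactor_bound:
  assumes "0 < r" "r < R"
  shows "\<exists>C\<ge>0. \<forall>\<phi> z w. tame R \<phi> z \<longrightarrow> w \<in> ball z r \<longrightarrow> norm (\<Prod>j\<in>J. cofactor (c j) (t j) \<phi> w) \<le> C"
proof -
  have "\<forall>j. \<exists>C\<ge>0. \<forall>\<phi> z w. tame R \<phi> z \<longrightarrow> w \<in> ball z r \<longrightarrow> norm (cofactor (c j) (t j) \<phi> w) \<le> C"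
    using cofactor_bound[OF assms] unfolding tame_def by metis
  then obtain C where C: "\<And>j. C j \<ge> 0"
    "\<And>j \<phi> z w. tame R \<phi> z \<Longrightarrow> w \<in> ball z r \<Longrightarrow> norm (cofactor (c j) (t j) \<phi> w) \<le> C j"
    by metis
  have "norm (\<Prod>j\<in>J. cofactor (c j) (t j) \<phi> w) \<le> (\<Prod>j\<in>J. C j)" if "tame R \<phi> z" "w \<in> ball z r" for \<phi> z w
    unfolding prod_norm[symmetric] using C that by (intro prod_mono) auto
  moreover have "(\<Prod>j\<in>J. C j) \<ge> 0" using C by (intro prod_nonneg) auto
  ultimately show ?thesis by blast
qed

lemma E_bound:
  assumes "0 < r" "r < R"
  obtains C where "C \<ge> 0" "\<And>\<phi> z w. tame R \<phi> z \<Longrightarrow> w \<in> ball z r \<Longrightarrow> norm (E1 \<phi> w) \<le> C"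
    "\<And>\<phi> z w. tame R \<phi> z \<Longrightarrow> w \<in> ball z r \<Longrightarrow> norm (E2 \<phi> w) \<le> C"
proof -
  obtain C1 where C1: "C1 \<ge> 0" "\<And>\<phi> z w. tame R \<phi> z \<Longrightarrow> w \<in> ball z r \<Longrightarrow> norm (E1 \<phi> w) \<le> C1"
    using prod_cofactor_bound[OF assms, where J = "{1..k}" and c = "\<lambda>j i. of_nat (m j) - of_nat i"]
    unfolding E1_def by blast
  obtain C2 where C2: "C2 \<ge> 0" "\<And>\<phi> z w. tame R \<phi> z \<Longrightarrow> w \<in> ball z r \<Longrightarrow> norm (E2 \<phi> w) \<le> C2"
    using prod_cofactor_bound[OF assms, where J = "{1..k}" and c = "\<lambda>j i. - (of_nat (m j) + of_nat i)"]
    unfolding E2_def by blast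
  show ?thesis
    by (rule that[of "max C1 C2"]) (use C1 C2 in \<open>auto simp: le_max_iff_disj\<close>)
qed

end

section \<open>Functions with tame translates\<close>

text \<open>Such g, of bounded spherical derivative on the whole plane, are known as Yosida
  functions; they are what the rescaling produces in the limit.\<close>

locale yosida =
  fixes g :: "complex \<Rightarrow> complex" and d :: real
  assumes d: "d > 0" and mero: "g nicely_meromorphic_on UNIV"
    and nonconst: "\<not> g constant_on UNIV"
    and tame: "\<And>z. tame d g z \<or> tame d (\<lambda>w. inverse (g w)) z"
begin

lemma eventually_neq: "eventually (\<lambda>w. g w \<noteq> c) (at z)"
proof (rule ccontr)
  assume "\<not> ?thesis"
  then have "frequently (\<lambda>w. g w = c) (at z)" by (simp add: frequently_def)
  then have "g w = c" for w
    using frequently_eq_meromorphic_imp_constant[of g c z UNIV w] mero by auto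
  then show False using nonconst by (auto simp: constant_on_def)
qed

lemma g_meromorphic: "g meromorphic_on A"
  using mero by (auto simp: nicely_meromorphic_on_def intro: meromorphic_on_subset)

lemma analytic: "\<not> is_pole g z \<Longrightarrow> g analytic_on {z}"
  using nicely_meromorphic_on_imp_analytic_at[OF mero] by simp

lemma eventually_not_pole: "eventually (\<lambda>w. \<not> is_pole g w) (at z)"
  using meromorphic_on_imp_not_pole_cosparse[OF g_meromorphic[of UNIV]]
  by (simp add: eventually_cosparse_open_eq)

text \<open>\<open>nicely_meromorphic_on\<close> stores 0 at a pole, so the value 0 is ambiguous. A
  genuine zero of g would be a pole of 1/g, which is holomorphic here; only a pole of g
  remains.\<close>

lemma pole_iff:
  assumes "tame r (\<lambda>w. inverse (g w)) z" "w \<in> ball z r"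
  shows "is_pole g w \<longleftrightarrow> g w = 0"
proof
  assume "is_pole g w"
  then show "g w = 0" using is_pole_zero_at_nicely_mero[OF mero] by simp
next
  assume "g w = 0"
  then have "isolated_zero g w \<or> is_pole g w"
    using zero_or_pole[OF mero, of w] eventually_neq by simp
  moreover have "\<not> is_pole (\<lambda>w. inverse (g w)) w"
    using assms not_is_pole_holomorphic[of "ball z r" w] by (auto simp: tame_def)
  ultimately show "is_pole g w" by (simp add: is_pole_inverse_iff)
qed

lemma not_pole:
  assumes "tame r g z" "w \<in> ball z r"
  shows "\<not> is_pole g w"
  using assms not_is_pole_holomorphic[of "ball z r" w g] by (auto simp: tame_def)

lemma norm_ge_half:
  assumes "tame r (\<lambda>w. inverse (g w)) z" "w \<in> ball z r" "\<not> is_pole g w"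
  shows "norm (g w) \<ge> 1/2"
proof -
  have "g w \<noteq> 0" using pole_iff[OF assms(1,2)] assms(3) by simp
  have "norm (inverse (g w)) \<le> 2" using assms by (auto simp: tame_def)
  then have "norm (g w) * norm (inverse (g w)) \<le> norm (g w) * 2" by (intro mult_left_mono) auto
  then show ?thesis using \<open>g w \<noteq> 0\<close> by (simp flip: norm_mult)
qed

text \<open>Otherwise 1/g would be entire and bounded, hence constant by Liouville's
  theorem.\<close>

lemma not_bounded_below:
  assumes "\<And>z. \<not> is_pole g z" "e > 0"
  obtains z where "norm (g z) < e"
proof -
  have "\<exists>z. norm (g z) < e"
  proof (rule ccontr)
    assume "\<not> ?thesis"
    then have ge: "norm (g z) \<ge> e" for z by (simp add: not_less)
    have nz: "g z \<noteq> 0" for z using ge[of z] assms(2) by auto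
    have hol: "g holomorphic_on UNIV"
      using nicely_meromorphic_without_singularities[OF mero] assms(1) by (auto intro: analytic_imp_holomorphic)
    have "(\<lambda>z. inverse (g z)) holomorphic_on UNIV" using nz by (intro holomorphic_intros hol) auto
    moreover have "norm (inverse (g z)) \<le> inverse e" for z
      unfolding norm_inverse using ge[of z] assms(2) by (intro le_imp_inverse_le) auto
    then have "bounded (range (\<lambda>z. inverse (g z)))" by (auto simp: bounded_iff)
    ultimately obtain c where "\<And>z. inverse (g z) = c"
      using Liouville_theorem by (metis constant_on_def UNIV_I)
    then have "g z = inverse c" for z by (metis inverse_inverse_eq)
    then show False using nonconst by (auto simp: constant_on_def)
  qed
  then show ?thesis using that by blast
qed

end

section \<open>Entire functions with vanishing products or derivatives\<close>

lemma entire_prod_zero: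
  fixes F :: "'i \<Rightarrow> complex \<Rightarrow> complex"
  assumes "finite I" "\<And>i. i \<in> I \<Longrightarrow> F i holomorphic_on UNIV" "\<And>z. (\<Prod>i\<in>I. F i z) = 0"
  obtains i where "i \<in> I" "\<And>z. F i z = 0"
proof -
  have "\<exists>i\<in>I. \<forall>z. F i z = 0"
  proof (rule ccontr)
    assume "\<not> ?thesis"
    then have *: "\<And>i. i \<in> I \<Longrightarrow> \<exists>z. F i z \<noteq> 0" by simp
    have "eventually (\<lambda>z. F i z \<noteq> 0) (at 0)" if i: "i \<in> I" for i
    proof (rule ccontr)
      assume "\<not> ?thesis"
      then have "frequently (\<lambda>w. F i w = 0) (at 0)" by (simp add: frequently_def)
      moreover have "F i nicely_meromorphic_on UNIV"
        using assms(2)[OF i] by (intro analytic_on_imp_nicely_meromorphic_on) (simp add: analytic_on_open)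
      ultimately have "F i w = 0" for w
        using frequently_eq_meromorphic_imp_constant[of "F i" 0 0 UNIV w] by auto
      then show False using *[OF i] by simp
    qed
    then have "eventually (\<lambda>z. \<forall>i\<in>I. F i z \<noteq> 0) (at 0)"
      using assms(1) by (simp add: eventually_ball_finite_distrib)
    then obtain z where "\<forall>i\<in>I. F i z \<noteq> 0" using eventually_happens[of _ "at (0::complex)"] at_neq_bot by blast
    then show False using assms(1) assms(3)[of z] by simp
  qed
  then show ?thesis using that by blast
qed

lemma entire_higher_deriv_zero:
  assumes hol: "h holomorphic_on UNIV" and 0: "\<And>z. (deriv ^^ t) h z = 0"
  shows "h z = (\<Sum>i<t. (deriv ^^ i) h 0 / fact i * z ^ i)"
proof -
  have "(deriv ^^ t) h = (\<lambda>_. 0)" using 0 by auto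
  then have "(deriv ^^ (j + t)) h = (\<lambda>_. 0)" for j
    unfolding funpow_add o_def by simp
  then have van: "(deriv ^^ i) h 0 = 0" if "i \<ge> t" for i
    using that by (metis le_add_diff_inverse2)
  have "((\<lambda>i. (deriv ^^ i) h 0 / fact i * (z - 0) ^ i) sums h z)"
    by (rule holomorphic_power_series[of h 0 "norm z + 1"])
      (auto intro: holomorphic_on_subset[OF hol])
  moreover have "((\<lambda>i. (deriv ^^ i) h 0 / fact i * (z - 0) ^ i) sums (\<Sum>i<t. (deriv ^^ i) h 0 / fact i * (z - 0) ^ i))"
    by (rule sums_finite) (auto simp: van)
  ultimately show ?thesis by (simp add: sums_unique2)
qed

text \<open>The growth has order (m - 1) / m < 1, so Cauchy's estimate on large circles kills the
  derivative. The estimate is kept in m-th powers.\<close>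

lemma entire_power_small_growth:
  fixes g :: "complex \<Rightarrow> complex"
  assumes hol: "g holomorphic_on UNIV" and B: "B \<ge> 0" and m: "m \<ge> 1"
    and growth: "\<And>z. norm z \<ge> 1 \<Longrightarrow> norm (g z) ^ m \<le> B * norm z ^ (m - 1)"
  shows "g constant_on UNIV"
proof -
  have "deriv g w = 0" for w
  proof (rule ccontr)
    assume "deriv g w \<noteq> 0"
    then have pos: "norm (deriv g w) ^ m > 0" by simp
    \<comment> \<open>The last summand gives R |g' w|^m > B 2^(m-1), against the m-th power of
      Cauchy's estimate; \<open>norm w + 1\<close> keeps the circle about w of radius R between the
      moduli 1 and 2 R.\<close>
    define R where "R = norm w + 1 + B * 2 ^ (m - 1) / norm (deriv g w) ^ m"
    have "0 \<le> B * 2 ^ (m - 1) / norm (deriv g w) ^ m" using B pos by simp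
    then have R: "R \<ge> norm w + 1" "R \<ge> 1" "R > B * 2 ^ (m - 1) / norm (deriv g w) ^ m"
      unfolding R_def using norm_ge_zero[of w] by linarith+
    define b where "b = root m (B * (2 * R) ^ (m - 1))"
    have bm: "b \<ge> 0" "b ^ m = B * (2 * R) ^ (m - 1)"
      using m B R by (auto simp: b_def)
    have "norm ((deriv ^^ 1) g w) \<le> fact 1 * b / R ^ 1"
    proof (rule Cauchy_inequality)
      fix x assume x: "norm (w - x) = R"
      have "norm x \<ge> 1" using x R norm_triangle_ineq4[of w x] by linarith
      moreover have "norm x \<le> 2 * R"
        using x R norm_triangle_ineq2[of x w] by (simp add: norm_minus_commute)
      then have "B * norm x ^ (m - 1) \<le> B * (2 * R) ^ (m - 1)"
        using B by (intro mult_left_mono power_mono) auto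
      ultimately have "norm (g x) ^ m \<le> B * (2 * R) ^ (m - 1)"
        using growth[of x] by linarith
      then have "norm (g x) ^ m \<le> b ^ m" using bm by simp
      then show "norm (g x) \<le> b" using bm(1) m power_le_imp_le_base[of "norm (g x)" "m - 1" b] by simp
    qed (use R in \<open>auto intro!: holomorphic_on_imp_continuous_on holomorphic_on_subset[OF hol]\<close>)
    then have "R * norm (deriv g w) \<le> b" using R by (simp add: field_simps)
    then have "(R * norm (deriv g w)) ^ m \<le> b ^ m" using R by (intro power_mono) auto
    then have "R ^ (m - 1) * (R * norm (deriv g w) ^ m) \<le> R ^ (m - 1) * (B * 2 ^ (m - 1))"
      using bm m power_Suc[of R "m - 1"] by (simp add: power_mult_distrib mult_ac)
    then have "R * norm (deriv g w) ^ m \<le> B * 2 ^ (m - 1)" using R by simp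
    then show False using R(3) pos by (simp add: field_simps)
  qed
  then have "(g has_field_derivative 0) (at z)" for z
    using holomorphic_derivI[OF hol, of z] by simp
  then have "\<exists>c. \<forall>x\<in>UNIV. g x = c"
    by (intro has_field_derivative_zero_constant) auto
  then show ?thesis by (auto simp: constant_on_def)
qed

locale monomial_yosida = monomial + yosida +
  assumes NT: "N > T"
begin

lemma P_has_pole: "is_pole g z \<Longrightarrow> is_pole (P g) z"
  using is_pole_diff_monomial[OF g_meromorphic _ order_trans[OF t tm] k] .

text \<open>A pole of g is a pole of P g, so g would be entire. If c is nonzero, let g take very
  small values: P g = g^(N-T) E1 g with bounded E1 becomes small as well. If c = 0, some factor
  vanishes identically, so either g is 0 or some g^m is a polynomial of degree less than t <= m, and
  g grows too slowly to be nonconstant.\<close>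

lemma P_not_constant:
  assumes c: "\<And>z. \<not> is_pole g z \<Longrightarrow> P g z = c"
  shows False
proof -
  have np: "\<not> is_pole g z" for z
  proof
    assume "is_pole g z"
    then have "is_pole (P g) z" by (rule P_has_pole)
    moreover have "eventually (\<lambda>w. P g w = c) (at z)"
      using eventually_not_pole[of z] by eventually_elim (rule c)
    ultimately have "is_pole (\<lambda>_. c) z" by (rule is_pole_transform) simp
    then show False by simp
  qed
  have hol: "g holomorphic_on UNIV"
    using nicely_meromorphic_without_singularities[OF mero] np by (auto intro: analytic_imp_holomorphic)
  show False
  proof (cases "c = 0")
    case False
    have d2: "0 < d / 2" "d / 2 < d" using d by auto
    obtain C where C: "C \<ge> 0" "\<And>\<phi> z w. tame d \<phi> z \<Longrightarrow> w \<in> ball z (d / 2) \<Longrightarrow> norm (E1 \<phi> w) \<le> C"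
      using E_bound[OF d2] by metis
    \<comment> \<open>Below 1/2 the chart 1/g is excluded, and the second bound makes |P g| smaller
      than |c|.\<close>
    define e where "e = min (1/2) (norm c / (C + 1))"
    have e: "e > 0" using False C(1) by (simp add: e_def)
    obtain z where z: "norm (g z) < e" using not_bounded_below[OF np e] .
    then have "\<not> tame d (\<lambda>w. inverse (g w)) z"
      using norm_ge_half[of d z z] np d by (auto simp: e_def)
    then have tz: "tame d g z" using tame by blast
    have "norm c = norm (g z) ^ (N - T) * norm (E1 g z)"
      using c[OF np[of z]] P_eq_E1[OF hol open_UNIV UNIV_I, of z] by (metis norm_mult norm_power)
    also have "\<dots> \<le> norm (g z) ^ 1 * C"
    proof (rule mult_mono)
      show "norm (g z) ^ (N - T) \<le> norm (g z) ^ 1"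
        using z NT by (intro power_decreasing) (auto simp: e_def)
      show "norm (E1 g z) \<le> C" using C(2)[OF tz] d by simp
    qed auto
    also have "\<dots> \<le> norm (g z) * (C + 1)" using C(1) by (simp add: mult_left_mono)
    also have "\<dots> < norm c / (C + 1) * (C + 1)" using z C(1) by (intro mult_strict_right_mono) (auto simp: e_def)
    finally show False using C(1) by simp
  next
    case True
    define F where "F = (\<lambda>j. if j = 0 then (\<lambda>z. g z ^ n) else (deriv ^^ t j) (\<lambda>w. g w ^ m j))"
    have "{0..k} = insert 0 {1..k}" by auto
    then have "(\<Prod>j\<in>{0..k}. F j z) = P g z" for z by (simp add: F_def diff_monomial_def)
    then have 1: "(\<Prod>j\<in>{0..k}. F j z) = 0" for z using c np True by simp
    have 2: "F j holomorphic_on UNIV" for j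
      unfolding F_def by (auto intro!: holomorphic_intros hol)
    obtain j where j: "j \<in> {0..k}" "\<And>z. F j z = 0"
      using entire_prod_zero[OF _ 2 1] by auto
    show False
    proof (cases "j = 0")
      case True
      then have "g z = 0" for z using j(2)[of z] by (simp add: F_def)
      then show False using nonconst by (auto simp: constant_on_def)
    next
      case False
      then have jk: "j \<in> {1..k}" using j by auto
      define a where "a = (\<lambda>i. (deriv ^^ i) (\<lambda>w. g w ^ m j) 0 / fact i)"
      have eq: "g z ^ m j = (\<Sum>i<t j. a i * z ^ i)" for z
        unfolding a_def using entire_higher_deriv_zero[of "\<lambda>w. g w ^ m j" "t j" z] j(2) False
        by (auto simp: F_def intro!: holomorphic_intros hol)
      have "g constant_on UNIV"
      proof (rule entire_power_small_growth[OF hol])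
        show "m j \<ge> 1" using t[OF jk] tm[OF jk] by simp
        show "0 \<le> (\<Sum>i<t j. norm (a i))" by (simp add: sum_nonneg)
        fix z :: complex assume z: "norm z \<ge> 1"
        have "norm (g z) ^ m j = norm (\<Sum>i<t j. a i * z ^ i)" by (simp add: eq flip: norm_power)
        also have "\<dots> \<le> (\<Sum>i<t j. norm (a i) * norm z ^ (m j - 1))"
        proof (rule sum_norm_le)
          fix i assume i: "i \<in> {..<t j}"
          have "norm z ^ i \<le> norm z ^ (m j - 1)" using i tm[OF jk] z by (intro power_increasing) auto
          then show "norm (a i * z ^ i) \<le> norm (a i) * norm z ^ (m j - 1)"
            by (simp add: norm_mult norm_power mult_left_mono)
        qed
        finally show "norm (g z) ^ m j \<le> (\<Sum>i<t j. norm (a i)) * norm z ^ (m j - 1)"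
          by (simp add: sum_distrib_right)
      qed
      then show False using nonconst by simp
    qed
  qed
qed

end

section \<open>Entire functions with an omitted value\<close>

context yosida
begin

lemma deriv_bound_tame:
  assumes "tame d \<phi> z" "w \<in> ball z (d / 2)"
  shows "norm (deriv \<phi> w) \<le> 8 / d"
proof -
  have "norm (deriv \<phi> w) \<le> 2 * 2 / (d - d / 2)"
    by (rule norm_deriv_le_of_ball[OF _ _ _ assms(2)]) (use assms(1) d in \<open>auto simp: tame_def\<close>)
  then show ?thesis by simp
qed

text \<open>In the chart that is tame at \<open>a\<close>, the function has Lipschitz constant 8 /
  d. In the chart 1/g the logarithm is estimated by ln (1 - y) >= - y - 2 y^2 with y = 8 s / d; s <
  d / 16 ensures y <= 1/2, and the quadratic term costs the factor 2 that leads to 16 / d.\<close>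

lemma ln_norm_near_unit_level:
  assumes np: "\<And>z. \<not> is_pole g z" and a: "norm (g a) \<le> 1" and x: "dist a x = s" "0 < s" "s < d / 16"
    and gx: "norm (g x) > 1"
  shows "ln (norm (g x)) \<le> 16 / d * s"
proof -
  have lip: "norm (\<phi> x - \<phi> a) \<le> 8 / d * s" if "tame d \<phi> a" for \<phi>
  proof -
    have hol: "\<phi> holomorphic_on ball a d" using that by (simp add: tame_def)
    have "norm (\<phi> x - \<phi> a) \<le> 8 / d * norm (x - a)"
    proof (rule field_differentiable_bound[of "ball a (d / 2)" \<phi> "deriv \<phi>" "8 / d"])
      fix y assume y: "y \<in> ball a (d / 2)"
      then have "y \<in> ball a d" using d by simp
      then show "(\<phi> has_field_derivative deriv \<phi> y) (at y within ball a (d / 2))"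
        using holomorphic_derivI[OF hol open_ball] by blast
      show "norm (deriv \<phi> y) \<le> 8 / d" by (rule deriv_bound_tame[OF that y])
    qed (use x d in auto)
    then show ?thesis using x by (simp add: dist_norm norm_minus_commute)
  qed
  consider "tame d g a" | "tame d (\<lambda>w. inverse (g w)) a" using tame by blast
  then show ?thesis
  proof cases
    case 1
    have "norm (g x) \<le> norm (g a) + norm (g x - g a)" using norm_triangle_sub by blast
    also have "\<dots> \<le> 1 + 8 / d * s" using lip[OF 1] a by simp
    finally have "norm (g x) - 1 \<le> 8 / d * s" by simp
    moreover have "ln (norm (g x)) \<le> norm (g x) - 1" using gx by (intro ln_le_minus_one) linarith
    moreover have "8 / d * s \<le> 16 / d * s" using d x by (intro mult_right_mono divide_right_mono) auto
    ultimately show ?thesis by linarith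
  next
    case 2
    have ga: "g a \<noteq> 0" using pole_iff[OF 2, of a] np d by simp
    have "norm (inverse (g a)) \<ge> 1" using a ga by (simp add: norm_inverse one_le_inverse)
    moreover have "norm (inverse (g a)) \<le> norm (inverse (g x)) + norm (inverse (g x) - inverse (g a))"
      by (metis norm_triangle_sub norm_minus_commute)
    ultimately have "1 - 8 / d * s \<le> norm (inverse (g x))" using lip[OF 2] by linarith
    moreover define y where "y = 8 / d * s"
    have y: "0 \<le> y" "y \<le> 1/2" using x d by (auto simp: y_def field_simps)
    moreover have "norm (inverse (g x)) > 0" using gx by auto
    ultimately have 1: "ln (1 - y) \<le> ln (norm (inverse (g x)))" unfolding y_def[symmetric] by (intro ln_mono) linarith+
    have "- y - 2 * y\<^sup>2 \<le> ln (1 - y)" using ln_one_minus_pos_lower_bound[OF y] .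
    moreover have "2 * y\<^sup>2 \<le> y" using y mult_right_mono[of "2 * y" 1 y] by (simp add: power2_eq_square)
    moreover have "ln (norm (inverse (g x))) = - ln (norm (g x))" using gx by (simp add: norm_inverse ln_inverse)
    ultimately have "ln (norm (g x)) \<le> 2 * y" using 1 by linarith
    then show ?thesis by (simp add: y_def)
  qed
qed

text \<open>
  The argument of Clunie and Hayman: \<open>ln |g|\<close> is a positive harmonic function on \<open>{|g| > 1}\<close> with
  bounded gradient on the boundary, so Harnack's inequality in the largest disc around \<open>z\<close> inside
  this set bounds \<open>ln |g z|\<close> linearly in the radius of the disc.
\<close>

lemma exponential_type:
  assumes np: "\<And>z. \<not> is_pole g z"
  obtains B K where "K \<ge> 0" "\<And>z. norm (g z) \<le> exp (B + K * norm z)"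
proof -
  have hol: "g holomorphic_on UNIV"
    using nicely_meromorphic_without_singularities[OF mero] np by (auto intro: analytic_imp_holomorphic)
  then have cont: "continuous_on UNIV g" by (rule holomorphic_on_imp_continuous_on)
  define F where "F = {z. norm (g z) \<le> 1}"
  have clF: "closed F" unfolding F_def by (intro closed_Collect_le continuous_on_norm cont continuous_on_const)
  obtain z0 where "norm (g z0) < 1" by (rule not_bounded_below[OF np zero_less_one])
  then have z0: "z0 \<in> F" by (simp add: F_def)
  have main: "norm (g z) \<le> exp (32 / d * (norm z0 + norm z))" for z
  proof (cases "z \<in> F")
    case True
    then have "norm (g z) \<le> exp 0" by (simp add: F_def)
    also have "exp 0 \<le> exp (32 / d * (norm z0 + norm z))" using d by simp
    finally show ?thesis .
  next
    case False
    obtain a where a: "a \<in> F" "\<And>y. y \<in> F \<Longrightarrow> dist z a \<le> dist z y"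
      using distance_attains_inf[OF clF] z0 by (metis empty_iff)
    define \<rho> where "\<rho> = dist z a"
    have \<rho>: "\<rho> > 0" using a False by (auto simp: \<rho>_def)
    have big: "norm (g w) > 1" if "w \<in> ball z \<rho>" for w
      using a(2)[of w] that by (force simp: F_def \<rho>_def)
    \<comment> \<open>The auxiliary point x below lies at distance s from \<open>a\<close> on the
      segment to z. Harnack's inequality gives ln |g z| times s / (2 \<open>\<rho>\<close> - s) as a
      lower bound for ln |g x|, which is at most 16 s / d; so s cancels.\<close>
    define s where "s = min \<rho> (d / 16) / 2"
    have s: "0 < s" "s < \<rho>" "s < d / 16" using \<rho> d by (auto simp: s_def)
    define x where "x = a + of_real (s / \<rho>) * (z - a)"
    have ax: "dist a x = s"
      using \<rho> s by (simp add: x_def dist_norm norm_mult norm_divide \<rho>_def norm_minus_commute)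
    have "z - x = of_real (1 - s / \<rho>) * (z - a)" by (simp add: x_def algebra_simps)
    then have "dist z x = \<bar>1 - s / \<rho>\<bar> * \<rho>" by (simp add: dist_norm norm_mult \<rho>_def del: of_real_diff)
    also have "\<bar>1 - s / \<rho>\<bar> = 1 - s / \<rho>" using \<rho> s by simp
    finally have zx: "dist z x = \<rho> - s" using \<rho> by (simp add: left_diff_distrib)
    have xb: "x \<in> ball z \<rho>" using zx s by simp
    have "(1 - (\<rho> - s) / \<rho>) / (1 + (\<rho> - s) / \<rho>) * ln (1 / norm (inverse (g z))) \<le> ln (1 / norm (inverse (g x)))"
    proof (rule zero_free_harnack(1)[where F = "\<lambda>w. inverse (g w)"])
      have nz: "g w \<noteq> 0" if "w \<in> ball z \<rho>" for w using big[OF that] by auto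
      then show "(\<lambda>w. inverse (g w)) holomorphic_on ball z \<rho>"
        by (intro holomorphic_intros holomorphic_on_subset[OF hol]) auto
      show "inverse (g w) \<noteq> 0" if "w \<in> ball z \<rho>" for w using nz[OF that] by simp
      show "norm (inverse (g w)) < 1" if "w \<in> ball z \<rho>" for w
        using big[OF that] by (simp add: norm_inverse inverse_less_1_iff)
    qed (use xb zx in auto)
    moreover have "(1 - (\<rho> - s) / \<rho>) / (1 + (\<rho> - s) / \<rho>) = s / (2 * \<rho> - s)"
      using \<rho> s by (simp add: field_simps)
    moreover have "1 / norm (inverse w) = norm w" for w :: complex by (simp only: norm_inverse divide_inverse inverse_inverse_eq mult_1)
    ultimately have "s / (2 * \<rho> - s) * ln (norm (g z)) \<le> ln (norm (g x))" by simp
    also have "\<dots> \<le> 16 / d * s"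
      using ln_norm_near_unit_level[OF np _ ax s(1,3) big[OF xb]] a by (simp add: F_def)
    finally have "s * (ln (norm (g z)) / (2 * \<rho> - s)) \<le> s * (16 / d)" by (simp add: mult.commute)
    then have "ln (norm (g z)) / (2 * \<rho> - s) \<le> 16 / d" using s(1) by (rule mult_left_le_imp_le)
    then have "ln (norm (g z)) \<le> 16 / d * (2 * \<rho> - s)" using s by (simp add: pos_divide_le_eq)
    also have "\<dots> \<le> 32 / d * \<rho>" using s d by (simp add: field_simps)
    also have "\<dots> \<le> 32 / d * (norm z0 + norm z)"
      using a(2)[OF z0] d norm_triangle_ineq4[of z z0]
      by (intro mult_left_mono) (auto simp: \<rho>_def dist_norm)
    finally have le: "ln (norm (g z)) \<le> 32 / d * (norm z0 + norm z)" .
    have "norm (g z) = exp (ln (norm (g z)))" using big[of z] \<rho> by (intro exp_ln[symmetric]) force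
    also have "\<dots> \<le> exp (32 / d * (norm z0 + norm z))" using le by (simp only: exp_le_cancel_iff)
    finally show ?thesis .
  qed
  show ?thesis
    by (rule that[of "32 / d" "32 / d * norm z0"]) (use main d in \<open>auto simp: distrib_left\<close>)
qed

end

context monomial_yosida
begin

lemma P_growth:
  obtains C where "C \<ge> 0" "\<And>z. \<not> is_pole g z \<Longrightarrow> norm (P g z) \<le> C * (2 + norm (g z)) ^ (N + T)"
proof -
  have d2: "0 < d / 2" "d / 2 < d" using d by auto
  obtain C where C: "C \<ge> 0" "\<And>\<phi> z w. tame d \<phi> z \<Longrightarrow> w \<in> ball z (d / 2) \<Longrightarrow> norm (E1 \<phi> w) \<le> C"
    "\<And>\<phi> z w. tame d \<phi> z \<Longrightarrow> w \<in> ball z (d / 2) \<Longrightarrow> norm (E2 \<phi> w) \<le> C"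
    using E_bound[OF d2] by metis
  have "norm (P g z) \<le> C * (2 + norm (g z)) ^ (N + T)" if np: "\<not> is_pole g z" for z
  proof -
    have zb: "z \<in> ball z d" "z \<in> ball z (d / 2)" using d by auto
    consider "tame d g z" | "tame d (\<lambda>w. inverse (g w)) z" using tame by blast
    then show ?thesis
    proof cases
      case 1
      have "norm (P g z) = norm (g z) ^ (N - T) * norm (E1 g z)"
        using P_eq_E1[OF _ open_ball zb(1)] 1 by (simp add: tame_def norm_mult norm_power)
      also have "\<dots> \<le> (2 + norm (g z)) ^ (N + T) * C"
      proof (rule mult_mono)
        have "norm (g z) ^ (N - T) \<le> (2 + norm (g z)) ^ (N - T)" by (intro power_mono) auto
        also have "\<dots> \<le> (2 + norm (g z)) ^ (N + T)" by (intro power_increasing) auto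
        finally show "norm (g z) ^ (N - T) \<le> (2 + norm (g z)) ^ (N + T)" .
      qed (use C(2)[OF 1 zb(2)] in auto)
      finally show ?thesis by (simp add: mult.commute)
    next
      case 2
      have "g z \<noteq> 0" using pole_iff[OF 2 zb(1)] np by simp
      then have "norm (P g z) = norm (g z) ^ (N + T) * norm (E2 (\<lambda>w. inverse (g w)) z)"
        using P_eq_E2[OF _ open_ball zb(1), of "\<lambda>w. inverse (g w)" g] 2
        by (simp add: tame_def norm_mult norm_power)
      also have "\<dots> \<le> (2 + norm (g z)) ^ (N + T) * C"
        using C(3)[OF 2 zb(2)] by (intro mult_mono power_mono) auto
      finally show ?thesis by (simp add: mult.commute)
    qed
  qed
  then show ?thesis using that C(1) by blast
qed

text \<open>P g inherits exponential type from g, so the zero-free function P g - b is the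
  exponential of a linear function. Its slope is nonzero because P g is not constant.\<close>

lemma entire_omitted_value_form:
  assumes np: "\<And>z. \<not> is_pole g z" and omit: "\<And>z. P g z \<noteq> b"
  obtains \<alpha> \<beta> where "\<alpha> \<noteq> 0" "\<And>z. P g z = b + exp (\<alpha> * z + \<beta>)"
proof -
  have hol: "g holomorphic_on UNIV"
    using nicely_meromorphic_without_singularities[OF mero] np by (auto intro: analytic_imp_holomorphic)
  obtain B K where BK: "K \<ge> 0" "\<And>z. norm (g z) \<le> exp (B + K * norm z)" using exponential_type[OF np] by metis
  obtain C where C: "C \<ge> 0" "\<And>z. norm (P g z) \<le> C * (2 + norm (g z)) ^ (N + T)" using P_growth np by metis
  have growth: "norm (P g z - b) \<le> exp ((ln (C + norm b + 1) + real (N + T) * (ln 3 + \<bar>B\<bar>)) + real (N + T) * K * norm z)" for z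
  proof -
    define e where "e = exp (\<bar>B\<bar> + K * norm z)"
    have e1: "e \<ge> 1" using BK(1) by (simp add: e_def)
    have "norm (g z) \<le> e" using BK(2)[of z] order_trans by (fastforce simp: e_def)
    then have "(2 + norm (g z)) ^ (N + T) \<le> (3 * e) ^ (N + T)" using e1 by (intro power_mono) auto
    then have "norm (P g z) \<le> C * (3 * e) ^ (N + T)" using C by (meson mult_left_mono order_trans)
    moreover have "norm b * 1 \<le> norm b * (3 * e) ^ (N + T)" using e1 by (intro mult_left_mono one_le_power) auto
    ultimately have "norm (P g z - b) \<le> C * (3 * e) ^ (N + T) + norm b * (3 * e) ^ (N + T)"
      using norm_triangle_ineq4[of "P g z" b] by linarith
    also have "\<dots> = (C + norm b) * (3 * e) ^ (N + T)" by (simp add: distrib_right)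
    also have "\<dots> \<le> (C + norm b + 1) * (3 * e) ^ (N + T)" using e1 by (intro mult_right_mono) auto
    also have "\<dots> = exp (ln (C + norm b + 1)) * exp (ln 3 + (\<bar>B\<bar> + K * norm z)) ^ (N + T)"
    proof -
      have "exp (ln (C + norm b + 1)) = C + norm b + 1" using C(1) norm_ge_zero[of b] by (intro exp_ln) linarith
      moreover have "exp (ln 3 + (\<bar>B\<bar> + K * norm z)) = 3 * e" unfolding e_def exp_add[of "ln 3"] by simp
      ultimately show ?thesis by simp
    qed
    also have "\<dots> = exp ((ln (C + norm b + 1) + real (N + T) * (ln 3 + \<bar>B\<bar>)) + real (N + T) * K * norm z)"
      by (simp add: exp_of_nat_mult[symmetric] exp_add[symmetric] distrib_left add.assoc mult.assoc del: of_nat_add)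
    finally show ?thesis .
  qed
  have holP: "(\<lambda>z. P g z - b) holomorphic_on UNIV"
    by (intro holomorphic_intros holomorphic_diff_monomial hol open_UNIV)
  obtain \<alpha> \<beta> where ab: "\<And>z. P g z - b = exp (\<alpha> * z + \<beta>)"
    using entire_zero_free_exponential_type[OF holP _ growth] omit BK(1) by auto
  have "\<alpha> \<noteq> 0"
  proof
    assume "\<alpha> = 0"
    then have "P g z = b + exp \<beta>" for z using ab[of z] by (simp add: algebra_simps)
    then show False using P_not_constant by blast
  qed
  then show ?thesis using that[of \<alpha> \<beta>] ab by (metis add.commute diff_add_cancel)
qed

end

lemma higher_deriv_exp_linear:
  fixes c e :: complex
  shows "(deriv ^^ i) (\<lambda>z. exp (c * z + e)) = (\<lambda>z. c ^ i * exp (c * z + e))"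
proof (induction i)
  case (Suc i)
  have "deriv (\<lambda>z. c ^ i * exp (c * z + e)) z = c ^ Suc i * exp (c * z + e)" for z
    by (rule DERIV_imp_deriv) (auto intro!: derivative_eq_intros)
  then show ?case using Suc by auto
qed auto

text \<open>Differentiation shows that (\<open>\<alpha>\<close> - c2) exp (\<open>\<alpha>\<close> z
  + \<open>\<beta>\<close>) has the constant value c2 b. Comparing z = 0 with z = 1 /
  \<open>\<alpha>\<close> gives c2 = \<open>\<alpha>\<close>, and then \<open>\<alpha>\<close> b =
  0.\<close>

lemma exp_linear_not_affine:
  fixes b \<alpha> \<beta> c1 c2 :: complex
  assumes "\<alpha> \<noteq> 0" "b \<noteq> 0" and eq: "\<And>z. c1 * exp (c2 * z) = b + exp (\<alpha> * z + \<beta>)"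
  shows False
proof -
  have "((\<lambda>z. c1 * exp (c2 * z)) has_field_derivative c2 * (c1 * exp (c2 * z))) (at z)" for z
    by (auto intro!: derivative_eq_intros)
  moreover have "((\<lambda>z. c1 * exp (c2 * z)) has_field_derivative \<alpha> * exp (\<alpha> * z + \<beta>)) (at z)" for z
    unfolding eq by (auto intro!: derivative_eq_intros)
  ultimately have "c2 * (c1 * exp (c2 * z)) = \<alpha> * exp (\<alpha> * z + \<beta>)" for z
    by (rule DERIV_unique)
  then have eq2: "c2 * (b + exp (\<alpha> * z + \<beta>)) = \<alpha> * exp (\<alpha> * z + \<beta>)" for z
    unfolding eq .
  have *: "(\<alpha> - c2) * (exp (\<alpha> * z) * exp \<beta>) = c2 * b" for z
    using eq2[of z] unfolding exp_add by (simp add: algebra_simps)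
  have "(\<alpha> - c2) * (exp (\<alpha> * (1 / \<alpha>)) * exp \<beta>) = (\<alpha> - c2) * (exp (\<alpha> * 0) * exp \<beta>)"
    using *[of "1 / \<alpha>"] *[of 0] by simp
  then have "(\<alpha> - c2) * exp 1 = (\<alpha> - c2) * (1::complex)" using assms(1) by simp
  moreover have "exp 1 \<noteq> (1::complex)"
    by (metis exp_of_real of_real_1 of_real_eq_1_iff exp_eq_one_iff zero_neq_one)
  ultimately have "c2 = \<alpha>" by auto
  then show False using *[of 0] assms by simp
qed

context monomial_yosida
begin

text \<open>At a zero of g, P g vanishes to order at least N - T >= 2, but the derivative of b + exp
  (\<open>\<alpha>\<close> z + \<open>\<beta>\<close>) has no zeros. So g is zero-free and of
  exponential type, hence an exponential itself; P g is then a multiple of one exponential and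
  cannot be b plus another.\<close>

theorem entire_picard:
  assumes np: "\<And>z. \<not> is_pole g z" and omit: "\<And>z. P g z \<noteq> b" and b: "b \<noteq> 0" and N2: "N \<ge> T + 2"
  shows False
proof -
  have hol: "g holomorphic_on UNIV"
    using nicely_meromorphic_without_singularities[OF mero] np by (auto intro: analytic_imp_holomorphic)
  obtain \<alpha> \<beta> where \<alpha>: "\<alpha> \<noteq> 0" and ab: "\<And>z. P g z = b + exp (\<alpha> * z + \<beta>)"
    using entire_omitted_value_form[OF np omit] by metis
  have nz: "g z \<noteq> 0" for z
  proof
    assume 0: "g z = 0"
    define h where "h = (\<lambda>w. g w ^ (N - T - 2) * E1 g w)"
    have hh: "h holomorphic_on UNIV" unfolding h_def by (intro holomorphic_intros holomorphic_E hol open_UNIV)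
    have dg: "(g has_field_derivative deriv g z) (at z)" "(h has_field_derivative deriv h z) (at z)"
      using holomorphic_derivI[OF hol open_UNIV] holomorphic_derivI[OF hh open_UNIV] by auto
    have "P g w = g w ^ 2 * h w" for w
    proof -
      have "N - T = 2 + (N - T - 2)" using N2 by simp
      then show ?thesis using P_eq_E1[OF hol open_UNIV UNIV_I, of w] by (metis h_def mult.assoc power_add)
    qed
    then have "(\<lambda>w. b + exp (\<alpha> * w + \<beta>)) = (\<lambda>w. g w ^ 2 * h w)" using ab by auto
    moreover have "((\<lambda>w. g w ^ 2 * h w) has_field_derivative 0) (at z)"
      by (rule derivative_eq_intros dg refl)+ (simp add: 0)
    moreover have "((\<lambda>w. b + exp (\<alpha> * w + \<beta>)) has_field_derivative \<alpha> * exp (\<alpha> * z + \<beta>)) (at z)"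
      by (auto intro!: derivative_eq_intros)
    ultimately have "\<alpha> * exp (\<alpha> * z + \<beta>) = 0" using DERIV_unique by metis
    then show False using \<alpha> by simp
  qed
  obtain B K where BK: "K \<ge> 0" "\<And>z. norm (g z) \<le> exp (B + K * norm z)" using exponential_type[OF np] by metis
  obtain \<gamma> \<delta> where g: "\<And>z. g z = exp (\<gamma> * z + \<delta>)"
    using entire_zero_free_exponential_type[OF hol nz BK(2,1)] by metis
  define c where "c = (\<Prod>j=1..k. (of_nat (m j) * \<gamma>) ^ t j)"
  have "(deriv ^^ i) (\<lambda>w. g w ^ q) z = (of_nat q * \<gamma>) ^ i * exp (\<gamma> * z + \<delta>) ^ q" for i q z
  proof -
    have "(\<lambda>w. g w ^ q) = (\<lambda>w. exp (of_nat q * \<gamma> * w + of_nat q * \<delta>))"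
      by (auto simp: g exp_of_nat_mult[symmetric] algebra_simps)
    then show ?thesis using higher_deriv_exp_linear[of i "of_nat q * \<gamma>" "of_nat q * \<delta>"]
      by (simp add: exp_of_nat_mult[symmetric] algebra_simps)
  qed
  then have "P g z = c * exp (\<gamma> * z + \<delta>) ^ N" for z
    by (simp add: diff_monomial_def g c_def prod.distrib N_def power_add power_sum)
  then have "(c * exp \<delta> ^ N) * exp (of_nat N * \<gamma> * z) = b + exp (\<alpha> * z + \<beta>)" for z
    using ab[of z] by (simp add: exp_add power_mult_distrib exp_of_nat_mult[symmetric] mult_ac)
  then show False by (rule exp_linear_not_affine[OF \<alpha> b])
qed

end

section \<open>Polynomials and exponentials near infinity\<close>

lemma exp_not_polynomially_bounded:
  fixes \<alpha> \<beta> :: complex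
  assumes "\<alpha> \<noteq> 0" and le: "\<And>z. norm z \<ge> R \<Longrightarrow> norm (exp (\<alpha> * z + \<beta>)) \<le> C * norm z ^ q"
  shows False
proof -
  have "((\<lambda>x. C / norm \<alpha> ^ q / exp (Re \<beta>) * (x ^ q / exp x)) \<longlongrightarrow> C / norm \<alpha> ^ q / exp (Re \<beta>) * (0::real)) at_top"
    by (intro tendsto_mult tendsto_const tendsto_power_div_exp_0)
  moreover have "eventually (\<lambda>x::real. C / norm \<alpha> ^ q / exp (Re \<beta>) * (x ^ q / exp x) \<ge> 1) at_top"
    using eventually_ge_at_top[of "max 0 (R * norm \<alpha>)"]
  proof eventually_elim
    case (elim x)
    \<comment> \<open>On the ray z = x / \<open>\<alpha>\<close> the exponential grows like
      e^x.\<close>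
    have n: "norm (of_real x / \<alpha>) = x / norm \<alpha>" using elim by (simp add: norm_divide)
    have "norm (exp (\<alpha> * (of_real x / \<alpha>) + \<beta>)) \<le> C * norm (of_real x / \<alpha>) ^ q"
      by (rule le) (use elim assms(1) in \<open>simp add: n pos_le_divide_eq\<close>)
    then have "exp x * exp (Re \<beta>) \<le> C * (x ^ q / norm \<alpha> ^ q)"
      using assms(1) unfolding n by (simp add: power_divide exp_add norm_mult norm_exp_eq_Re)
    then have "1 \<le> C * (x ^ q / norm \<alpha> ^ q) / (exp x * exp (Re \<beta>))" by (subst pos_le_divide_eq) auto
    also have "\<dots> = C / norm \<alpha> ^ q / exp (Re \<beta>) * (x ^ q / exp x)" by (simp add: field_simps)
    finally show ?case .
  qed
  ultimately have "(1::real) \<le> C / norm \<alpha> ^ q / exp (Re \<beta>) * 0"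
    by (rule tendsto_lowerbound) simp
  then show False by simp
qed

lemma poly_of_higher_deriv_const:
  assumes hol: "h holomorphic_on UNIV" and c: "\<And>z. (deriv ^^ t) h z = c"
  obtains p :: "complex poly" where "\<And>z. h z = poly p z" "coeff p t = c / fact t" "degree p \<le> t"
proof -
  have "(deriv ^^ Suc t) h z = 0" for z
  proof -
    have "(deriv ^^ t) h = (\<lambda>_. c)" using c by auto
    then show ?thesis by simp
  qed
  then have eq: "h z = (\<Sum>i<Suc t. (deriv ^^ i) h 0 / fact i * z ^ i)" for z
    by (rule entire_higher_deriv_zero[OF hol])
  define p where "p = (\<Sum>i<Suc t. monom ((deriv ^^ i) h 0 / fact i) i)"
  have "h z = poly p z" for z unfolding eq[of z] p_def by (simp add: poly_sum poly_monom del: sum.lessThan_Suc)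
  moreover have "coeff p t = c / fact t"
  proof -
    have "coeff p t = (\<Sum>i<Suc t. if i = t then (deriv ^^ i) h 0 / fact i else 0)"
      unfolding p_def by (simp add: coeff_sum del: sum.lessThan_Suc)
    also have "\<dots> = c / fact t" using c[of 0] by simp
    finally show ?thesis .
  qed
  moreover have "degree p \<le> t" unfolding p_def
    by (intro degree_sum_le) (auto intro: order_trans[OF degree_monom_le])
  ultimately show ?thesis using that by metis
qed

lemma poly_growth:
  fixes p :: "complex poly"
  assumes "degree p \<le> t"
  obtains C where "C \<ge> 0" "\<And>z. norm z \<ge> 1 \<Longrightarrow> norm (poly p z) \<le> C * norm z ^ t"
proof
  show "0 \<le> (\<Sum>i\<le>degree p. norm (coeff p i))" by (simp add: sum_nonneg)
  fix z :: complex assume z: "norm z \<ge> 1"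
  have "norm (poly p z) \<le> (\<Sum>i\<le>degree p. norm (coeff p i) * norm z ^ t)"
    unfolding poly_altdef
  proof (rule sum_norm_le)
    fix i assume i: "i \<in> {..degree p}"
    have "norm z ^ i \<le> norm z ^ t" using i assms z by (intro power_increasing) auto
    then show "norm (coeff p i * z ^ i) \<le> norm (coeff p i) * norm z ^ t"
      by (simp add: norm_mult norm_power mult_left_mono)
  qed
  then show "norm (poly p z) \<le> (\<Sum>i\<le>degree p. norm (coeff p i)) * norm z ^ t"
    by (simp add: sum_distrib_right)
qed

lemma poly_large:
  fixes p :: "complex poly"
  assumes "degree p \<ge> 1"
  obtains R where "\<And>z. norm z \<ge> R \<Longrightarrow> norm (poly p z) > B"
proof -
  have "filterlim (poly p) at_infinity at_infinity" using assms by (intro filterlim_poly_at_infinity) auto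
  then have "filterlim (\<lambda>z. norm (poly p z)) at_top at_infinity"
    by (simp add: filterlim_at_infinity_conv_norm_at_top)
  then have "eventually (\<lambda>z. norm (poly p z) > B) at_infinity"
    by (simp add: filterlim_at_top_dense)
  then show ?thesis using that by (auto simp: eventually_at_infinity)
qed

lemma poly_bounded_below:
  fixes p :: "complex poly"
  assumes "p \<noteq> 0"
  obtains R c where "c > 0" "\<And>z. norm z \<ge> R \<Longrightarrow> norm (poly p z) \<ge> c"
proof (cases "degree p = 0")
  case True
  then obtain a where "p = [:a:]" using degree_eq_zeroE by blast
  then show ?thesis using assms that[of "norm a" 0] by simp
next
  case False
  obtain R where "\<And>z. norm z \<ge> R \<Longrightarrow> norm (poly p z) > 1" by (rule poly_large[of p 1]) (use False in auto)
  then show ?thesis using that[of 1 R] by (simp add: less_imp_le)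
qed

lemma entire_poly_growth_imp_poly:
  assumes "f holomorphic_on UNIV" "\<And>z. R \<le> norm z \<Longrightarrow> norm (f z) \<le> B * norm z ^ n"
  obtains p :: "complex poly" where "\<And>z. f z = poly p z"
proof
  fix z
  show "f z = poly (\<Sum>i\<le>n. monom ((deriv ^^ i) f 0 / fact i) i) z"
    using Liouville_polynomial[OF assms, where \<xi> = z] by (simp add: poly_sum poly_monom)
qed

context yosida
begin

text \<open>In the chart 1/g one has g' = - g^2 (1/g)', so the bound for (1/g)' carries over as long
  as |g| <= 1.\<close>

lemma deriv_bound_small:
  assumes "norm (g z) \<le> 1" "\<not> is_pole g z"
  shows "norm (deriv g z) \<le> 8 / d"
proof -
  have z: "z \<in> ball z (d / 2)" "z \<in> ball z d" using d by auto
  consider "tame d g z" | "tame d (\<lambda>w. inverse (g w)) z" using tame by blast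
  then show ?thesis
  proof cases
    case 1
    then show ?thesis using deriv_bound_tame[OF 1 z(1)] by simp
  next
    case 2
    have nz: "g z \<noteq> 0" using pole_iff[OF 2 z(2)] assms(2) by simp
    have "(g has_field_derivative deriv g z) (at z)"
      using analytic[OF assms(2)] by (simp add: analytic_on_imp_differentiable_at DERIV_deriv_iff_field_differentiable)
    then have "((\<lambda>w. inverse (g w)) has_field_derivative - (deriv g z / g z ^ 2)) (at z)"
      using nz by (auto intro!: derivative_eq_intros simp: power2_eq_square field_simps)
    then have "deriv (\<lambda>w. inverse (g w)) z = - (deriv g z / g z ^ 2)" by (rule DERIV_imp_deriv)
    then have "norm (deriv g z) = norm (g z) ^ 2 * norm (deriv (\<lambda>w. inverse (g w)) z)"
      using nz by (simp add: norm_divide norm_power)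
    also have "\<dots> \<le> 1 * (8 / d)"
      using deriv_bound_tame[OF 2 z(1)] assms(1) d by (intro mult_mono) (auto simp: power_le_one)
    finally show ?thesis by simp
  qed
qed

end

context monomial_yosida
begin

text \<open>
  Here \<open>g^m = K + A e^(\<alpha> z)\<close> with a polynomial \<open>K\<close> of degree \<open>t\<close>, and the exponential is eliminated
  by \<open>\<alpha> g^m - (g^m)' = \<alpha> K - K'\<close>, whose left-hand side is divisible by \<open>g^t\<close>.
\<close>

theorem entire_picard_borderline:
  assumes np: "\<And>z. \<not> is_pole g z" and omit: "\<And>z. P g z \<noteq> b" and b: "b \<noteq> 0"
    and kn: "k = 1" "n = 0" "m 1 = t 1 + 1"
  shows False
proof -
  define q where "q = t 1"
  have q: "q \<ge> 1" "m 1 = Suc q" using t[of 1] kn by (auto simp: q_def)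
  have hol: "g holomorphic_on UNIV"
    using nicely_meromorphic_without_singularities[OF mero] np by (auto intro: analytic_imp_holomorphic)
  obtain \<alpha> \<beta> where \<alpha>: "\<alpha> \<noteq> 0" and ab: "\<And>z. P g z = b + exp (\<alpha> * z + \<beta>)"
    using entire_omitted_value_form[OF np omit] by metis
  define G where "G = (\<lambda>z. g z ^ Suc q)"
  have holG: "G holomorphic_on UNIV" unfolding G_def by (intro holomorphic_intros hol)
  have PG: "P g z = (deriv ^^ q) G z" for z
    using kn by (simp add: diff_monomial_def G_def q_def)
  define ex where "ex = (\<lambda>z. exp (\<alpha> * z + \<beta>))"
  define K where "K = (\<lambda>z. G z - inverse (\<alpha> ^ q) * ex z)"
  have holex: "ex holomorphic_on UNIV" unfolding ex_def by (intro holomorphic_intros)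
  have holK: "K holomorphic_on UNIV" unfolding K_def by (intro holomorphic_intros holG holex)
  have "(deriv ^^ q) K z = b" for z
  proof -
    have "(deriv ^^ q) K z = (deriv ^^ q) G z - (deriv ^^ q) (\<lambda>z. inverse (\<alpha> ^ q) * ex z) z"
      unfolding K_def by (rule higher_deriv_diff[where S=UNIV]) (auto intro!: holomorphic_intros holG holex)
    also have "(deriv ^^ q) (\<lambda>z. inverse (\<alpha> ^ q) * ex z) z = inverse (\<alpha> ^ q) * (deriv ^^ q) ex z"
      by (rule higher_deriv_cmult[OF holex]) auto
    also have "(deriv ^^ q) ex z = \<alpha> ^ q * ex z" unfolding ex_def by (simp add: higher_deriv_exp_linear)
    finally show ?thesis using ab[of z] PG[of z] \<alpha> by (simp add: ex_def)
  qed
  then obtain p where p: "\<And>z. K z = poly p z" "coeff p q = b / fact q" "degree p \<le> q"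
    using poly_of_higher_deriv_const[OF holK] by metis
  \<comment> \<open>The right-hand side of the relation without the exponential. Its coefficient at
    z^q is \<open>\<alpha>\<close> b / q!, since p' has degree below q; hence \<open>s\<close> has
    degree exactly q and is unbounded.\<close>
  define s where "s = smult \<alpha> p - pderiv p"
  have "degree p < Suc q" using p(3) by simp
  then have "coeff s q = \<alpha> * (b / fact q)"
    by (simp add: s_def coeff_pderiv p(2) coeff_eq_0)
  then have "coeff s q \<noteq> 0" using \<alpha> b by simp
  then have s: "degree s \<ge> q" "s \<noteq> 0" using le_degree by auto
  have sdeg: "degree s \<le> q" unfolding s_def
    using p(3) by (intro degree_diff_le) (auto simp: degree_pderiv)
  define \<kappa> where "\<kappa> = (\<lambda>z. \<alpha> * g z - of_nat (Suc q) * deriv g z)"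
  have key: "g z ^ q * \<kappa> z = poly s z" for z
  proof -
    have dg: "(g has_field_derivative deriv g z) (at z)" using holomorphic_derivI[OF hol open_UNIV] by simp
    have "(K has_field_derivative (of_nat (Suc q) * g z ^ q * deriv g z - inverse (\<alpha> ^ q) * (\<alpha> * ex z))) (at z)"
      unfolding K_def G_def ex_def by (rule derivative_eq_intros dg refl)+ simp
    moreover have "K = poly p" using p(1) by auto
    ultimately have "poly (pderiv p) z = of_nat (Suc q) * g z ^ q * deriv g z - inverse (\<alpha> ^ q) * (\<alpha> * ex z)"
      using DERIV_unique poly_DERIV by metis
    then show ?thesis
      using p(1)[of z] by (simp add: s_def \<kappa>_def K_def G_def algebra_simps)
  qed
  \<comment> \<open>Where |g| <= 1, both factors of s = g^q \<open>\<kappa>\<close> are bounded, so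
    |g| > 1 far out. There \<open>\<kappa>\<close> is dominated by s, hence \<open>\<kappa>\<close>
    is a polynomial.\<close>
  obtain R1 where R1: "\<And>z. norm z \<ge> R1 \<Longrightarrow> norm (poly s z) > norm \<alpha> + real (Suc q) * (8 / d)"
    by (rule poly_large[of s]) (use s q in auto)
  have big: "norm (g z) > 1" if "norm z \<ge> R1" for z
  proof (rule ccontr)
    assume "\<not> ?thesis"
    then have le: "norm (g z) \<le> 1" by simp
    have "norm (\<kappa> z) \<le> norm \<alpha> * norm (g z) + real (Suc q) * norm (deriv g z)"
      unfolding \<kappa>_def by (rule order_trans[OF norm_triangle_ineq4]) (simp add: norm_mult del: of_nat_Suc)
    also have "\<dots> \<le> norm \<alpha> * 1 + real (Suc q) * (8 / d)"
      using le deriv_bound_small[OF le np] by (intro add_mono mult_left_mono) auto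
    finally have "norm (poly s z) \<le> 1 * (norm \<alpha> * 1 + real (Suc q) * (8 / d))"
      unfolding key[symmetric] norm_mult norm_power using le by (intro mult_mono power_le_one) auto
    then show False using R1[OF that] by simp
  qed
  obtain C where C: "C \<ge> 0" "\<And>z. norm z \<ge> 1 \<Longrightarrow> norm (poly s z) \<le> C * norm z ^ q"
    using poly_growth[OF sdeg] by metis
  have hol\<kappa>: "\<kappa> holomorphic_on UNIV" unfolding \<kappa>_def by (intro holomorphic_intros hol) auto
  have "norm (\<kappa> z) \<le> C * norm z ^ q" if z: "max R1 1 \<le> norm z" for z
  proof -
    have "1 * norm (\<kappa> z) \<le> norm (g z) ^ q * norm (\<kappa> z)"
      using big[of z] z by (intro mult_right_mono one_le_power) auto
    also have "\<dots> = norm (poly s z)" by (simp flip: key add: norm_mult norm_power)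
    finally show ?thesis using C(2)[of z] z by simp
  qed
  then obtain r where r: "\<And>z. \<kappa> z = poly r z" using entire_poly_growth_imp_poly[OF hol\<kappa>] by metis
  have "r \<noteq> 0"
  proof
    assume "r = 0"
    then have "poly s z = 0" for z using key[of z] r[of z] by simp
    then show False using s(2) poly_all_0_iff_0 by blast
  qed
  then obtain R2 c where c: "c > 0" "\<And>z. norm z \<ge> R2 \<Longrightarrow> norm (poly r z) \<ge> c"
    using poly_bounded_below by metis
  obtain C' where C': "C' \<ge> 0" "\<And>z. norm z \<ge> 1 \<Longrightarrow> norm (poly p z) \<le> C' * norm z ^ q"
    using poly_growth[OF p(3)] by metis
  \<comment> \<open>Since M >= 1 and q >= 1, C / c <= M^q, so q-th roots may be taken: g grows at
    most linearly, which would bound the exponential polynomially.\<close>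
  define M where "M = max 1 (C / c)"
  have gM: "norm (g z) \<le> M * norm z" if z: "norm z \<ge> max (max R1 R2) 1" for z
  proof -
    have "norm (g z) ^ q * c \<le> norm (g z) ^ q * norm (\<kappa> z)"
      using c(2)[of z] z by (intro mult_left_mono) (auto simp: r)
    also have "\<dots> = norm (poly s z)" by (simp flip: key add: norm_mult norm_power)
    also have "\<dots> \<le> C * norm z ^ q" using C z by simp
    finally have "norm (g z) ^ q \<le> C / c * norm z ^ q" using c(1) by (simp add: field_simps)
    also have "\<dots> \<le> M ^ q * norm z ^ q"
    proof (rule mult_right_mono)
      have "C / c \<le> M ^ 1" by (simp add: M_def)
      also have "\<dots> \<le> M ^ q" using q by (intro power_increasing) (auto simp: M_def)
      finally show "C / c \<le> M ^ q" .
    qed auto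
    finally have "norm (g z) ^ Suc (q - 1) \<le> (M * norm z) ^ Suc (q - 1)"
      using q by (simp add: power_mult_distrib)
    then show ?thesis by (rule power_le_imp_le_base) (auto simp: M_def)
  qed
  have "norm (exp (\<alpha> * z + \<beta>)) \<le> (norm \<alpha> ^ q * (M ^ Suc q + C')) * norm z ^ Suc q"
    if z: "norm z \<ge> max (max R1 R2) 1" for z
  proof -
    have "exp (\<alpha> * z + \<beta>) = \<alpha> ^ q * (G z - poly p z)"
      using p(1)[of z] \<alpha> by (simp add: K_def ex_def field_simps)
    then have eq: "norm (exp (\<alpha> * z + \<beta>)) = norm \<alpha> ^ q * norm (G z - poly p z)" by (metis norm_mult norm_power)
    have "norm (G z - poly p z) \<le> norm (G z) + norm (poly p z)" by (rule norm_triangle_ineq4)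
    also have "norm (G z) \<le> (M * norm z) ^ Suc q"
      unfolding G_def norm_power using gM[OF z] by (intro power_mono) auto
    also have "norm (poly p z) \<le> C' * norm z ^ Suc q"
    proof -
      have "norm (poly p z) \<le> C' * norm z ^ q" using C' z by simp
      also have "\<dots> \<le> C' * norm z ^ Suc q" using C'(1) z by (intro mult_left_mono power_increasing) auto
      finally show ?thesis .
    qed
    finally have "norm (G z - poly p z) \<le> (M ^ Suc q + C') * norm z ^ Suc q"
      by (simp only: power_mult_distrib distrib_right add_mono order_refl)
    then show ?thesis unfolding eq mult.assoc by (intro mult_left_mono) auto
  qed
  then show False by (rule exp_not_polynomially_bounded[OF \<alpha>])
qed

end

section \<open>A lower bound for log-subharmonic functions\<close>

lemma max_modulus_circle:
  fixes F :: "complex \<Rightarrow> complex"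
  assumes hol: "F holomorphic_on ball c R" and s: "0 < s" "s < R"
  obtains z where "dist c z = s" "norm (F z) \<ge> norm (F c)"
proof -
  have cont: "continuous_on (sphere c s) (\<lambda>z. norm (F z))"
    using s by (intro continuous_on_norm holomorphic_on_imp_continuous_on holomorphic_on_subset[OF hol]) auto
  have "sphere c s \<noteq> {}" using s by simp
  then obtain z where z: "z \<in> sphere c s" "\<And>y. y \<in> sphere c s \<Longrightarrow> norm (F y) \<le> norm (F z)"
    using continuous_attains_sup[OF compact_sphere _ cont] by blast
  have "norm (F c) \<le> norm (F z)"
  proof (rule maximum_modulus_frontier[where f = F and S = "cball c s"])
    show "F holomorphic_on interior (cball c s)" using s by (intro holomorphic_on_subset[OF hol]) auto
    show "continuous_on (closure (cball c s)) F"
      using s by (intro holomorphic_on_imp_continuous_on holomorphic_on_subset[OF hol]) auto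
  qed (use z s in auto)
  then show ?thesis using that z by auto
qed

text \<open>
  \<open>log_sub K \<Theta> z\<close> is a local form of the inequality \<open>\<Delta> (ln \<Theta>) \<ge> - 4 K\<close> at \<open>z\<close>.
\<close>

definition log_sub :: "real \<Rightarrow> (complex \<Rightarrow> real) \<Rightarrow> complex \<Rightarrow> bool" where
  "log_sub K \<Theta> z \<longleftrightarrow> (\<exists>r F. r > 0 \<and> F holomorphic_on ball z r \<and> norm (F z) = \<Theta> z \<and>
     (\<forall>w\<in>ball z r. norm (F w) * exp (- K * (norm (w - z))\<^sup>2) \<le> \<Theta> w))"

text \<open>The comparison function is \<open>\<tau>\<close> ln (|z - c| / R) + (K + 1) (R^2 - |z -
  c|^2). Its logarithmic part is harmonic and its quadratic part has Laplacian - 4 (K + 1), below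
  the - 4 K allowed for ln \<open>\<Theta>\<close>. So the difference, which is ln \<open>h\<close>,
  is strictly subharmonic and cannot have an interior maximum above the boundary values.\<close>

lemma annulus_maximum_principle:
  fixes \<Theta> :: "complex \<Rightarrow> real" and \<tau> :: nat
  assumes cont: "continuous_on UNIV \<Theta>" and sub: "\<And>z. \<Theta> z > 0 \<Longrightarrow> log_sub K \<Theta> z"
    and K: "K \<ge> 0" and M: "M > 0" and R: "0 < \<eta>" "\<eta> < R"
    and outer: "\<And>z. dist c z = R \<Longrightarrow> \<Theta> z \<le> M"
    and inner: "\<And>z. dist c z = \<eta> \<Longrightarrow> \<Theta> z \<le> M * (\<eta> / R) ^ \<tau>"
    and z: "\<eta> \<le> dist c z" "dist c z \<le> R"
  shows "\<Theta> z \<le> M * (dist c z / R) ^ \<tau> * exp ((K + 1) * R\<^sup>2)"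
proof -
  define A where "A = cball c R - ball c \<eta>"
  define h where "h = (\<lambda>z. \<Theta> z * (R / dist c z) ^ \<tau> * exp ((K + 1) * ((dist c z)\<^sup>2 - R\<^sup>2)))"
  have A: "compact A" unfolding A_def by (intro compact_diff compact_cball open_ball)
  have pos: "dist c w > 0" if "w \<in> A" for w using that R unfolding A_def by auto
  have "continuous_on A h" unfolding h_def
    by (intro continuous_intros continuous_on_subset[OF cont]) (use pos in auto)
  moreover have zA: "z \<in> A" using z by (simp add: A_def)
  ultimately obtain z0 where z0: "z0 \<in> A" "\<And>w. w \<in> A \<Longrightarrow> h w \<le> h z0"
    using continuous_attains_sup[OF A, of h] by blast
  have le: "h z0 \<le> M"
  proof (rule ccontr)
    assume "\<not> h z0 \<le> M"
    then have gt: "h z0 > M" by simp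
    have "dist c z0 \<noteq> R"
    proof
      assume 1: "dist c z0 = R"
      then have "h z0 = \<Theta> z0" using R by (simp add: h_def)
      with gt outer[OF 1] show False by simp
    qed
    moreover have "dist c z0 \<noteq> \<eta>"
    proof
      assume 1: "dist c z0 = \<eta>"
      have "\<eta>\<^sup>2 \<le> R\<^sup>2" using R by (intro power_mono) auto
      then have e: "exp ((K + 1) * (\<eta>\<^sup>2 - R\<^sup>2)) \<le> 1" using K by (simp add: mult_nonneg_nonpos)
      have "\<Theta> z0 * (R / \<eta>) ^ \<tau> \<le> M * (\<eta> / R) ^ \<tau> * (R / \<eta>) ^ \<tau>"
        using inner[OF 1] R by (intro mult_right_mono) auto
      also have "\<dots> = M" using R by (simp add: power_divide)
      finally have "\<Theta> z0 * (R / \<eta>) ^ \<tau> \<le> M" .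
      then have "\<Theta> z0 * (R / \<eta>) ^ \<tau> * exp ((K + 1) * (\<eta>\<^sup>2 - R\<^sup>2)) \<le> M * 1"
        using M e by (intro mult_mono) auto
      then show False using gt by (simp add: h_def 1)
    qed
    ultimately have dz0: "\<eta> < dist c z0" "dist c z0 < R" using z0(1) by (auto simp: A_def)
    define D where "D = dist c z0"
    have D: "\<eta> < D" "D < R" "D > 0" using dz0 R by (auto simp: D_def)
    have "\<Theta> z0 > 0"
    proof (rule ccontr)
      assume "\<not> \<Theta> z0 > 0"
      then have "h z0 \<le> 0" unfolding h_def using D R by (intro mult_nonpos_nonneg) (auto simp: mult_nonpos_nonneg)
      then show False using gt M by simp
    qed
    then obtain r F where F: "r > 0" "F holomorphic_on ball z0 r" "norm (F z0) = \<Theta> z0"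
      "\<And>w. w \<in> ball z0 r \<Longrightarrow> norm (F w) * exp (- K * (norm (w - z0))\<^sup>2) \<le> \<Theta> w"
      using sub[of z0] unfolding log_sub_def by blast
    define r' where "r' = min r (min (D - \<eta>) (R - D))"
    have r': "r' > 0" "r' \<le> r" "r' \<le> D - \<eta>" "r' \<le> R - D" using F D by (auto simp: r'_def)
    have inA: "w \<in> A" if "w \<in> ball z0 r'" for w
    proof -
      have "dist c w \<le> D + dist z0 w" "D \<le> dist c w + dist z0 w"
        unfolding D_def by (metis dist_triangle, metis dist_triangle dist_commute)
      then show ?thesis using that r' D by (auto simp: A_def)
    qed
    \<comment> \<open>A holomorphic companion of \<open>h\<close> at the maximum point
      \<open>z0\<close>: the power of 1 / |w - c| and the part of |w - c|^2 linear in w - z0 come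
      from moduli of holomorphic functions. What remains is the factor exp (s^2), the surplus of K +
      1 over K, which contradicts maximality on a small circle.\<close>
    define F2 where "F2 = (\<lambda>w. F w * ((z0 - c) / (w - c)) ^ \<tau> * exp (2 * of_real (K + 1) * cnj (z0 - c) * (w - z0)))"
    have nc: "w \<noteq> c" if "w \<in> ball z0 r'" for w using pos[OF inA[OF that]] by auto
    have "F holomorphic_on ball z0 r'" using r' by (intro holomorphic_on_subset[OF F(2)]) auto
    then have "F2 holomorphic_on ball z0 r'"
      unfolding F2_def using nc by (intro holomorphic_intros) auto
    then obtain w where w: "dist z0 w = r' / 2" "norm (F2 w) \<ge> norm (F2 z0)"
      using max_modulus_circle[of F2 z0 r' "r' / 2"] r' by auto
    have wb: "w \<in> ball z0 r'" using w r' by simp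
    define s where "s = norm (w - z0)"
    have "s = r' / 2" using w(1) by (simp add: s_def dist_norm norm_minus_commute)
    then have s: "s > 0" using r' by simp
    have sq: "(dist c w)\<^sup>2 = D\<^sup>2 + Re (2 * cnj (z0 - c) * (w - z0)) + s\<^sup>2"
    proof -
      have "w - c = (z0 - c) + (w - z0)" by simp
      then have "(norm (w - c))\<^sup>2 = (norm (z0 - c))\<^sup>2 + Re (2 * cnj (z0 - c) * (w - z0)) + (norm (w - z0))\<^sup>2"
        unfolding cmod_power2 by (simp add: power2_eq_square algebra_simps)
      then show ?thesis by (simp add: D_def s_def dist_norm norm_minus_commute)
    qed
    define E where "E = (R / D) ^ \<tau> * exp ((K + 1) * (D\<^sup>2 - R\<^sup>2))"
    have E: "E > 0" using R D by (simp add: E_def)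
    have hz0: "h z0 = norm (F2 z0) * E"
      using D by (auto simp: h_def F2_def E_def F(3)[symmetric] D_def norm_mult norm_power)
    have nF2: "norm (F2 w) = norm (F w) * (D / dist c w) ^ \<tau> * exp ((K + 1) * Re (2 * cnj (z0 - c) * (w - z0)))"
      unfolding F2_def D_def
      by (simp add: norm_mult norm_power norm_divide norm_exp_eq_Re dist_norm norm_minus_commute algebra_simps)
    have "norm (F2 w) * E * exp (s\<^sup>2) = norm (F w) * exp (- K * s\<^sup>2) * (R / dist c w) ^ \<tau> * exp ((K + 1) * ((dist c w)\<^sup>2 - R\<^sup>2))"
    proof -
      have "(D / dist c w) ^ \<tau> * (R / D) ^ \<tau> = (R / dist c w) ^ \<tau>" using D by (simp flip: power_mult_distrib)
      moreover have "exp ((K + 1) * Re (2 * cnj (z0 - c) * (w - z0))) * exp ((K + 1) * (D\<^sup>2 - R\<^sup>2)) * exp (s\<^sup>2) =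
          exp (- K * s\<^sup>2) * exp ((K + 1) * ((dist c w)\<^sup>2 - R\<^sup>2))"
        unfolding sq exp_add[symmetric] by (simp add: algebra_simps)
      moreover have "norm (F2 w) * E * exp (s\<^sup>2) = norm (F w) * ((D / dist c w) ^ \<tau> * (R / D) ^ \<tau>) *
         (exp ((K + 1) * Re (2 * cnj (z0 - c) * (w - z0))) * exp ((K + 1) * (D\<^sup>2 - R\<^sup>2)) * exp (s\<^sup>2))"
        unfolding nF2 E_def by (simp only: mult_ac)
      ultimately show ?thesis by (simp only: mult_ac)
    qed
    also have "\<dots> \<le> h w"
    proof -
      have "norm (F w) * exp (- K * s\<^sup>2) \<le> \<Theta> w" using F(4)[of w] wb r' by (simp add: s_def)
      then show ?thesis unfolding h_def using R by (intro mult_right_mono) auto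
    qed
    also have "\<dots> \<le> h z0" using z0(2)[OF inA[OF wb]] .
    finally have "norm (F2 w) * E * exp (s\<^sup>2) \<le> norm (F2 z0) * E" unfolding hz0 .
    also have "\<dots> \<le> norm (F2 w) * E" using w E by (intro mult_right_mono) auto
    finally have "norm (F2 w) * E * exp (s\<^sup>2) \<le> norm (F2 w) * E * 1" by simp
    moreover have "norm (F2 w) * E > 0"
    proof -
      have "norm (F2 z0) * E > 0" using hz0 gt M by simp
      also have "norm (F2 z0) * E \<le> norm (F2 w) * E" using w E by (intro mult_right_mono) auto
      finally show ?thesis .
    qed
    ultimately have "exp (s\<^sup>2) \<le> 1" by (metis mult_le_cancel_left_pos)
    then show False using s by simp
  qed
  have dz: "dist c z > 0" using pos[OF zA] .
  have "\<Theta> z = h z * (dist c z / R) ^ \<tau> * exp ((K + 1) * (R\<^sup>2 - (dist c z)\<^sup>2))"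
  proof -
    have "(R / dist c z) ^ \<tau> * (dist c z / R) ^ \<tau> = 1" using dz R by (simp flip: power_mult_distrib)
    moreover have "exp ((K + 1) * ((dist c z)\<^sup>2 - R\<^sup>2)) * exp ((K + 1) * (R\<^sup>2 - (dist c z)\<^sup>2)) = 1"
      by (simp add: algebra_simps flip: exp_add)
    moreover have "h z * (dist c z / R) ^ \<tau> * exp ((K + 1) * (R\<^sup>2 - (dist c z)\<^sup>2)) =
       \<Theta> z * ((R / dist c z) ^ \<tau> * (dist c z / R) ^ \<tau>) *
       (exp ((K + 1) * ((dist c z)\<^sup>2 - R\<^sup>2)) * exp ((K + 1) * (R\<^sup>2 - (dist c z)\<^sup>2)))"
      unfolding h_def by (simp only: mult_ac)
    ultimately show ?thesis by (simp only: mult_1_right)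
  qed
  also have "\<dots> \<le> M * (dist c z / R) ^ \<tau> * exp ((K + 1) * R\<^sup>2)"
  proof (intro mult_mono)
    show "h z \<le> M" using z0(2)[OF zA] le by simp
    have "(K + 1) * (R\<^sup>2 - (dist c z)\<^sup>2) \<le> (K + 1) * R\<^sup>2" using K by (intro mult_left_mono) auto
    then show "exp ((K + 1) * (R\<^sup>2 - (dist c z)\<^sup>2)) \<le> exp ((K + 1) * R\<^sup>2)" by simp
  qed (use M R in auto)
  finally show ?thesis .
qed

text \<open>If \<open>\<Theta>\<close> were tiny on the disc about c, the annulus principle with
  outer radius R = 2 dist c z0 would bound \<open>\<Theta>\<close> at \<open>z0\<close> by M'
  (1/2)^\<open>\<tau>\<close> exp ((K + 1) R^2), contradicting its fixed positive value for
  \<open>\<tau>\<close> of order R^2. The inner boundary condition needs smallness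
  (\<open>\<eta>\<close> / R)^\<open>\<tau>\<close>; with ln (R / \<open>\<eta>\<close>) estimated
  linearly, its exponent is of order R^3, whence the cube.\<close>

lemma log_sub_lower_bound:
  fixes \<Theta> :: "complex \<Rightarrow> real"
  assumes cont: "continuous_on UNIV \<Theta>" and sub: "\<And>z. \<Theta> z > 0 \<Longrightarrow> log_sub K \<Theta> z"
    and K: "K \<ge> 0" and bound: "\<And>z. \<Theta> z \<le> M" and pos: "\<Theta> z0 > 0" and \<eta>: "\<eta> > 0"
  obtains A where "A \<ge> 0" "\<And>c. \<exists>z. dist c z \<le> \<eta> \<and> \<Theta> z \<ge> exp (- A * (1 + norm c) ^ 3)"
proof -
  define M' where "M' = max M 1"
  have M': "M' \<ge> 1" "\<And>z. \<Theta> z \<le> M'" using bound by (auto simp: M'_def le_max_iff_disj)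
  define L where "L = ln (M' / \<Theta> z0)"
  have L: "L \<ge> 0" unfolding L_def using M'(2)[of z0] pos by (intro ln_ge_zero) (auto simp: field_simps)
  \<comment> \<open>Chosen so that the outer radius R is at most a (1 + |c|).\<close>
  define a where "a = 2 * (1 + norm z0)"
  have a: "a \<ge> 2" by (simp add: a_def)
  define A0 where "A0 = (2 * ((K + 1) * a\<^sup>2 + L) + 2) * (a / \<eta>)"
  define A where "A = A0 + L"
  have K1: "(K + 1) * a\<^sup>2 \<ge> 0" using K by (intro mult_nonneg_nonneg) auto
  have A0: "A0 \<ge> 0" unfolding A0_def using K1 L a \<eta> by (intro mult_nonneg_nonneg) auto
  show ?thesis
  proof (rule that[of A])
    show "A \<ge> 0" using A0 L by (simp add: A_def)
    fix c :: complex
    define X where "X = 1 + norm c"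
    have X: "X \<ge> 1" by (simp add: X_def)
    have X3: "X ^ 3 \<ge> 1" using X by simp
    show "\<exists>z. dist c z \<le> \<eta> \<and> \<Theta> z \<ge> exp (- A * (1 + norm c) ^ 3)"
    proof (rule ccontr)
      assume "\<not> ?thesis"
      then have small: "\<Theta> z < exp (- A * X ^ 3)" if "dist c z \<le> \<eta>" for z
        using that unfolding X_def by (meson not_less)
      define D where "D = dist c z0"
      have D: "\<eta> < D"
      proof (rule ccontr)
        assume "\<not> \<eta> < D"
        then have "\<Theta> z0 < exp (- A * X ^ 3)" by (intro small) (simp add: D_def)
        also have "\<dots> \<le> exp (- L)"
        proof -
          have "L * 1 \<le> A * X ^ 3" using A0 L X3 by (intro mult_mono) (auto simp: A_def)
          then show ?thesis by simp
        qed
        also have "\<dots> = \<Theta> z0 / M'" unfolding L_def using pos M'(1) by (simp add: exp_minus)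
        also have "\<dots> \<le> \<Theta> z0" using pos M'(1) by (simp add: divide_le_eq)
        finally show False by simp
      qed
      define R where "R = 2 * D"
      have R: "\<eta> < R" "R > 0" using D \<eta> by (auto simp: R_def)
      have RX: "R \<le> a * X"
      proof -
        have "D \<le> norm c + norm z0" unfolding D_def dist_norm by (rule norm_triangle_ineq4)
        also have "\<dots> \<le> (1 + norm c) * (1 + norm z0)" by (simp add: algebra_simps)
        finally show ?thesis by (simp add: R_def a_def X_def algebra_simps)
      qed
      \<comment> \<open>Half of \<open>\<tau>\<close> must exceed (K + 1) R^2 + L, because
        (1/2)^\<open>\<tau>\<close> will be estimated by exp (- \<open>\<tau>\<close> / 2).\<close>
      define \<tau> where "\<tau> = nat \<lceil>2 * ((K + 1) * R\<^sup>2 + L)\<rceil> + 1"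
      have KR: "(K + 1) * R\<^sup>2 \<ge> 0" using K by (intro mult_nonneg_nonneg) auto
      have \<tau>1: "real \<tau> > 2 * ((K + 1) * R\<^sup>2 + L)"
        unfolding \<tau>_def using real_nat_ceiling_ge[of "2 * ((K + 1) * R\<^sup>2 + L)"] by linarith
      have \<tau>2: "real \<tau> \<le> 2 * ((K + 1) * R\<^sup>2 + L) + 2"
      proof -
        have *: "real (nat \<lceil>x\<rceil>) \<le> x + 1" if "x \<ge> 0" for x :: real using that by linarith
        have "0 \<le> 2 * ((K + 1) * R\<^sup>2 + L)" using KR L by simp
        from *[OF this] show ?thesis unfolding \<tau>_def of_nat_add by simp
      qed
      have \<tau>3: "real \<tau> \<le> (2 * ((K + 1) * a\<^sup>2 + L) + 2) * X\<^sup>2"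
      proof -
        have "R\<^sup>2 \<le> (a * X)\<^sup>2" using RX R by (intro power_mono) auto
        then have "(K + 1) * R\<^sup>2 \<le> (K + 1) * (a\<^sup>2 * X\<^sup>2)" using K by (intro mult_left_mono) (auto simp: power_mult_distrib)
        moreover have X2: "1 \<le> X\<^sup>2" using X by simp
        moreover have "L * 1 \<le> L * X\<^sup>2" using L X2 by (intro mult_left_mono)
        ultimately show ?thesis using \<tau>2 by (simp add: algebra_simps)
      qed
      have inner: "\<Theta> z \<le> M' * (\<eta> / R) ^ \<tau>" if "dist c z = \<eta>" for z
      proof -
        have "ln (R / \<eta>) \<le> R / \<eta>" using R \<eta> ln_le_minus_one[of "R / \<eta>"] by simp
        also have "\<dots> \<le> a / \<eta> * X" using RX \<eta> by (simp add: divide_right_mono)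
        finally have 1: "ln (R / \<eta>) \<le> a / \<eta> * X" .
        have "real \<tau> * ln (R / \<eta>) \<le> (2 * ((K + 1) * a\<^sup>2 + L) + 2) * X\<^sup>2 * (a / \<eta> * X)"
          using \<tau>3 1 R \<eta> K1 L by (intro mult_mono mult_nonneg_nonneg) (auto intro!: ln_ge_zero)
        also have "\<dots> = A0 * X ^ 3" by (simp add: A0_def power2_eq_square power3_eq_cube)
        also have "\<dots> \<le> A * X ^ 3" using L X by (intro mult_right_mono) (auto simp: A_def)
        finally have 2: "- A * X ^ 3 \<le> - (real \<tau> * ln (R / \<eta>))" by simp
        have "\<Theta> z \<le> exp (- A * X ^ 3)" using small[of z] that by simp
        also have "\<dots> \<le> exp (- (real \<tau> * ln (R / \<eta>)))" using 2 by (simp only: exp_le_cancel_iff)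
        also have "\<dots> = exp (ln (\<eta> / R)) ^ \<tau>" using R \<eta> by (simp add: ln_div exp_of_nat_mult[symmetric] algebra_simps)
        also have "\<dots> = 1 * (\<eta> / R) ^ \<tau>" using R \<eta> by simp
        also have "\<dots> \<le> M' * (\<eta> / R) ^ \<tau>" using M' R \<eta> by (intro mult_right_mono) auto
        finally show ?thesis .
      qed
      have "\<Theta> z0 \<le> M' * (dist c z0 / R) ^ \<tau> * exp ((K + 1) * R\<^sup>2)"
        by (rule annulus_maximum_principle[OF cont sub K _ \<eta> R(1) M'(2) inner])
          (use M' D R \<eta> in \<open>auto simp: R_def D_def\<close>)
      also have "dist c z0 / R = 1 / 2" using D \<eta> unfolding R_def D_def[symmetric] by simp
      also have "(1 / 2) ^ \<tau> \<le> exp (- (1/2) :: real) ^ \<tau>"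
      proof (rule power_mono)
        have "exp (1/2 :: real) ^ 2 \<le> 4" using e_less_272 by (simp flip: exp_of_nat_mult)
        then have "exp (1/2 :: real) \<le> 2" using power2_le_imp_le[of "exp (1/2 :: real)" 2] by simp
        then show "1 / 2 \<le> exp (- (1/2) :: real)" unfolding exp_minus inverse_eq_divide by (simp add: frac_le)
      qed auto
      also have "exp (- (1/2) :: real) ^ \<tau> = exp (- real \<tau> / 2)" by (simp flip: exp_of_nat_mult)
      finally have "\<Theta> z0 \<le> M' * exp (- real \<tau> / 2) * exp ((K + 1) * R\<^sup>2)" using M' by (simp add: mult_right_mono mult_left_mono)
      also have "\<dots> = M' * exp ((K + 1) * R\<^sup>2 - real \<tau> / 2)" by (simp add: mult.assoc algebra_simps flip: exp_add)
      also have "\<dots> < M' * exp (- L)" using M' \<tau>1 by (intro mult_strict_left_mono) auto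
      also have "\<dots> = \<Theta> z0" unfolding L_def using pos M'(1) by (simp add: exp_minus)
      finally show False by simp
    qed
  qed
qed

lemma norm_diff_quotient_tame:
  assumes "tame d \<phi> c" "d > 0" "w \<in> ball c (d / 2)"
  shows "norm (\<phi> w - \<phi> c) \<le> 8 / d * norm (w - c)"
proof (rule field_differentiable_bound[of "ball c (d / 2)" \<phi> "deriv \<phi>" "8 / d"])
  have hol: "\<phi> holomorphic_on ball c d" using assms by (simp add: tame_def)
  fix y assume y: "y \<in> ball c (d / 2)"
  then have "y \<in> ball c d" using assms by simp
  then show "(\<phi> has_field_derivative deriv \<phi> y) (at y within ball c (d / 2))"
    using holomorphic_derivI[OF hol open_ball] by blast
  have "norm (deriv \<phi> y) \<le> 2 * 2 / (d - d / 2)"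
    by (rule norm_deriv_le_of_ball[OF hol _ _ y]) (use assms in \<open>auto simp: tame_def\<close>)
  then show "norm (deriv \<phi> y) \<le> 8 / d" by simp
qed (use assms in auto)

text \<open>The minorant rests on the identity (1 + |p|^2) (1 + |\<open>\<phi>\<close>|^2) = |1 +
  cnj p \<open>\<phi>\<close>|^2 + |\<open>\<phi>\<close> - p|^2 with p = \<open>\<phi>\<close> c.
  Replacing the root by the modulus of the holomorphic \<open>G\<close> = 1 + cnj p
  \<open>\<phi>\<close> is exact at c. The error is quadratic: |\<open>\<phi>\<close> - p| <= (8 /
  d) |w - c| and |G| >= 1/2 give the relative error 256 |w - c|^2 / d^2, and the square root halves
  256 to 128.\<close>

lemma log_sub_quotient:
  fixes \<phi> Y :: "complex \<Rightarrow> complex" and \<kappa> :: nat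
  assumes \<phi>: "tame d \<phi> c" and d: "d > 0" and Y: "Y holomorphic_on ball c d"
    and eq: "\<And>w. w \<in> ball c d \<Longrightarrow> \<Theta> w = norm (Y w) / sqrt (1 + (norm (\<phi> w))\<^sup>2) ^ \<kappa>"
  shows "log_sub (128 * real \<kappa> / d\<^sup>2) \<Theta> c"
proof -
  define p where "p = \<phi> c"
  define S where "S = sqrt (1 + (norm p)\<^sup>2)"
  have S: "S \<ge> 1" "S\<^sup>2 = 1 + (norm p)\<^sup>2" by (auto simp: S_def)
  define r where "r = d / 32"
  have r: "r > 0" "r \<le> d" using d by (auto simp: r_def)
  have p2: "norm p \<le> 2" using \<phi> d by (auto simp: tame_def p_def)
  define G where "G = (\<lambda>w. 1 + cnj p * \<phi> w)"
  have bd: "norm (\<phi> w - p) \<le> 8 / d * norm (w - c)" if "w \<in> ball c r" for w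
    unfolding p_def by (rule norm_diff_quotient_tame[OF \<phi> d]) (use that d in \<open>auto simp: r_def\<close>)
  have Gc: "G c = of_real (S\<^sup>2)" unfolding G_def S(2) p_def[symmetric] of_real_add complex_norm_square
    by (simp add: mult.commute)
  have G: "norm (G w) \<ge> 1/2" if w: "w \<in> ball c r" for w
  proof -
    have "norm (cnj p * (\<phi> w - p)) \<le> 2 * (8 / d * norm (w - c))"
      unfolding norm_mult using bd[OF w] p2 by (intro mult_mono) auto
    also have "\<dots> \<le> 2 * (8 / d * r)"
      using w d by (intro mult_left_mono) (auto simp: dist_norm norm_minus_commute)
    also have "\<dots> = 1/2" using d by (simp add: r_def)
    finally have "norm (cnj p * (\<phi> w - p)) \<le> 1/2" .
    moreover have "G w = G c + cnj p * (\<phi> w - p)" by (simp add: G_def p_def algebra_simps)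
    then have "norm (G w) \<ge> norm (G c) - norm (cnj p * (\<phi> w - p))"
      by (metis add.commute norm_diff_ineq)
    moreover have "norm (G c) \<ge> 1" unfolding Gc norm_of_real using S by simp
    ultimately show ?thesis by linarith
  qed
  define F where "F = (\<lambda>w. Y w * of_real (S ^ \<kappa>) / G w ^ \<kappa>)"
  have hol\<phi>: "\<phi> holomorphic_on ball c r" using \<phi> r by (auto simp: tame_def intro: holomorphic_on_subset)
  have "G w \<noteq> 0" if "w \<in> ball c r" for w using G[OF that] by auto
  then have "F holomorphic_on ball c r" unfolding F_def
    by (intro holomorphic_intros holomorphic_on_subset[OF Y]) (use r in \<open>auto simp: G_def intro!: holomorphic_intros hol\<phi>\<close>)
  moreover have "norm (F c) = \<Theta> c"
  proof -
    have "norm (G c) = S * S" using S(1) unfolding Gc norm_of_real by (simp add: power2_eq_square)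
    then have "norm (F c) = norm (Y c) * S ^ \<kappa> / (S ^ \<kappa> * S ^ \<kappa>)"
      using S(1) unfolding F_def norm_divide norm_mult norm_power norm_of_real by (simp add: power_mult_distrib)
    also have "\<dots> = norm (Y c) / S ^ \<kappa>" using S(1) by simp
    finally show ?thesis using eq[of c] d by (simp add: S_def p_def)
  qed
  moreover have "norm (F w) * exp (- (128 * real \<kappa> / d\<^sup>2) * (norm (w - c))\<^sup>2) \<le> \<Theta> w" if w: "w \<in> ball c r" for w
  proof -
    define s where "s = norm (w - c)"
    define e where "e = exp (128 / d\<^sup>2 * s\<^sup>2)"
    have G0: "norm (G w) > 0" using G[OF w] by linarith
    have "S\<^sup>2 * (1 + (norm (\<phi> w))\<^sup>2) = (norm (G w))\<^sup>2 + (norm (\<phi> w - p))\<^sup>2"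
      unfolding S(2) G_def cmod_power2 by (simp add: power2_eq_square algebra_simps)
    also have "(norm (\<phi> w - p))\<^sup>2 \<le> (norm (G w))\<^sup>2 * (256 / d\<^sup>2 * s\<^sup>2)"
    proof -
      have "norm (\<phi> w - p) \<le> (2 * norm (G w)) * (8 / d * s)"
        using bd[OF w] G[OF w] d mult_mono[of 1 "2 * norm (G w)" "norm (\<phi> w - p)" "8 / d * s"] by (simp add: s_def)
      then have "(norm (\<phi> w - p))\<^sup>2 \<le> ((2 * norm (G w)) * (8 / d * s))\<^sup>2" by (intro power_mono) auto
      then show ?thesis by (simp add: power_mult_distrib power_divide mult_ac)
    qed
    also have "(norm (G w))\<^sup>2 + (norm (G w))\<^sup>2 * (256 / d\<^sup>2 * s\<^sup>2) = (norm (G w))\<^sup>2 * (1 + 256 / d\<^sup>2 * s\<^sup>2)"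
      by (simp add: algebra_simps)
    also have "\<dots> \<le> (norm (G w))\<^sup>2 * e\<^sup>2"
    proof (intro mult_left_mono)
      have "1 + 256 / d\<^sup>2 * s\<^sup>2 \<le> exp (256 / d\<^sup>2 * s\<^sup>2)" by (rule exp_ge_add_one_self)
      also have "\<dots> = e\<^sup>2" by (simp add: e_def flip: exp_of_nat_mult)
      finally show "1 + 256 / d\<^sup>2 * s\<^sup>2 \<le> e\<^sup>2" .
    qed auto
    finally have "S\<^sup>2 * (1 + (norm (\<phi> w))\<^sup>2) \<le> (norm (G w) * e)\<^sup>2" by (simp add: power_mult_distrib)
    then have "sqrt (S\<^sup>2 * (1 + (norm (\<phi> w))\<^sup>2)) \<le> norm (G w) * e"
      by (intro real_le_lsqrt) (auto simp: e_def)
    then have "S * sqrt (1 + (norm (\<phi> w))\<^sup>2) \<le> norm (G w) * e" using S(1) by (simp add: real_sqrt_mult)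
    then have "(S * sqrt (1 + (norm (\<phi> w))\<^sup>2)) ^ \<kappa> \<le> (norm (G w) * e) ^ \<kappa>"
      using S(1) by (intro power_mono) auto
    then have "S ^ \<kappa> * sqrt (1 + (norm (\<phi> w))\<^sup>2) ^ \<kappa> \<le> norm (G w) ^ \<kappa> * e ^ \<kappa>" by (simp add: power_mult_distrib)
    moreover have q: "sqrt (1 + (norm (\<phi> w))\<^sup>2) ^ \<kappa> > 0"
      by (intro zero_less_power real_sqrt_gt_zero add_pos_nonneg) auto
    moreover have "norm (G w) ^ \<kappa> * e ^ \<kappa> > 0" using G0 by (simp add: e_def)
    ultimately have "S ^ \<kappa> / (norm (G w) ^ \<kappa> * e ^ \<kappa>) \<le> 1 / sqrt (1 + (norm (\<phi> w))\<^sup>2) ^ \<kappa>"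
      by (simp add: pos_divide_le_eq pos_le_divide_eq mult.commute)
    then have "norm (Y w) * (S ^ \<kappa> / (norm (G w) ^ \<kappa> * e ^ \<kappa>)) \<le> norm (Y w) * (1 / sqrt (1 + (norm (\<phi> w))\<^sup>2) ^ \<kappa>)"
      by (intro mult_left_mono) auto
    also have "\<dots> = \<Theta> w" using eq[of w] w r by auto
    also have "norm (Y w) * (S ^ \<kappa> / (norm (G w) ^ \<kappa> * e ^ \<kappa>)) = norm (F w) / e ^ \<kappa>"
      using S(1) by (simp add: F_def norm_mult norm_divide norm_power)
    also have "\<dots> = norm (F w) * exp (- (128 * real \<kappa> / d\<^sup>2) * s\<^sup>2)"
      by (simp add: e_def exp_minus divide_inverse mult_ac flip: exp_of_nat_mult)
    finally show ?thesis by (simp add: s_def)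
  qed
  ultimately show ?thesis unfolding log_sub_def using r(1) by blast
qed

lemma isCont_holomorphic: "f holomorphic_on S \<Longrightarrow> open S \<Longrightarrow> z \<in> S \<Longrightarrow> isCont f z"
  by (meson holomorphic_on_imp_continuous_on continuous_on_eq_continuous_at)

lemma Lim_eq_of_eventually:
  fixes f h :: "complex \<Rightarrow> 'a::t2_space"
  assumes "isCont h z" "eventually (\<lambda>w. f w = h w) (at z)"
  shows "(f \<longlongrightarrow> h z) (at z)"
proof (rule Lim_transform_eventually)
  show "(h \<longlongrightarrow> h z) (at z)" using assms(1) by (simp add: isCont_def)
  show "eventually (\<lambda>w. h w = f w) (at z)" using assms(2) by eventually_elim simp
qed

text \<open>The logarithmic derivative of \<open>Y\<close> has at most a simple pole at c, which the
  zero of \<open>\<phi>\<close> cancels. With n the order of the zero of \<open>Y\<close>, its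
  principal part contributes n times \<open>\<phi>\<close>' at c.\<close>

lemma tendsto_times_log_deriv:
  assumes hol: "Y holomorphic_on S" "open S" "connected S" "c \<in> S" and nz: "\<exists>w\<in>S. Y w \<noteq> 0"
    and \<phi>: "\<phi> holomorphic_on S" "\<phi> c = 0"
  obtains l where "((\<lambda>w. \<phi> w * (deriv Y w / Y w)) \<longlongrightarrow> l) (at c)"
proof -
  define h n where "h = zor_poly Y c" and "n = nat (zorder Y c)"
  obtain r where r: "r > 0" "cball c r \<subseteq> S" and h: "h holomorphic_on cball c r"
    "\<And>w. w \<in> cball c r \<Longrightarrow> Y w = h w * (w - c) ^ n \<and> h w \<noteq> 0"
    using zorder_exist_zero[OF hol nz] unfolding h_def n_def by blast
  have holh: "h holomorphic_on ball c r" using h(1) ball_subset_cball holomorphic_on_subset by blast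
  have d\<phi>: "(\<phi> has_field_derivative deriv \<phi> c) (at c)" using holomorphic_derivI[OF \<phi>(1) hol(2,4)] .
  have "((\<lambda>w. (\<phi> w - \<phi> c) / (w - c)) \<longlongrightarrow> deriv \<phi> c) (at c)" using d\<phi> by (simp add: has_field_derivative_iff)
  then have 1: "((\<lambda>w. \<phi> w / (w - c)) \<longlongrightarrow> deriv \<phi> c) (at c)" using \<phi>(2) by simp
  have "isCont (\<lambda>w. \<phi> w * (deriv h w / h w)) c"
  proof (rule isCont_holomorphic[of _ "ball c r"])
    show "(\<lambda>w. \<phi> w * (deriv h w / h w)) holomorphic_on ball c r"
      using h(2) r by (intro holomorphic_intros holh holomorphic_on_subset[OF \<phi>(1)]) auto
  qed (use r in auto)
  then have 2: "((\<lambda>w. \<phi> w * (deriv h w / h w)) \<longlongrightarrow> \<phi> c * (deriv h c / h c)) (at c)" by (simp add: isCont_def)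
  have "eventually (\<lambda>w. w \<in> ball c r \<and> w \<noteq> c) (at c)"
    using eventually_at_ball[OF r(1), of c UNIV] eventually_neq_at_within[of c c UNIV] by eventually_elim auto
  then have "eventually (\<lambda>w. \<phi> w * (deriv h w / h w) + of_nat n * (\<phi> w / (w - c)) = \<phi> w * (deriv Y w / Y w)) (at c)"
  proof eventually_elim
    case (elim w)
    have dh: "(h has_field_derivative deriv h w) (at w)" using holomorphic_derivI[OF holh open_ball] elim by blast
    have "((\<lambda>w. h w * (w - c) ^ n) has_field_derivative deriv h w * (w - c) ^ n + h w * (of_nat n * (w - c) ^ (n - 1))) (at w)"
      by (rule derivative_eq_intros dh refl)+ simp
    then have "(Y has_field_derivative deriv h w * (w - c) ^ n + h w * (of_nat n * (w - c) ^ (n - 1))) (at w)"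
      by (rule has_field_derivative_transform_within_open[where S = "ball c r"]) (use h(2) elim in auto)
    then have dY: "deriv Y w = deriv h w * (w - c) ^ n + h w * (of_nat n * (w - c) ^ (n - 1))"
      by (rule DERIV_imp_deriv)
    have hw: "h w \<noteq> 0" "Y w = h w * (w - c) ^ n" using h(2)[of w] elim by auto
    have "deriv Y w / Y w = deriv h w / h w + of_nat n / (w - c)"
    proof (cases n)
      case 0
      then show ?thesis unfolding dY hw(2) by simp
    next
      case (Suc k)
      have "w - c \<noteq> 0" using elim by simp
      then show ?thesis unfolding dY hw(2) add_divide_distrib Suc using hw(1) by simp
    qed
    then show ?case by (simp only: distrib_left times_divide_eq_right mult.commute)
  qed
  moreover have "((\<lambda>w. \<phi> w * (deriv h w / h w) + of_nat n * (\<phi> w / (w - c))) \<longlongrightarrow>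
      \<phi> c * (deriv h c / h c) + of_nat n * deriv \<phi> c) (at c)"
    by (intro tendsto_add tendsto_mult tendsto_const 1 2)
  ultimately have "((\<lambda>w. \<phi> w * (deriv Y w / Y w)) \<longlongrightarrow>
      \<phi> c * (deriv h c / h c) + of_nat n * deriv \<phi> c) (at c)"
    by (rule Lim_transform_eventually[rotated])
  then show ?thesis by (rule that)
qed

lemma (in monomial_yosida) P_not_locally_constant:
  assumes B: "open B" "B \<noteq> {}" "\<And>w. w \<in> B \<Longrightarrow> \<not> is_pole g w" "\<And>w. w \<in> B \<Longrightarrow> P g w = c"
  shows False
proof -
  have an: "P g analytic_on {z}" if "\<not> is_pole g z" for z
    using analytic[OF that] unfolding diff_monomial_def[abs_def] by (intro analytic_intros) auto
  define F where "F = remove_sings (P g)"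
  have FP: "F w = P g w" if "\<not> is_pole g w" for w using an[OF that] by (simp add: F_def)
  have "F nicely_meromorphic_on UNIV"
    unfolding F_def by (intro remove_sings_nicely_meromorphic meromorphic_diff_monomial g_meromorphic)
  moreover have "F constant_on B" using FP B by (auto simp: constant_on_def)
  ultimately have "F constant_on UNIV"
    using constant_on_extend_nicely_meromorphic_on[of F UNIV B] B by auto
  then obtain c' where "\<And>w. F w = c'" by (auto simp: constant_on_def)
  then show False using P_not_constant[of c'] FP by metis
qed

section \<open>Meromorphic functions with an omitted value\<close>

locale omitted_value = monomial_yosida +
  fixes b :: complex
  assumes b: "b \<noteq> 0" and omit: "\<And>z. \<not> is_pole g z \<Longrightarrow> P g z \<noteq> b" and N3: "N \<ge> T + 3"
begin

abbreviation h :: "complex \<Rightarrow> complex" where "h \<equiv> \<lambda>w. inverse (g w)"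

text \<open>
  The value is a limit because the quotient has to be extended to the poles of \<open>g\<close>.
\<close>

definition \<Theta> :: "complex \<Rightarrow> real" where
  "\<Theta> z = Lim (at z) (\<lambda>w. norm (P g w - b) / sqrt (1 + (norm (g w))\<^sup>2) ^ (N + T))"
definition U :: "complex \<Rightarrow> complex" where "U w = deriv (P g) w / (P g w - b)"
definition V1 :: "complex \<Rightarrow> complex" where "V1 = remove_sings (\<lambda>w. U w / g w)"
definition V2 :: "complex \<Rightarrow> complex" where "V2 = remove_sings (\<lambda>w. U w / (g w)\<^sup>2)"

text \<open>
  \<open>Y1\<close> is \<open>P g - b\<close>, used where \<open>g\<close> is bounded, and \<open>Y2\<close> is \<open>(P g - b) / g^(N+T)\<close>, used where
  \<open>h = 1/g\<close> is bounded; \<open>D1 = (P g)' / g^2\<close> and \<open>W2 = U / g\<close> there.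
\<close>

definition Y1 :: "complex \<Rightarrow> complex" where "Y1 w = g w ^ (N - T) * E1 g w - b"
definition D1 :: "complex \<Rightarrow> complex" where
  "D1 w = g w ^ (N - T - 3) * (of_nat (N - T) * deriv g w * E1 g w + g w * deriv (E1 g) w)"
definition Y2 :: "complex \<Rightarrow> complex" where "Y2 w = E2 h w - b * h w ^ (N + T)"
definition W2 :: "complex \<Rightarrow> complex" where
  "W2 w = h w * (deriv Y2 w / Y2 w) - of_nat (N + T) * deriv h w"

lemma eventually_generic:
  assumes "z \<in> ball c r"
  shows "eventually (\<lambda>w. w \<in> ball c r \<and> \<not> is_pole g w \<and> g w \<noteq> 0) (at z)"
proof -
  have "eventually (\<lambda>w. w \<in> ball c r) (at z)" using assms by (intro eventually_at_in_open') auto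
  then show ?thesis using eventually_not_pole[of z] eventually_neq[of 0 z] by eventually_elim auto
qed

lemma holomorphic_Y1:
  assumes "tame d g c"
  shows "Y1 holomorphic_on ball c d" "D1 holomorphic_on ball c d"
proof -
  have hol: "g holomorphic_on ball c d" using assms by (simp add: tame_def)
  have holE: "E1 g holomorphic_on ball c d" by (rule holomorphic_E(1)[OF hol open_ball])
  show "Y1 holomorphic_on ball c d" "D1 holomorphic_on ball c d"
    unfolding Y1_def[abs_def] D1_def[abs_def] by (intro holomorphic_intros hol holE open_ball)+
qed

lemma T1_facts:
  assumes tm: "tame d g c" and w: "w \<in> ball c d"
  shows "P g w - b = Y1 w" "Y1 w \<noteq> 0" "deriv (P g) w = (g w)\<^sup>2 * D1 w" "deriv Y1 w = (g w)\<^sup>2 * D1 w"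
proof -
  have hol: "g holomorphic_on ball c d" using tm by (simp add: tame_def)
  have eq: "P g x = g x ^ (N - T) * E1 g x" if "x \<in> ball c d" for x
    by (rule P_eq_E1[OF hol open_ball that])
  show 1: "P g w - b = Y1 w" using eq[OF w] by (simp add: Y1_def)
  show "Y1 w \<noteq> 0" using omit[OF not_pole[OF tm w]] 1 by auto
  have dg: "(g has_field_derivative deriv g w) (at w)" by (rule holomorphic_derivI[OF hol open_ball w])
  have dE: "(E1 g has_field_derivative deriv (E1 g) w) (at w)"
    by (rule holomorphic_derivI[OF holomorphic_E(1)[OF hol open_ball] open_ball w])
  \<comment> \<open>With N - T = q + 3, one differentiation leaves g^(q+2), of which g^2 is split
    off. This is where N - T >= 3 is used.\<close>
  define q where "q = N - T - 3"
  have q: "N - T = Suc (Suc (Suc q))" using N3 by (simp add: q_def)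
  have D: "((\<lambda>x. g x ^ (N - T) * E1 g x) has_field_derivative (g w)\<^sup>2 * D1 w) (at w)"
    by (rule derivative_eq_intros dg dE refl)+
      (simp add: D1_def q_def[symmetric] q algebra_simps power2_eq_square)
  have "(Y1 has_field_derivative (g w)\<^sup>2 * D1 w) (at w)"
    using DERIV_diff[OF D DERIV_const[of b]] unfolding Y1_def[abs_def] by simp
  then show "deriv Y1 w = (g w)\<^sup>2 * D1 w" by (rule DERIV_imp_deriv)
  have "(P g has_field_derivative (g w)\<^sup>2 * D1 w) (at w)"
    by (rule has_field_derivative_transform_within_open[OF D open_ball w]) (simp add: eq)
  then show "deriv (P g) w = (g w)\<^sup>2 * D1 w" by (rule DERIV_imp_deriv)
qed

lemma T1_V:
  assumes tm: "tame d g c" and z: "z \<in> ball c d"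
  shows "((\<lambda>w. U w / g w) \<longlongrightarrow> g z * (D1 z / Y1 z)) (at z)"
    and "((\<lambda>w. U w / (g w)\<^sup>2) \<longlongrightarrow> D1 z / Y1 z) (at z)"
proof -
  have hol: "g holomorphic_on ball c d" using tm by (simp add: tame_def)
  have hD: "(\<lambda>w. D1 w / Y1 w) holomorphic_on ball c d"
    using T1_facts(2)[OF tm] by (intro holomorphic_intros holomorphic_Y1[OF tm])
  have e: "eventually (\<lambda>w. U w / (g w)\<^sup>2 = D1 w / Y1 w) (at z)" "eventually (\<lambda>w. U w / g w = g w * (D1 w / Y1 w)) (at z)"
    using eventually_generic[OF z] by (eventually_elim, simp add: U_def T1_facts[OF tm] power2_eq_square)+
  show "((\<lambda>w. U w / (g w)\<^sup>2) \<longlongrightarrow> D1 z / Y1 z) (at z)"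
    by (rule Lim_eq_of_eventually[OF isCont_holomorphic[OF hD open_ball z] e(1)])
  have "(\<lambda>w. g w * (D1 w / Y1 w)) holomorphic_on ball c d" by (intro holomorphic_on_mult hol hD)
  from Lim_eq_of_eventually[OF isCont_holomorphic[OF this open_ball z] e(2)]
  show "((\<lambda>w. U w / g w) \<longlongrightarrow> g z * (D1 z / Y1 z)) (at z)" .
qed

lemma holomorphic_Y2:
  assumes "tame d h c"
  shows "Y2 holomorphic_on ball c d"
proof -
  have hol: "h holomorphic_on ball c d" using assms by (simp add: tame_def)
  show ?thesis unfolding Y2_def[abs_def] by (intro holomorphic_intros holomorphic_E(2) hol open_ball)
qed

text \<open>Logarithmic differentiation of P g - b = g^(N+T) Y2 gives U = (N + T) g'/g + Y2'/Y2.
  Since g' = - h' g^2, division by g turns the first term into - (N + T) h', which is regular at the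
  poles of g.\<close>

lemma T2_facts:
  assumes tm: "tame d h c" and w: "w \<in> ball c d" and np: "\<not> is_pole g w"
  shows "g w \<noteq> 0" "P g w - b = g w ^ (N + T) * Y2 w" "Y2 w \<noteq> 0" "U w / g w = W2 w"
proof -
  have hol: "h holomorphic_on ball c d" using tm by (simp add: tame_def)
  show g0: "g w \<noteq> 0" using pole_iff[OF tm w] np by simp
  have eq: "P g x - b = inverse (h x) ^ (N + T) * Y2 x" if "x \<in> ball c d" "h x \<noteq> 0" for x
  proof -
    have "P g x = g x ^ (N + T) * E2 h x"
      by (rule P_eq_E2[OF hol open_ball that(1) that(2)]) simp
    moreover have "inverse (h x) ^ (N + T) * h x ^ (N + T) = 1" using that(2) by (simp flip: power_mult_distrib)
    ultimately show ?thesis by (simp add: Y2_def algebra_simps)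
  qed
  show 1: "P g w - b = g w ^ (N + T) * Y2 w" using eq[OF w] g0 by simp
  show Y0: "Y2 w \<noteq> 0" using 1 omit[OF np] by auto
  define S where "S = ball c d \<inter> h -` (- {0})"
  have S: "open S" "w \<in> S" unfolding S_def
    using hol w g0 by (auto intro!: continuous_open_preimage holomorphic_on_imp_continuous_on)
  have dh: "(h has_field_derivative deriv h w) (at w)" by (rule holomorphic_derivI[OF hol open_ball w])
  have dY: "(Y2 has_field_derivative deriv Y2 w) (at w)" by (rule holomorphic_derivI[OF holomorphic_Y2[OF tm] open_ball w])
  have hw: "h w \<noteq> 0" using g0 by simp
  have "((\<lambda>x. inverse (h x)) has_field_derivative - (deriv h w * (g w)\<^sup>2)) (at w)"
    by (rule derivative_eq_intros dh hw refl)+ (simp add: power2_eq_square)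
  then have dg: "(g has_field_derivative - (deriv h w * (g w)\<^sup>2)) (at w)" by simp
  have "((\<lambda>x. g x ^ (N + T) * Y2 x + b) has_field_derivative
      of_nat (N + T) * g w ^ (N + T - 1) * (- (deriv h w * (g w)\<^sup>2)) * Y2 w + g w ^ (N + T) * deriv Y2 w) (at w)"
    by (rule derivative_eq_intros dg dY refl)+ (simp add: algebra_simps)
  moreover have "g x ^ (N + T) * Y2 x + b = P g x" if "x \<in> S" for x
    using eq[of x] that by (simp add: S_def algebra_simps)
  ultimately have "(P g has_field_derivative
      of_nat (N + T) * g w ^ (N + T - 1) * (- (deriv h w * (g w)\<^sup>2)) * Y2 w + g w ^ (N + T) * deriv Y2 w) (at w)"
    by (rule has_field_derivative_transform_within_open[OF _ S])
  then have "deriv (P g) w = of_nat (N + T) * g w ^ (N + T - 1) * (- (deriv h w * (g w)\<^sup>2)) * Y2 w + g w ^ (N + T) * deriv Y2 w"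
    by (rule DERIV_imp_deriv)
  also have "g w ^ (N + T - 1) * (g w)\<^sup>2 = g w ^ (N + T) * g w"
  proof -
    obtain q where "N + T = Suc q" using N3 by (cases "N + T") auto
    then show ?thesis by (simp add: power2_eq_square)
  qed
  then have "of_nat (N + T) * g w ^ (N + T - 1) * (- (deriv h w * (g w)\<^sup>2)) * Y2 w =
      g w ^ (N + T) * (- (of_nat (N + T) * deriv h w * g w * Y2 w))"
    by (simp only: mult_minus_left mult_minus_right mult_ac)
  finally have "deriv (P g) w = g w ^ (N + T) * (deriv Y2 w - of_nat (N + T) * deriv h w * g w * Y2 w)"
    by (simp add: right_diff_distrib)
  then have "U w = (deriv Y2 w - of_nat (N + T) * deriv h w * g w * Y2 w) / Y2 w"
    using g0 unfolding U_def 1 by simp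
  then have "U w / g w = (deriv Y2 w - of_nat (N + T) * deriv h w * g w * Y2 w) / Y2 w * h w"
    by (simp add: divide_inverse)
  also have "(deriv Y2 w - of_nat (N + T) * deriv h w * g w * Y2 w) / Y2 w = deriv Y2 w / Y2 w - of_nat (N + T) * deriv h w * g w"
    using Y0 by (simp add: diff_divide_distrib)
  also have "\<dots> * h w = h w * (deriv Y2 w / Y2 w) - of_nat (N + T) * deriv h w * (g w * h w)"
    by (simp only: left_diff_distrib right_diff_distrib mult_ac)
  finally show "U w / g w = W2 w" using g0 by (simp add: W2_def)
qed

lemma U_divide:
  assumes "g w \<noteq> 0"
  shows "U w / (g w)\<^sup>2 = h w * (U w / g w)"
  using assms by (simp add: power2_eq_square field_simps)

lemma T2_V:
  assumes tm: "tame d h c" and z: "z \<in> ball c d" and Y: "Y2 z \<noteq> 0"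
  shows "((\<lambda>w. U w / g w) \<longlongrightarrow> W2 z) (at z)" "((\<lambda>w. U w / (g w)\<^sup>2) \<longlongrightarrow> h z * W2 z) (at z)"
proof -
  have hol: "h holomorphic_on ball c d" using tm by (simp add: tame_def)
  note holY = holomorphic_Y2[OF tm]
  have c: "isCont Y2 z" "isCont (deriv Y2) z" "isCont h z" "isCont (deriv h) z"
    by (rule isCont_holomorphic[OF _ open_ball z]; intro holomorphic_deriv holY hol open_ball)+
  have W: "isCont W2 z" unfolding W2_def[abs_def] by (intro continuous_intros c Y)
  have e: "eventually (\<lambda>w. U w / g w = W2 w) (at z)" "eventually (\<lambda>w. U w / (g w)\<^sup>2 = h w * W2 w) (at z)"
    using eventually_generic[OF z] by (eventually_elim, simp add: T2_facts[OF tm] U_divide)+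
  show "((\<lambda>w. U w / g w) \<longlongrightarrow> W2 z) (at z)" by (rule Lim_eq_of_eventually[OF W e(1)])
  have "isCont (\<lambda>w. h w * W2 w) z" by (intro continuous_mult c W)
  from Lim_eq_of_eventually[OF this e(2)] show "((\<lambda>w. U w / (g w)\<^sup>2) \<longlongrightarrow> h z * W2 z) (at z)" .
qed

text \<open>At a multiple pole of g the factor \<open>Y2\<close> vanishes, but h vanishes there as
  well, so h Y2'/Y2 still has a limit.\<close>

lemma T2_V_pole:
  assumes tm: "tame d h c" and z: "z \<in> ball c d" and pole: "is_pole g z"
  shows "\<exists>l. ((\<lambda>w. U w / g w) \<longlongrightarrow> l) (at z)" "\<exists>l. ((\<lambda>w. U w / (g w)\<^sup>2) \<longlongrightarrow> l) (at z)"
proof -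
  have hol: "h holomorphic_on ball c d" using tm by (simp add: tame_def)
  have hz: "h z = 0" using pole_iff[OF tm z] pole by simp
  have "eventually (\<lambda>w. w \<in> ball c d \<and> \<not> is_pole g w \<and> g w \<noteq> 0) (at z)" by (rule eventually_generic[OF z])
  then obtain w where "w \<in> ball c d" "\<not> is_pole g w" using eventually_happens[of _ "at z"] at_neq_bot by blast
  then have "\<exists>w\<in>ball c d. Y2 w \<noteq> 0" using T2_facts(3)[OF tm] by blast
  then obtain l where l: "((\<lambda>w. h w * (deriv Y2 w / Y2 w)) \<longlongrightarrow> l) (at z)"
    using tendsto_times_log_deriv[OF holomorphic_Y2[OF tm] open_ball connected_ball z _ hol hz] by metis
  have ch: "(h \<longlongrightarrow> h z) (at z)" "(deriv h \<longlongrightarrow> deriv h z) (at z)"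
    using isCont_holomorphic[OF hol open_ball z] isCont_holomorphic[OF holomorphic_deriv[OF hol open_ball] open_ball z]
    by (auto simp: isCont_def)
  have W: "(W2 \<longlongrightarrow> l - of_nat (N + T) * deriv h z) (at z)"
    unfolding W2_def[abs_def] by (intro tendsto_intros l ch)
  have e: "eventually (\<lambda>w. W2 w = U w / g w) (at z)" "eventually (\<lambda>w. h w * W2 w = U w / (g w)\<^sup>2) (at z)"
    using eventually_generic[OF z] by (eventually_elim, simp add: T2_facts[OF tm] U_divide)+
  show "\<exists>l. ((\<lambda>w. U w / g w) \<longlongrightarrow> l) (at z)" using Lim_transform_eventually[OF W e(1)] by blast
  have "((\<lambda>w. h w * W2 w) \<longlongrightarrow> h z * (l - of_nat (N + T) * deriv h z)) (at z)" by (intro tendsto_mult ch W)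
  from Lim_transform_eventually[OF this e(2)] show "\<exists>l. ((\<lambda>w. U w / (g w)\<^sup>2) \<longlongrightarrow> l) (at z)" by blast
qed

lemma V_limits:
  "\<exists>l. ((\<lambda>w. U w / g w) \<longlongrightarrow> l) (at z)" "\<exists>l. ((\<lambda>w. U w / (g w)\<^sup>2) \<longlongrightarrow> l) (at z)"
proof -
  have z: "z \<in> ball z d" using d by simp
  consider "tame d g z" | "tame d h z" "is_pole g z" | "tame d h z" "\<not> is_pole g z" using tame by blast
  then have "(\<exists>l. ((\<lambda>w. U w / g w) \<longlongrightarrow> l) (at z)) \<and> (\<exists>l. ((\<lambda>w. U w / (g w)\<^sup>2) \<longlongrightarrow> l) (at z))"
  proof cases
    case 1
    show ?thesis using T1_V[OF 1 z] by blast
  next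
    case 2
    show ?thesis using T2_V_pole[OF 2(1) z 2(2)] by blast
  next
    case 3
    show ?thesis using T2_V[OF 3(1) z T2_facts(3)[OF 3(1) z 3(2)]] by blast
  qed
  then show "\<exists>l. ((\<lambda>w. U w / g w) \<longlongrightarrow> l) (at z)" "\<exists>l. ((\<lambda>w. U w / (g w)\<^sup>2) \<longlongrightarrow> l) (at z)" by auto
qed

lemma V_entire: "V1 holomorphic_on UNIV" "V2 holomorphic_on UNIV"
proof -
  have m: "(\<lambda>w. U w / g w) meromorphic_on A" "(\<lambda>w. U w / (g w)\<^sup>2) meromorphic_on A" for A
    unfolding U_def by (intro meromorphic_intros meromorphic_diff_monomial g_meromorphic)+
  have "V1 analytic_on {z}" "V2 analytic_on {z}" for z
    unfolding V1_def V2_def using V_limits[of z]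
    by (auto intro: remove_sings_analytic_at meromorphic_on_isolated_singularity[OF m(1)]
        meromorphic_on_isolated_singularity[OF m(2)])
  then show "V1 holomorphic_on UNIV" "V2 holomorphic_on UNIV"
    by (metis analytic_on_analytic_at analytic_imp_holomorphic)+
qed

text \<open>\<open>V2\<close> is D1 / Y1, and no lower bound for \<open>Y1\<close> is at hand. Since
  P g = Y1 + b and Y1' = g^2 D1, one has b D1 / Y1 = g^(N-T-2) E1 Y1'/Y1 - D1, and division by b
  bounds \<open>V2\<close> by the logarithmic derivative of \<open>Y1\<close>, also at zeros of
  g.\<close>

lemma chart1:
  obtains C where "C \<ge> 0"
    "\<And>c w. tame d g c \<Longrightarrow> w \<in> ball c (d / 2) \<Longrightarrow> norm (Y1 w) \<le> C \<and>
       norm (V2 w) \<le> C * (1 + norm (deriv Y1 w / Y1 w)) \<and> norm (V1 w) \<le> 2 * C * (1 + norm (deriv Y1 w / Y1 w))"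
proof -
  \<comment> \<open>\<open>E1\<close> is bounded on a disc larger than that of radius d / 2, as its
    derivative is needed too.\<close>
  have r: "0 < 3 * d / 4" "3 * d / 4 < d" using d by auto
  obtain C where C: "C \<ge> 0" "\<And>\<phi> z w. tame d \<phi> z \<Longrightarrow> w \<in> ball z (3 * d / 4) \<Longrightarrow> norm (E1 \<phi> w) \<le> C"
    using E_bound[OF r] by metis
  define CD where "CD = 2 ^ (N - T - 3) * (real (N - T) * (8 / d) * C + 2 * (8 / d * C))"
  define CB where "CB = (2 ^ (N - T - 2) * C + CD) / norm b"
  define CC where "CC = max (2 ^ (N - T) * C + norm b) CB"
  have CD: "CD \<ge> 0" unfolding CD_def using C(1) d by (intro mult_nonneg_nonneg add_nonneg_nonneg) auto
  have "CC \<ge> 0" using C(1) by (simp add: CC_def le_max_iff_disj)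
  moreover have "norm (Y1 w) \<le> CC \<and>
       norm (V2 w) \<le> CC * (1 + norm (deriv Y1 w / Y1 w)) \<and> norm (V1 w) \<le> 2 * CC * (1 + norm (deriv Y1 w / Y1 w))"
    if tm: "tame d g c" and w: "w \<in> ball c (d / 2)" for c w
  proof -
    have wd: "w \<in> ball c d" "w \<in> ball c (3 * d / 4)" using w d by auto
    have hol: "g holomorphic_on ball c d" using tm by (simp add: tame_def)
    have g2: "norm (g w) \<le> 2" using tm wd by (auto simp: tame_def)
    have E: "norm (E1 g w) \<le> C" by (rule C(2)[OF tm wd(2)])
    have pw: "norm (g w ^ q * E1 g w) \<le> 2 ^ q * C" for q
      unfolding norm_mult norm_power using g2 E by (intro mult_mono power_mono) auto
    have "norm (Y1 w) \<le> 2 ^ (N - T) * C + norm b"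
      unfolding Y1_def using pw[of "N - T"] norm_triangle_ineq4[of "g w ^ (N - T) * E1 g w" b] by linarith
    then have 1: "norm (Y1 w) \<le> CC" by (simp add: CC_def)
    have dE: "norm (deriv (E1 g) w) \<le> 2 * C / (3 * d / 4 - d / 2)"
    proof (rule norm_deriv_le_of_ball[OF _ _ _ w])
      show "E1 g holomorphic_on ball c (3 * d / 4)"
        by (rule holomorphic_E(1)[OF holomorphic_on_subset[OF hol] open_ball]) (use d in auto)
    qed (use C(2)[OF tm] d in auto)
    have dg: "norm (deriv g w) \<le> 8 / d" by (rule deriv_bound_tame[OF tm w])
    have "norm (D1 w) \<le> CD"
    proof -
      have "norm (of_nat (N - T) * deriv g w * E1 g w + g w * deriv (E1 g) w) \<le>
          norm (of_nat (N - T) * deriv g w * E1 g w) + norm (g w * deriv (E1 g) w)" by (rule norm_triangle_ineq)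
      also have "\<dots> \<le> real (N - T) * (8 / d) * C + 2 * (8 / d * C)"
      proof (rule add_mono)
        show "norm (of_nat (N - T) * deriv g w * E1 g w) \<le> real (N - T) * (8 / d) * C"
          unfolding norm_mult norm_of_nat using dg E d by (intro mult_mono mult_nonneg_nonneg) auto
        show "norm (g w * deriv (E1 g) w) \<le> 2 * (8 / d * C)"
          unfolding norm_mult using g2 dE by (intro mult_mono) auto
      qed
      finally show ?thesis unfolding D1_def CD_def norm_mult[of "g w ^ (N - T - 3)"] norm_power
        using g2 by (intro mult_mono power_mono) auto
    qed
    moreover have "b * (D1 w / Y1 w) = g w ^ (N - T - 2) * E1 g w * (deriv Y1 w / Y1 w) - D1 w"
    proof -
      have Y: "Y1 w \<noteq> 0" by (rule T1_facts(2)[OF tm wd(1)])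
      have q: "N - T = (N - T - 2) + 2" using N3 by simp
      have "g w ^ (N - T - 2) * E1 g w * (g w)\<^sup>2 = Y1 w + b"
        unfolding Y1_def by (subst (2) q) (simp only: power_add, simp)
      then have "g w ^ (N - T - 2) * E1 g w * ((g w)\<^sup>2 * D1 w) = (Y1 w + b) * D1 w"
        by (metis mult.assoc)
      then have "g w ^ (N - T - 2) * E1 g w * (deriv Y1 w / Y1 w) = (Y1 w + b) * D1 w / Y1 w"
        unfolding T1_facts(4)[OF tm wd(1)] by simp
      then show ?thesis using Y by (simp add: distrib_right add_divide_distrib)
    qed
    moreover define u where "u = norm (deriv Y1 w / Y1 w)"
    ultimately have "norm b * norm (D1 w / Y1 w) \<le> 2 ^ (N - T - 2) * C * u + CD"
      using norm_triangle_ineq4[of "g w ^ (N - T - 2) * E1 g w * (deriv Y1 w / Y1 w)" "D1 w"]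
        mult_right_mono[OF pw[of "N - T - 2"], of u]
      unfolding norm_mult[symmetric] u_def by (simp add: norm_mult)
    also have "\<dots> \<le> (2 ^ (N - T - 2) * C + CD) * (1 + u)"
      using C(1) CD by (simp add: algebra_simps u_def)
    finally have "norm (D1 w / Y1 w) \<le> CB * (1 + u)" using b by (simp add: CB_def field_simps)
    also have "\<dots> \<le> CC * (1 + u)" by (intro mult_right_mono) (auto simp: CC_def u_def)
    finally have le: "norm (D1 w / Y1 w) \<le> CC * (1 + u)" .
    have "V2 w = D1 w / Y1 w" "V1 w = g w * (D1 w / Y1 w)"
      unfolding V1_def V2_def by (rule remove_sings_eqI T1_V[OF tm wd(1)])+
    moreover have "norm (g w * (D1 w / Y1 w)) \<le> 2 * (CC * (1 + u))"
      unfolding norm_mult using g2 le by (intro mult_mono) auto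
    ultimately show ?thesis using 1 le by (simp add: u_def mult.assoc)
  qed
  ultimately show ?thesis using that[of CC] by blast
qed

lemma chart2:
  obtains C where "C \<ge> 0"
    "\<And>c w. tame d h c \<Longrightarrow> w \<in> ball c (d / 2) \<Longrightarrow> norm (Y2 w) \<le> C"
    "\<And>c w. tame d h c \<Longrightarrow> w \<in> ball c (d / 2) \<Longrightarrow> Y2 w \<noteq> 0 \<Longrightarrow>
       norm (V1 w) \<le> C * (1 + norm (deriv Y2 w / Y2 w)) \<and> norm (V2 w) \<le> 2 * C * (1 + norm (deriv Y2 w / Y2 w))"
proof -
  have r: "0 < d / 2" "d / 2 < d" using d by auto
  obtain C where C: "C \<ge> 0" "\<And>\<phi> z w. tame d \<phi> z \<Longrightarrow> w \<in> ball z (d / 2) \<Longrightarrow> norm (E2 \<phi> w) \<le> C"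
    using E_bound[OF r] by metis
  define CC where "CC = max (C + norm b * 2 ^ (N + T)) (2 + real (N + T) * (8 / d))"
  have "CC \<ge> 0" using d by (simp add: CC_def le_max_iff_disj)
  moreover have "norm (Y2 w) \<le> CC" if tm: "tame d h c" and w: "w \<in> ball c (d / 2)" for c w
  proof -
    have wd: "w \<in> ball c d" using w d by auto
    have "norm (h w) \<le> 2" using tm wd by (auto simp: tame_def)
    then have "norm (b * h w ^ (N + T)) \<le> norm b * 2 ^ (N + T)"
      unfolding norm_mult norm_power by (intro mult_left_mono power_mono) auto
    then have "norm (Y2 w) \<le> C + norm b * 2 ^ (N + T)"
      unfolding Y2_def using C(2)[OF tm w] norm_triangle_ineq4[of "E2 h w" "b * h w ^ (N + T)"] by linarith
    then show ?thesis by (simp add: CC_def)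
  qed
  moreover have "norm (V1 w) \<le> CC * (1 + norm (deriv Y2 w / Y2 w)) \<and> norm (V2 w) \<le> 2 * CC * (1 + norm (deriv Y2 w / Y2 w))"
    if tm: "tame d h c" and w: "w \<in> ball c (d / 2)" and Y: "Y2 w \<noteq> 0" for c w
  proof -
    have wd: "w \<in> ball c d" using w d by auto
    have h2: "norm (h w) \<le> 2" using tm wd by (auto simp: tame_def)
    have dh: "norm (deriv h w) \<le> 8 / d" by (rule deriv_bound_tame[OF tm w])
    define u where "u = norm (deriv Y2 w / Y2 w)"
    have "norm (W2 w) \<le> norm (h w * (deriv Y2 w / Y2 w)) + norm (of_nat (N + T) * deriv h w)"
      unfolding W2_def by (rule norm_triangle_ineq4)
    also have "\<dots> \<le> 2 * u + real (N + T) * (8 / d)"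
    proof (rule add_mono)
      show "norm (h w * (deriv Y2 w / Y2 w)) \<le> 2 * u"
        unfolding norm_mult[of "h w"] u_def using h2 by (intro mult_right_mono) auto
      show "norm (of_nat (N + T) * deriv h w) \<le> real (N + T) * (8 / d)"
        unfolding norm_mult norm_of_nat using dh by (intro mult_left_mono) auto
    qed
    also have "\<dots> \<le> (2 + real (N + T) * (8 / d)) * (1 + u)"
    proof -
      have "real (N + T) * (8 / d) * u \<ge> 0" using d by (intro mult_nonneg_nonneg) (auto simp: u_def)
      then show ?thesis by (simp add: distrib_left distrib_right u_def)
    qed
    also have "\<dots> \<le> CC * (1 + u)" by (intro mult_right_mono) (auto simp: CC_def u_def)
    finally have le: "norm (W2 w) \<le> CC * (1 + u)" .
    have "V1 w = W2 w" "V2 w = h w * W2 w"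
      unfolding V1_def V2_def by (rule remove_sings_eqI T2_V[OF tm wd Y])+
    moreover have "norm (h w * W2 w) \<le> 2 * (CC * (1 + u))"
      unfolding norm_mult using h2 le by (intro mult_mono) auto
    ultimately show ?thesis using le by (simp add: u_def mult.assoc)
  qed
  ultimately show ?thesis using that[of CC] by blast
qed

end

context omitted_value
begin

lemma Theta_eq1:
  assumes tm: "tame d g c" and z: "z \<in> ball c d"
  shows "\<Theta> z = norm (Y1 z) / sqrt (1 + (norm (g z))\<^sup>2) ^ (N + T)"
proof -
  have hol: "g holomorphic_on ball c d" using tm by (simp add: tame_def)
  have p: "sqrt (1 + (norm (g z))\<^sup>2) ^ (N + T) \<noteq> 0" by (simp add: add_nonneg_eq_0_iff)
  have "isCont (\<lambda>w. norm (Y1 w) / sqrt (1 + (norm (g w))\<^sup>2) ^ (N + T)) z"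
    by (intro continuous_intros isCont_holomorphic[OF holomorphic_Y1(1)[OF tm] open_ball z]
        isCont_holomorphic[OF hol open_ball z] p)
  moreover have "eventually (\<lambda>w. norm (P g w - b) / sqrt (1 + (norm (g w))\<^sup>2) ^ (N + T) =
      norm (Y1 w) / sqrt (1 + (norm (g w))\<^sup>2) ^ (N + T)) (at z)"
    using eventually_generic[OF z] by eventually_elim (simp add: T1_facts(1)[OF tm])
  ultimately show ?thesis unfolding \<Theta>_def by (intro tendsto_Lim Lim_eq_of_eventually) auto
qed

text \<open>The exponent N + T makes the formula the same in both charts: |P g - b| = |g|^(N+T)
  |Y2|, and sqrt (1 + |g|^2) = |g| sqrt (1 + |1/g|^2).\<close>

lemma Theta_eq2:
  assumes tm: "tame d h c" and z: "z \<in> ball c d"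
  shows "\<Theta> z = norm (Y2 z) / sqrt (1 + (norm (h z))\<^sup>2) ^ (N + T)"
proof -
  have hol: "h holomorphic_on ball c d" using tm by (simp add: tame_def)
  have p: "sqrt (1 + (norm (h z))\<^sup>2) ^ (N + T) \<noteq> 0" by (simp add: add_nonneg_eq_0_iff)
  have "isCont (\<lambda>w. norm (Y2 w) / sqrt (1 + (norm (h w))\<^sup>2) ^ (N + T)) z"
    by (intro continuous_intros isCont_holomorphic[OF holomorphic_Y2[OF tm] open_ball z]
        isCont_holomorphic[OF hol open_ball z] p)
  moreover have "eventually (\<lambda>w. norm (P g w - b) / sqrt (1 + (norm (g w))\<^sup>2) ^ (N + T) =
      norm (Y2 w) / sqrt (1 + (norm (h w))\<^sup>2) ^ (N + T)) (at z)"
    using eventually_generic[OF z]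
  proof eventually_elim
    case (elim w)
    define x where "x = norm (g w)"
    have x: "x > 0" using elim by (simp add: x_def)
    have "sqrt (1 + x\<^sup>2) = sqrt (x\<^sup>2 * (1 + (inverse x)\<^sup>2))"
      using x by (simp add: distrib_left flip: power_mult_distrib)
    also have "\<dots> = x * sqrt (1 + (inverse x)\<^sup>2)" using x by (simp add: real_sqrt_mult)
    finally have s: "sqrt (1 + x\<^sup>2) = x * sqrt (1 + (inverse x)\<^sup>2)" .
    have "norm (P g w - b) = x ^ (N + T) * norm (Y2 w)"
      using T2_facts(2)[OF tm, of w] elim by (simp add: norm_mult norm_power x_def)
    moreover have "norm (h w) = inverse x" by (simp add: x_def norm_inverse)
    ultimately show ?case using x unfolding x_def[symmetric] s power_mult_distrib by simp
  qed
  ultimately show ?thesis unfolding \<Theta>_def by (intro tendsto_Lim Lim_eq_of_eventually) auto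
qed

lemma Theta_chart:
  obtains \<phi> Y where "tame d \<phi> c" "Y holomorphic_on ball c d"
    "\<And>w. w \<in> ball c d \<Longrightarrow> \<Theta> w = norm (Y w) / sqrt (1 + (norm (\<phi> w))\<^sup>2) ^ (N + T)"
    "\<phi> = g \<and> Y = Y1 \<or> \<phi> = h \<and> Y = Y2"
  using tame[of c] Theta_eq1 Theta_eq2 holomorphic_Y1(1) holomorphic_Y2 by metis

lemma isCont_Theta: "isCont \<Theta> z"
proof -
  obtain \<phi> Y where c: "tame d \<phi> z" "Y holomorphic_on ball z d"
    "\<And>w. w \<in> ball z d \<Longrightarrow> \<Theta> w = norm (Y w) / sqrt (1 + (norm (\<phi> w))\<^sup>2) ^ (N + T)"
    using Theta_chart by metis
  have z: "z \<in> ball z d" using d by simp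
  have hol: "\<phi> holomorphic_on ball z d" using c(1) by (simp add: tame_def)
  have p: "sqrt (1 + (norm (\<phi> z))\<^sup>2) ^ (N + T) \<noteq> 0" by (simp add: add_nonneg_eq_0_iff)
  have c1: "isCont (\<lambda>w. norm (Y w) / sqrt (1 + (norm (\<phi> w))\<^sup>2) ^ (N + T)) z"
    by (intro continuous_intros isCont_holomorphic[OF c(2) open_ball z]
        isCont_holomorphic[OF hol open_ball z] p)
  have ev: "eventually (\<lambda>w. norm (Y w) / sqrt (1 + (norm (\<phi> w))\<^sup>2) ^ (N + T) = \<Theta> w) (nhds z)"
    using c(3) z by (auto simp: eventually_nhds intro!: exI[of _ "ball z d"])
  show ?thesis by (rule isCont_cong[OF ev, THEN iffD1, OF c1])
qed

text \<open>Within r / 64 of c some point has \<open>\<Theta>\<close> >= exp (- A X^3), where X = 1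
  + |c|. So the local function \<open>Y\<close> is not too small there, and on some circle about c
  its logarithmic derivative is at most a multiple of the square of X^3, whence the exponent 6. The
  chart estimates bound V1 and V2 on that circle, and the maximum principle carries this to
  c.\<close>

lemma V_growth:
  obtains B where "\<And>z. norm (V1 z) \<le> B * (1 + norm z) ^ 6" "\<And>z. norm (V2 z) \<le> B * (1 + norm z) ^ 6"
proof -
  obtain C1 where C1: "C1 \<ge> 0"
    "\<And>c w. tame d g c \<Longrightarrow> w \<in> ball c (d / 2) \<Longrightarrow> norm (Y1 w) \<le> C1 \<and>
       norm (V2 w) \<le> C1 * (1 + norm (deriv Y1 w / Y1 w)) \<and> norm (V1 w) \<le> 2 * C1 * (1 + norm (deriv Y1 w / Y1 w))"
    using chart1 by metis
  obtain C2 where C2: "C2 \<ge> 0"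
    "\<And>c w. tame d h c \<Longrightarrow> w \<in> ball c (d / 2) \<Longrightarrow> norm (Y2 w) \<le> C2"
    "\<And>c w. tame d h c \<Longrightarrow> w \<in> ball c (d / 2) \<Longrightarrow> Y2 w \<noteq> 0 \<Longrightarrow>
       norm (V1 w) \<le> C2 * (1 + norm (deriv Y2 w / Y2 w)) \<and> norm (V2 w) \<le> 2 * C2 * (1 + norm (deriv Y2 w / Y2 w))"
    using chart2 by metis
  define C where "C = max 1 (2 * max C1 C2)"
  have C: "C \<ge> 1" "C1 \<le> C" "2 * C1 \<le> C" "C2 \<le> C" "2 * C2 \<le> C" using C1(1) C2(1) by (auto simp: C_def)
  \<comment> \<open>The common content of the two charts, so that later it is irrelevant whether
    \<open>Y\<close> is \<open>Y1\<close> or \<open>Y2\<close>.\<close>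
  define R where "R = (\<lambda>Y w. \<Theta> w \<le> norm (Y w) \<and> norm (Y w) \<le> C \<and>
      (Y w \<noteq> 0 \<longrightarrow> norm (V1 w) \<le> C * (1 + norm (deriv Y w / Y w)) \<and> norm (V2 w) \<le> C * (1 + norm (deriv Y w / Y w))))"
  have data: "\<exists>Y. Y holomorphic_on ball c (d / 2) \<and> (\<forall>w\<in>ball c (d / 2). R Y w)" for c
  proof -
    obtain \<phi> Y where c: "tame d \<phi> c" "Y holomorphic_on ball c d"
      "\<And>w. w \<in> ball c d \<Longrightarrow> \<Theta> w = norm (Y w) / sqrt (1 + (norm (\<phi> w))\<^sup>2) ^ (N + T)"
      "\<phi> = g \<and> Y = Y1 \<or> \<phi> = h \<and> Y = Y2"
      by (rule Theta_chart[of c]) (rule that)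
    have "Y holomorphic_on ball c (d / 2)" using d by (intro holomorphic_on_subset[OF c(2)]) auto
    moreover have "R Y w" if w: "w \<in> ball c (d / 2)" for w
      unfolding R_def
    proof (intro conjI impI)
      define S where "S = sqrt (1 + (norm (\<phi> w))\<^sup>2) ^ (N + T)"
      have s1: "S \<ge> 1" unfolding S_def by (intro one_le_power) simp
      then have "norm (Y w) * 1 \<le> norm (Y w) * S" by (intro mult_left_mono) auto
      then have "norm (Y w) / S \<le> norm (Y w)" using s1 by (simp add: pos_divide_le_eq)
      then show "\<Theta> w \<le> norm (Y w)" using c(3)[of w] w d by (simp add: S_def)
      have up: "x \<le> C * (1 + norm y)" if "x \<le> K * (1 + norm y)" "K \<le> C" for x K :: real and y :: complex
        using that(1) mult_right_mono[OF that(2), of "1 + norm y"] by simp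
      let ?u = "deriv Y w / Y w"
      have "norm (Y w) \<le> C \<and> (Y w \<noteq> 0 \<longrightarrow> norm (V1 w) \<le> C * (1 + norm ?u) \<and> norm (V2 w) \<le> C * (1 + norm ?u))"
        using c(4)
      proof (elim disjE conjE)
        assume e: "\<phi> = g" "Y = Y1"
        have t: "tame d g c" using c(1) e by simp
        have 1: "norm (Y w) \<le> C1" "norm (V2 w) \<le> C1 * (1 + norm ?u)" "norm (V1 w) \<le> 2 * C1 * (1 + norm ?u)"
          using C1(2)[OF t w] unfolding e(2) by auto
        show ?thesis by (intro conjI impI order_trans[OF 1(1) C(2)] up[OF 1(2) C(2)] up[OF 1(3) C(3)])
      next
        assume e: "\<phi> = h" "Y = Y2"
        have t: "tame d h c" using c(1) e by simp
        have 1: "norm (Y w) \<le> C2" using C2(2)[OF t w] unfolding e(2) .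
        have 2: "norm (V1 w) \<le> C2 * (1 + norm ?u)" "norm (V2 w) \<le> 2 * C2 * (1 + norm ?u)" if "Y w \<noteq> 0"
          using C2(3)[OF t w that[unfolded e(2)]] unfolding e(2) by auto
        show ?thesis by (intro conjI impI order_trans[OF 1 C(4)] up[OF 2(1) C(4)] up[OF 2(2) C(5)])
      qed
      then show "norm (Y w) \<le> C" "Y w \<noteq> 0 \<Longrightarrow> norm (V1 w) \<le> C * (1 + norm ?u)"
        "Y w \<noteq> 0 \<Longrightarrow> norm (V2 w) \<le> C * (1 + norm ?u)" by auto
    qed
    ultimately show ?thesis by blast
  qed
  have cont: "continuous_on UNIV \<Theta>" using isCont_Theta by (simp add: continuous_on_eq_continuous_at)
  have sub: "log_sub (128 * real (N + T) / d\<^sup>2) \<Theta> z" for z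
  proof -
    obtain \<phi> Y where c: "tame d \<phi> z" "Y holomorphic_on ball z d"
      "\<And>w. w \<in> ball z d \<Longrightarrow> \<Theta> w = norm (Y w) / sqrt (1 + (norm (\<phi> w))\<^sup>2) ^ (N + T)"
      "\<phi> = g \<and> Y = Y1 \<or> \<phi> = h \<and> Y = Y2"
      by (rule Theta_chart[of z]) (rule that)
    show ?thesis by (rule log_sub_quotient[OF c(1) d c(2,3)])
  qed
  have bound: "\<Theta> z \<le> C" for z
  proof -
    have "z \<in> ball z (d / 2)" using d by simp
    then have "\<exists>Y. R Y z" using data[of z] by blast
    then show ?thesis unfolding R_def by force
  qed
  obtain z0 where z0: "\<Theta> z0 > 0"
  proof -
    obtain \<phi> Y where c: "tame d \<phi> 0" "Y holomorphic_on ball 0 d"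
      "\<And>w. w \<in> ball 0 d \<Longrightarrow> \<Theta> w = norm (Y w) / sqrt (1 + (norm (\<phi> w))\<^sup>2) ^ (N + T)"
      "\<phi> = g \<and> Y = Y1 \<or> \<phi> = h \<and> Y = Y2"
      by (rule Theta_chart[of 0]) (rule that)
    have "eventually (\<lambda>w. w \<in> ball 0 d \<and> \<not> is_pole g w \<and> g w \<noteq> 0) (at 0)"
      using d by (intro eventually_generic) simp
    then obtain w where w: "w \<in> ball 0 d" "\<not> is_pole g w"
      using eventually_happens[of _ "at (0::complex)"] at_neq_bot by blast
    have "Y w \<noteq> 0" using c(1,4) T1_facts(2)[OF _ w(1)] T2_facts(3)[OF _ w] by auto
    then have "norm (Y w) / sqrt (1 + (norm (\<phi> w))\<^sup>2) ^ (N + T) > 0"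
      by (intro divide_pos_pos zero_less_power) (auto simp: add_pos_nonneg)
    then show ?thesis using c(3)[OF w(1)] that[of w] by simp
  qed
  define r where "r = d / 2"
  have r: "r > 0" using d by (simp add: r_def)
  have K0: "128 * real (N + T) / d\<^sup>2 \<ge> 0" and r64: "r / 64 > 0" using r by auto
  obtain A where A: "A \<ge> 0" "\<And>c. \<exists>z. dist c z \<le> r / 64 \<and> \<Theta> z \<ge> exp (- A * (1 + norm c) ^ 3)"
    by (rule log_sub_lower_bound[OF cont sub K0 bound z0 r64]) (rule that)
  define B where "B = C * (1 + 1000 / r * (1 + A + ln C)\<^sup>2)"
  have main: "norm (V1 c) \<le> B * (1 + norm c) ^ 6 \<and> norm (V2 c) \<le> B * (1 + norm c) ^ 6" for c
  proof -
    define X where "X = 1 + norm c"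
    have X: "X ^ 3 \<ge> 1" by (simp add: X_def one_le_power)
    obtain Y where Y: "Y holomorphic_on ball c r" "\<And>w. w \<in> ball c r \<Longrightarrow> \<Theta> w \<le> norm (Y w)"
      "\<And>w. w \<in> ball c r \<Longrightarrow> norm (Y w) \<le> C"
      "\<And>w. w \<in> ball c r \<Longrightarrow> Y w \<noteq> 0 \<Longrightarrow> norm (V1 w) \<le> C * (1 + norm (deriv Y w / Y w))"
      "\<And>w. w \<in> ball c r \<Longrightarrow> Y w \<noteq> 0 \<Longrightarrow> norm (V2 w) \<le> C * (1 + norm (deriv Y w / Y w))"
    proof -
      from data[of c] obtain Y where Y: "Y holomorphic_on ball c r" and *: "\<forall>w\<in>ball c r. R Y w"
        unfolding r_def by blast
      show ?thesis by (rule that[OF Y]) (use * in \<open>simp_all del: mem_ball add: R_def\<close>)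
    qed
    obtain z' where z': "dist c z' \<le> r / 64" "\<Theta> z' \<ge> exp (- A * X ^ 3)" using A(2)[of c] by (auto simp: X_def)
    have zb: "z' \<in> ball c r" using z'(1) r by simp
    have lnC: "ln C \<ge> 0" using C(1) by simp
    \<comment> \<open>\<open>log_deriv_on_circle\<close> measures \<open>Y\<close> relative to its
      upper bound C, which adds ln C to the exponent.\<close>
    have "C * exp (- (A * X ^ 3 + ln C)) = exp (- A * X ^ 3)"
      using C(1) by (simp add: exp_diff exp_minus field_simps)
    then have ge: "norm (Y z') \<ge> C * exp (- (A * X ^ 3 + ln C))" using z'(2) Y(2)[OF zb] by linarith
    obtain s where s: "r / 64 \<le> s" "s \<le> r / 32"
      "\<And>w. dist c w = s \<Longrightarrow> Y w \<noteq> 0 \<and> norm (deriv Y w / Y w) \<le> 1000 / r * (1 + (A * X ^ 3 + ln C))\<^sup>2"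
    proof -
      have "C > 0" using C(1) by simp
      then show ?thesis
        by (rule log_deriv_on_circle[OF Y(1) r _ Y(3) z'(1) ge]) (assumption | rule that)+
    qed
    have sr: "0 < s" "s < r" using s r by auto
    have le1: "1000 / r * (1 + (A * X ^ 3 + ln C))\<^sup>2 \<le> 1000 / r * (1 + A + ln C)\<^sup>2 * X ^ 6"
    proof -
      have "1 + (A * X ^ 3 + ln C) \<le> (1 + A + ln C) * X ^ 3"
        using X lnC mult_left_mono[OF X, of "ln C"] by (simp add: algebra_simps)
      then have "(1 + (A * X ^ 3 + ln C))\<^sup>2 \<le> ((1 + A + ln C) * X ^ 3)\<^sup>2"
      proof (rule power_mono)
        have "0 \<le> A * X ^ 3" using A(1) X by (intro mult_nonneg_nonneg) linarith+
        then show "0 \<le> 1 + (A * X ^ 3 + ln C)" using lnC by linarith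
      qed
      then show ?thesis using r by (simp add: power_mult_distrib mult.assoc divide_right_mono flip: power_mult)
    qed
    have X6: "X ^ 6 \<ge> 1" by (simp add: X_def one_le_power)
    have circ: "C * (1 + norm (deriv Y w / Y w)) \<le> B * X ^ 6" if "dist c w = s" for w
    proof -
      have "1 + norm (deriv Y w / Y w) \<le> 1 * X ^ 6 + 1000 / r * (1 + A + ln C)\<^sup>2 * X ^ 6"
        using s(3)[OF that] le1 X6 by linarith
      then have "C * (1 + norm (deriv Y w / Y w)) \<le> C * ((1 + 1000 / r * (1 + A + ln C)\<^sup>2) * X ^ 6)"
        using C(1) by (intro mult_left_mono) (auto simp: distrib_right)
      then show ?thesis by (simp add: B_def mult.assoc)
    qed
    obtain w1 where w1: "dist c w1 = s" "norm (V1 w1) \<ge> norm (V1 c)"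
      by (rule max_modulus_circle[OF holomorphic_on_subset[OF V_entire(1) subset_UNIV] sr]) (rule that)
    obtain w2 where w2: "dist c w2 = s" "norm (V2 w2) \<ge> norm (V2 c)"
      by (rule max_modulus_circle[OF holomorphic_on_subset[OF V_entire(2) subset_UNIV] sr]) (rule that)
    have "norm (V1 w1) \<le> C * (1 + norm (deriv Y w1 / Y w1))"
      using Y(4)[of w1] s(3)[OF w1(1)] w1(1) sr by auto
    moreover have "norm (V2 w2) \<le> C * (1 + norm (deriv Y w2 / Y w2))"
      using Y(5)[of w2] s(3)[OF w2(1)] w2(1) sr by auto
    ultimately show ?thesis using circ[OF w1(1)] circ[OF w2(1)] w1(2) w2(2) unfolding X_def by linarith
  qed
  show ?thesis by (rule that[of B]) (use main in auto)
qed

lemma V_polynomial: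
  obtains p1 p2 :: "complex poly" where "\<And>z. V1 z = poly p1 z" "\<And>z. V2 z = poly p2 z"
proof -
  obtain B where B: "\<And>z. norm (V1 z) \<le> B * (1 + norm z) ^ 6" "\<And>z. norm (V2 z) \<le> B * (1 + norm z) ^ 6"
    using V_growth by metis
  have B0: "B \<ge> 0" using B(1)[of 0] order_trans[OF norm_ge_zero] by fastforce
  have le: "B * (1 + norm z) ^ 6 \<le> (B * 2 ^ 6) * norm z ^ 6" if "1 \<le> norm z" for z :: complex
  proof -
    have "(1 + norm z) ^ 6 \<le> (2 * norm z) ^ 6" using that by (intro power_mono) auto
    then show ?thesis using B0 mult_left_mono[of _ _ B] by (simp add: power_mult_distrib mult.assoc)
  qed
  obtain p1 :: "complex poly" where "\<And>z. V1 z = poly p1 z"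
    using entire_poly_growth_imp_poly[OF V_entire(1) order_trans[OF B(1) le]] by metis
  moreover obtain p2 :: "complex poly" where "\<And>z. V2 z = poly p2 z"
    using entire_poly_growth_imp_poly[OF V_entire(2) order_trans[OF B(2) le]] by metis
  ultimately show ?thesis using that by metis
qed

end

text \<open>Nothing is asked at zeros of q, so the value stored at a pole is irrelevant and the
  class is closed under products and derivatives without cancelling common factors.\<close>

definition rational_fun :: "(complex \<Rightarrow> complex) \<Rightarrow> bool" where
  "rational_fun f \<longleftrightarrow> (\<exists>p q. q \<noteq> 0 \<and> (\<forall>z. poly q z \<noteq> 0 \<longrightarrow> f z = poly p z / poly q z))"

lemma rational_funI: "q \<noteq> 0 \<Longrightarrow> (\<And>z. poly q z \<noteq> 0 \<Longrightarrow> f z = poly p z / poly q z) \<Longrightarrow> rational_fun f"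
  unfolding rational_fun_def by blast

lemma rational_fun_const: "rational_fun (\<lambda>_. c)"
  by (rule rational_funI[of 1 _ "[:c:]"]) auto

lemma rational_fun_mult:
  assumes "rational_fun f" "rational_fun f'"
  shows "rational_fun (\<lambda>z. f z * f' z)"
proof -
  obtain p q where 1: "q \<noteq> 0" "\<And>z. poly q z \<noteq> 0 \<Longrightarrow> f z = poly p z / poly q z"
    using assms(1) unfolding rational_fun_def by blast
  obtain p' q' where 2: "q' \<noteq> 0" "\<And>z. poly q' z \<noteq> 0 \<Longrightarrow> f' z = poly p' z / poly q' z"
    using assms(2) unfolding rational_fun_def by blast
  show ?thesis by (rule rational_funI[of "q * q'" _ "p * p'"]) (use 1 2 in auto)
qed

lemma rational_fun_power: "rational_fun f \<Longrightarrow> rational_fun (\<lambda>z. f z ^ q)"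
  by (induction q) (auto intro: rational_fun_const rational_fun_mult)

lemma rational_fun_prod:
  assumes "finite J" "\<And>j. j \<in> J \<Longrightarrow> rational_fun (f j)"
  shows "rational_fun (\<lambda>z. \<Prod>j\<in>J. f j z)"
  using assms by (induction rule: finite_induct) (auto intro: rational_fun_const rational_fun_mult)

lemma open_poly_nonzero: "open {z::complex. poly q z \<noteq> 0}"
  by (intro open_Collect_neq continuous_intros)

lemma deriv_rational:
  fixes p q :: "complex poly"
  assumes "\<And>z. poly q z \<noteq> 0 \<Longrightarrow> f z = poly p z / poly q z" and z: "poly q z \<noteq> 0"
  shows "deriv f z = (poly (pderiv p) z * poly q z - poly p z * poly (pderiv q) z) / poly q z ^ 2"
proof (rule DERIV_imp_deriv)
  have "((\<lambda>z. poly p z / poly q z) has_field_derivative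
      (poly (pderiv p) z * poly q z - poly p z * poly (pderiv q) z) / (poly q z * poly q z)) (at z)"
    by (rule DERIV_divide poly_DERIV z)+
  then have "((\<lambda>z. poly p z / poly q z) has_field_derivative
      (poly (pderiv p) z * poly q z - poly p z * poly (pderiv q) z) / poly q z ^ 2) (at z)"
    by (simp add: power2_eq_square)
  then show "(f has_field_derivative
      (poly (pderiv p) z * poly q z - poly p z * poly (pderiv q) z) / poly q z ^ 2) (at z)"
    by (rule has_field_derivative_transform_within_open[OF _ open_poly_nonzero[of q]]) (use assms in auto)
qed

lemma rational_fun_deriv:
  assumes "rational_fun f"
  shows "rational_fun (deriv f)"
proof -
  obtain p q where 1: "q \<noteq> 0" "\<And>z. poly q z \<noteq> 0 \<Longrightarrow> f z = poly p z / poly q z"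
    using assms(1) unfolding rational_fun_def by blast
  show ?thesis
    by (rule rational_funI[of "q ^ 2" _ "pderiv p * q - p * pderiv q"])
      (use 1 deriv_rational[OF 1(2)] in \<open>auto simp: poly_power\<close>)
qed

lemma rational_fun_diff_monomial:
  assumes "rational_fun f"
  shows "rational_fun (diff_monomial n k m t f)"
proof -
  have "rational_fun ((deriv ^^ i) (\<lambda>w. f w ^ q))" for i q
    by (induction i) (auto intro: rational_fun_power rational_fun_deriv assms)
  then show ?thesis unfolding diff_monomial_def[abs_def]
    by (intro rational_fun_mult rational_fun_power rational_fun_prod assms) auto
qed

lemma eventually_poly_nonzero:
  assumes "(p :: complex poly) \<noteq> 0"
  shows "eventually (\<lambda>z. poly p z \<noteq> 0) at_infinity"
proof -
  obtain R c where "c > 0" "\<And>z. norm z \<ge> R \<Longrightarrow> norm (poly p z) \<ge> c"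
    using poly_bounded_below[OF assms] by metis
  then show ?thesis unfolding eventually_at_infinity by (metis norm_zero not_less)
qed

lemma poly_log_deriv_tendsto_0:
  fixes p :: "complex poly"
  shows "((\<lambda>z. poly (pderiv p) z / poly p z) \<longlongrightarrow> 0) at_infinity"
proof (cases "degree p = 0")
  case True
  then have "pderiv p = 0" by (simp add: pderiv_eq_0_iff)
  then show ?thesis by simp
next
  case False
  then show ?thesis by (intro poly_divide_tendsto_0_at_infinity) (simp add: degree_pderiv)
qed

lemma degree_less_of_tendsto_0:
  fixes p q :: "complex poly"
  assumes p: "p \<noteq> 0" and q: "q \<noteq> 0" and lim: "((\<lambda>z. poly p z / poly q z) \<longlongrightarrow> 0) at_infinity"
  shows "degree p < degree q"
proof (rule ccontr)
  assume "\<not> degree p < degree q"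
  then have le: "degree q \<le> degree p" by simp
  have "((\<lambda>z. poly p z / poly q z * (poly q z / z ^ degree q)) \<longlongrightarrow> 0 * lead_coeff q) at_infinity"
    by (intro tendsto_mult lim poly_divide_tendsto_aux)
  then have "((\<lambda>z. norm (poly p z / poly q z * (poly q z / z ^ degree q))) \<longlongrightarrow> 0) at_infinity"
    by (simp add: tendsto_norm_zero)
  moreover have "((\<lambda>z. norm (poly p z / z ^ degree p)) \<longlongrightarrow> norm (lead_coeff p)) at_infinity"
    by (intro tendsto_norm poly_divide_tendsto_aux)
  moreover have "eventually (\<lambda>z::complex. norm z \<ge> 1) at_infinity" by (auto simp: eventually_at_infinity)
  then have "eventually (\<lambda>z. norm (poly p z / z ^ degree p) \<le> norm (poly p z / poly q z * (poly q z / z ^ degree q))) at_infinity"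
    using eventually_poly_nonzero[OF q]
  proof eventually_elim
    case (elim z)
    have "norm z ^ degree q \<le> norm z ^ degree p" using elim le by (intro power_increasing) auto
    moreover have "norm z > 0" using elim by linarith
    ultimately have "norm (poly p z) / norm z ^ degree p \<le> norm (poly p z) / norm z ^ degree q"
      by (intro divide_left_mono mult_pos_pos) auto
    then show ?case using elim by (simp add: norm_divide norm_power)
  qed
  ultimately have "norm (lead_coeff p) \<le> 0" by (rule tendsto_le[OF trivial_limit_at_infinity])
  then show False using p by simp
qed

context omitted_value
begin

lemma P_analytic: "\<not> is_pole g z \<Longrightarrow> P g analytic_on {z}"
  using analytic[of z] unfolding diff_monomial_def[abs_def] by (intro analytic_intros) auto

lemma V_at:
  assumes "\<not> is_pole g z" "g z \<noteq> 0"
  shows "V1 z = U z / g z" "V2 z = U z / (g z)\<^sup>2"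
proof -
  have "U analytic_on {z}" unfolding U_def[abs_def]
    by (intro analytic_intros P_analytic assms) (use omit[OF assms(1)] in auto)
  then have "(\<lambda>w. U w / g w) analytic_on {z}" "(\<lambda>w. U w / (g w)\<^sup>2) analytic_on {z}"
    using assms by (auto intro!: analytic_intros analytic)
  then show "V1 z = U z / g z" "V2 z = U z / (g z)\<^sup>2" unfolding V1_def V2_def by simp_all
qed

lemma V_not_zero:
  assumes "(\<forall>z. V1 z = 0) \<or> (\<forall>z. V2 z = 0)"
  shows False
proof -
  have "eventually (\<lambda>w. w \<in> ball 0 d \<and> \<not> is_pole g w \<and> g w \<noteq> 0) (at 0)"
    using d by (intro eventually_generic) simp
  then obtain r where r: "r > 0" "\<And>w. w \<noteq> 0 \<Longrightarrow> dist w 0 < r \<Longrightarrow> \<not> is_pole g w \<and> g w \<noteq> 0"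
    unfolding eventually_at by auto
  \<comment> \<open>A disc with 0 on its boundary: good behaviour is known only in a punctured
    neighbourhood of 0, and U = 0 on a connected open set suffices to make P g constant
    there.\<close>
  define B where "B = ball (of_real (r / 2) :: complex) (r / 2)"
  have B: "\<not> is_pole g w \<and> g w \<noteq> 0" if "w \<in> B" for w
  proof (rule r(2))
    have "norm w \<le> norm (of_real (r / 2) :: complex) + dist (of_real (r / 2)) w"
      using norm_triangle_ineq2[of w "of_real (r / 2)"] by (simp add: dist_norm norm_minus_commute)
    then show "dist w 0 < r" using that r(1) by (simp add: B_def)
    show "w \<noteq> 0" using that r(1) by (auto simp: B_def dist_norm norm_divide)
  qed
  have dP: "(P g has_field_derivative 0) (at w within B)" if w: "w \<in> B" for w
  proof -
    have "U w = 0" using assms V_at[of w] B[OF w] by auto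
    then have "deriv (P g) w = 0" using omit[of w] B[OF w] by (simp add: U_def)
    moreover have "(P g has_field_derivative deriv (P g) w) (at w)"
      using P_analytic[of w] B[OF w] analytic_on_imp_differentiable_at DERIV_deriv_iff_field_differentiable by blast
    ultimately show ?thesis using has_field_derivative_at_within by fastforce
  qed
  then obtain c where c: "\<And>w. w \<in> B \<Longrightarrow> P g w = c"
    using has_field_derivative_zero_constant[of B "P g"] by (auto simp: B_def)
  show False
  proof (rule P_not_locally_constant[of B c])
    show "open B" "B \<noteq> {}" using r(1) by (auto simp: B_def)
  qed (use B c in auto)
qed

theorem no_omitted_value: False
proof -
  obtain p1 p2 :: "complex poly" where p: "\<And>z. V1 z = poly p1 z" "\<And>z. V2 z = poly p2 z"
    using V_polynomial by metis
  have p0: "p1 \<noteq> 0" "p2 \<noteq> 0" using V_not_zero p by auto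
  have g_eq: "\<not> is_pole g z \<and> g z = poly p1 z / poly p2 z" if z: "poly p2 z \<noteq> 0" for z
  proof -
    have "eventually (\<lambda>w. poly p2 w \<noteq> 0) (at z)"
      using open_poly_nonzero[of p2] z eventually_at_in_open'[of "{z. poly p2 z \<noteq> 0}" z] by simp
    then have ev: "eventually (\<lambda>w. poly p1 w / poly p2 w = g w) (at z)"
      using eventually_not_pole[of z] eventually_neq[of 0 z]
    proof eventually_elim
      case (elim w)
      have "poly p1 w = g w * poly p2 w"
        using V_at[OF elim(2,3)] p elim by (simp add: power2_eq_square)
      then show ?case using elim by simp
    qed
    \<comment> \<open>The quotient is known to equal g only near z; its finite limit at z excludes a
      pole and determines the value of g.\<close>
    have "((\<lambda>w. poly p1 w / poly p2 w) \<longlongrightarrow> poly p1 z / poly p2 z) (at z)"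
      by (intro tendsto_intros z)
    then have lim: "(g \<longlongrightarrow> poly p1 z / poly p2 z) (at z)" by (rule Lim_transform_eventually[OF _ ev])
    then have np: "\<not> is_pole g z"
      unfolding is_pole_def using not_tendsto_and_filterlim_at_infinity[of "at z" g] by auto
    then have "(g \<longlongrightarrow> g z) (at z)" using mero by (auto simp: nicely_meromorphic_on_def)
    then show ?thesis using np LIM_unique[OF lim] by simp
  qed
  have "rational_fun g" by (rule rational_funI[OF p0(2)]) (use g_eq in auto)
  then have "rational_fun (P g)" by (rule rational_fun_diff_monomial)
  then obtain p q where pq: "q \<noteq> 0" "\<And>z. poly q z \<noteq> 0 \<Longrightarrow> P g z = poly p z / poly q z"
    unfolding rational_fun_def by blast
  define a where "a = p - smult b q"
  have az: "P g z - b = poly a z / poly q z" if "poly q z \<noteq> 0" for z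
    using pq(2)[OF that] that by (simp add: a_def diff_divide_distrib)
  have a0: "a \<noteq> 0"
  proof
    assume "a = 0"
    moreover have "eventually (\<lambda>z. poly q z \<noteq> 0 \<and> poly p2 z \<noteq> 0) at_infinity"
      using eventually_poly_nonzero[OF pq(1)] eventually_poly_nonzero[OF p0(2)] by eventually_elim auto
    then obtain z where "poly q z \<noteq> 0" "poly p2 z \<noteq> 0"
      using eventually_happens'[OF trivial_limit_at_infinity] by blast
    ultimately show False using az[of z] omit[of z] g_eq[of z] by simp
  qed
  \<comment> \<open>U is the logarithmic derivative of a / q, a difference of logarithmic
    derivatives of polynomials.\<close>
  have "((\<lambda>z. poly (pderiv a) z / poly a z - poly (pderiv q) z / poly q z) \<longlongrightarrow> 0 - 0) at_infinity"
    by (intro tendsto_diff poly_log_deriv_tendsto_0)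
  moreover have "eventually (\<lambda>z. poly (pderiv a) z / poly a z - poly (pderiv q) z / poly q z = U z) at_infinity"
    using eventually_poly_nonzero[OF pq(1)] eventually_poly_nonzero[OF a0]
  proof eventually_elim
    case (elim z)
    have dP: "deriv (P g) z = (poly (pderiv p) z * poly q z - poly p z * poly (pderiv q) z) / poly q z ^ 2"
      by (rule deriv_rational[OF pq(2) elim(1)])
    have "U z = (poly (pderiv p) z * poly q z - poly p z * poly (pderiv q) z) / (poly q z * poly a z)"
      unfolding U_def az[OF elim(1)] dP using elim by (simp add: power2_eq_square)
    also have "poly (pderiv p) z * poly q z - poly p z * poly (pderiv q) z =
        poly (pderiv a) z * poly q z - poly a z * poly (pderiv q) z"
      by (simp add: a_def pderiv_diff pderiv_smult algebra_simps)
    finally show ?case using elim by (simp add: diff_frac_eq mult.commute)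
  qed
  ultimately have U0: "(U \<longlongrightarrow> 0) at_infinity" using Lim_transform_eventually by fastforce
  have evU: "eventually (\<lambda>z. U z = poly (p1\<^sup>2) z / poly p2 z) at_infinity"
    using eventually_poly_nonzero[OF p0(1)] eventually_poly_nonzero[OF p0(2)]
  proof eventually_elim
    case (elim z)
    have g: "\<not> is_pole g z" "g z = poly p1 z / poly p2 z" "g z \<noteq> 0" using g_eq[OF elim(2)] elim by auto
    have "U z = V1 z * g z" using V_at(1)[OF g(1,3)] g(3) by simp
    then show ?case using p(1) g(2) by (simp add: poly_power power2_eq_square)
  qed
  have "((\<lambda>z. poly (p1\<^sup>2) z / poly p2 z) \<longlongrightarrow> 0) at_infinity"
    by (rule Lim_transform_eventually[OF U0 evU])
  then have deg: "degree (p1\<^sup>2) < degree p2" by (intro degree_less_of_tendsto_0 p0) (use p0 in auto)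
  moreover have "degree p1 \<le> degree (p1\<^sup>2)" using p0 by (simp add: power2_eq_square degree_mult_eq)
  ultimately have "((\<lambda>z. poly p1 z / poly p2 z) \<longlongrightarrow> 0) at_infinity"
    by (intro poly_divide_tendsto_0_at_infinity) simp
  then have ev1: "eventually (\<lambda>z. norm (poly p1 z / poly p2 z) < 1/4) at_infinity"
    using tendstoD[of "\<lambda>z. poly p1 z / poly p2 z" 0 at_infinity "1/4"] by (simp add: dist_norm)
  have ev2: "eventually (\<lambda>z. norm (U z) < 1) at_infinity"
    using tendstoD[OF U0, of 1] by (simp add: dist_norm)
  obtain C where C: "C \<ge> 0"
    "\<And>c w. tame d g c \<Longrightarrow> w \<in> ball c (d / 2) \<Longrightarrow> norm (Y1 w) \<le> C \<and>
       norm (V2 w) \<le> C * (1 + norm (deriv Y1 w / Y1 w)) \<and> norm (V1 w) \<le> 2 * C * (1 + norm (deriv Y1 w / Y1 w))"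
    using chart1 by metis
  have "eventually (\<lambda>z. norm (poly p2 z) \<le> 2 * C) at_infinity"
    using ev1 ev2 eventually_poly_nonzero[OF p0(2)]
  proof eventually_elim
    case (elim z)
    have g: "\<not> is_pole g z" "norm (g z) < 1/4" using g_eq[OF elim(3)] elim(1) by auto
    have zb: "z \<in> ball z d" "z \<in> ball z (d / 2)" using d by auto
    \<comment> \<open>|g| < 1/4 excludes the chart 1/g, in which |g| is at least 1/2 off the
      poles.\<close>
    have tm: "tame d g z" using tame[of z] norm_ge_half[OF _ zb(1) g(1)] g(2) by fastforce
    have "deriv Y1 z / Y1 z = U z"
      unfolding U_def T1_facts(1,3)[OF tm zb(1)] T1_facts(4)[OF tm zb(1)] ..
    then have "norm (V2 z) \<le> C * (1 + norm (U z))" using C(2)[OF tm zb(2)] by simp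
    also have "\<dots> \<le> C * 2" using C(1) elim(2) by (intro mult_left_mono) auto
    finally show ?case using p(2) by (simp add: mult.commute)
  qed
  moreover obtain R where "\<And>z. norm z \<ge> R \<Longrightarrow> norm (poly p2 z) > 2 * C"
    by (rule poly_large[of p2 "2 * C"]) (use deg in auto)
  then have "eventually (\<lambda>z. norm (poly p2 z) > 2 * C) at_infinity" by (auto simp: eventually_at_infinity)
  ultimately have "eventually (\<lambda>z::complex. False) at_infinity" by eventually_elim simp
  then show False using eventually_happens'[OF trivial_limit_at_infinity] by blast
qed

end

section \<open>The rescaling density\<close>

text \<open>A continuity argument. Let w0 be a nearest point to z at which \<open>\<phi>\<close> has
  a pole or modulus at least 2. On the disc up to w0 the derivative is at most 4 K, so
  |\<open>\<phi>\<close>| stays below 1 + 4 K \<open>\<delta>\<close> <= 3/2, while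
  |\<open>\<phi>\<close>| > 3/2 near w0.\<close>

lemma tame_of_deriv_bound:
  assumes mero: "\<phi> nicely_meromorphic_on ball z r" and \<delta>: "0 < \<delta>" "\<delta> \<le> r" "8 * K * \<delta> \<le> 1" and K: "K \<ge> 0"
    and z: "\<not> is_pole \<phi> z" "norm (\<phi> z) \<le> 1"
    and bd: "\<And>w. w \<in> ball z r \<Longrightarrow> \<not> is_pole \<phi> w \<Longrightarrow> norm (deriv \<phi> w) \<le> K * max 1 ((norm (\<phi> w))\<^sup>2)"
  shows "tame \<delta> \<phi> z"
proof -
  define A where "A = {w \<in> ball z \<delta>. \<not> is_pole \<phi> w \<and> norm (\<phi> w) < 2}"
  have an: "\<phi> analytic_on {w}" if "w \<in> ball z \<delta>" "\<not> is_pole \<phi> w" for w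
    by (rule nicely_meromorphic_on_imp_analytic_at[OF mero]) (use that \<delta> in auto)
  have "open A"
  proof (subst open_subopen, intro ballI)
    fix w assume w: "w \<in> A"
    then obtain S where S: "open S" "w \<in> S" "\<phi> holomorphic_on S"
      using an unfolding A_def analytic_at by blast
    have "continuous_on (S \<inter> ball z \<delta>) (\<lambda>x. norm (\<phi> x))"
      by (intro continuous_on_norm holomorphic_on_imp_continuous_on holomorphic_on_subset[OF S(3)]) auto
    then have "open ((S \<inter> ball z \<delta>) \<inter> (\<lambda>x. norm (\<phi> x)) -` {..<2})"
      using S(1) by (intro continuous_open_preimage) auto
    moreover have "(S \<inter> ball z \<delta>) \<inter> (\<lambda>x. norm (\<phi> x)) -` {..<2} \<subseteq> A"
      using not_is_pole_holomorphic[OF S(1) _ S(3)] by (auto simp: A_def)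
    moreover have "w \<in> (S \<inter> ball z \<delta>) \<inter> (\<lambda>x. norm (\<phi> x)) -` {..<2}" using w S by (auto simp: A_def)
    ultimately show "\<exists>T. open T \<and> w \<in> T \<and> T \<subseteq> A" by blast
  qed
  have "ball z \<delta> \<subseteq> A"
  proof (rule ccontr)
    assume "\<not> ball z \<delta> \<subseteq> A"
    then obtain w1 where w1: "w1 \<in> ball z \<delta>" "w1 \<notin> A" by blast
    have "closed (cball z (dist z w1) - A)" using \<open>open A\<close> by (intro closed_Diff) auto
    moreover have "cball z (dist z w1) - A \<noteq> {}" using w1 by auto
    ultimately obtain w0 where w0: "w0 \<in> cball z (dist z w1) - A"
      "\<And>y. y \<in> cball z (dist z w1) - A \<Longrightarrow> dist z w0 \<le> dist z y"
      by (rule distance_attains_inf[where a = z]) (rule that)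
    define \<rho> where "\<rho> = dist z w0"
    have \<rho>\<delta>: "\<rho> < \<delta>" using w0(1) w1(1) by (auto simp: \<rho>_def)
    have sub: "ball z \<rho> \<subseteq> A"
    proof
      fix y assume y: "y \<in> ball z \<rho>"
      show "y \<in> A"
      proof (rule ccontr)
        assume "y \<notin> A"
        then have "y \<in> cball z (dist z w1) - A" using y w0(1) by (auto simp: \<rho>_def)
        then show False using w0(2)[of y] y by (simp add: \<rho>_def)
      qed
    qed
    have "z \<in> A" using z \<delta> by (auto simp: A_def)
    then have "w0 \<noteq> z" using w0(1) by auto
    then have \<rho>: "\<rho> > 0" by (simp add: \<rho>_def)
    have small: "norm (\<phi> w) \<le> 3/2" if w: "w \<in> ball z \<rho>" for w
    proof -
      have "norm (\<phi> w - \<phi> z) \<le> 4 * K * norm (w - z)"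
      proof (rule field_differentiable_bound[of "ball z \<rho>" \<phi> "deriv \<phi>" "4 * K"])
        fix y assume y: "y \<in> ball z \<rho>"
        then have yA: "y \<in> ball z \<delta>" "\<not> is_pole \<phi> y" "norm (\<phi> y) < 2" using sub by (auto simp: A_def)
        have "(\<phi> has_field_derivative deriv \<phi> y) (at y)"
          using an[OF yA(1,2)] analytic_on_imp_differentiable_at DERIV_deriv_iff_field_differentiable by blast
        then show "(\<phi> has_field_derivative deriv \<phi> y) (at y within ball z \<rho>)" by (rule has_field_derivative_at_within)
        have "(norm (\<phi> y))\<^sup>2 \<le> 2\<^sup>2" using yA(3) by (intro power_mono) auto
        then have "K * max 1 ((norm (\<phi> y))\<^sup>2) \<le> K * 4" using K by (intro mult_left_mono) auto
        then show "norm (deriv \<phi> y) \<le> 4 * K" using bd[of y] yA \<delta> by auto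
      qed (use w \<rho> in auto)
      also have "\<dots> \<le> 4 * K * \<delta>" using w \<rho>\<delta> K by (intro mult_left_mono) (auto simp: dist_norm norm_minus_commute)
      also have "\<dots> \<le> 1/2" using \<delta>(3) by simp
      finally have "norm (\<phi> w - \<phi> z) \<le> 1/2" .
      then show ?thesis using z(2) norm_triangle_sub[of "\<phi> w" "\<phi> z"] by linarith
    qed
    have ev: "eventually (\<lambda>w. norm (\<phi> w) > 3/2) (at w0)"
    proof (cases "is_pole \<phi> w0")
      case True
      then have "filterlim (\<lambda>w. norm (\<phi> w)) at_top (at w0)"
        by (simp add: is_pole_def filterlim_at_infinity_conv_norm_at_top)
      then show ?thesis unfolding filterlim_at_top_dense by blast
    next
      case False
      have w0b: "w0 \<in> ball z \<delta>" using \<rho>\<delta> by (simp add: \<rho>_def)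
      then have ge: "norm (\<phi> w0) \<ge> 2" using False w0(1) by (auto simp: A_def)
      have "isCont \<phi> w0" using an[OF w0b False] by (rule analytic_at_imp_isCont)
      then have "((\<lambda>w. norm (\<phi> w)) \<longlongrightarrow> norm (\<phi> w0)) (at w0)" by (intro tendsto_norm) (simp add: isCont_def)
      then show ?thesis using ge by (intro order_tendstoD(1)) auto
    qed
    have fr: "frequently (\<lambda>w. w \<in> ball z \<rho>) (at w0)"
    proof -
      have "w0 \<in> closure (ball z \<rho>)" using \<rho> by (simp add: \<rho>_def)
      moreover have "w0 \<notin> ball z \<rho>" by (simp add: \<rho>_def)
      ultimately have "w0 islimpt ball z \<rho>" by (simp add: closure_def)
      then show ?thesis by (simp add: islimpt_conv_frequently_at)
    qed
    obtain w where "w \<in> ball z \<rho>" "norm (\<phi> w) > 3/2"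
      using frequently_ex[OF frequently_eventually_conj[OF fr ev]] by blast
    then show False using small[of w] by simp
  qed
  then have np: "\<not> is_pole \<phi> w" "norm (\<phi> w) \<le> 2" if "w \<in> ball z \<delta>" for w
    using that by (auto simp: A_def)
  have "\<phi> analytic_on ball z \<delta>" using an np(1) analytic_on_analytic_at by blast
  then show ?thesis using np(2) by (auto simp: tame_def analytic_imp_holomorphic)
qed

text \<open>The second clause is needed because inverse 0 = 0: for f = 0 the function 1/f is 0 as
  well and would look like the coordinate of the constant infinity.\<close>

definition tame_inv :: "real \<Rightarrow> (complex \<Rightarrow> complex) \<Rightarrow> complex \<Rightarrow> bool" where
  "tame_inv r f z \<longleftrightarrow> tame r (\<lambda>w. inverse (f w)) z \<and> (\<forall>w\<in>ball z r. f w = 0 \<longrightarrow> is_pole f w)"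

lemma tame_inv_or_zero:
  assumes mero: "f nicely_meromorphic_on ball z r" and tm: "tame r (\<lambda>w. inverse (f w)) z"
  shows "tame_inv r f z \<or> tame r f z"
proof -
  consider "\<forall>w\<in>ball z r. f w = 0" | "\<forall>\<^sub>\<approx>w\<in>ball z r. f w \<noteq> 0"
    using nicely_meromorphic_imp_constant_or_avoid[OF mero open_ball connected_ball, of 0] by blast
  then show ?thesis
  proof cases
    case 1
    have "f holomorphic_on ball z r" by (rule holomorphic_transform[of "\<lambda>_. 0"]) (use 1 in auto)
    then show ?thesis using 1 by (auto simp: tame_def)
  next
    case 2
    have "is_pole f w" if w: "w \<in> ball z r" "f w = 0" for w
    proof -
      have "eventually (\<lambda>x. f x \<noteq> 0) (at w)" using 2 w by (simp add: eventually_cosparse_open_eq)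
      then have "isolated_zero f w \<or> is_pole f w" using zero_or_pole[OF mero w] by simp
      moreover have "\<not> is_pole (\<lambda>w. inverse (f w)) w"
        using not_is_pole_holomorphic[OF open_ball w(1)] tm by (simp add: tame_def)
      ultimately show ?thesis by (simp add: is_pole_inverse_iff)
    qed
    then show ?thesis using tm by (simp add: tame_inv_def)
  qed
qed

text \<open>
  A substitute for the spherical derivative that is adapted to the rescaling
  \<open>g w = \<rho>^(-\<alpha>) f (z + \<rho> w)\<close>: the density of \<open>g\<close> is \<open>\<rho>\<close> times the density of \<open>f\<close>. For \<open>\<alpha> = 0\<close> it is
  comparable with the spherical derivative.
\<close>

definition density :: "real \<Rightarrow> (complex \<Rightarrow> complex) \<Rightarrow> complex \<Rightarrow> real" where
  "density \<alpha> f z =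
     (let A = norm (deriv f z) powr (1 / (1 - \<alpha>)); B = norm (deriv (\<lambda>w. inverse (f w)) z) powr (1 / (1 + \<alpha>))
      in if is_pole f z then B else if f z = 0 then A else min A B)"

lemma deriv_inverse_analytic:
  assumes "f analytic_on {z}" "f z \<noteq> 0"
  shows "deriv (\<lambda>w. inverse (f w)) z = - deriv f z / (f z)\<^sup>2"
proof (rule DERIV_imp_deriv)
  have "(f has_field_derivative deriv f z) (at z)"
    using assms(1) analytic_on_imp_differentiable_at DERIV_deriv_iff_field_differentiable by blast
  then show "((\<lambda>w. inverse (f w)) has_field_derivative - deriv f z / (f z)\<^sup>2) (at z)"
    using assms(2) by (auto intro!: derivative_eq_intros simp: power2_eq_square field_simps)
qed

lemma powr_le_imp_le:
  fixes x a K :: real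
  assumes "x powr (1 / a) \<le> K" "a > 0" "x \<ge> 0"
  shows "x \<le> K powr a"
proof -
  have "(x powr (1 / a)) powr a \<le> K powr a" using assms powr_mono2[of a "x powr (1 / a)" K] by simp
  then show ?thesis using assms by (simp add: powr_powr)
qed

text \<open>A bound for the minimum controls only one of the two derivatives, but as |(1/f)'| = |f'|
  / |f|^2, either alternative yields |f'| <= K1 max 1 |f|^2 and the same inequality for 1/f. The
  previous estimate is applied to whichever of f, 1/f has modulus at most 1 at z.\<close>

lemma tame_of_density_bound:
  assumes \<alpha>: "0 \<le> \<alpha>" "\<alpha> < 1" and mero: "f nicely_meromorphic_on ball z r"
    and K: "\<And>w. w \<in> ball z r \<Longrightarrow> density \<alpha> f w \<le> K"
    and K1: "K1 \<ge> K powr (1 - \<alpha>)" "K1 \<ge> K powr (1 + \<alpha>)" and \<delta>: "0 < \<delta>" "\<delta> \<le> r" "8 * K1 * \<delta> \<le> 1"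
  shows "tame \<delta> f z \<or> tame_inv \<delta> f z"
proof -
  define \<phi> where "\<phi> = (\<lambda>w. inverse (f w))"
  have K10: "K1 \<ge> 0" using K1(1) powr_ge_zero order_trans by blast
  have mero': "\<phi> nicely_meromorphic_on ball z r"
    unfolding \<phi>_def by (rule nicely_meromorphic_on_inverse[OF mero])
  have an: "f analytic_on {w}" if "w \<in> ball z r" "\<not> is_pole f w" for w
    by (rule nicely_meromorphic_on_imp_analytic_at[OF mero that])
  have A: "norm (deriv f w) \<le> K1" if "norm (deriv f w) powr (1 / (1 - \<alpha>)) \<le> K" for w
    using powr_le_imp_le[OF that] \<alpha> K1 by auto
  have B: "norm (deriv \<phi> w) \<le> K1" if "norm (deriv \<phi> w) powr (1 / (1 + \<alpha>)) \<le> K" for w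
    using powr_le_imp_le[OF that] \<alpha> K1 by auto
  have AB: "norm (deriv f w) \<le> K1 \<or> norm (deriv \<phi> w) \<le> K1" "norm (deriv \<phi> w) = norm (deriv f w) / (norm (f w))\<^sup>2"
    if "w \<in> ball z r" "\<not> is_pole f w" "f w \<noteq> 0" for w
  proof -
    show "norm (deriv f w) \<le> K1 \<or> norm (deriv \<phi> w) \<le> K1"
      using K[OF that(1)] that A[of w] B[of w] by (auto simp: density_def \<phi>_def Let_def min_le_iff_disj)
    show "norm (deriv \<phi> w) = norm (deriv f w) / (norm (f w))\<^sup>2"
      unfolding \<phi>_def using deriv_inverse_analytic[OF an[OF that(1,2)] that(3)] by (simp add: norm_divide norm_power)
  qed
  have bd1: "norm (deriv f w) \<le> K1 * max 1 ((norm (f w))\<^sup>2)" if w: "w \<in> ball z r" "\<not> is_pole f w" for w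
  proof (cases "f w = 0")
    case True
    then show ?thesis using K[OF w(1)] w(2) A[of w] K10 by (simp add: density_def Let_def)
  next
    case False
    have "norm (deriv f w) \<le> K1 \<or> norm (deriv f w) \<le> K1 * (norm (f w))\<^sup>2"
      using AB[OF w False] False by (auto simp: divide_le_eq)
    moreover have "K1 * 1 \<le> K1 * max 1 ((norm (f w))\<^sup>2)" "K1 * (norm (f w))\<^sup>2 \<le> K1 * max 1 ((norm (f w))\<^sup>2)"
      using K10 by (intro mult_left_mono; simp)+
    ultimately show ?thesis by linarith
  qed
  have bd2: "norm (deriv \<phi> w) \<le> K1 * max 1 ((norm (\<phi> w))\<^sup>2)" if w: "w \<in> ball z r" "\<not> is_pole \<phi> w" for w
  proof -
    have m: "K1 * 1 \<le> K1 * max 1 ((norm (\<phi> w))\<^sup>2)" "K1 * (norm (\<phi> w))\<^sup>2 \<le> K1 * max 1 ((norm (\<phi> w))\<^sup>2)"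
      using K10 by (intro mult_left_mono; simp)+
    consider "is_pole f w" | "\<not> is_pole f w" "f w \<noteq> 0" | "\<not> is_pole f w" "f w = 0" by blast
    then show ?thesis
    proof cases
      case 1
      then have "norm (deriv \<phi> w) \<le> K1" using K[OF w(1)] B[of w] by (simp add: density_def \<phi>_def Let_def)
      then show ?thesis using m by linarith
    next
      case 2
      have "norm (deriv f w) \<le> K1 \<Longrightarrow> norm (deriv \<phi> w) \<le> K1 * (norm (\<phi> w))\<^sup>2"
        unfolding AB(2)[OF w(1) 2] by (simp add: \<phi>_def norm_inverse divide_inverse power_inverse mult_right_mono)
      then show ?thesis using AB(1)[OF w(1) 2] m by linarith
    next
      case 3
      \<comment> \<open>An isolated zero of f would be a pole of 1/f. So the zeros accumulate, f
        vanishes identically, and so does 1/f by the convention for division by 0.\<close>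
      have "frequently (\<lambda>x. f x = 0) (at w)"
      proof (rule ccontr)
        assume "\<not> ?thesis"
        then have "eventually (\<lambda>x. f x \<noteq> 0) (at w)" by (simp add: frequently_def)
        then have "isolated_zero f w" using zero_or_pole[OF mero w(1) 3(2)] 3(1) by simp
        then show False using w(2) by (simp add: \<phi>_def is_pole_inverse_iff)
      qed
      then have "f x = 0" if "x \<in> ball z r" for x
        using frequently_eq_meromorphic_imp_constant[OF _ mero open_ball connected_ball w(1)] that by blast
      then have "deriv \<phi> w = deriv (\<lambda>_. 0) w"
        by (intro deriv_cong_ev) (use w(1) in \<open>auto simp: \<phi>_def eventually_nhds intro!: exI[of _ "ball z r"]\<close>)
      then show ?thesis using K10 by simp
    qed
  qed
  have zb: "z \<in> ball z r" using \<delta> by simp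
  show ?thesis
  proof (cases "\<not> is_pole f z \<and> norm (f z) \<le> 1")
    case True
    then have "tame \<delta> f z" using tame_of_deriv_bound[OF mero \<delta> K10 _ _ bd1] by blast
    then show ?thesis ..
  next
    case False
    have "\<not> is_pole \<phi> z \<and> norm (\<phi> z) \<le> 1"
    proof (cases "is_pole f z")
      case True
      then have "f z = 0" using is_pole_zero_at_nicely_mero[OF mero _ zb] by simp
      moreover have "\<not> isolated_zero f z"
      proof
        assume "isolated_zero f z"
        then have "f \<midarrow>z\<rightarrow> 0" by (simp add: isolated_zero_def)
        then show False using True not_tendsto_and_filterlim_at_infinity[of "at z" f 0] by (auto simp: is_pole_def)
      qed
      ultimately show ?thesis by (simp add: \<phi>_def is_pole_inverse_iff)
    next
      case np: False
      then have n1: "norm (f z) > 1" using False by simp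
      then have "f z \<noteq> 0" by auto
      moreover have "\<not> isolated_zero f z"
      proof
        assume "isolated_zero f z"
        then have "f \<midarrow>z\<rightarrow> 0" by (simp add: isolated_zero_def)
        moreover have "f \<midarrow>z\<rightarrow> f z" using analytic_at_imp_isCont[OF an[OF zb np]] by (simp add: isCont_def)
        ultimately show False using LIM_unique \<open>f z \<noteq> 0\<close> by blast
      qed
      ultimately show ?thesis using n1 by (simp add: \<phi>_def is_pole_inverse_iff norm_inverse inverse_le_1_iff)
    qed
    then have "tame \<delta> \<phi> z" using tame_of_deriv_bound[OF mero' \<delta> K10 _ _ bd2] by blast
    moreover have "f nicely_meromorphic_on ball z \<delta>" using mero by (rule nicely_meromorphic_on_subset) (use \<delta> in auto)
    ultimately show ?thesis using tame_inv_or_zero unfolding \<phi>_def by blast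
  qed
qed

section \<open>Limits in the spherical metric\<close>

lemma inner_inv_stereographic:
  "inv_stereographic (Some a) \<bullet> inv_stereographic (Some b) =
     1 - 2 * (norm (a - b))\<^sup>2 / ((1 + (norm a)\<^sup>2) * (1 + (norm b)\<^sup>2))"
proof -
  define A B where "A = 1 + (norm a)\<^sup>2" and "B = 1 + (norm b)\<^sup>2"
  have AB: "A > 0" "B > 0" by (auto simp: A_def B_def add_pos_nonneg)
  have "inv_stereographic (Some a) \<bullet> inv_stereographic (Some b) =
      (2 * a / of_real A) \<bullet> (2 * b / of_real B) + (A - 2) / A * ((B - 2) / B)"
    by (simp add: A_def B_def)
  also have "(2 * a / of_real A) \<bullet> (2 * b / of_real B) = 4 * (a \<bullet> b) / (A * B)"
    using AB by (simp add: inner_complex_def add_divide_distrib[symmetric])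
  also have "4 * (a \<bullet> b) / (A * B) + (A - 2) / A * ((B - 2) / B) = 1 - 2 * (A + B - 2 - 2 * (a \<bullet> b)) / (A * B)"
    using AB by (simp add: field_simps)
  also have "A + B - 2 - 2 * (a \<bullet> b) = (norm (a - b))\<^sup>2"
    unfolding A_def B_def cmod_power2 inner_complex_def by (simp add: power2_eq_square algebra_simps)
  finally show ?thesis by (simp add: A_def B_def)
qed

lemma norm_diff_inv_stereographic:
  "(norm (inv_stereographic p - inv_stereographic q))\<^sup>2 = 2 - 2 * (inv_stereographic p \<bullet> inv_stereographic q)"
proof -
  have 1: "inv_stereographic p \<bullet> inv_stereographic p = 1" for p
    using norm_inv_stereographic norm_eq_1 by blast
  show ?thesis by (simp add: power2_norm_eq_inner inner_diff_left inner_diff_right 1 inner_commute[of "inv_stereographic q" "inv_stereographic p"] del: inv_stereographic.simps)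
qed

lemma inv_stereographic_lipschitz:
  "norm (inv_stereographic (Some a) - inv_stereographic (Some b)) \<le> 2 * norm (a - b)"
proof (rule power2_le_imp_le)
  define C where "C = (1 + (norm a)\<^sup>2) * (1 + (norm b)\<^sup>2)"
  have "1 * 1 \<le> C" unfolding C_def by (intro mult_mono) auto
  then have "4 * (norm (a - b))\<^sup>2 / C \<le> 4 * (norm (a - b))\<^sup>2 / 1" by (intro divide_left_mono) auto
  then show "(norm (inv_stereographic (Some a) - inv_stereographic (Some b)))\<^sup>2 \<le> (2 * norm (a - b))\<^sup>2"
    unfolding norm_diff_inv_stereographic inner_inv_stereographic C_def[symmetric] by (simp add: power_mult_distrib)
qed auto

text \<open>
  The isometry of the sphere that corresponds to \<open>z \<mapsto> 1/z\<close>.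
\<close>

definition antipode :: "complex \<times> real \<Rightarrow> complex \<times> real" where "antipode p = (cnj (fst p), - snd p)"

lemma norm_antipode_diff: "norm (antipode p - antipode q) = norm (p - q)"
proof -
  have "antipode p - antipode q = (cnj (fst p - fst q), - (snd p - snd q))" by (simp add: antipode_def)
  then have "norm (antipode p - antipode q) = sqrt ((norm (fst p - fst q))\<^sup>2 + (norm (snd p - snd q))\<^sup>2)"
    unfolding norm_Pair by (simp only: complex_mod_cnj norm_Pair norm_minus_cancel)
  then show ?thesis by (simp add: norm_prod_def)
qed

text \<open>The value of f on the sphere, read off from the coordinate w = 1/f.\<close>

definition inv_sphere :: "complex \<Rightarrow> riemann_sphere" where
  "inv_sphere w = (if w = 0 then None else Some (inverse w))"

lemma inv_stereographic_inv_sphere: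
  "inv_stereographic (inv_sphere w) = antipode (inv_stereographic (Some w))"
proof (cases "w = 0")
  case False
  define s where "s = (norm w)\<^sup>2"
  have s: "s > 0" using False by (simp add: s_def)
  have ws: "w * cnj w = of_real s" by (simp only: s_def complex_norm_square)
  have i: "inverse w = cnj w / of_real s"
    using False s by (simp add: nonzero_eq_divide_eq ws[symmetric])
  have "(norm (inverse w))\<^sup>2 = 1 / s" by (simp add: s_def norm_inverse power_inverse divide_inverse)
  moreover have "2 * inverse w / of_real (1 + 1 / s) = cnj (2 * w / of_real (1 + s))"
  proof -
    have "2 * inverse w / of_real (1 + 1 / s) = 2 * cnj w / (of_real s * of_real (1 + 1 / s))" by (simp add: i)
    also have "of_real s * of_real (1 + 1 / s) = (of_real (1 + s) :: complex)"
      unfolding of_real_mult[symmetric] using s by (simp add: distrib_left)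
    finally show ?thesis by simp
  qed
  moreover have "(1 / s - 1) / (1 + 1 / s) = - ((s - 1) / (1 + s))"
  proof -
    have "1 / s - 1 = (1 - s) / s" "1 + 1 / s = (1 + s) / s" using s by (simp_all add: field_simps)
    then have "(1 / s - 1) / (1 + 1 / s) = (1 - s) / (1 + s)" using s by simp
    then show ?thesis by (simp add: minus_divide_left)
  qed
  ultimately show ?thesis using False by (simp add: inv_sphere_def antipode_def s_def)
qed (simp add: inv_sphere_def antipode_def)

lemma inj_inv_stereographic: "inv_stereographic p = inv_stereographic q \<Longrightarrow> p = q"
proof -
  have *: "a = b" if "inv_stereographic (Some a) = inv_stereographic (Some b)" for a b
  proof -
    have "inv_stereographic (Some a) \<bullet> inv_stereographic (Some b) = 1"
      unfolding that using norm_inv_stereographic norm_eq_1 by blast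
    moreover have "(1 + (norm a)\<^sup>2) * (1 + (norm b)\<^sup>2) > 0" by (intro mult_pos_pos add_pos_nonneg) auto
    ultimately show "a = b" unfolding inner_inv_stereographic by auto
  qed
  have **: "inv_stereographic (Some a) \<noteq> inv_stereographic None" for a
  proof
    assume "inv_stereographic (Some a) = inv_stereographic None"
    then have "((norm a)\<^sup>2 - 1) / (1 + (norm a)\<^sup>2) = 1" by simp
    moreover have "1 + (norm a)\<^sup>2 > 0" by (intro add_pos_nonneg) auto
    ultimately show False by simp
  qed
  assume "inv_stereographic p = inv_stereographic q"
  then show "p = q" using * ** by (cases p; cases q) metis+
qed

text \<open>The chord belonging to the angle t has length sqrt (2 - 2 cos t). Closeness may hence be
  checked for the Euclidean distance of the stereographic images, which is Lipschitz in each
  chart.\<close>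

lemma spherical_dist_less:
  assumes "e > 0"
  obtains d where "d > 0" "\<And>p q. norm (inv_stereographic p - inv_stereographic q) < d \<Longrightarrow> spherical_dist p q < e"
proof -
  \<comment> \<open>The cap at 1 keeps the angle within [0, pi], where cos is invertible.\<close>
  define e' where "e' = min e 1"
  have e': "0 < e'" "e' \<le> e" "e' < pi" using assms pi_gt3 by (auto simp: e'_def)
  have c1: "cos e' < 1" using cos_monotone_0_pi[of 0 e'] e' by simp
  define d where "d = sqrt (2 * (1 - cos e'))"
  have d: "d > 0" using c1 by (simp add: d_def)
  have "spherical_dist p q < e" if "norm (inv_stereographic p - inv_stereographic q) < d" for p q
  proof -
    define x where "x = inv_stereographic p \<bullet> inv_stereographic q"
    have "(norm (inv_stereographic p - inv_stereographic q))\<^sup>2 < d\<^sup>2" using that by (intro power_strict_mono) auto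
    also have "d\<^sup>2 = 2 * (1 - cos e')" using c1 by (simp add: d_def)
    finally have x: "cos e' < x" unfolding norm_diff_inv_stereographic x_def by simp
    have "x \<le> 1" unfolding x_def
      using norm_cauchy_schwarz[of "inv_stereographic p" "inv_stereographic q"] by simp
    then have "arccos x < arccos (cos e')" using x by (intro arccos_less_arccos) auto
    then show ?thesis using e' by (simp add: spherical_dist_def x_def arccos_cos)
  qed
  then show ?thesis using that d by blast
qed

lemma sphere_map_tame: "tame r f c \<Longrightarrow> w \<in> ball c r \<Longrightarrow> sphere_map f w = Some (f w)"
  using not_is_pole_holomorphic[of "ball c r" w f] by (simp add: tame_def sphere_map_def)

lemma sphere_map_tame_inv:
  assumes "tame_inv r f c" "w \<in> ball c r" "is_pole f w \<Longrightarrow> f w = 0"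
  shows "sphere_map f w = inv_sphere (inverse (f w))"
  using assms by (auto simp: tame_inv_def sphere_map_def inv_sphere_def)

section \<open>Convergence in charts and diagonal extraction\<close>

definition chart_limit :: "real \<Rightarrow> complex \<Rightarrow> (nat \<Rightarrow> complex \<Rightarrow> complex) \<Rightarrow> (complex \<Rightarrow> complex) \<Rightarrow> bool" where
  "chart_limit r c F H \<longleftrightarrow> H holomorphic_on ball c r \<and> (\<forall>w\<in>ball c r. norm (H w) \<le> 2) \<and>
     (\<forall>K. compact K \<longrightarrow> K \<subseteq> ball c r \<longrightarrow> uniform_limit K F H sequentially)"

lemma chart_limit_tendsto:
  assumes "chart_limit r c F H" "w \<in> ball c r"
  shows "(\<lambda>v. F v w) \<longlonglongrightarrow> H w"
proof (rule tendsto_uniform_limitI[where f = F and l = H and x = w])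
  have *: "\<And>K. compact K \<Longrightarrow> K \<subseteq> ball c r \<Longrightarrow> uniform_limit K F H sequentially"
    using assms(1) unfolding chart_limit_def by blast
  show "uniform_limit {w} F H sequentially" by (rule *) (use assms(2) in auto)
qed simp

lemma chart_limit_exists:
  assumes "\<And>v. tame r (F v) c"
  obtains k H where "strict_mono (k :: nat \<Rightarrow> nat)" "chart_limit r c (F \<circ> k) H"
proof -
  define \<H> where "\<H> = {h. tame r h c}"
  obtain H k where H: "H holomorphic_on ball c r" "strict_mono (k :: nat \<Rightarrow> nat)"
    "\<And>x. x \<in> ball c r \<Longrightarrow> (\<lambda>n. F (k n) x) \<longlonglongrightarrow> H x"
    "\<And>K. \<lbrakk>compact K; K \<subseteq> ball c r\<rbrakk> \<Longrightarrow> uniform_limit K (F \<circ> k) H sequentially"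
  proof (rule Montel[of "ball c r" \<H> F])
    show "h holomorphic_on ball c r" if "h \<in> \<H>" for h using that by (simp add: \<H>_def tame_def)
    show "\<exists>B. \<forall>h\<in>\<H>. \<forall>z\<in>K. norm (h z) \<le> B" if "compact K" "K \<subseteq> ball c r" for K
      by (rule exI[of _ 2]) (use that in \<open>auto simp: \<H>_def tame_def\<close>)
    show "range F \<subseteq> \<H>" using assms by (auto simp: \<H>_def)
  qed auto
  have "norm (H w) \<le> 2" if w: "w \<in> ball c r" for w
  proof (rule tendsto_upperbound[OF tendsto_norm[OF H(3)[OF w]]])
    show "eventually (\<lambda>n. norm (F (k n) w) \<le> 2) sequentially"
      using assms w by (intro always_eventually) (auto simp: tame_def)
  qed auto
  then have "chart_limit r c (F \<circ> k) H" using H(1,4) by (auto simp: chart_limit_def)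
  then show ?thesis by (rule that[OF H(2)])
qed

text \<open>The hypothesis on \<open>F'\<close> describes how a diagonal sequence relates to each
  sequence it was drawn from: from some index on, its members occur there no earlier.\<close>

lemma uniform_limit_refine:
  assumes "uniform_limit K F H sequentially" and k: "\<And>j. j \<ge> J \<Longrightarrow> \<exists>j'\<ge>j. F' j = F j'"
  shows "uniform_limit K F' H sequentially"
proof (rule uniform_limitI)
  fix e :: real assume "e > 0"
  then obtain M where M: "\<And>n. n \<ge> M \<Longrightarrow> \<forall>x\<in>K. dist (F n x) (H x) < e"
    using uniform_limitD[OF assms(1)] unfolding eventually_sequentially by blast
  show "\<forall>\<^sub>F n in sequentially. \<forall>x\<in>K. dist (F' n x) (H x) < e"
    unfolding eventually_sequentially
  proof (intro exI allI impI)
    fix n assume "max J M \<le> n"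
    then have "J \<le> n" by simp
    then obtain j' where "j' \<ge> n" "F' n = F j'" using k by blast
    then show "\<forall>x\<in>K. dist (F' n x) (H x) < e" using M[of j'] \<open>max J M \<le> n\<close> by simp
  qed
qed

lemma chart_limit_refine:
  assumes "chart_limit r c F H" "\<And>j. j \<ge> J \<Longrightarrow> \<exists>j'\<ge>j. F' j = F j'"
  shows "chart_limit r c F' H"
  using assms(1) uniform_limit_refine[OF _ assms(2)] unfolding chart_limit_def by blast

lemma eventually_refine:
  assumes "eventually (\<lambda>v. Q (F v)) sequentially" and k: "\<And>j. j \<ge> J \<Longrightarrow> \<exists>j'\<ge>j. F' j = F j'"
  shows "eventually (\<lambda>v. Q (F' v)) sequentially"
proof -
  obtain M where M: "\<And>n. n \<ge> M \<Longrightarrow> Q (F n)" using assms(1) unfolding eventually_sequentially by blast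
  have "Q (F' n)" if "n \<ge> max J M" for n
  proof -
    have "J \<le> n" using that by simp
    then obtain j' where "j' \<ge> n" "F' n = F j'" using k by blast
    then show ?thesis using M[of j'] that by simp
  qed
  then show ?thesis unfolding eventually_sequentially by blast
qed

definition conv_chart :: "real \<Rightarrow> complex \<Rightarrow> (nat \<Rightarrow> complex \<Rightarrow> complex) \<Rightarrow> bool" where
  "conv_chart r c F \<longleftrightarrow>
     (eventually (\<lambda>v. tame r (F v) c) sequentially \<and> (\<exists>H. chart_limit r c F H)) \<or>
     (eventually (\<lambda>v. tame_inv r (F v) c) sequentially \<and> (\<exists>H. chart_limit r c (\<lambda>v w. inverse (F v w)) H))"

lemma conv_chart_refine:
  assumes F: "conv_chart r c F" and k: "\<And>j. j \<ge> J \<Longrightarrow> \<exists>j'\<ge>j. F' j = F j'"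
  shows "conv_chart r c F'"
proof -
  have k': "\<exists>j'\<ge>j. (\<lambda>w. inverse (F' j w)) = (\<lambda>w. inverse (F j' w))" if "j \<ge> J" for j
    using k[OF that] by metis
  from F show ?thesis unfolding conv_chart_def
  proof (elim disjE conjE exE)
    fix H assume H: "eventually (\<lambda>v. tame r (F v) c) sequentially" "chart_limit r c F H"
    show "(eventually (\<lambda>v. tame r (F' v) c) sequentially \<and> (\<exists>H. chart_limit r c F' H)) \<or>
     (eventually (\<lambda>v. tame_inv r (F' v) c) sequentially \<and> (\<exists>H. chart_limit r c (\<lambda>v w. inverse (F' v w)) H))"
      by (intro disjI1 conjI exI[of _ H] chart_limit_refine[OF H(2) k] eventually_refine[of "\<lambda>f. tame r f c", OF H(1) k])
  next
    fix H assume H: "eventually (\<lambda>v. tame_inv r (F v) c) sequentially" "chart_limit r c (\<lambda>v w. inverse (F v w)) H"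
    show "(eventually (\<lambda>v. tame r (F' v) c) sequentially \<and> (\<exists>H. chart_limit r c F' H)) \<or>
     (eventually (\<lambda>v. tame_inv r (F' v) c) sequentially \<and> (\<exists>H. chart_limit r c (\<lambda>v w. inverse (F' v w)) H))"
      by (intro disjI2 conjI exI[of _ H] chart_limit_refine[OF H(2) k'] eventually_refine[of "\<lambda>f. tame_inv r f c", OF H(1) k])
  qed
qed

lemma infinite_subseq:
  assumes "infinite {v. Q (v :: nat)}"
  obtains k where "strict_mono (k :: nat \<Rightarrow> nat)" "\<And>v. Q (k v)"
  using infinite_enumerate[OF assms] that by blast

lemma conv_chart_exists:
  assumes "eventually (\<lambda>v. tame r (F v) c \<or> tame_inv r (F v) c) sequentially"
  obtains k where "strict_mono (k :: nat \<Rightarrow> nat)" "conv_chart r c (F \<circ> k)"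
proof -
  have "infinite {v. tame r (F v) c \<or> tame_inv r (F v) c}"
  proof -
    obtain M where "\<And>v. v \<ge> M \<Longrightarrow> tame r (F v) c \<or> tame_inv r (F v) c"
      using assms unfolding eventually_sequentially by blast
    then have "{M..} \<subseteq> {v. tame r (F v) c \<or> tame_inv r (F v) c}" by auto
    then show ?thesis using infinite_Ici finite_subset by blast
  qed
  then have "infinite ({v. tame r (F v) c} \<union> {v. tame_inv r (F v) c})" by (simp add: Collect_disj_eq)
  then consider "infinite {v. tame r (F v) c}" | "infinite {v. tame_inv r (F v) c}" by auto
  then show ?thesis
  proof cases
    case 1
    obtain k where k: "strict_mono (k :: nat \<Rightarrow> nat)" "\<And>v. tame r (F (k v)) c" using infinite_subseq[OF 1] by metis
    obtain l H where l: "strict_mono (l :: nat \<Rightarrow> nat)" "chart_limit r c ((\<lambda>v. F (k v)) \<circ> l) H"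
      using chart_limit_exists[of r "\<lambda>v. F (k v)" c] k(2) by metis
    have "conv_chart r c (F \<circ> (k \<circ> l))" using k l unfolding conv_chart_def by (auto simp: o_def)
    then show ?thesis using that strict_mono_o[OF k(1) l(1)] by blast
  next
    case 2
    obtain k where k: "strict_mono (k :: nat \<Rightarrow> nat)" "\<And>v. tame_inv r (F (k v)) c" using infinite_subseq[OF 2] by metis
    have t: "tame r (\<lambda>w. inverse (F (k v) w)) c" for v using k(2)[of v] by (simp add: tame_inv_def)
    obtain l H where l: "strict_mono (l :: nat \<Rightarrow> nat)" "chart_limit r c ((\<lambda>v w. inverse (F (k v) w)) \<circ> l) H"
      using chart_limit_exists[of r "\<lambda>v w. inverse (F (k v) w)" c] t by metis
    have "conv_chart r c (F \<circ> (k \<circ> l))" using k l unfolding conv_chart_def by (auto simp: o_def)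
    then show ?thesis using that strict_mono_o[OF k(1) l(1)] by blast
  qed
qed

theorem conv_chart_diagonal:
  fixes f :: "nat \<Rightarrow> complex \<Rightarrow> complex" and \<sigma> :: "nat \<Rightarrow> complex"
  assumes "\<And>i. eventually (\<lambda>v. tame (\<delta> i) (f v) (\<sigma> i) \<or> tame_inv (\<delta> i) (f v) (\<sigma> i)) sequentially"
  obtains k where "strict_mono (k :: nat \<Rightarrow> nat)" "\<And>i. conv_chart (\<delta> i) (\<sigma> i) (f \<circ> k)"
proof -
  \<comment> \<open>The diagonalization lemma quantifies over all index sequences r, also bounded
    ones, along which no convergence can be expected. The first alternative accounts for them; it is
    refuted at the end for the strictly increasing k.\<close>
  define Q where "Q = (\<lambda>i (r :: nat \<Rightarrow> nat). (\<exists>M. eventually (\<lambda>j. r j \<le> M) sequentially) \<or> conv_chart (\<delta> i) (\<sigma> i) (f \<circ> r))"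
  obtain k where k: "strict_mono (k :: nat \<Rightarrow> nat)" "\<And>i. Q i (id \<circ> k)"
  proof (rule subsequence_diagonalization_lemma[of Q id])
    fix i and r :: "nat \<Rightarrow> nat"
    show "\<exists>k. strict_mono (k :: nat \<Rightarrow> nat) \<and> Q i (r \<circ> k)"
    proof (cases "\<exists>M. infinite {j. r j \<le> M}")
      case True
      then obtain M where "infinite {j. r j \<le> M}" by blast
      then obtain k where k: "strict_mono (k :: nat \<Rightarrow> nat)" "\<And>j. r (k j) \<le> M" by (rule infinite_subseq) (rule that)
      have "eventually (\<lambda>j. (r \<circ> k) j \<le> M) sequentially" using k(2) by (intro always_eventually) simp
      then have "Q i (r \<circ> k)" unfolding Q_def by blast
      then show ?thesis using k(1) by blast
    next
      case False
      have "filterlim r sequentially sequentially"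
        unfolding filterlim_at_top
      proof
        fix Z
        have "finite {j. r j \<le> Z}" using False by blast
        then have "eventually (\<lambda>j. j \<notin> {j. r j \<le> Z}) sequentially"
          unfolding cofinite_eq_sequentially[symmetric] by (simp add: eventually_cofinite)
        then show "eventually (\<lambda>j. Z \<le> r j) sequentially" by eventually_elim auto
      qed
      then have "eventually (\<lambda>j. tame (\<delta> i) ((f \<circ> r) j) (\<sigma> i) \<or> tame_inv (\<delta> i) ((f \<circ> r) j) (\<sigma> i)) sequentially"
        using eventually_compose_filterlim[OF assms[of i]] by simp
      then obtain k where "strict_mono (k :: nat \<Rightarrow> nat)" "conv_chart (\<delta> i) (\<sigma> i) ((f \<circ> r) \<circ> k)"
        by (rule conv_chart_exists) (rule that)
      then show ?thesis unfolding Q_def o_assoc by blast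
    qed
  next
    fix i and r k1 k2 :: "nat \<Rightarrow> nat" and J
    assume Q: "Q i (r \<circ> k1)" and k: "\<And>j. J \<le> j \<Longrightarrow> \<exists>j'. j \<le> j' \<and> k2 j = k1 j'"
    have k': "\<exists>j'\<ge>j. (r \<circ> k2) j = (r \<circ> k1) j'" if "j \<ge> J" for j using k[OF that] by auto
    have k'': "\<exists>j'\<ge>j. (f \<circ> (r \<circ> k2)) j = (f \<circ> (r \<circ> k1)) j'" if "j \<ge> J" for j using k[OF that] by auto
    from Q show "Q i (r \<circ> k2)" unfolding Q_def
    proof
      assume "\<exists>M. eventually (\<lambda>j. (r \<circ> k1) j \<le> M) sequentially"
      then obtain M where "eventually (\<lambda>j. (r \<circ> k1) j \<le> M) sequentially" by blast
      from eventually_refine[of "\<lambda>x. x \<le> M", OF this k']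
      show "(\<exists>M. eventually (\<lambda>j. (r \<circ> k2) j \<le> M) sequentially) \<or> conv_chart (\<delta> i) (\<sigma> i) (f \<circ> (r \<circ> k2))" by blast
    next
      assume "conv_chart (\<delta> i) (\<sigma> i) (f \<circ> (r \<circ> k1))"
      from conv_chart_refine[OF this k'']
      show "(\<exists>M. eventually (\<lambda>j. (r \<circ> k2) j \<le> M) sequentially) \<or> conv_chart (\<delta> i) (\<sigma> i) (f \<circ> (r \<circ> k2))" by blast
    qed
  qed auto
  have "conv_chart (\<delta> i) (\<sigma> i) (f \<circ> k)" for i
  proof -
    have "\<not> eventually (\<lambda>j. k j \<le> M) sequentially" for M
    proof
      assume "eventually (\<lambda>j. k j \<le> M) sequentially"
      then obtain J where "\<And>j. j \<ge> J \<Longrightarrow> k j \<le> M" unfolding eventually_sequentially by blast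
      from this[of "max J (Suc M)"] show False using seq_suble[OF k(1), of "max J (Suc M)"] by simp
    qed
    then show ?thesis using k(2)[of i] by (auto simp: Q_def)
  qed
  then show ?thesis by (rule that[OF k(1)])
qed

text \<open>Half discs cover, so that every point has a chart in which convergence is uniform on a
  compact disc around it.\<close>

lemma countable_ball_cover:
  fixes D :: "complex set"
  assumes D: "D \<noteq> {}" "\<And>z. z \<in> D \<Longrightarrow> \<delta> z > 0"
  obtains \<sigma> :: "nat \<Rightarrow> complex" where "\<And>i. \<sigma> i \<in> D" "\<And>z. z \<in> D \<Longrightarrow> \<exists>i. z \<in> ball (\<sigma> i) (\<delta> (\<sigma> i) / 2)"
proof -
  obtain \<F> where \<F>: "\<F> \<subseteq> (\<lambda>c. ball c (\<delta> c / 2)) ` D" "countable \<F>" "\<Union>\<F> = \<Union>((\<lambda>c. ball c (\<delta> c / 2)) ` D)"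
    by (rule Lindelof[of "(\<lambda>c. ball c (\<delta> c / 2)) ` D"]) (auto intro: that)
  obtain C where C: "C \<subseteq> D" "countable C" "\<F> = (\<lambda>c. ball c (\<delta> c / 2)) ` C"
    using countable_subset_image[THEN iffD1, of \<F> "\<lambda>c. ball c (\<delta> c / 2)" D] \<F>(1,2) by blast
  have cov: "\<exists>c\<in>C. z \<in> ball c (\<delta> c / 2)" if "z \<in> D" for z
  proof -
    have "z \<in> \<Union>\<F>" unfolding \<F>(3) using that D(2)[OF that] by (auto intro!: bexI[of _ z])
    then show ?thesis using C(3) by blast
  qed
  then have ne: "C \<noteq> {}" using D(1) by blast
  show ?thesis
  proof (rule that[of "from_nat_into C"])
    show "from_nat_into C i \<in> D" for i using from_nat_into[OF ne] C(1) by blast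
    show "\<exists>i. z \<in> ball (from_nat_into C i) (\<delta> (from_nat_into C i) / 2)" if "z \<in> D" for z
      using cov[OF that] from_nat_into_surj[OF C(2)] by metis
  qed
qed

lemma chart_limit_cong:
  assumes "chart_limit r c F H" "\<And>w. w \<in> ball c r \<Longrightarrow> H w = H' w"
  shows "chart_limit r c F H'"
  unfolding chart_limit_def
proof (intro conjI allI impI ballI)
  show "H' holomorphic_on ball c r"
    by (rule holomorphic_transform[of H]) (use assms in \<open>auto simp: chart_limit_def\<close>)
  show "norm (H' w) \<le> 2" if "w \<in> ball c r" for w using assms that by (auto simp: chart_limit_def)
  fix K assume K: "compact K" "K \<subseteq> ball c r"
  then have "uniform_limit K F H sequentially" using assms(1) by (simp add: chart_limit_def)
  moreover have "\<And>x. x \<in> K \<Longrightarrow> H x = H' x" using assms(2) K(2) by blast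
  ultimately show "uniform_limit K F H' sequentially" using uniform_limit_cong'[of K F F H H' sequentially] by simp
qed

lemma tendsto_inv_stereographic:
  assumes "a \<longlonglongrightarrow> x"
  shows "(\<lambda>v. inv_stereographic (Some (a v))) \<longlonglongrightarrow> inv_stereographic (Some x)"
proof (rule tendstoI)
  fix e :: real assume "e > 0"
  then have "eventually (\<lambda>v. dist (a v) x < e / 2) sequentially" using tendstoD[OF assms, of "e / 2"] by simp
  then show "eventually (\<lambda>v. dist (inv_stereographic (Some (a v))) (inv_stereographic (Some x)) < e) sequentially"
  proof eventually_elim
    case (elim v)
    show ?case using inv_stereographic_lipschitz[of "a v" x] elim unfolding dist_norm by linarith
  qed
qed

lemma tendsto_antipode:
  assumes "f \<longlonglongrightarrow> l"
  shows "(\<lambda>v. antipode (f v)) \<longlonglongrightarrow> antipode l"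
proof (rule tendstoI)
  fix e :: real assume "e > 0"
  then show "eventually (\<lambda>v. dist (antipode (f v)) (antipode l) < e) sequentially"
    using tendstoD[OF assms, of e] by (simp only: dist_norm norm_antipode_diff)
qed

text \<open>The three possible limits on a disc: finite values in the chart g, a function that may
  have poles in the chart 1/g, and the constant infinity.\<close>

definition limit_chart1 :: "real \<Rightarrow> complex \<Rightarrow> (nat \<Rightarrow> complex \<Rightarrow> complex) \<Rightarrow> (complex \<Rightarrow> complex) \<Rightarrow> bool" where
  "limit_chart1 r c F g \<longleftrightarrow> eventually (\<lambda>v. tame r (F v) c) sequentially \<and> tame r g c \<and> chart_limit r c F g"

definition limit_chart2 :: "real \<Rightarrow> complex \<Rightarrow> (nat \<Rightarrow> complex \<Rightarrow> complex) \<Rightarrow> (complex \<Rightarrow> complex) \<Rightarrow> bool" where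
  "limit_chart2 r c F g \<longleftrightarrow> eventually (\<lambda>v. tame_inv r (F v) c) sequentially \<and> tame_inv r g c \<and>
     chart_limit r c (\<lambda>v w. inverse (F v w)) (\<lambda>w. inverse (g w))"

definition limit_chart_inf :: "real \<Rightarrow> complex \<Rightarrow> (nat \<Rightarrow> complex \<Rightarrow> complex) \<Rightarrow> bool" where
  "limit_chart_inf r c F \<longleftrightarrow> eventually (\<lambda>v. tame_inv r (F v) c) sequentially \<and>
     chart_limit r c (\<lambda>v w. inverse (F v w)) (\<lambda>_. 0)"

lemma eventually_nonzero_ball:
  assumes H: "H holomorphic_on ball c r" and nz: "\<exists>w\<in>ball c r. H w \<noteq> (0::complex)" and z: "z \<in> ball c r"
  shows "eventually (\<lambda>w. H w \<noteq> 0) (at z)"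
proof -
  have "H nicely_meromorphic_on ball c r"
    using H by (intro analytic_on_imp_nicely_meromorphic_on) (simp add: analytic_on_open)
  then show ?thesis
    using frequently_eq_meromorphic_imp_constant[OF _ _ open_ball connected_ball z, of H 0] nz
    unfolding frequently_def by blast
qed

text \<open>Montel's theorem on countably many discs and diagonal extraction give local limits,
  which have to be glued. Meromorphy is only assumed from some index on, depending on the disc,
  because rescaled functions live on growing discs.\<close>

theorem normal_limit:
  fixes f :: "nat \<Rightarrow> complex \<Rightarrow> complex"
  assumes D: "open D" "connected D" "D \<noteq> {}"
    and \<delta>: "\<And>z. z \<in> D \<Longrightarrow> \<delta> z > 0" "\<And>z. z \<in> D \<Longrightarrow> ball z (\<delta> z) \<subseteq> D"
    and mero: "\<And>z. z \<in> D \<Longrightarrow> eventually (\<lambda>v. f v nicely_meromorphic_on ball z (\<delta> z)) sequentially"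
    and tm: "\<And>z. z \<in> D \<Longrightarrow> eventually (\<lambda>v. tame (\<delta> z) (f v) z \<or> tame_inv (\<delta> z) (f v) z) sequentially"
  obtains k where "strict_mono (k :: nat \<Rightarrow> nat)"
    "(\<forall>z\<in>D. \<exists>c\<in>D. z \<in> ball c (\<delta> c / 2) \<and> limit_chart_inf (\<delta> c) c (f \<circ> k)) \<or>
     (\<exists>g. g nicely_meromorphic_on D \<and>
       (\<forall>z\<in>D. \<exists>c\<in>D. z \<in> ball c (\<delta> c / 2) \<and> (limit_chart1 (\<delta> c) c (f \<circ> k) g \<or> limit_chart2 (\<delta> c) c (f \<circ> k) g)))"
proof -
  obtain \<sigma> :: "nat \<Rightarrow> complex" where \<sigma>: "\<And>i. \<sigma> i \<in> D" "\<And>z. z \<in> D \<Longrightarrow> \<exists>i. z \<in> ball (\<sigma> i) (\<delta> (\<sigma> i) / 2)"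
    by (rule countable_ball_cover[of D \<delta>, OF D(3) \<delta>(1)]) (assumption | rule that)+
  obtain k where k: "strict_mono (k :: nat \<Rightarrow> nat)" "\<And>i. conv_chart (\<delta> (\<sigma> i)) (\<sigma> i) (f \<circ> k)"
    by (rule conv_chart_diagonal[of "\<lambda>i. \<delta> (\<sigma> i)" f \<sigma>, OF tm[OF \<sigma>(1)]]) (rule that)
  define S where "S = (\<lambda>v w. inv_stereographic (sphere_map ((f \<circ> k) v) w))"
  \<comment> \<open>The pointwise limit on the sphere is independent of the chart, which makes the
    local limits agree on overlaps.\<close>
  define G where "G = (\<lambda>w. THE p. (\<lambda>v. S v w) \<longlonglongrightarrow> inv_stereographic p)"
  have G: "G w = p" if "(\<lambda>v. S v w) \<longlonglongrightarrow> inv_stereographic p" for w p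
    unfolding G_def using that LIMSEQ_unique inj_inv_stereographic by (intro the_equality) blast+
  define g where "g = (\<lambda>w. case G w of Some x \<Rightarrow> x | None \<Rightarrow> 0)"
  have kseq: "eventually (\<lambda>v. Q (k v)) sequentially" if "eventually Q sequentially" for Q
    using eventually_subseq[OF k(1) that] .
  have G1: "G w = Some (H w)"
    if "eventually (\<lambda>v. tame r ((f \<circ> k) v) c) sequentially" "chart_limit r c (f \<circ> k) H" "w \<in> ball c r" for r c H w
  proof (rule G)
    have "(\<lambda>v. inv_stereographic (Some ((f \<circ> k) v w))) \<longlonglongrightarrow> inv_stereographic (Some (H w))"
      by (rule tendsto_inv_stereographic[OF chart_limit_tendsto[OF that(2,3)]])
    moreover have "eventually (\<lambda>v. inv_stereographic (Some ((f \<circ> k) v w)) = S v w) sequentially"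
      using that(1) by eventually_elim (simp add: S_def sphere_map_tame[OF _ that(3)])
    ultimately show "(\<lambda>v. S v w) \<longlonglongrightarrow> inv_stereographic (Some (H w))" by (rule Lim_transform_eventually)
  qed
  have G2: "G w = inv_sphere (H w)"
    if c: "c \<in> D" and ev: "eventually (\<lambda>v. tame_inv (\<delta> c) ((f \<circ> k) v) c) sequentially"
      and lim: "chart_limit (\<delta> c) c (\<lambda>v w. inverse ((f \<circ> k) v w)) H" and w: "w \<in> ball c (\<delta> c)" for c H w
  proof (rule G)
    have "(\<lambda>v. antipode (inv_stereographic (Some (inverse ((f \<circ> k) v w))))) \<longlonglongrightarrow> antipode (inv_stereographic (Some (H w)))"
      by (rule tendsto_antipode[OF tendsto_inv_stereographic[OF chart_limit_tendsto[OF lim w]]])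
    moreover have "eventually (\<lambda>v. antipode (inv_stereographic (Some (inverse ((f \<circ> k) v w)))) = S v w) sequentially"
      using ev kseq[OF mero[OF c]]
    proof eventually_elim
      case (elim v)
      have "is_pole ((f \<circ> k) v) w \<Longrightarrow> (f \<circ> k) v w = 0" using is_pole_zero_at_nicely_mero[OF elim(2) _ w] by simp
      then show ?case using sphere_map_tame_inv[OF elim(1) w] by (simp add: S_def inv_stereographic_inv_sphere)
    qed
    ultimately show "(\<lambda>v. S v w) \<longlonglongrightarrow> inv_stereographic (inv_sphere (H w))"
      unfolding inv_stereographic_inv_sphere by (rule Lim_transform_eventually)
  qed
  \<comment> \<open>The points near which the limit is identically infinite. Each disc of the cover
    lies inside \<open>E\<close> or misses it, so \<open>E\<close> and its complement in D are open,
    and connectedness leaves only two cases.\<close>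
  define E where "E = {z \<in> D. eventually (\<lambda>w. G w = None) (nhds z)}"
  have trich: "limit_chart_inf (\<delta> c) c (f \<circ> k) \<and> ball c (\<delta> c) \<subseteq> E \<or>
     (limit_chart1 (\<delta> c) c (f \<circ> k) g \<or> limit_chart2 (\<delta> c) c (f \<circ> k) g) \<and> ball c (\<delta> c) \<inter> E = {}"
    if c: "c \<in> D" and conv: "conv_chart (\<delta> c) c (f \<circ> k)" for c
    using conv unfolding conv_chart_def
  proof (elim disjE conjE exE)
    fix H assume ev: "eventually (\<lambda>v. tame (\<delta> c) ((f \<circ> k) v) c) sequentially" and lim: "chart_limit (\<delta> c) c (f \<circ> k) H"
    have gH: "H w = g w" if "w \<in> ball c (\<delta> c)" for w using G1[OF ev lim that] by (simp add: g_def)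
    have cl: "chart_limit (\<delta> c) c (f \<circ> k) g" by (rule chart_limit_cong[OF lim gH])
    then have "limit_chart1 (\<delta> c) c (f \<circ> k) g" using ev unfolding limit_chart1_def tame_def chart_limit_def by blast
    moreover have "z \<notin> E" if "z \<in> ball c (\<delta> c)" for z
      using G1[OF ev lim that] eventually_nhds_x_imp_x[of "\<lambda>w. G w = None" z] by (auto simp: E_def)
    ultimately show ?thesis by blast
  next
    fix H assume ev: "eventually (\<lambda>v. tame_inv (\<delta> c) ((f \<circ> k) v) c) sequentially"
      and lim: "chart_limit (\<delta> c) c (\<lambda>v w. inverse ((f \<circ> k) v w)) H"
    have H: "H holomorphic_on ball c (\<delta> c)" "\<And>w. w \<in> ball c (\<delta> c) \<Longrightarrow> norm (H w) \<le> 2"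
      using lim by (auto simp: chart_limit_def)
    note G2' = G2[OF c ev lim]
    show ?thesis
    proof (cases "\<exists>w\<in>ball c (\<delta> c). H w \<noteq> 0")
      case False
      have "limit_chart_inf (\<delta> c) c (f \<circ> k)"
        using ev chart_limit_cong[OF lim, of "\<lambda>_. 0"] False by (auto simp: limit_chart_inf_def)
      moreover have "z \<in> E" if z: "z \<in> ball c (\<delta> c)" for z
      proof -
        have "\<forall>w\<in>ball c (\<delta> c). G w = None" using G2' False by (simp add: inv_sphere_def)
        then have "eventually (\<lambda>w. G w = None) (nhds z)"
          using z unfolding eventually_nhds by (intro exI[of _ "ball c (\<delta> c)"]) auto
        then show ?thesis using z \<delta>(2)[OF c] by (auto simp: E_def)
      qed
      ultimately show ?thesis by blast
    next
      case True
      have gH: "H w = inverse (g w)" if "w \<in> ball c (\<delta> c)" for w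
        using G2'[OF that] by (auto simp: g_def inv_sphere_def)
      have cl: "chart_limit (\<delta> c) c (\<lambda>v w. inverse ((f \<circ> k) v w)) (\<lambda>w. inverse (g w))"
        by (rule chart_limit_cong[OF lim gH])
      then have t: "tame (\<delta> c) (\<lambda>w. inverse (g w)) c" by (auto simp: tame_def chart_limit_def)
      have nz: "eventually (\<lambda>x. H x \<noteq> 0) (at w)" if "w \<in> ball c (\<delta> c)" for w
        by (rule eventually_nonzero_ball[OF H(1) True that])
      \<comment> \<open>A zero of the limit H of the functions 1/f is isolated, so it becomes a pole
        of g rather than a zero.\<close>
      have "is_pole g w" if w: "w \<in> ball c (\<delta> c)" "g w = 0" for w
      proof -
        have Hw: "H w = 0" using gH[OF w(1)] w(2) by simp
        have "isCont H w" by (rule isCont_holomorphic[OF H(1) open_ball w(1)])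
        then have "H \<midarrow>w\<rightarrow> 0" using Hw by (simp add: isCont_def)
        then have "isolated_zero H w" using nz[OF w(1)] by (simp add: isolated_zero_def)
        then have "is_pole (\<lambda>x. inverse (H x)) w" by (simp add: is_pole_inverse_iff)
        moreover have "eventually (\<lambda>x. inverse (H x) = g x) (at w)"
          using eventually_at_in_open'[OF open_ball w(1)] by eventually_elim (simp add: gH)
        ultimately show ?thesis by (rule is_pole_transform) simp
      qed
      then have "limit_chart2 (\<delta> c) c (f \<circ> k) g" using ev t cl by (auto simp: limit_chart2_def tame_inv_def)
      moreover have "z \<notin> E" if z: "z \<in> ball c (\<delta> c)" for z
      proof
        assume "z \<in> E"
        then have "eventually (\<lambda>w. G w = None) (at z)" by (auto simp: E_def eventually_at_filter elim: eventually_mono)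
        then have "eventually (\<lambda>w. False) (at z)"
          using nz[OF z] eventually_at_in_open'[OF open_ball z] by eventually_elim (simp add: G2' inv_sphere_def)
        then show False by simp
      qed
      ultimately show ?thesis by blast
    qed
  qed
  have "open E"
  proof (subst open_subopen, intro ballI)
    fix z assume "z \<in> E"
    then obtain U where "open U" "z \<in> U" "\<forall>w\<in>U. G w = None" "z \<in> D" by (auto simp: E_def eventually_nhds)
    then show "\<exists>T. open T \<and> z \<in> T \<and> T \<subseteq> E"
      using D(1) by (intro exI[of _ "U \<inter> D"]) (auto simp: E_def eventually_nhds)
  qed
  moreover have "open (D - E)"
  proof (subst open_subopen, intro ballI)
    fix z assume z: "z \<in> D - E"
    then obtain i where i: "z \<in> ball (\<sigma> i) (\<delta> (\<sigma> i) / 2)" using \<sigma>(2) by blast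
    then have zi: "z \<in> ball (\<sigma> i) (\<delta> (\<sigma> i))" using \<delta>(1)[OF \<sigma>(1)[of i]] by simp
    then have "ball (\<sigma> i) (\<delta> (\<sigma> i)) \<inter> E = {}" using trich[OF \<sigma>(1) k(2), of i] z by blast
    then show "\<exists>T. open T \<and> z \<in> T \<and> T \<subseteq> D - E" using zi \<delta>(2)[OF \<sigma>(1)[of i]] by (intro exI[of _ "ball (\<sigma> i) (\<delta> (\<sigma> i))"]) auto
  qed
  moreover have "E \<subseteq> D" by (auto simp: E_def)
  ultimately consider "E = {}" | "E = D"
    using connectedD[OF D(2), of E "D - E"] by blast
  then show ?thesis
  proof cases
    case 2
    have "\<exists>c\<in>D. z \<in> ball c (\<delta> c / 2) \<and> limit_chart_inf (\<delta> c) c (f \<circ> k)" if z: "z \<in> D" for z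
    proof -
      obtain i where i: "z \<in> ball (\<sigma> i) (\<delta> (\<sigma> i) / 2)" using \<sigma>(2)[OF z] by blast
      have "\<sigma> i \<in> ball (\<sigma> i) (\<delta> (\<sigma> i)) \<inter> E" using 2 \<sigma>(1) \<delta>(1) by simp
      then show ?thesis using trich[OF \<sigma>(1) k(2), of i] i \<sigma>(1) by blast
    qed
    then show ?thesis using that[OF k(1)] by blast
  next
    case 1
    have charts: "\<exists>c\<in>D. z \<in> ball c (\<delta> c / 2) \<and> (limit_chart1 (\<delta> c) c (f \<circ> k) g \<or> limit_chart2 (\<delta> c) c (f \<circ> k) g)"
      if z: "z \<in> D" for z
    proof -
      obtain i where i: "z \<in> ball (\<sigma> i) (\<delta> (\<sigma> i) / 2)" using \<sigma>(2)[OF z] by blast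
      have "\<sigma> i \<in> ball (\<sigma> i) (\<delta> (\<sigma> i))" using \<sigma>(1) \<delta>(1) by simp
      then show ?thesis using trich[OF \<sigma>(1) k(2), of i] i \<sigma>(1) 1 by blast
    qed
    have at: "isolated_singularity_at g z \<and> (g analytic_on {z} \<or> is_pole g z \<and> g z = 0)" if z: "z \<in> D" for z
    proof -
      obtain c where c: "c \<in> D" "z \<in> ball c (\<delta> c / 2)" "limit_chart1 (\<delta> c) c (f \<circ> k) g \<or> limit_chart2 (\<delta> c) c (f \<circ> k) g"
        using charts[OF z] by blast
      have zb: "z \<in> ball c (\<delta> c)" using c(2) \<delta>(1)[OF c(1)] by simp
      from c(3) show ?thesis
      proof
        assume "limit_chart1 (\<delta> c) c (f \<circ> k) g"
        then have "g holomorphic_on ball c (\<delta> c)" by (simp add: limit_chart1_def tame_def)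
        then have "g analytic_on {z}" using zb open_ball analytic_at by blast
        then show ?thesis using analytic_at_imp_no_pole isolated_singularity_at_analytic by blast
      next
        assume "limit_chart2 (\<delta> c) c (f \<circ> k) g"
        then have t: "tame_inv (\<delta> c) g c" by (simp add: limit_chart2_def)
        then have "(\<lambda>w. inverse (g w)) holomorphic_on ball c (\<delta> c)" by (simp add: tame_inv_def tame_def)
        then have a: "(\<lambda>w. inverse (g w)) analytic_on {z}" using zb open_ball analytic_at by blast
        then have "(\<lambda>w. inverse (inverse (g w))) meromorphic_on {z}"
          by (intro meromorphic_on_inverse analytic_on_imp_meromorphic_on)
        then have "isolated_singularity_at g z" by (simp add: meromorphic_at_iff)
        moreover have "g analytic_on {z}" if "g z \<noteq> 0"
        proof -
          have "(\<lambda>w. inverse (inverse (g w))) analytic_on {z}" by (rule analytic_on_inverse[OF a]) (use that in auto)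
          then show ?thesis by simp
        qed
        moreover have "is_pole g z" if "g z = 0" using t zb that unfolding tame_inv_def by blast
        ultimately show ?thesis by blast
      qed
    qed
    have "g nicely_meromorphic_on D"
    proof (rule nicely_meromorphic_onI_open[OF D(1), of g "{z \<in> D. is_pole g z}"])
      show "g analytic_on D - {z \<in> D. is_pole g z}" using at analytic_on_analytic_at by blast
      show "\<And>x. x \<in> {z \<in> D. is_pole g z} \<Longrightarrow> is_pole g x \<and> g x = 0"
        using at analytic_at_imp_no_pole by blast
      show "\<And>x. x \<in> D \<Longrightarrow> isolated_singularity_at g x" using at by blast
    qed
    then show ?thesis using that[OF k(1)] charts by blast
  qed
qed

section \<open>From chart limits to spherical limits\<close>

lemma spherical_limit_of_charts:
  assumes \<delta>: "\<And>z. z \<in> D \<Longrightarrow> \<delta> z > 0" "\<And>z. z \<in> D \<Longrightarrow> ball z (\<delta> z) \<subseteq> D"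
    and mero: "\<And>v. F v nicely_meromorphic_on D" and g: "g nicely_meromorphic_on D"
    and charts: "\<And>z. z \<in> D \<Longrightarrow> \<exists>c\<in>D. z \<in> ball c (\<delta> c / 2) \<and> (limit_chart1 (\<delta> c) c F g \<or> limit_chart2 (\<delta> c) c F g)"
  shows "spherically_locally_uniform_limit D (\<lambda>v. sphere_map (F v)) (sphere_map g)"
  unfolding spherically_locally_uniform_limit_def
proof
  fix z assume z: "z \<in> D"
  obtain c where c: "c \<in> D" "z \<in> ball c (\<delta> c / 2)" "limit_chart1 (\<delta> c) c F g \<or> limit_chart2 (\<delta> c) c F g"
    using charts[OF z] by blast
  have dc: "\<delta> c > 0" by (rule \<delta>(1)[OF c(1)])
  have sub: "cball c (\<delta> c / 2) \<subseteq> ball c (\<delta> c)" using dc by auto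
  have subD: "ball c (\<delta> c / 2) \<subseteq> D" using sub \<delta>(2)[OF c(1)] ball_subset_cball by blast
  have conv: "\<forall>\<^sub>F v in sequentially. \<forall>w\<in>ball c (\<delta> c / 2). spherical_dist (sphere_map (F v) w) (sphere_map g w) < e"
    if e: "e > 0" for e
  proof -
    obtain d where d: "d > 0" "\<And>p q. norm (inv_stereographic p - inv_stereographic q) < d \<Longrightarrow> spherical_dist p q < e"
      by (rule spherical_dist_less[OF e]) (rule that)
    from c(3) show ?thesis
    proof
      assume l: "limit_chart1 (\<delta> c) c F g"
      then have "uniform_limit (cball c (\<delta> c / 2)) F g sequentially"
        using sub by (simp add: limit_chart1_def chart_limit_def)
      then have "eventually (\<lambda>v. \<forall>w\<in>cball c (\<delta> c / 2). dist (F v w) (g w) < d / 2) sequentially"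
        using d(1) by (intro uniform_limitD) auto
      moreover have "eventually (\<lambda>v. tame (\<delta> c) (F v) c) sequentially" using l by (simp add: limit_chart1_def)
      ultimately show ?thesis
      proof eventually_elim
        case (elim v)
        show ?case
        proof
          fix w assume w: "w \<in> ball c (\<delta> c / 2)"
          then have wb: "w \<in> ball c (\<delta> c)" using dc by simp
          have "sphere_map (F v) w = Some (F v w)" "sphere_map g w = Some (g w)"
            using sphere_map_tame[OF elim(2) wb] sphere_map_tame[OF _ wb, of g] l by (auto simp: limit_chart1_def)
          moreover have "dist (F v w) (g w) < d / 2" using elim(1) w by simp
          ultimately show "spherical_dist (sphere_map (F v) w) (sphere_map g w) < e"
            using inv_stereographic_lipschitz[of "F v w" "g w"] by (intro d(2)) (simp add: dist_norm)
        qed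
      qed
    next
      assume l: "limit_chart2 (\<delta> c) c F g"
      then have "uniform_limit (cball c (\<delta> c / 2)) (\<lambda>v w. inverse (F v w)) (\<lambda>w. inverse (g w)) sequentially"
        using sub by (simp add: limit_chart2_def chart_limit_def)
      then have "eventually (\<lambda>v. \<forall>w\<in>cball c (\<delta> c / 2). dist (inverse (F v w)) (inverse (g w)) < d / 2) sequentially"
        using d(1) by (intro uniform_limitD) auto
      moreover have "eventually (\<lambda>v. tame_inv (\<delta> c) (F v) c) sequentially" using l by (simp add: limit_chart2_def)
      ultimately show ?thesis
      proof eventually_elim
        case (elim v)
        show ?case
        proof
          fix w assume w: "w \<in> ball c (\<delta> c / 2)"
          then have wb: "w \<in> ball c (\<delta> c)" using dc by simp
          then have wD: "w \<in> D" using \<delta>(2)[OF c(1)] by blast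
          have tg: "tame_inv (\<delta> c) g c" using l by (simp add: limit_chart2_def)
          have "sphere_map (F v) w = inv_sphere (inverse (F v w))" "sphere_map g w = inv_sphere (inverse (g w))"
            using sphere_map_tame_inv[OF elim(2) wb] sphere_map_tame_inv[OF tg wb]
              is_pole_zero_at_nicely_mero[OF mero _ wD] is_pole_zero_at_nicely_mero[OF g _ wD] by auto
          moreover have "dist (inverse (F v w)) (inverse (g w)) < d / 2" using elim(1) w by simp
          ultimately show "spherical_dist (sphere_map (F v) w) (sphere_map g w) < e"
            using inv_stereographic_lipschitz[of "inverse (F v w)" "inverse (g w)"]
            by (intro d(2)) (simp add: dist_norm inv_stereographic_inv_sphere norm_antipode_diff)
        qed
      qed
    qed
  qed
  show "\<exists>U. open U \<and> z \<in> U \<and> U \<subseteq> D \<and>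
      (\<forall>e>0. \<forall>\<^sub>F v in sequentially. \<forall>w\<in>U. spherical_dist (sphere_map (F v) w) (sphere_map g w) < e)"
    by (rule exI[of _ "ball c (\<delta> c / 2)"]) (use c(2) subD conv in auto)
qed

lemma spherical_limit_infinity_of_charts:
  assumes \<delta>: "\<And>z. z \<in> D \<Longrightarrow> \<delta> z > 0" "\<And>z. z \<in> D \<Longrightarrow> ball z (\<delta> z) \<subseteq> D"
    and mero: "\<And>v. F v nicely_meromorphic_on D"
    and charts: "\<And>z. z \<in> D \<Longrightarrow> \<exists>c\<in>D. z \<in> ball c (\<delta> c / 2) \<and> limit_chart_inf (\<delta> c) c F"
  shows "spherically_locally_uniform_limit D (\<lambda>v. sphere_map (F v)) (\<lambda>_. None)"
  unfolding spherically_locally_uniform_limit_def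
proof
  fix z assume z: "z \<in> D"
  obtain c where c: "c \<in> D" "z \<in> ball c (\<delta> c / 2)" "limit_chart_inf (\<delta> c) c F"
    using charts[OF z] by blast
  have dc: "\<delta> c > 0" by (rule \<delta>(1)[OF c(1)])
  have sub: "cball c (\<delta> c / 2) \<subseteq> ball c (\<delta> c)" using dc by auto
  have subD: "ball c (\<delta> c / 2) \<subseteq> D" using sub \<delta>(2)[OF c(1)] ball_subset_cball by blast
  have conv: "\<forall>\<^sub>F v in sequentially. \<forall>w\<in>ball c (\<delta> c / 2). spherical_dist (sphere_map (F v) w) None < e"
    if e: "e > 0" for e
  proof -
    obtain d where d: "d > 0" "\<And>p q. norm (inv_stereographic p - inv_stereographic q) < d \<Longrightarrow> spherical_dist p q < e"
      by (rule spherical_dist_less[OF e]) (rule that)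
    have "uniform_limit (cball c (\<delta> c / 2)) (\<lambda>v w. inverse (F v w)) (\<lambda>_. 0) sequentially"
      using sub c(3) by (simp add: limit_chart_inf_def chart_limit_def)
    then have "eventually (\<lambda>v. \<forall>w\<in>cball c (\<delta> c / 2). dist (inverse (F v w)) 0 < d / 2) sequentially"
      using d(1) by (intro uniform_limitD) auto
    moreover have "eventually (\<lambda>v. tame_inv (\<delta> c) (F v) c) sequentially" using c(3) by (simp add: limit_chart_inf_def)
    ultimately show ?thesis
    proof eventually_elim
      case (elim v)
      show ?case
      proof
        fix w assume w: "w \<in> ball c (\<delta> c / 2)"
        then have wb: "w \<in> ball c (\<delta> c)" using dc by simp
        then have wD: "w \<in> D" using \<delta>(2)[OF c(1)] by blast
        have "sphere_map (F v) w = inv_sphere (inverse (F v w))"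
          using sphere_map_tame_inv[OF elim(2) wb] is_pole_zero_at_nicely_mero[OF mero _ wD] by auto
        moreover have "None = inv_sphere 0" by (simp add: inv_sphere_def)
        moreover have "dist (inverse (F v w)) 0 < d / 2" using elim(1) w by simp
        then have "norm (inv_stereographic (inv_sphere (inverse (F v w))) - inv_stereographic (inv_sphere 0)) < d"
          unfolding inv_stereographic_inv_sphere norm_antipode_diff
          using inv_stereographic_lipschitz[of "inverse (F v w)" 0] by (simp only: dist_norm)
        then have "spherical_dist (inv_sphere (inverse (F v w))) (inv_sphere 0) < e" by (rule d(2))
        ultimately show "spherical_dist (sphere_map (F v) w) None < e" by simp
      qed
    qed
  qed
  show "\<exists>U. open U \<and> z \<in> U \<and> U \<subseteq> D \<and>
      (\<forall>e>0. \<forall>\<^sub>F v in sequentially. \<forall>w\<in>U. spherical_dist (sphere_map (F v) w) None < e)"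
    by (rule exI[of _ "ball c (\<delta> c / 2)"]) (use c(2) subD conv in auto)
qed

section \<open>Rescaling of non-normal families\<close>

lemma is_pole_affine:
  fixes \<zeta> z :: complex
  assumes "\<rho> > 0"
  shows "is_pole (\<lambda>w. f (z + of_real \<rho> * w)) \<zeta> \<longleftrightarrow> is_pole f (z + of_real \<rho> * \<zeta>)"
proof
  assume "is_pole f (z + of_real \<rho> * \<zeta>)"
  then show "is_pole (\<lambda>w. f (z + of_real \<rho> * w)) \<zeta>"
  proof (rule is_pole_compose)
    show "(\<lambda>w. z + of_real \<rho> * w) \<midarrow>\<zeta>\<rightarrow> z + of_real \<rho> * \<zeta>" by (intro tendsto_intros)
    show "eventually (\<lambda>w. z + of_real \<rho> * w \<noteq> z + of_real \<rho> * \<zeta>) (at \<zeta>)"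
      using assms by (auto simp: eventually_at_filter)
  qed
next
  assume l: "is_pole (\<lambda>w. f (z + of_real \<rho> * w)) \<zeta>"
  have "is_pole (\<lambda>x. f (z + of_real \<rho> * ((x - z) / of_real \<rho>))) (z + of_real \<rho> * \<zeta>)"
  proof (rule is_pole_compose[OF l])
    show "(\<lambda>x. (x - z) / of_real \<rho>) \<midarrow>z + of_real \<rho> * \<zeta>\<rightarrow> \<zeta>"
      using assms by (auto intro!: tendsto_eq_intros)
    show "eventually (\<lambda>x. (x - z) / of_real \<rho> \<noteq> \<zeta>) (at (z + of_real \<rho> * \<zeta>))"
      using assms by (auto simp: eventually_at_filter field_simps)
  qed
  then show "is_pole f (z + of_real \<rho> * \<zeta>)" using assms by simp
qed

lemma is_pole_cmult:
  assumes "c \<noteq> (0 :: complex)"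
  shows "is_pole (\<lambda>w. c * f w) z \<longleftrightarrow> is_pole f z"
proof -
  have *: "is_pole (\<lambda>w. c * f w) z" if "is_pole f z" "c \<noteq> 0" for c :: complex and f
    using that tendsto_mult_filterlim_at_infinity[of "\<lambda>_. c" c "at z" f] by (simp add: is_pole_def)
  have "is_pole f z" if "is_pole (\<lambda>w. c * f w) z"
    using *[OF that, of "inverse c"] assms by (simp add: mult.assoc[symmetric])
  then show ?thesis using *[of f c] assms by blast
qed

lemma deriv_cmult_affine:
  assumes "h analytic_on {z + of_real \<rho> * \<zeta>}"
  shows "deriv (\<lambda>w. c * h (z + of_real \<rho> * w)) \<zeta> = c * of_real \<rho> * deriv h (z + of_real \<rho> * \<zeta>)"
proof (rule DERIV_imp_deriv)
  have "(h has_field_derivative deriv h (z + of_real \<rho> * \<zeta>)) (at (z + of_real \<rho> * \<zeta>))"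
    using assms analytic_on_imp_differentiable_at DERIV_deriv_iff_field_differentiable by blast
  then have "((\<lambda>w. h (z + of_real \<rho> * w)) has_field_derivative deriv h (z + of_real \<rho> * \<zeta>) * of_real \<rho>) (at \<zeta>)"
    by (rule DERIV_chain2) (auto intro!: derivative_eq_intros)
  from DERIV_cmult[OF this, of c]
  show "((\<lambda>w. c * h (z + of_real \<rho> * w)) has_field_derivative c * of_real \<rho> * deriv h (z + of_real \<rho> * \<zeta>)) (at \<zeta>)"
    by (simp add: mult_ac)
qed

lemma inverse_analytic_at:
  assumes mero: "f nicely_meromorphic_on D" and p: "p \<in> D" and f: "is_pole f p \<or> f p \<noteq> 0"
  shows "(\<lambda>w. inverse (f w)) analytic_on {p}"
proof (cases "is_pole f p")
  case True
  then have "f p = 0" using is_pole_zero_at_nicely_mero[OF mero _ p] by simp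
  moreover have "\<not> isolated_zero f p"
    using True not_tendsto_and_filterlim_at_infinity[of "at p" f 0] by (auto simp: is_pole_def isolated_zero_def)
  ultimately have "\<not> is_pole (\<lambda>w. inverse (f w)) p" by (simp add: is_pole_inverse_iff)
  then show ?thesis by (rule nicely_meromorphic_on_imp_analytic_at[OF nicely_meromorphic_on_inverse[OF mero] p])
next
  case False
  have "f analytic_on {p}" by (rule nicely_meromorphic_on_imp_analytic_at[OF mero p False])
  then show ?thesis by (rule analytic_on_inverse) (use f False in auto)
qed

text \<open>The derivative of the rescaled function carries the factor
  \<open>\<rho>\<close>^(1-\<open>\<alpha>\<close>) and that of its inverse
  \<open>\<rho>\<close>^(1+\<open>\<alpha>\<close>). The exponents in \<open>density\<close> are the
  reciprocals, so both alternatives scale by exactly \<open>\<rho>\<close>.\<close>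

lemma density_rescale:
  fixes \<zeta> z :: complex
  assumes \<rho>: "\<rho> > 0" and \<alpha>: "0 \<le> \<alpha>" "\<alpha> < 1" and mero: "f nicely_meromorphic_on D" and p: "z + of_real \<rho> * \<zeta> \<in> D"
  shows "density \<alpha> (\<lambda>w. of_real (\<rho> powr - \<alpha>) * f (z + of_real \<rho> * w)) \<zeta> = \<rho> * density \<alpha> f (z + of_real \<rho> * \<zeta>)"
proof -
  define p where "p = z + of_real \<rho> * \<zeta>"
  define c where "c = \<rho> powr - \<alpha>"
  define g where "g = (\<lambda>w. complex_of_real c * f (z + of_real \<rho> * w))"
  define \<phi> where "\<phi> = (\<lambda>w. inverse (f w))"
  have c: "c > 0" using \<rho> by (simp add: c_def)
  have gp: "is_pole g \<zeta> \<longleftrightarrow> is_pole f p" unfolding g_def p_def using c is_pole_affine[OF \<rho>] by (simp add: is_pole_cmult)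
  have g0: "g \<zeta> = 0 \<longleftrightarrow> f p = 0" using c by (simp add: g_def p_def)
  have A: "norm (deriv g \<zeta>) powr (1 / (1 - \<alpha>)) = \<rho> * norm (deriv f p) powr (1 / (1 - \<alpha>))" if "\<not> is_pole f p"
  proof -
    have "deriv g \<zeta> = of_real c * of_real \<rho> * deriv f p"
      unfolding g_def p_def
      by (rule deriv_cmult_affine, rule nicely_meromorphic_on_imp_analytic_at[OF mero assms(5)]) (use that in \<open>simp add: p_def\<close>)
    then have "norm (deriv g \<zeta>) = (c * \<rho>) * norm (deriv f p)" using c \<rho> by (simp add: norm_mult)
    also have "c * \<rho> = \<rho> powr (1 - \<alpha>)" using \<rho> powr_add[of \<rho> "- \<alpha>" 1] by (simp add: c_def)
    finally show ?thesis using \<rho> \<alpha> by (simp add: powr_mult powr_powr)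
  qed
  have B: "norm (deriv (\<lambda>w. inverse (g w)) \<zeta>) powr (1 / (1 + \<alpha>)) = \<rho> * norm (deriv \<phi> p) powr (1 / (1 + \<alpha>))"
    if "is_pole f p \<or> f p \<noteq> 0"
  proof -
    have "(\<lambda>w. inverse (g w)) = (\<lambda>w. of_real (inverse c) * \<phi> (z + of_real \<rho> * w))"
      by (simp add: g_def \<phi>_def fun_eq_iff)
    then have "deriv (\<lambda>w. inverse (g w)) \<zeta> = of_real (inverse c) * of_real \<rho> * deriv \<phi> p"
      unfolding p_def using inverse_analytic_at[OF mero assms(5)] that
      by (simp only: \<phi>_def p_def) (rule deriv_cmult_affine, simp)
    then have "norm (deriv (\<lambda>w. inverse (g w)) \<zeta>) = (inverse c * \<rho>) * norm (deriv \<phi> p)"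
      using c \<rho> by (simp add: norm_mult norm_inverse norm_divide)
    also have "inverse c * \<rho> = \<rho> powr (1 + \<alpha>)" using \<rho> by (simp add: c_def powr_minus powr_add)
    finally show ?thesis using \<rho> \<alpha> by (simp add: powr_mult powr_powr)
  qed
  have "density \<alpha> g \<zeta> = \<rho> * density \<alpha> f p"
    unfolding density_def Let_def gp g0 using A B \<rho>
    by (auto simp: \<phi>_def[symmetric] min_mult_distrib_left)
  then show ?thesis by (simp add: g_def p_def c_def)
qed

text \<open>The density need not be continuous, but it is dominated by the expression for f near a
  regular point and by that for 1/f near a pole.\<close>

lemma density_locally_bounded:
  assumes D: "open D" "z \<in> D" and mero: "f nicely_meromorphic_on D" and \<alpha>: "0 \<le> \<alpha>" "\<alpha> < 1"
  obtains U K where "open U" "z \<in> U" "\<And>w. w \<in> U \<Longrightarrow> density \<alpha> f w \<le> K"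
proof -
  have bd: "\<exists>U K. open U \<and> z \<in> U \<and> (\<forall>w\<in>U. norm (deriv h w) powr e \<le> K)"
    if "h analytic_on {z}" "e \<ge> 0" for h e
  proof -
    have "deriv h analytic_on {z}" by (rule analytic_deriv[OF that(1)])
    then have "((\<lambda>w. norm (deriv h w)) \<longlongrightarrow> norm (deriv h z)) (nhds z)"
      by (intro tendsto_norm) (rule tendsto_at_iff_tendsto_nhds[THEN iffD1], simp add: analytic_at_imp_isCont isContD)
    then have "eventually (\<lambda>w. norm (deriv h w) < norm (deriv h z) + 1) (nhds z)" by (rule order_tendstoD) simp
    then obtain U where U: "open U" "z \<in> U" "\<And>w. w \<in> U \<Longrightarrow> norm (deriv h w) < norm (deriv h z) + 1"
      unfolding eventually_nhds by blast
    have "norm (deriv h w) powr e \<le> (norm (deriv h z) + 1) powr e" if "w \<in> U" for w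
      using U(3)[OF that] \<open>e \<ge> 0\<close> by (intro powr_mono2) auto
    then show ?thesis using U by blast
  qed
  show ?thesis
  proof (cases "is_pole f z")
    case False
    then have an: "f analytic_on {z}" by (rule nicely_meromorphic_on_imp_analytic_at[OF mero D(2)])
    obtain U K where U: "open U" "z \<in> U" "\<And>w. w \<in> U \<Longrightarrow> norm (deriv f w) powr (1 / (1 - \<alpha>)) \<le> K"
      using bd[OF an, of "1 / (1 - \<alpha>)"] \<alpha> by auto
    obtain S where S: "open S" "z \<in> S" "f holomorphic_on S" using an unfolding analytic_at by blast
    show ?thesis
    proof (rule that[of "U \<inter> S" K])
      show "density \<alpha> f w \<le> K" if "w \<in> U \<inter> S" for w
        using U(3)[of w] that not_is_pole_holomorphic[OF S(1) _ S(3), of w] by (auto simp: density_def Let_def)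
    qed (use U S in auto)
  next
    case True
    have an: "(\<lambda>w. inverse (f w)) analytic_on {z}" using inverse_analytic_at[OF mero D(2)] True by blast
    obtain U K where U: "open U" "z \<in> U" "\<And>w. w \<in> U \<Longrightarrow> norm (deriv (\<lambda>w. inverse (f w)) w) powr (1 / (1 + \<alpha>)) \<le> K"
      using bd[OF an, of "1 / (1 + \<alpha>)"] \<alpha> by auto
    have "eventually (\<lambda>w. f w \<noteq> 0) (at z)" using non_zero_neighbour_pole[OF True] .
    then obtain S where S: "open S" "z \<in> S" "\<And>w. w \<in> S \<Longrightarrow> w \<noteq> z \<Longrightarrow> f w \<noteq> 0"
      unfolding eventually_at_topological by blast
    show ?thesis
    proof (rule that[of "U \<inter> S" K])
      show "density \<alpha> f w \<le> K" if "w \<in> U \<inter> S" for w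
        using U(3)[of w] that S(3)[of w] True by (cases "w = z") (auto simp: density_def Let_def)
    qed (use U S in auto)
  qed
qed

lemma locally_bounded_imp_bounded_on_compact:
  fixes h :: "'a :: topological_space \<Rightarrow> real"
  assumes K: "compact K" and h: "\<And>z. z \<in> K \<Longrightarrow> \<exists>U M. open U \<and> z \<in> U \<and> (\<forall>w\<in>U. h w \<le> M)"
  obtains B where "\<And>z. z \<in> K \<Longrightarrow> h z \<le> B"
proof -
  obtain U M where UM: "\<And>z. z \<in> K \<Longrightarrow> open (U z)" "\<And>z. z \<in> K \<Longrightarrow> z \<in> U z"
      "\<And>z w. z \<in> K \<Longrightarrow> w \<in> U z \<Longrightarrow> h w \<le> M z"
    using h by metis
  obtain C where C: "C \<subseteq> K" "finite C" "K \<subseteq> (\<Union>c\<in>C. U c)"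
    by (rule compactE_image[OF K, of K U]) (use UM in auto)
  show ?thesis
  proof (rule that[of "Max (M ` C)"])
    fix z assume "z \<in> K"
    then obtain c where "c \<in> C" "z \<in> U c" using C(3) by blast
    then have "h z \<le> M c" using UM(3) C(1) by blast
    also have "M c \<le> Max (M ` C)" using \<open>c \<in> C\<close> C(2) by (intro Max_ge) auto
    finally show "h z \<le> Max (M ` C)" .
  qed
qed

text \<open>The weight 2 r - |w - z0| vanishes on the boundary, so a point z nearly maximizing
  weight times h stays inside. As h need not be continuous, the supremum is only approached up to a
  factor 2. Within half the distance of z to the boundary the weight drops by at most another factor
  2, whence h <= 4 h z there.\<close>

lemma rescaling_point:
  fixes z0 :: complex and h :: "complex \<Rightarrow> real"
  assumes r: "r > 0" and L: "L > 0" and h0: "\<And>w. h w \<ge> 0" and B: "\<And>w. w \<in> cball z0 (2 * r) \<Longrightarrow> h w \<le> B"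
    and x: "x \<in> cball z0 r" "h x \<ge> L"
  obtains z \<rho> R where "\<rho> > 0" "\<rho> * h z = 1" "R \<ge> r * L / 4" "\<rho> \<le> 4 / L"
    "\<And>w. dist z w < \<rho> * R \<Longrightarrow> w \<in> cball z0 (2 * r) \<and> \<rho> * h w \<le> 4"
proof -
  define F where "F = (\<lambda>w. (2 * r - dist z0 w) * h w)"
  define S where "S = Sup (F ` cball z0 (2 * r))"
  have "F w \<le> 2 * r * B" if "w \<in> cball z0 (2 * r)" for w
    unfolding F_def using that h0[of w] B[OF that] r by (intro mult_mono) auto
  then have bdd: "bdd_above (F ` cball z0 (2 * r))" by (rule bdd_aboveI2)
  have le: "F w \<le> S" if "w \<in> cball z0 (2 * r)" for w
    unfolding S_def using that bdd by (intro cSup_upper) auto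
  have "r * L \<le> F x" unfolding F_def using x r L by (intro mult_mono) auto
  also have "F x \<le> S" using x r by (intro le) auto
  finally have S: "r * L \<le> S" .
  then have Spos: "S > 0" using mult_pos_pos[OF r L] by linarith
  have "S / 2 < Sup (F ` cball z0 (2 * r))" using Spos by (simp add: S_def)
  moreover have "F ` cball z0 (2 * r) \<noteq> {}" using r by simp
  ultimately have "\<exists>y\<in>F ` cball z0 (2 * r). S / 2 < y" using less_cSup_iff[OF _ bdd] by blast
  then obtain z where z: "z \<in> cball z0 (2 * r)" "S / 2 < F z" by blast
  define d where "d = 2 * r - dist z0 z"
  have dh: "S / 2 < d * h z" using z(2) by (simp add: F_def d_def)
  have d0: "d \<ge> 0" "d \<le> 2 * r" using z(1) by (auto simp: d_def)
  have d: "d > 0" using d0 dh Spos by (cases "d = 0") auto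
  have hz: "h z > 0" using dh Spos d h0[of z] by (cases "h z = 0") auto
  show ?thesis
  proof (rule that[of "1 / h z" z "d * h z / 2"])
    show "d * h z / 2 \<ge> r * L / 4" using dh S by linarith
    have "r * L / 2 < d * h z" using dh S by linarith
    also have "\<dots> \<le> 2 * r * h z" using d0 hz by (intro mult_right_mono) auto
    finally have "L / 4 \<le> h z" using r by (simp add: field_simps)
    then show "1 / h z \<le> 4 / L" using L hz by (simp add: field_simps)
    fix w assume "dist z w < 1 / h z * (d * h z / 2)"
    then have w: "dist z w < d / 2" using hz by simp
    have tri: "dist z0 w \<le> dist z0 z + dist z w" by (rule dist_triangle)
    have dw: "2 * r - dist z0 w \<ge> d / 2" using tri w d_def by linarith
    then have wc: "w \<in> cball z0 (2 * r)" using d by simp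
    have "d / 2 * h w \<le> F w" unfolding F_def using dw h0 by (intro mult_right_mono) auto
    also have "\<dots> \<le> S" by (rule le[OF wc])
    also have "\<dots> \<le> 2 * (d * h z)" using dh by simp
    finally have "d * h w \<le> d * (4 * h z)" by simp
    then have "h w \<le> 4 * h z" using d by simp
    then show "w \<in> cball z0 (2 * r) \<and> 1 / h z * h w \<le> 4" using wc hz by (simp add: field_simps)
  qed (use hz in auto)
qed

lemma density_nonneg: "density \<alpha> f z \<ge> 0"
  by (auto simp: density_def Let_def)

text \<open>The sufficient half of Marty's criterion, with the density in place of the spherical
  derivative.\<close>

theorem normal_of_density_bounded:
  assumes D: "open D" "connected D" "D \<noteq> {}" and \<alpha>: "0 \<le> \<alpha>" "\<alpha> < 1"
    and mero: "\<And>f. f \<in> \<F> \<Longrightarrow> f nicely_meromorphic_on D"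
    and bd: "\<And>z. z \<in> D \<Longrightarrow> \<exists>r>0. ball z r \<subseteq> D \<and> (\<exists>K. \<forall>f\<in>\<F>. \<forall>w\<in>ball z r. density \<alpha> f w \<le> K)"
  shows "normal_family_on \<F> D"
  unfolding normal_family_on_def
proof (intro allI impI)
  fix f :: "nat \<Rightarrow> complex \<Rightarrow> complex" assume "range f \<subseteq> \<F>"
  then have f: "f v \<in> \<F>" for v by auto
  have "\<exists>\<delta>>0. ball z \<delta> \<subseteq> D \<and> (\<forall>v. tame \<delta> (f v) z \<or> tame_inv \<delta> (f v) z)" if z: "z \<in> D" for z
  proof -
    obtain r K where rK: "r > 0" "ball z r \<subseteq> D" "\<And>f w. f \<in> \<F> \<Longrightarrow> w \<in> ball z r \<Longrightarrow> density \<alpha> f w \<le> K"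
      using bd[OF z] by blast
    define K1 where "K1 = max (K powr (1 - \<alpha>)) (K powr (1 + \<alpha>))"
    define \<delta> where "\<delta> = min r (1 / (8 * (K1 + 1)))"
    have K1: "K1 \<ge> 0" by (simp add: K1_def le_max_iff_disj)
    then have \<delta>: "0 < \<delta>" "\<delta> \<le> r" using rK(1) by (auto simp: \<delta>_def)
    have "8 * K1 * \<delta> \<le> 8 * K1 * (1 / (8 * (K1 + 1)))" using K1 by (intro mult_left_mono) (auto simp: \<delta>_def)
    also have "\<dots> \<le> 1" using K1 by (simp add: field_simps)
    finally have d: "8 * K1 * \<delta> \<le> 1" .
    have "tame \<delta> (f v) z \<or> tame_inv \<delta> (f v) z" for v
    proof (rule tame_of_density_bound[OF \<alpha> nicely_meromorphic_on_subset[OF mero[OF f] rK(2)]])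
      show "density \<alpha> (f v) w \<le> K" if "w \<in> ball z r" for w by (rule rK(3)[OF f that])
    qed (use \<delta> d in \<open>auto simp: K1_def\<close>)
    then show ?thesis using \<delta> rK(2) by (intro exI[of _ \<delta>]) auto
  qed
  then obtain \<delta> where \<delta>: "\<And>z. z \<in> D \<Longrightarrow> \<delta> z > 0" "\<And>z. z \<in> D \<Longrightarrow> ball z (\<delta> z) \<subseteq> D"
     "\<And>z v. z \<in> D \<Longrightarrow> tame (\<delta> z) (f v) z \<or> tame_inv (\<delta> z) (f v) z"
    by metis
  obtain k where k: "strict_mono (k :: nat \<Rightarrow> nat)"
    "(\<forall>z\<in>D. \<exists>c\<in>D. z \<in> ball c (\<delta> c / 2) \<and> limit_chart_inf (\<delta> c) c (f \<circ> k)) \<or>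
     (\<exists>g. g nicely_meromorphic_on D \<and>
       (\<forall>z\<in>D. \<exists>c\<in>D. z \<in> ball c (\<delta> c / 2) \<and> (limit_chart1 (\<delta> c) c (f \<circ> k) g \<or> limit_chart2 (\<delta> c) c (f \<circ> k) g)))"
  proof (rule normal_limit[where D = D and \<delta> = \<delta> and f = f, OF D \<delta>(1,2)])
    show "eventually (\<lambda>v. f v nicely_meromorphic_on ball z (\<delta> z)) sequentially" if "z \<in> D" for z
      by (intro always_eventually allI nicely_meromorphic_on_subset[OF mero[OF f] \<delta>(2)[OF that]])
    show "eventually (\<lambda>v. tame (\<delta> z) (f v) z \<or> tame_inv (\<delta> z) (f v) z) sequentially" if "z \<in> D" for z
      by (intro always_eventually allI \<delta>(3)[OF that])
  qed (assumption | rule that)+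
  have mero': "(f \<circ> k) v nicely_meromorphic_on D" for v using mero[OF f] by simp
  show "\<exists>r :: nat \<Rightarrow> nat. strict_mono r \<and>
         ((\<exists>g. g nicely_meromorphic_on D \<and>
             spherically_locally_uniform_limit D (\<lambda>v. sphere_map (f (r v))) (sphere_map g)) \<or>
          spherically_locally_uniform_limit D (\<lambda>v. sphere_map (f (r v))) (\<lambda>_. None))"
  proof (intro exI[of _ k] conjI k(1))
    from k(2) show "(\<exists>g. g nicely_meromorphic_on D \<and>
             spherically_locally_uniform_limit D (\<lambda>v. sphere_map (f (k v))) (sphere_map g)) \<or>
          spherically_locally_uniform_limit D (\<lambda>v. sphere_map (f (k v))) (\<lambda>_. None)"
    proof
      assume a: "\<forall>z\<in>D. \<exists>c\<in>D. z \<in> ball c (\<delta> c / 2) \<and> limit_chart_inf (\<delta> c) c (f \<circ> k)"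
      have "spherically_locally_uniform_limit D (\<lambda>v. sphere_map ((f \<circ> k) v)) (\<lambda>_. None)"
        by (rule spherical_limit_infinity_of_charts[OF \<delta>(1,2) mero' bspec[OF a]])
      then show ?thesis by simp
    next
      assume "\<exists>g. g nicely_meromorphic_on D \<and>
       (\<forall>z\<in>D. \<exists>c\<in>D. z \<in> ball c (\<delta> c / 2) \<and> (limit_chart1 (\<delta> c) c (f \<circ> k) g \<or> limit_chart2 (\<delta> c) c (f \<circ> k) g))"
      then obtain g where g: "g nicely_meromorphic_on D" and
        a: "\<forall>z\<in>D. \<exists>c\<in>D. z \<in> ball c (\<delta> c / 2) \<and> (limit_chart1 (\<delta> c) c (f \<circ> k) g \<or> limit_chart2 (\<delta> c) c (f \<circ> k) g)"
        by blast
      have "spherically_locally_uniform_limit D (\<lambda>v. sphere_map ((f \<circ> k) v)) (sphere_map g)"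
        by (rule spherical_limit_of_charts[OF \<delta>(1,2) mero' g bspec[OF a]])
      then show ?thesis using g by auto
    qed
  qed
qed

text \<open>By the preceding criterion the density is unbounded near some z0. For each v a function
  with density above a suitable L is rescaled at a nearly maximal point.\<close>

theorem zalcman:
  assumes D: "open D" "connected D" "D \<noteq> {}" and \<alpha>: "0 \<le> \<alpha>" "\<alpha> < 1"
    and mero: "\<And>f. f \<in> \<F> \<Longrightarrow> f nicely_meromorphic_on D"
    and nn: "\<not> normal_family_on \<F> D"
  obtains f z \<rho> G where "\<And>v :: nat. f v \<in> \<F>" "\<And>v. 0 < \<rho> v" "\<And>v. \<rho> v \<le> 1 / (real v + 1)"
    "\<And>v w. norm w < real v + 1 \<Longrightarrow> z v + of_real (\<rho> v) * w \<in> D"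
    "\<And>v w. G v w = of_real (\<rho> v powr - \<alpha>) * f v (z v + of_real (\<rho> v) * w)"
    "\<And>v. G v nicely_meromorphic_on ball 0 (real v + 1)"
    "\<And>v w. norm w < real v + 1 \<Longrightarrow> density \<alpha> (G v) w \<le> 4" "\<And>v. density \<alpha> (G v) 0 = 1"
proof -
  obtain z0 where z0: "z0 \<in> D" "\<And>r. r > 0 \<Longrightarrow> ball z0 r \<subseteq> D \<Longrightarrow> \<not> (\<exists>K. \<forall>f\<in>\<F>. \<forall>w\<in>ball z0 r. density \<alpha> f w \<le> K)"
  proof -
    have "\<exists>z\<in>D. \<not> (\<exists>r>0. ball z r \<subseteq> D \<and> (\<exists>K. \<forall>f\<in>\<F>. \<forall>w\<in>ball z r. density \<alpha> f w \<le> K))"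
    proof (rule ccontr)
      assume "\<not> ?thesis"
      then have *: "\<And>z. z \<in> D \<Longrightarrow> \<exists>r>0. ball z r \<subseteq> D \<and> (\<exists>K. \<forall>f\<in>\<F>. \<forall>w\<in>ball z r. density \<alpha> f w \<le> K)" by blast
      show False by (rule nn[THEN notE], rule normal_of_density_bounded[OF D \<alpha> mero *])
    qed
    then obtain z where "z \<in> D" "\<not> (\<exists>r>0. ball z r \<subseteq> D \<and> (\<exists>K. \<forall>f\<in>\<F>. \<forall>w\<in>ball z r. density \<alpha> f w \<le> K))"
      by (rule bexE)
    then show ?thesis by (intro that[of z]) auto
  qed
  obtain e where e: "e > 0" "cball z0 e \<subseteq> D" using D(1) z0(1) open_contains_cball by blast
  define r where "r = e / 2"
  have r: "r > 0" "cball z0 (2 * r) \<subseteq> D" "ball z0 r \<subseteq> D" using e ball_subset_cball[of z0 r] by (auto simp: r_def subset_iff)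
  have main: "\<exists>f z \<rho>. f \<in> \<F> \<and> 0 < \<rho> \<and> \<rho> \<le> 1 / (real v + 1) \<and>
    (\<forall>w. norm w < real v + 1 \<longrightarrow> z + of_real \<rho> * w \<in> D \<and> \<rho> * density \<alpha> f (z + of_real \<rho> * w) \<le> 4) \<and> \<rho> * density \<alpha> f z = 1"
    for v
  proof -
    \<comment> \<open>The first summand makes the radius r L / 4 at least v + 1, the second makes
      \<open>\<rho>\<close> <= 4 / L at most 1 / (v + 1).\<close>
    define L where "L = 4 * (real v + 1) / r + 4 * (real v + 1)"
    have L: "L > 0" "r * L / 4 \<ge> real v + 1" "4 / L \<le> 1 / (real v + 1)"
    proof -
      have a: "4 * (real v + 1) / r > 0" using r(1) by simp
      show L0: "L > 0" using a by (simp add: L_def add_pos_pos)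
      have "r * L / 4 = (real v + 1) + r * (real v + 1)" using r(1) by (simp add: L_def field_simps)
      then show "r * L / 4 \<ge> real v + 1" using r(1) by simp
      have "L \<ge> 4 * (real v + 1)" using a by (simp add: L_def)
      then show "4 / L \<le> 1 / (real v + 1)" using L0 by (simp add: divide_simps)
    qed
    obtain f x where fx: "f \<in> \<F>" "x \<in> ball z0 r" "density \<alpha> f x > L"
    proof -
      have "\<not> (\<forall>f\<in>\<F>. \<forall>w\<in>ball z0 r. density \<alpha> f w \<le> L)" using z0(2)[OF r(1,3)] by blast
      then show ?thesis using that by (auto simp: not_le)
    qed
    obtain B where B: "\<And>w. w \<in> cball z0 (2 * r) \<Longrightarrow> density \<alpha> f w \<le> B"
    proof (rule locally_bounded_imp_bounded_on_compact[of "cball z0 (2 * r)" "density \<alpha> f"])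
      fix z assume "z \<in> cball z0 (2 * r)"
      then have "z \<in> D" using r by blast
      then obtain U K where "open U" "z \<in> U" "\<And>w. w \<in> U \<Longrightarrow> density \<alpha> f w \<le> K"
        by (rule density_locally_bounded[OF D(1) _ mero[OF fx(1)] \<alpha>]) (rule that)
      then show "\<exists>U M. open U \<and> z \<in> U \<and> (\<forall>w\<in>U. density \<alpha> f w \<le> M)" by blast
    qed (use that in auto)
    obtain z \<rho> R where zr: "\<rho> > 0" "\<rho> * density \<alpha> f z = 1" "R \<ge> r * L / 4" "\<rho> \<le> 4 / L"
      "\<And>w. dist z w < \<rho> * R \<Longrightarrow> w \<in> cball z0 (2 * r) \<and> \<rho> * density \<alpha> f w \<le> 4"
      by (rule rescaling_point[OF r(1) L(1), of "density \<alpha> f" z0 B x])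
        (use fx B density_nonneg in \<open>auto intro: that\<close>)
    have "z + of_real \<rho> * w \<in> D \<and> \<rho> * density \<alpha> f (z + of_real \<rho> * w) \<le> 4" if "norm w < real v + 1" for w
    proof -
      have "norm w < R" using that L(2) zr(3) by linarith
      then have "\<rho> * norm w < \<rho> * R" using zr(1) by simp
      then have "dist z (z + of_real \<rho> * w) < \<rho> * R" using zr(1) by (simp add: dist_norm norm_mult)
      from zr(5)[OF this] show ?thesis using r(2) by blast
    qed
    moreover have "\<rho> \<le> 1 / (real v + 1)" using zr(4) L(3) by linarith
    ultimately show ?thesis using fx(1) zr(1,2) by blast
  qed
  obtain f z \<rho> where f: "\<And>v. f v \<in> \<F>" "\<And>v. 0 < \<rho> v" "\<And>v. \<rho> v \<le> 1 / (real v + 1)"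
    "\<And>v w. norm w < real v + 1 \<Longrightarrow> z v + of_real (\<rho> v) * w \<in> D"
    "\<And>v w. norm w < real v + 1 \<Longrightarrow> \<rho> v * density \<alpha> (f v) (z v + of_real (\<rho> v) * w) \<le> 4"
    "\<And>v. \<rho> v * density \<alpha> (f v) (z v) = 1"
    using main by metis
  define G where "G = (\<lambda>v w. of_real (\<rho> v powr - \<alpha>) * f v (z v + of_real (\<rho> v) * w))"
  have dG: "density \<alpha> (G v) w = \<rho> v * density \<alpha> (f v) (z v + of_real (\<rho> v) * w)" if "norm w < real v + 1" for v w
    unfolding G_def by (rule density_rescale[OF f(2) \<alpha> mero[OF f(1)] f(4)[OF that]])
  show ?thesis
  proof (rule that[of f \<rho> z G, OF f(1-4)])
    show "G v w = of_real (\<rho> v powr - \<alpha>) * f v (z v + of_real (\<rho> v) * w)" for v w by (simp add: G_def)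
    show "density \<alpha> (G v) w \<le> 4" if "norm w < real v + 1" for v w using dG[OF that] f(5)[OF that] by simp
    show "density \<alpha> (G v) 0 = 1" for v using dG[of 0 v] f(6)[of v] by simp
    show "G v nicely_meromorphic_on ball 0 (real v + 1)" for v
      unfolding G_def
    proof (rule nicely_meromorphic_on_cmult_left)
      have fm: "f v nicely_meromorphic_on D" by (rule mero[OF f(1)])
      show "(\<lambda>w. f v (z v + of_real (\<rho> v) * w)) nicely_meromorphic_on ball 0 (real v + 1)"
        unfolding nicely_meromorphic_on_def
      proof (intro conjI ballI)
        show "(\<lambda>w. f v (z v + of_real (\<rho> v) * w)) meromorphic_on ball 0 (real v + 1)"
          by (rule meromorphic_on_compose[of "f v" D])
            (use fm f(4)[of _ v] in \<open>auto simp: nicely_meromorphic_on_def intro!: analytic_intros\<close>)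
        fix w :: complex assume "w \<in> ball 0 (real v + 1)"
        then have p: "z v + of_real (\<rho> v) * w \<in> D" using f(4) by simp
        have "is_pole (f v) (z v + of_real (\<rho> v) * w) \<and> f v (z v + of_real (\<rho> v) * w) = 0
           \<or> f v analytic_on {z v + of_real (\<rho> v) * w}"
          using nicely_meromorphic_on_imp_analytic_at[OF fm p] is_pole_zero_at_nicely_mero[OF fm _ p] by blast
        then show "is_pole (\<lambda>w. f v (z v + of_real (\<rho> v) * w)) w \<and> f v (z v + of_real (\<rho> v) * w) = 0 \<or>
            (\<lambda>w. f v (z v + of_real (\<rho> v) * w)) \<midarrow>w\<rightarrow> f v (z v + of_real (\<rho> v) * w)"
        proof (elim disj_forward)
          assume "f v analytic_on {z v + of_real (\<rho> v) * w}"
          then have "isCont (f v) (z v + of_real (\<rho> v) * w)" by (rule analytic_at_imp_isCont)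
          then have "isCont (\<lambda>w. f v (z v + of_real (\<rho> v) * w)) w" by (rule isCont_o2[rotated]) (intro continuous_intros)
          then show "(\<lambda>w. f v (z v + of_real (\<rho> v) * w)) \<midarrow>w\<rightarrow> f v (z v + of_real (\<rho> v) * w)" by (simp add: isCont_def)
        qed (simp add: is_pole_affine[OF f(2)])
      qed
    qed
  qed
qed

section \<open>The limit function\<close>

lemma uniform_limit_deriv:
  fixes F :: "nat \<Rightarrow> complex \<Rightarrow> complex"
  assumes lim: "uniform_limit (ball \<zeta> s) F g sequentially" and hol: "eventually (\<lambda>v. F v holomorphic_on ball \<zeta> s) sequentially"
    and g: "g holomorphic_on ball \<zeta> s" and r: "r < s"
  shows "uniform_limit (ball \<zeta> r) (\<lambda>v. deriv (F v)) (deriv g) sequentially"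
proof (rule uniform_limitI)
  fix e :: real assume e: "e > 0"
  define e' where "e' = e * (s - r) / 4"
  have e': "e' > 0" using e r by (simp add: e'_def)
  have "2 * e' / (s - r) = e / 2" using r by (simp add: e'_def field_simps)
  then have e2: "2 * e' / (s - r) < e" using e by simp
  from uniform_limitD[OF lim e'] hol
  show "eventually (\<lambda>v. \<forall>w\<in>ball \<zeta> r. dist (deriv (F v) w) (deriv g w) < e) sequentially"
  proof eventually_elim
    case (elim v)
    show ?case
    proof
      fix w assume w: "w \<in> ball \<zeta> r"
      have ws: "w \<in> ball \<zeta> s" using w r by simp
      have "norm (deriv (\<lambda>w. F v w - g w) w) \<le> 2 * e' / (s - r)"
      proof (rule norm_deriv_le_of_ball[OF _ _ r w])
        show "(\<lambda>w. F v w - g w) holomorphic_on ball \<zeta> s" by (intro holomorphic_intros elim(2) g)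
        show "norm (F v x - g x) \<le> e'" if "x \<in> ball \<zeta> s" for x
          using elim(1) that by (simp add: dist_norm less_imp_le)
      qed
      also have "deriv (\<lambda>w. F v w - g w) w = deriv (F v) w - deriv g w"
        using elim(2) g ws by (intro deriv_diff holomorphic_on_imp_differentiable_at[OF _ open_ball])
      finally show "dist (deriv (F v) w) (deriv g w) < e" using e2 by (simp add: dist_norm)
    qed
  qed
qed

lemma uniform_limit_higher_deriv:
  fixes F :: "nat \<Rightarrow> complex \<Rightarrow> complex"
  assumes lim: "uniform_limit (ball \<zeta> s) F g sequentially" and hol: "eventually (\<lambda>v. F v holomorphic_on ball \<zeta> s) sequentially"
    and g: "g holomorphic_on ball \<zeta> s" and r: "r < s"
  shows "uniform_limit (ball \<zeta> r) (\<lambda>v. (deriv ^^ q) (F v)) ((deriv ^^ q) g) sequentially"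
  using r
proof (induction q arbitrary: r)
  case 0
  have "ball \<zeta> r \<subseteq> ball \<zeta> s" using 0 by (intro subset_ball) simp
  then show ?case using uniform_limit_on_subset[OF lim] by simp
next
  case (Suc q)
  define r' where "r' = (r + s) / 2"
  have r': "r < r'" "r' < s" using Suc.prems by (auto simp: r'_def)
  have sub: "ball \<zeta> r' \<subseteq> ball \<zeta> s" using r' by (intro subset_ball) simp
  have h: "(deriv ^^ q) f holomorphic_on ball \<zeta> r'" if "f holomorphic_on ball \<zeta> s" for f
    by (rule holomorphic_on_subset[OF holomorphic_higher_deriv[OF that open_ball] sub])
  have "eventually (\<lambda>v. (deriv ^^ q) (F v) holomorphic_on ball \<zeta> r') sequentially"
    using hol by (rule eventually_mono) (rule h)
  from uniform_limit_deriv[OF Suc.IH[OF r'(2)] this h[OF g] r'(1)] show ?case by simp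
qed

lemma uniform_limit_power_bounded:
  fixes F :: "nat \<Rightarrow> complex \<Rightarrow> complex"
  assumes "uniform_limit S F g sequentially" "bounded (g ` S)"
  shows "uniform_limit S (\<lambda>v w. F v w ^ q) (\<lambda>w. g w ^ q) sequentially \<and> bounded ((\<lambda>w. g w ^ q) ` S)"
proof -
  obtain B where B: "\<And>w. w \<in> S \<Longrightarrow> norm (g w) \<le> B" using assms(2) by (auto simp: bounded_iff)
  have bd: "bounded ((\<lambda>w. g w ^ q) ` S)" for q
    unfolding bounded_iff using B by (intro exI[of _ "B ^ q"]) (auto simp: norm_power intro!: power_mono)
  have "uniform_limit S (\<lambda>v w. F v w ^ q) (\<lambda>w. g w ^ q) sequentially"
  proof (induction q)
    case (Suc q)
    show ?case using uniform_lim_mult[OF assms(1) Suc assms(2) bd] by simp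
  qed (auto intro!: uniform_limitI)
  then show ?thesis using bd by blast
qed

lemma uniform_limit_prod_bounded:
  fixes F :: "'i \<Rightarrow> nat \<Rightarrow> complex \<Rightarrow> complex"
  assumes "finite J" "\<And>j. j \<in> J \<Longrightarrow> uniform_limit S (F j) (g j) sequentially \<and> bounded (g j ` S)"
  shows "uniform_limit S (\<lambda>v w. \<Prod>j\<in>J. F j v w) (\<lambda>w. \<Prod>j\<in>J. g j w) sequentially \<and> bounded ((\<lambda>w. \<Prod>j\<in>J. g j w) ` S)"
  using assms
proof (induction J rule: finite_induct)
  case empty
  have "bounded ((\<lambda>_. 1 :: complex) ` S)" by (rule finite_imp_bounded) (rule finite_subset[of _ "{1}"], auto)
  then show ?case by (auto intro!: uniform_limitI)
next
  case (insert j J)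
  have a: "uniform_limit S (F j) (g j) sequentially" "bounded (g j ` S)" using insert.prems by auto
  have b: "uniform_limit S (\<lambda>v w. \<Prod>j\<in>J. F j v w) (\<lambda>w. \<Prod>j\<in>J. g j w) sequentially" "bounded ((\<lambda>w. \<Prod>j\<in>J. g j w) ` S)"
    using insert by auto
  obtain B1 B2 where B: "\<And>w. w \<in> S \<Longrightarrow> norm (g j w) \<le> B1" "\<And>w. w \<in> S \<Longrightarrow> norm (\<Prod>j\<in>J. g j w) \<le> B2"
    using a(2) b(2) unfolding bounded_iff by blast
  have "norm (g j w * (\<Prod>j\<in>J. g j w)) \<le> B1 * B2" if "w \<in> S" for w
    unfolding norm_mult using B[OF that] by (intro mult_mono) (auto intro: order_trans[OF norm_ge_zero])
  then have "bounded ((\<lambda>w. g j w * (\<Prod>j\<in>J. g j w)) ` S)" unfolding bounded_iff by blast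
  then show ?case using uniform_lim_mult[OF a(1) b(1) a(2) b(2)] insert.hyps by simp
qed

lemma uniform_limit_diff_monomial:
  fixes F :: "nat \<Rightarrow> complex \<Rightarrow> complex"
  assumes lim: "uniform_limit (ball \<zeta> s) F g sequentially" and hol: "eventually (\<lambda>v. F v holomorphic_on ball \<zeta> s) sequentially"
    and g: "g holomorphic_on ball \<zeta> s" "bounded (g ` ball \<zeta> s)" and r: "r < s"
  shows "uniform_limit (ball \<zeta> r) (\<lambda>v. diff_monomial n k m t (F v)) (diff_monomial n k m t g) sequentially"
proof -
  have sub: "cball \<zeta> r \<subseteq> ball \<zeta> s" "ball \<zeta> r \<subseteq> cball \<zeta> r" using r by auto
  have bd: "bounded (h ` ball \<zeta> r)" if "h holomorphic_on ball \<zeta> s" for h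
  proof -
    have "continuous_on (cball \<zeta> r) h"
      by (rule holomorphic_on_imp_continuous_on[OF holomorphic_on_subset[OF that sub(1)]])
    then have "compact (h ` cball \<zeta> r)" by (rule compact_continuous_image) simp
    then show ?thesis using bounded_subset[OF compact_imp_bounded image_mono[OF sub(2)]] by blast
  qed
  have pw: "uniform_limit (ball \<zeta> s) (\<lambda>v w. F v w ^ q) (\<lambda>w. g w ^ q) sequentially" for q
    using uniform_limit_power_bounded[OF lim g(2)] by blast
  have holp: "eventually (\<lambda>v. (\<lambda>w. F v w ^ q) holomorphic_on ball \<zeta> s) sequentially" for q
    using hol by (rule eventually_mono) (intro holomorphic_intros)
  have gp: "(\<lambda>w. g w ^ q) holomorphic_on ball \<zeta> s" for q by (intro holomorphic_intros g)
  have gd: "(deriv ^^ i) (\<lambda>w. g w ^ q) holomorphic_on ball \<zeta> s" for i q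
    by (rule holomorphic_higher_deriv[OF gp open_ball])
  have P: "uniform_limit (ball \<zeta> r) (\<lambda>v w. \<Prod>j=1..k. (deriv ^^ t j) (\<lambda>w. F v w ^ m j) w) (\<lambda>w. \<Prod>j=1..k. (deriv ^^ t j) (\<lambda>w. g w ^ m j) w) sequentially
      \<and> bounded ((\<lambda>w. \<Prod>j=1..k. (deriv ^^ t j) (\<lambda>w. g w ^ m j) w) ` ball \<zeta> r)"
    by (intro uniform_limit_prod_bounded finite_atLeastAtMost conjI bd[OF gd] uniform_limit_higher_deriv[OF pw holp gp r])
  have Q: "uniform_limit (ball \<zeta> r) (\<lambda>v w. F v w ^ n) (\<lambda>w. g w ^ n) sequentially"
    by (rule uniform_limit_on_subset[OF pw]) (use sub in blast)
  show ?thesis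
    unfolding diff_monomial_def[abs_def]
    using uniform_lim_mult[OF Q conjunct1[OF P] bd[OF gp] conjunct2[OF P]] .
qed

text \<open>In the chart 1/g the limit is nonzero at the given point, hence bounded away from 0 on a
  small disc, and so eventually are the approximating functions. Inversion then preserves uniform
  convergence.\<close>

lemma uniform_limit_near_nonpole:
  assumes l: "limit_chart1 \<delta> c F g \<or> limit_chart2 \<delta> c F g" and z: "\<zeta> \<in> ball c \<delta>" "\<not> is_pole g \<zeta>"
  obtains s where "s > 0" "uniform_limit (ball \<zeta> s) F g sequentially"
    "eventually (\<lambda>v. F v holomorphic_on ball \<zeta> s) sequentially" "g holomorphic_on ball \<zeta> s" "bounded (g ` ball \<zeta> s)"
proof -
  obtain s where s: "s > 0" "cball \<zeta> s \<subseteq> ball c \<delta>" using z(1) open_ball open_contains_cball by blast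
  have sub: "ball \<zeta> s \<subseteq> ball c \<delta>" using s(2) ball_subset_cball by blast
  from l show ?thesis
  proof
    assume l1: "limit_chart1 \<delta> c F g"
    show ?thesis
    proof (rule that[OF s(1)])
      have "uniform_limit (cball \<zeta> s) F g sequentially" using l1 s(2) by (simp add: limit_chart1_def chart_limit_def)
      then show "uniform_limit (ball \<zeta> s) F g sequentially" by (rule uniform_limit_on_subset) auto
      have "eventually (\<lambda>v. tame \<delta> (F v) c) sequentially" using l1 by (simp add: limit_chart1_def)
      then show "eventually (\<lambda>v. F v holomorphic_on ball \<zeta> s) sequentially"
        by (rule eventually_mono) (use holomorphic_on_subset[OF _ sub] in \<open>simp add: tame_def\<close>)
      have tg: "tame \<delta> g c" using l1 by (simp add: limit_chart1_def)
      then show "g holomorphic_on ball \<zeta> s" using holomorphic_on_subset[OF _ sub] by (simp add: tame_def)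
      have "norm (g w) \<le> 2" if "w \<in> ball \<zeta> s" for w using tg that sub unfolding tame_def by blast
      then show "bounded (g ` ball \<zeta> s)" unfolding bounded_iff by blast
    qed
  next
    assume l2: "limit_chart2 \<delta> c F g"
    have tg: "tame_inv \<delta> g c" using l2 by (simp add: limit_chart2_def)
    define \<phi> where "\<phi> = (\<lambda>w. inverse (g w))"
    have \<phi>: "\<phi> holomorphic_on ball c \<delta>" using tg by (simp add: tame_inv_def tame_def \<phi>_def)
    have "g \<zeta> \<noteq> 0" using tg z unfolding tame_inv_def by blast
    then have nz: "norm (\<phi> \<zeta>) > 0" by (simp add: \<phi>_def)
    define \<epsilon> where "\<epsilon> = norm (\<phi> \<zeta>) / 2"
    have \<epsilon>: "\<epsilon> > 0" "\<epsilon> < norm (\<phi> \<zeta>)" using nz by (auto simp: \<epsilon>_def)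
    have "isCont \<phi> \<zeta>" by (rule isCont_holomorphic[OF \<phi> open_ball z(1)])
    then have "((\<lambda>w. norm (\<phi> w)) \<longlongrightarrow> norm (\<phi> \<zeta>)) (at \<zeta>)" by (intro tendsto_norm) (simp add: isCont_def)
    then have "eventually (\<lambda>w. \<epsilon> < norm (\<phi> w)) (at \<zeta>)" using \<epsilon>(2) by (rule order_tendstoD)
    then obtain d where d: "d > 0" "\<And>w. w \<noteq> \<zeta> \<Longrightarrow> dist w \<zeta> < d \<Longrightarrow> \<epsilon> < norm (\<phi> w)"
      unfolding eventually_at by auto
    define s' where "s' = min s d"
    have s': "s' > 0" using s d by (simp add: s'_def)
    have sub': "ball \<zeta> s' \<subseteq> ball \<zeta> s" by (rule subset_ball) (simp add: s'_def)
    have big: "\<epsilon> \<le> norm (\<phi> w)" if "w \<in> ball \<zeta> s'" for w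
      using that d(2)[of w] \<epsilon>(2) by (cases "w = \<zeta>") (auto simp: s'_def dist_commute)
    have "uniform_limit (cball \<zeta> s) (\<lambda>v w. inverse (F v w)) \<phi> sequentially"
      using l2 s(2) by (simp add: limit_chart2_def chart_limit_def \<phi>_def)
    then have lim: "uniform_limit (ball \<zeta> s') (\<lambda>v w. inverse (F v w)) \<phi> sequentially"
      by (rule uniform_limit_on_subset) (use sub' ball_subset_cball in blast)
    show ?thesis
    proof (rule that[OF s'])
      show "uniform_limit (ball \<zeta> s') F g sequentially"
        using uniform_lim_inverse[OF lim big \<epsilon>(1)] by (simp add: \<phi>_def o_def)
      have "eventually (\<lambda>v. \<forall>w\<in>ball \<zeta> s'. dist (inverse (F v w)) (\<phi> w) < \<epsilon>) sequentially"
        by (rule uniform_limitD[OF lim \<epsilon>(1)])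
      moreover have "eventually (\<lambda>v. tame_inv \<delta> (F v) c) sequentially" using l2 by (simp add: limit_chart2_def)
      ultimately show "eventually (\<lambda>v. F v holomorphic_on ball \<zeta> s') sequentially"
      proof eventually_elim
        case (elim v)
        have "inverse (F v w) \<noteq> 0" if w: "w \<in> ball \<zeta> s'" for w
        proof
          assume "inverse (F v w) = 0"
          then show False using elim(1) big[OF w] w by (force simp: dist_norm)
        qed
        moreover have "(\<lambda>w. inverse (F v w)) holomorphic_on ball \<zeta> s'"
          using elim(2) holomorphic_on_subset[of _ "ball c \<delta>"] sub sub' unfolding tame_inv_def tame_def by blast
        ultimately have "(\<lambda>w. inverse (inverse (F v w))) holomorphic_on ball \<zeta> s'" by (rule holomorphic_on_inverse[rotated])
        then show ?case by simp
      qed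
      have "\<phi> holomorphic_on ball \<zeta> s'" by (rule holomorphic_on_subset[OF \<phi>]) (use sub sub' in blast)
      moreover have "\<phi> w \<noteq> 0" if "w \<in> ball \<zeta> s'" for w using big[OF that] \<epsilon>(1) by auto
      ultimately have "(\<lambda>w. inverse (\<phi> w)) holomorphic_on ball \<zeta> s'" by (rule holomorphic_on_inverse)
      then show "g holomorphic_on ball \<zeta> s'" by (simp add: \<phi>_def)
      have "norm (g w) \<le> inverse \<epsilon>" if "w \<in> ball \<zeta> s'" for w
        using le_imp_inverse_le[OF big[OF that] \<epsilon>(1)] by (simp add: \<phi>_def norm_inverse)
      then show "bounded (g ` ball \<zeta> s')" unfolding bounded_iff by blast
    qed
  qed
qed

section \<open>Properties inherited by the limit\<close>

lemma Hurwitz_eventually: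
  fixes F :: "nat \<Rightarrow> complex \<Rightarrow> complex"
  assumes S: "open S" "connected S" and g: "g holomorphic_on S"
    and lim: "\<And>K. compact K \<Longrightarrow> K \<subseteq> S \<Longrightarrow> uniform_limit K F g sequentially"
    and F: "eventually (\<lambda>v. F v holomorphic_on S \<and> (\<forall>w\<in>S. F v w \<noteq> 0)) sequentially"
    and z: "z \<in> S" "g z = 0" and w: "w \<in> S"
  shows "g w = 0"
proof (rule ccontr)
  assume "g w \<noteq> 0"
  then have nc: "\<not> g constant_on S" using z w unfolding constant_on_def by metis
  obtain M where M: "\<And>v. v \<ge> M \<Longrightarrow> F v holomorphic_on S \<and> (\<forall>w\<in>S. F v w \<noteq> 0)"
    using F unfolding eventually_sequentially by blast
  have "g z \<noteq> 0"
  proof (rule Hurwitz_no_zeros[OF S _ g _ nc _ z(1), of "\<lambda>v. F (v + M)"])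
    show "F (v + M) holomorphic_on S" for v using M by simp
    show "F (v + M) x \<noteq> 0" if "x \<in> S" for v x using M[of "v + M"] that by simp
    fix K assume K: "compact K" "K \<subseteq> S"
    have "filterlim (\<lambda>v. v + M) sequentially sequentially" by (rule filterlim_add_const_nat_at_top)
    from filterlim_compose[OF lim[OF K] this] show "uniform_limit K (\<lambda>v. F (v + M)) g sequentially" .
  qed
  then show False using z(2) by simp
qed

text \<open>Used to show that the limit is nonconstant: density 1 at the origin forces a derivative
  of modulus at least 1 there, in either chart.\<close>

lemma deriv_small_of_constant_limit:
  assumes l: "chart_limit \<delta> c F H" and hol: "eventually (\<lambda>v. F v holomorphic_on ball c \<delta>) sequentially"
    and const: "\<And>w. w \<in> ball c \<delta> \<Longrightarrow> H w = C" and z: "z \<in> ball c \<delta>"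
  shows "eventually (\<lambda>v. norm (deriv (F v) z) < 1) sequentially"
proof -
  obtain s where s: "s > 0" "cball z s \<subseteq> ball c \<delta>" using z open_ball open_contains_cball by blast
  have sub: "ball z s \<subseteq> ball c \<delta>" using s(2) ball_subset_cball by blast
  have "uniform_limit (cball z s) F H sequentially" using l s(2) by (simp add: chart_limit_def)
  then have lim: "uniform_limit (ball z s) F H sequentially" by (rule uniform_limit_on_subset) auto
  have hol': "eventually (\<lambda>v. F v holomorphic_on ball z s) sequentially"
    using hol by (rule eventually_mono) (rule holomorphic_on_subset[OF _ sub])
  have "H holomorphic_on ball z s" by (rule holomorphic_transform[of "\<lambda>_. C"]) (use const sub in auto)
  from uniform_limitD[OF uniform_limit_deriv[OF lim hol' this, of "s / 2"], of 1] s(1)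
  have "eventually (\<lambda>v. \<forall>w\<in>ball z (s / 2). dist (deriv (F v) w) (deriv H w) < 1) sequentially" by simp
  moreover have "deriv H z = deriv (\<lambda>_. C) z"
  proof (rule deriv_cong_ev)
    show "eventually (\<lambda>w. H w = C) (nhds z)"
      using eventually_nhds_in_open[OF open_ball z] by (rule eventually_mono) (rule const)
  qed simp
  then have "deriv H z = 0" by simp
  moreover have "z \<in> ball z (s / 2)" using s(1) by simp
  ultimately show ?thesis by (elim eventually_mono) (metis dist_0_norm dist_commute)
qed

lemma density_ge_1:
  assumes \<alpha>: "0 \<le> \<alpha>" "\<alpha> < 1" and d: "density \<alpha> f z \<ge> 1"
  shows "\<not> is_pole f z \<Longrightarrow> norm (deriv f z) \<ge> 1"
    and "is_pole f z \<or> f z \<noteq> 0 \<Longrightarrow> norm (deriv (\<lambda>w. inverse (f w)) z) \<ge> 1"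
proof -
  have *: "x \<ge> 1" if "x powr e \<ge> 1" "e > 0" "x \<ge> 0" for x e :: real
    using that powr_less_mono2[of e x 1] by (cases "x < 1") auto
  have D: "\<not> is_pole f z \<Longrightarrow> density \<alpha> f z \<le> norm (deriv f z) powr (1 / (1 - \<alpha>))"
    "is_pole f z \<or> f z \<noteq> 0 \<Longrightarrow> density \<alpha> f z \<le> norm (deriv (\<lambda>w. inverse (f w)) z) powr (1 / (1 + \<alpha>))"
    unfolding density_def Let_def by (simp_all only: if_False if_True min.cobounded1 min.cobounded2 order_refl split: if_split) blast+
  show "norm (deriv f z) \<ge> 1" if "\<not> is_pole f z"
    by (rule *[OF order_trans[OF d D(1)[OF that]]]) (use \<alpha> in simp_all)
  show "norm (deriv (\<lambda>w. inverse (f w)) z) \<ge> 1" if "is_pole f z \<or> f z \<noteq> 0"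
    by (rule *[OF order_trans[OF d D(2)[OF that]]]) (use \<alpha> in simp_all)
qed

text \<open>Hurwitz' theorem on a small disc about a non-pole: the limit of the zero-free functions
  P F - b is zero-free or identically 0, and the latter would make P g locally constant.\<close>

lemma (in monomial_yosida) limit_omits_value:
  assumes charts: "\<And>z. \<exists>c. z \<in> ball c \<delta> \<and> (limit_chart1 \<delta> c F g \<or> limit_chart2 \<delta> c F g)"
    and omit: "\<And>M. eventually (\<lambda>v. \<forall>w. norm w \<le> M \<longrightarrow> \<not> is_pole (F v) w \<longrightarrow> norm (F v w) \<le> M \<longrightarrow> P (F v) w \<noteq> b) sequentially"
    and z: "\<not> is_pole g z"
  shows "P g z \<noteq> b"
proof
  assume Pb: "P g z = b"
  obtain c where c: "z \<in> ball c \<delta>" "limit_chart1 \<delta> c F g \<or> limit_chart2 \<delta> c F g" using charts by blast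
  obtain s where s: "s > 0" "uniform_limit (ball z s) F g sequentially"
    "eventually (\<lambda>v. F v holomorphic_on ball z s) sequentially" "g holomorphic_on ball z s" "bounded (g ` ball z s)"
    by (rule uniform_limit_near_nonpole[OF c(2,1) z]) (rule that)
  define S where "S = ball z (s / 2)"
  have sub: "S \<subseteq> ball z s" using s(1) by (auto simp: S_def)
  have lim: "uniform_limit S (\<lambda>v. P (F v)) (P g) sequentially"
    unfolding S_def by (rule uniform_limit_diff_monomial[OF s(2-5)]) (use s(1) in simp)
  obtain B where B: "\<And>w. w \<in> ball z s \<Longrightarrow> norm (g w) \<le> B" using s(5) unfolding bounded_iff by blast
  \<comment> \<open>The omitted value is only guaranteed at bounded points where F is bounded by the
    same constant; on the small disc, F stays within 1 of g.\<close>
  define M where "M = max (norm z + s) (B + 1)"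
  have "eventually (\<lambda>v. \<forall>w\<in>ball z s. dist (F v w) (g w) < 1) sequentially" by (rule uniform_limitD[OF s(2)]) simp
  with omit[of M] s(3)
  have ev: "eventually (\<lambda>v. (\<lambda>w. P (F v) w - b) holomorphic_on S \<and> (\<forall>w\<in>S. P (F v) w - b \<noteq> 0)) sequentially"
  proof eventually_elim
    case (elim v)
    have "P (F v) holomorphic_on S" by (rule holomorphic_on_subset[OF holomorphic_diff_monomial[OF elim(2) open_ball] sub])
    then have "(\<lambda>w. P (F v) w - b) holomorphic_on S" by (intro holomorphic_intros)
    moreover have "P (F v) w \<noteq> b" if "w \<in> S" for w
    proof -
      have w: "w \<in> ball z s" using that sub by blast
      have "norm w \<le> norm z + dist z w" by (metis dist_norm norm_minus_commute norm_triangle_sub)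
      then have "norm w \<le> M" using w by (simp add: M_def)
      moreover have "norm (F v w) \<le> norm (g w) + dist (F v w) (g w)" using norm_triangle_sub[of "F v w" "g w"] by (simp add: dist_norm)
      then have "norm (F v w) \<le> M" using B[OF w] elim(3) w by (fastforce simp: M_def)
      moreover have "\<not> is_pole (F v) w" by (rule not_is_pole_holomorphic[OF open_ball w elim(2)])
      ultimately show ?thesis using elim(1) by blast
    qed
    ultimately show ?case by simp
  qed
  have gS: "g holomorphic_on S" by (rule holomorphic_on_subset[OF s(4) sub])
  have Pg: "P g w - b = 0" if "w \<in> S" for w
  proof (rule Hurwitz_eventually[where S = S and g = "\<lambda>w. P g w - b" and z = z, OF _ _ _ _ ev _ _ that])
    show "open S" "connected S" "z \<in> S" "P g z - b = 0" using s(1) Pb by (auto simp: S_def)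
    then show "(\<lambda>w. P g w - b) holomorphic_on S" by (intro holomorphic_intros holomorphic_diff_monomial gS)
    fix K assume "compact K" "K \<subseteq> S"
    then have "uniform_limit K (\<lambda>v. P (F v)) (P g) sequentially" using uniform_limit_on_subset[OF lim] by blast
    then show "uniform_limit K (\<lambda>v w. P (F v) w - b) (\<lambda>w. P g w - b) sequentially"
      by (intro uniform_limit_intros)
  qed
  show False
  proof (rule P_not_locally_constant[of S b])
    show "open S" "S \<noteq> {}" using s(1) by (auto simp: S_def)
    show "\<not> is_pole g w" if "w \<in> S" for w using not_is_pole_holomorphic[OF _ that gS] by (simp add: S_def)
    show "P g w = b" if "w \<in> S" for w using Pg[OF that] by simp
  qed
qed

text \<open>Near a pole of g the functions 1/F are eventually zero-free, so by Hurwitz' theorem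
  their limit 1/g, which vanishes at the pole, would vanish identically.\<close>

lemma (in yosida) limit_has_no_pole:
  assumes charts: "\<And>z. \<exists>c. z \<in> ball c \<delta> \<and> (limit_chart1 \<delta> c F g \<or> limit_chart2 \<delta> c F g)"
    and F: "\<And>M. eventually (\<lambda>v. \<forall>w. norm w \<le> M \<longrightarrow> \<not> is_pole (F v) w) sequentially"
  shows "\<not> is_pole g z"
proof
  assume p: "is_pole g z"
  obtain c where c: "z \<in> ball c \<delta>" "limit_chart1 \<delta> c F g \<or> limit_chart2 \<delta> c F g" using charts by blast
  have "\<not> limit_chart1 \<delta> c F g" using not_pole[OF _ c(1)] p by (auto simp: limit_chart1_def)
  then have l: "eventually (\<lambda>v. tame_inv \<delta> (F v) c) sequentially"
     "chart_limit \<delta> c (\<lambda>v w. inverse (F v w)) (\<lambda>w. inverse (g w))"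
    using c(2) by (auto simp: limit_chart2_def)
  have ev: "eventually (\<lambda>v. (\<lambda>w. inverse (F v w)) holomorphic_on ball c \<delta> \<and> (\<forall>w\<in>ball c \<delta>. inverse (F v w) \<noteq> 0)) sequentially"
    using l(1) F[of "norm c + \<delta>"]
  proof eventually_elim
    case (elim v)
    have "inverse (F v w) \<noteq> 0" if w: "w \<in> ball c \<delta>" for w
    proof -
      have "norm w \<le> norm c + dist c w" by (metis dist_norm norm_minus_commute norm_triangle_sub)
      then have "norm w \<le> norm c + \<delta>" using w by simp
      then show ?thesis using elim w unfolding tame_inv_def by auto
    qed
    then show ?case using elim(1) unfolding tame_inv_def tame_def by blast
  qed
  have "inverse (g w) = 0" if "w \<in> ball c \<delta>" for w
  proof (rule Hurwitz_eventually[where S = "ball c \<delta>" and g = "\<lambda>w. inverse (g w)" and z = z, OF _ _ _ _ ev c(1) _ that])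
    show "(\<lambda>w. inverse (g w)) holomorphic_on ball c \<delta>" using l(2) by (simp add: chart_limit_def)
    show "uniform_limit K (\<lambda>v w. inverse (F v w)) (\<lambda>w. inverse (g w)) sequentially" if "compact K" "K \<subseteq> ball c \<delta>" for K
      using l(2) that by (simp add: chart_limit_def)
    show "inverse (g z) = 0" using is_pole_zero_at_nicely_mero[OF mero p] by simp
  qed auto
  then have "eventually (\<lambda>w. g w = 0) (at z)" using eventually_at_in_open'[OF open_ball c(1)] by (auto elim: eventually_mono)
  then have "eventually (\<lambda>w. False) (at z)" using eventually_neq[of 0 z] by eventually_elim simp
  then show False by simp
qed

section \<open>Limits of rescaled non-normal families\<close>

context monomial
begin

text \<open>By invariance P f = b at the corresponding point, hence f^N = a there. If a were 0, then
  f and with it P f would vanish, as N > T, contradicting b nonzero. Otherwise G has modulus (|a| /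
  \<open>\<rho>\<close>^T)^(1/N), which becomes large as \<open>\<rho>\<close> tends to 0.\<close>

lemma rescaled_omits:
  assumes NT: "N > T" and \<alpha>: "\<alpha> = real T / real N"
    and f: "f nicely_meromorphic_on D" and b: "b \<noteq> 0" and \<rho>: "\<rho> > 0"
    and sol: "\<And>p. p \<in> D \<Longrightarrow> \<not> is_pole f p \<Longrightarrow> P f p = b \<Longrightarrow> f p ^ N = a"
    and G: "\<And>w. G w = of_real (\<rho> powr - \<alpha>) * f (z + of_real \<rho> * w)"
    and w: "z + of_real \<rho> * w \<in> D" "\<not> is_pole G w" "P G w = b"
  shows "a \<noteq> 0" "norm (G w) ^ N = norm a / \<rho> ^ T"
proof -
  define p where "p = z + of_real \<rho> * w"
  define c where "c = \<rho> powr - \<alpha>"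
  have c: "c > 0" using \<rho> by (simp add: c_def)
  have G': "G = (\<lambda>w. of_real c * f (z + of_real \<rho> * w))" by (auto simp: G c_def)
  have N: "N > 0" using NT by simp
  have "c ^ N = \<rho> powr (- real T)" using \<rho> N by (simp add: c_def \<alpha> powr_powr flip: powr_realpow)
  then have cN: "c ^ N = 1 / \<rho> ^ T" using \<rho> by (simp add: powr_minus_divide powr_realpow)
  have np: "\<not> is_pole f p" using w(2) c unfolding G' p_def by (simp add: is_pole_cmult is_pole_affine[OF \<rho>])
  then have "f analytic_on {p}" using nicely_meromorphic_on_imp_analytic_at[OF f] w(1) by (simp add: p_def)
  then obtain S where S: "open S" "p \<in> S" "f holomorphic_on S" unfolding analytic_at by blast
  have "P G w = of_real c ^ N * of_real \<rho> ^ T * P f p"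
    unfolding G' p_def N_def T_def by (rule diff_monomial_rescale[OF S(3,1)]) (use S(2) in \<open>simp add: p_def\<close>)
  also have "(of_real c :: complex) ^ N * of_real \<rho> ^ T = of_real (c ^ N * \<rho> ^ T)" by simp
  also have "c ^ N * \<rho> ^ T = 1" using \<rho> by (simp add: cN)
  finally have Pp: "P f p = b" using w(3) by simp
  then have fp: "f p ^ N = a" using sol w(1) np by (simp add: p_def)
  show "a \<noteq> 0"
  proof
    assume "a = 0"
    then have "f p = 0" using fp N by simp
    then have "P f p = 0" using P_eq_E1[OF S(3,1,2)] NT by simp
    then show False using Pp b by simp
  qed
  show "norm (G w) ^ N = norm a / \<rho> ^ T"
    using c by (simp add: G' norm_mult power_mult_distrib cN fp[symmetric] norm_power p_def[symmetric])
qed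

text \<open>The density bound 4 makes the rescaled functions uniformly tame on growing discs, so a
  subsequence converges on the plane. The normalization at 0 rules out the constant limits, infinity
  included.\<close>

theorem rescaling_limit:
  assumes NT: "N > T" and D: "open D" "connected D" "D \<noteq> {}"
    and meroF: "\<And>f. f \<in> \<F> \<Longrightarrow> f nicely_meromorphic_on D" and b: "b \<noteq> 0"
    and sol: "\<And>f p. f \<in> \<F> \<Longrightarrow> p \<in> D \<Longrightarrow> \<not> is_pole f p \<Longrightarrow> P f p = b \<Longrightarrow> f p ^ N = a"
    and nn: "\<not> normal_family_on \<F> D"
  obtains g d where "monomial_yosida n k m t g d" "\<And>z. \<not> is_pole g z \<Longrightarrow> P g z \<noteq> b"
    "(\<And>f. f \<in> \<F> \<Longrightarrow> f holomorphic_on D) \<Longrightarrow> (\<And>z. \<not> is_pole g z)"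
proof -
  define \<alpha> where "\<alpha> = real T / real N"
  have \<alpha>: "0 \<le> \<alpha>" "\<alpha> < 1" using NT by (auto simp: \<alpha>_def)
  obtain f z \<rho> G where f: "\<And>v :: nat. f v \<in> \<F>" "\<And>v. 0 < \<rho> v" "\<And>v. \<rho> v \<le> 1 / (real v + 1)"
    "\<And>v w. norm w < real v + 1 \<Longrightarrow> z v + of_real (\<rho> v) * w \<in> D"
    "\<And>v w. G v w = of_real (\<rho> v powr - \<alpha>) * f v (z v + of_real (\<rho> v) * w)"
    "\<And>v. G v nicely_meromorphic_on ball 0 (real v + 1)"
    "\<And>v w. norm w < real v + 1 \<Longrightarrow> density \<alpha> (G v) w \<le> 4" "\<And>v. density \<alpha> (G v) 0 = 1"
    by (rule zalcman[OF D \<alpha> meroF nn]) (assumption | rule that)+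
  have large: "eventually (\<lambda>v. M < real v) sequentially" for M
    using filterlim_real_sequentially by (simp add: filterlim_at_top_dense)
  define K1 where "K1 = max (4 powr (1 - \<alpha>)) (4 powr (1 + \<alpha>))"
  have K1: "K1 > 0" by (simp add: K1_def less_max_iff_disj)
  \<comment> \<open>One radius for all centres: the condition 8 K1 \<open>\<delta>\<close> <= 1 of
    \<open>tame_of_density_bound\<close>, taken with equality for density bound 4.\<close>
  define \<delta> where "\<delta> = 1 / (8 * K1)"
  have \<delta>: "\<delta> > 0" using K1 by (simp add: \<delta>_def)
  have d1: "8 * K1 * \<delta> \<le> 1" using K1 by (simp add: \<delta>_def)
  have inball: "norm w < real v + 1" if "norm x + \<delta> < real v" "w \<in> ball x \<delta>" for x w :: complex and v
  proof -
    have "norm w \<le> norm x + dist x w" by (metis dist_norm norm_minus_commute norm_triangle_sub)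
    then show ?thesis using that by simp
  qed
  have mero': "eventually (\<lambda>v. G v nicely_meromorphic_on ball x \<delta>) sequentially" for x
    using large[of "norm x + \<delta>"]
  proof eventually_elim
    case (elim v)
    show ?case by (rule nicely_meromorphic_on_subset[OF f(6)]) (use inball[OF elim] in auto)
  qed
  have tm: "eventually (\<lambda>v. tame \<delta> (G v) x \<or> tame_inv \<delta> (G v) x) sequentially" for x
    using large[of "norm x + \<delta>"] mero'[of x]
  proof eventually_elim
    case (elim v)
    show ?case
      by (rule tame_of_density_bound[OF \<alpha> elim(2) _ _ _ \<delta> order_refl d1, of 4])
        (use f(7) inball[OF elim(1)] in \<open>auto simp: K1_def\<close>)
  qed
  obtain l where l: "strict_mono (l :: nat \<Rightarrow> nat)"
    "(\<forall>z\<in>UNIV. \<exists>c\<in>UNIV. z \<in> ball c (\<delta> / 2) \<and> limit_chart_inf \<delta> c (G \<circ> l)) \<or>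
     (\<exists>g. g nicely_meromorphic_on UNIV \<and>
       (\<forall>z\<in>UNIV. \<exists>c\<in>UNIV. z \<in> ball c (\<delta> / 2) \<and> (limit_chart1 \<delta> c (G \<circ> l) g \<or> limit_chart2 \<delta> c (G \<circ> l) g)))"
  proof (rule normal_limit[where D = UNIV and \<delta> = "\<lambda>_. \<delta>" and f = G])
    show "eventually (\<lambda>v. G v nicely_meromorphic_on ball z \<delta>) sequentially" for z by (rule mero')
    show "eventually (\<lambda>v. tame \<delta> (G v) z \<or> tame_inv \<delta> (G v) z) sequentially" for z by (rule tm)
    show "connected (UNIV :: complex set)" by (rule connected_UNIV)
    fix k :: "nat \<Rightarrow> nat"
    assume "strict_mono k" "(\<forall>z\<in>UNIV. \<exists>c\<in>UNIV. z \<in> ball c (\<delta> / 2) \<and> limit_chart_inf \<delta> c (G \<circ> k)) \<or>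
     (\<exists>g. g nicely_meromorphic_on UNIV \<and>
       (\<forall>z\<in>UNIV. \<exists>c\<in>UNIV. z \<in> ball c (\<delta> / 2) \<and> (limit_chart1 \<delta> c (G \<circ> k) g \<or> limit_chart2 \<delta> c (G \<circ> k) g)))"
    then show thesis by (rule that)
  qed (simp_all add: \<delta>)
  define F where "F = G \<circ> l"
  have sub: "eventually (\<lambda>v. Q (l v)) sequentially" if "eventually Q sequentially" for Q
    using eventually_subseq[OF l(1) that] .
  \<comment> \<open>In the chart 1/F a constant limit would make the derivative of 1/F at 0 small,
    against density 1 there. Taking the constant 0 excludes the limit infinity.\<close>
  have inv_const: False
    if "z \<in> ball c \<delta>" "eventually (\<lambda>v. tame_inv \<delta> (F v) c) sequentially" "chart_limit \<delta> c (\<lambda>v w. inverse (F v w)) H"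
      "\<And>w. w \<in> ball c \<delta> \<Longrightarrow> H w = C" "z = 0" for z c H C
  proof -
    have hol: "eventually (\<lambda>v. (\<lambda>w. inverse (F v w)) holomorphic_on ball c \<delta>) sequentially"
      using that(2) by (rule eventually_mono) (simp add: tame_inv_def tame_def)
    have "eventually (\<lambda>v. norm (deriv (\<lambda>w. inverse (F v w)) z) < 1) sequentially"
      by (rule deriv_small_of_constant_limit[OF that(3) hol]) (use that in auto)
    from this that(2)
    have "eventually (\<lambda>v. False) sequentially"
    proof eventually_elim
      case (elim v)
      have np: "is_pole (F v) z \<or> F v z \<noteq> 0" using elim(2) that(1) unfolding tame_inv_def by blast
      have "density \<alpha> (F v) z \<ge> 1" using f(8)[of "l v"] that(5) by (simp add: F_def)
      from density_ge_1(2)[OF \<alpha> this np] show ?case using elim(1) by linarith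
    qed
    then show False by simp
  qed
  have ninf: "\<not> (\<exists>c. 0 \<in> ball c \<delta> \<and> limit_chart_inf \<delta> c F)"
    using inv_const[of 0 _ "\<lambda>_. 0" 0] unfolding limit_chart_inf_def by blast
  have half: "z \<in> ball c \<delta>" if "z \<in> ball c (\<delta> / 2)" for z c :: complex using that \<delta> by simp
  obtain g where g: "g nicely_meromorphic_on UNIV"
    "\<And>z. \<exists>c. z \<in> ball c (\<delta> / 2) \<and> (limit_chart1 \<delta> c F g \<or> limit_chart2 \<delta> c F g)"
  proof (cases "\<exists>c. 0 \<in> ball c (\<delta> / 2) \<and> limit_chart_inf \<delta> c F")
    case True
    then show ?thesis using ninf half by blast
  next
    case False
    then have "\<not> (\<forall>z\<in>UNIV. \<exists>c\<in>UNIV. z \<in> ball c (\<delta> / 2) \<and> limit_chart_inf \<delta> c (G \<circ> l))"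
      unfolding F_def by blast
    then obtain g where "g nicely_meromorphic_on UNIV"
      "\<forall>z\<in>UNIV. \<exists>c\<in>UNIV. z \<in> ball c (\<delta> / 2) \<and> (limit_chart1 \<delta> c (G \<circ> l) g \<or> limit_chart2 \<delta> c (G \<circ> l) g)"
      using l(2) by blast
    then show ?thesis unfolding F_def[symmetric] by (intro that) blast+
  qed
  have charts: "\<exists>c. z \<in> ball c \<delta> \<and> (limit_chart1 \<delta> c F g \<or> limit_chart2 \<delta> c F g)" for z
    using g(2)[of z] half by blast
  have "yosida g (\<delta> / 2)"
  proof
    show "\<delta> / 2 > 0" "g nicely_meromorphic_on UNIV" using \<delta> g by auto
    show "tame (\<delta> / 2) g z \<or> tame (\<delta> / 2) (\<lambda>w. inverse (g w)) z" for z
    proof -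
      obtain c where c: "z \<in> ball c (\<delta> / 2)" "limit_chart1 \<delta> c F g \<or> limit_chart2 \<delta> c F g" using g(2) by blast
      \<comment> \<open>Each z lies in the half disc of some chart, so the chart contains a disc of
        radius \<open>\<delta>\<close> / 2 about z; this is the radius kept for g.\<close>
      have "ball z (\<delta> / 2) \<subseteq> ball c \<delta>"
      proof
        fix w assume "w \<in> ball z (\<delta> / 2)"
        then show "w \<in> ball c \<delta>" using c(1) dist_triangle[of c w z] by simp
      qed
      then have "tame (\<delta> / 2) h z" if "tame \<delta> h c" for h
        using that holomorphic_on_subset[of h "ball c \<delta>" "ball z (\<delta> / 2)"] unfolding tame_def by blast
      then show ?thesis using c(2) unfolding limit_chart1_def limit_chart2_def tame_inv_def by blast
    qed
    show "\<not> g constant_on UNIV"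
    proof
      assume "g constant_on UNIV"
      then obtain C where C: "\<And>w. g w = C" by (auto simp: constant_on_def)
      obtain c where c: "0 \<in> ball c \<delta>" "limit_chart1 \<delta> c F g \<or> limit_chart2 \<delta> c F g" using charts by blast
      have "\<not> limit_chart2 \<delta> c F g"
        using inv_const[OF c(1), of "\<lambda>w. inverse (g w)" "inverse C"] C by (auto simp: limit_chart2_def)
      then have l1: "eventually (\<lambda>v. tame \<delta> (F v) c) sequentially" "chart_limit \<delta> c F g"
        using c(2) by (auto simp: limit_chart1_def)
      have hol: "eventually (\<lambda>v. F v holomorphic_on ball c \<delta>) sequentially"
        using l1(1) by (rule eventually_mono) (simp add: tame_def)
      have "eventually (\<lambda>v. norm (deriv (F v) 0) < 1) sequentially"
        by (rule deriv_small_of_constant_limit[OF l1(2) hol]) (use C c in auto)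
      from this hol
      have "eventually (\<lambda>v. False) sequentially"
      proof eventually_elim
        case (elim v)
        have np: "\<not> is_pole (F v) 0" by (rule not_is_pole_holomorphic[OF open_ball c(1) elim(2)])
        have "density \<alpha> (F v) 0 \<ge> 1" using f(8)[of "l v"] by (simp add: F_def)
        from density_ge_1(1)[OF \<alpha> this np] show ?case using elim(1) by linarith
      qed
      then show False by simp
    qed
  qed
  then interpret yosida g "\<delta> / 2" .
  interpret my: monomial_yosida n k m t g "\<delta> / 2" by unfold_locales (rule NT)
  have omit: "eventually (\<lambda>v. \<forall>w. norm w \<le> M \<longrightarrow> \<not> is_pole (F v) w \<longrightarrow> norm (F v w) \<le> M \<longrightarrow> P (F v) w \<noteq> b) sequentially" for M
  proof -
    have "eventually (\<lambda>v. \<forall>w. norm w \<le> M \<longrightarrow> \<not> is_pole (G v) w \<longrightarrow> norm (G v w) \<le> M \<longrightarrow> P (G v) w \<noteq> b) sequentially"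
      \<comment> \<open>For a = 0 the second threshold is 0 by convention, and
        \<open>rescaled_omits\<close> yields the contradiction by showing that a is nonzero.\<close>
      using large[of M] large[of "M ^ N / norm a"]
    proof eventually_elim
      case (elim v)
      show ?case
      proof (intro allI impI notI)
        fix w assume w: "norm w \<le> M" "\<not> is_pole (G v) w" "norm (G v w) \<le> M" "P (G v) w = b"
        have wD: "z v + of_real (\<rho> v) * w \<in> D" using f(4) w(1) elim(1) by simp
        have r: "a \<noteq> 0" "norm (G v w) ^ N = norm a / \<rho> v ^ T"
          by (rule rescaled_omits[OF NT \<alpha>_def meroF[OF f(1)] b f(2) sol[OF f(1)] f(5) wD w(2,4)], assumption+)+
        have "\<rho> v ^ T \<le> \<rho> v ^ 1"
        proof (rule power_decreasing)
          have "1 / (real v + 1) \<le> 1" by simp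
          then show "\<rho> v \<le> 1" using f(3)[of v] by linarith
        qed (use f(2)[of v] T_pos in auto)
        also have "\<dots> \<le> 1 / (real v + 1)" using f(3) by simp
        finally have rT: "\<rho> v ^ T \<le> 1 / (real v + 1)" .
        have rp: "\<rho> v ^ T > 0" using f(2) by simp
        have "real v + 1 \<le> 1 / \<rho> v ^ T" using rT rp by (simp add: field_simps)
        then have "norm a * (real v + 1) \<le> norm a * (1 / \<rho> v ^ T)" by (rule mult_left_mono[OF _ norm_ge_zero])
        also have "norm a * (1 / \<rho> v ^ T) = norm (G v w) ^ N" unfolding r(2) by (simp only: times_divide_eq_right mult_1_right)
        also have "\<dots> \<le> M ^ N" by (rule power_mono[OF w(3) norm_ge_zero])
        finally have *: "norm a * (real v + 1) \<le> M ^ N" .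
        have "norm a > 0" using r(1) by simp
        from pos_le_divide_eq[OF this] have "real v + 1 \<le> M ^ N / norm a" using * by (simp only: mult.commute)
        then show False using elim(2) by simp
      qed
    qed
    from sub[OF this] show ?thesis by (simp add: F_def)
  qed
  show ?thesis
  proof (rule that[of g "\<delta> / 2"])
    show "monomial_yosida n k m t g (\<delta> / 2)" by unfold_locales
    show "P g z \<noteq> b" if "\<not> is_pole g z" for z by (rule my.limit_omits_value[OF charts omit that])
    assume hol: "\<And>f. f \<in> \<F> \<Longrightarrow> f holomorphic_on D"
    show "\<not> is_pole g x" for x
    proof (rule limit_has_no_pole[OF charts])
      fix M
      have "eventually (\<lambda>v. \<forall>w. norm w \<le> M \<longrightarrow> \<not> is_pole (G v) w) sequentially"
        using large[of M]
      proof eventually_elim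
        case (elim v)
        show ?case
        proof (intro allI impI)
          fix w :: complex assume "norm w \<le> M"
          then have "z v + of_real (\<rho> v) * w \<in> D" using f(4) elim by simp
          then have "\<not> is_pole (f v) (z v + of_real (\<rho> v) * w)"
            using not_is_pole_holomorphic[OF D(1) _ hol[OF f(1)]] by blast
          moreover have "G v = (\<lambda>w. of_real (\<rho> v powr - \<alpha>) * f v (z v + of_real (\<rho> v) * w))" by (auto simp: f(5))
          ultimately show "\<not> is_pole (G v) w" using f(2)[of v] by (simp add: is_pole_cmult is_pole_affine)
        qed
      qed
      from sub[OF this] show "eventually (\<lambda>v. \<forall>w. norm w \<le> M \<longrightarrow> \<not> is_pole (F v) w) sequentially" by (simp add: F_def)
    qed
  qed
qed

end

section \<open>The normality criterion\<close>

theorem theorem3: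
  fixes D :: "complex set" and \<F> :: "(complex \<Rightarrow> complex) set"
    and a b :: complex and n k :: nat and m t :: "nat \<Rightarrow> nat"
  assumes "open D" and "connected D" and "D \<noteq> {}"
    and "\<forall>f\<in>\<F>. f nicely_meromorphic_on D"
    and "b \<noteq> 0" and "k \<ge> 1"
    and "\<forall>j\<in>{1..k}. m j \<ge> 1" and "\<forall>j\<in>{1..k}. t j \<ge> 1"
    and "\<forall>f\<in>\<F>. solutions D (\<lambda>z. f z ^ (n + (\<Sum>j=1..k. m j))) a =
           solutions D (\<lambda>z. f z ^ n * (\<Prod>j=1..k. (deriv ^^ t j) (\<lambda>w. f w ^ m j) z)) b"
  shows "((\<forall>j\<in>{1..k}. m j \<ge> t j) \<and> n + (\<Sum>j=1..k. m j) \<ge> (\<Sum>j=1..k. t j) + 3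
            \<longrightarrow> normal_family_on \<F> D) \<and>
         ((\<forall>f\<in>\<F>. f holomorphic_on D) \<and>
          (k = 1 \<and> n = 0 \<and> m 1 \<ge> t 1 + 1 \<or>
           (n \<ge> 1 \<or> k \<ge> 2) \<and> (\<forall>j\<in>{1..k}. m j \<ge> t j) \<and>
             n + (\<Sum>j=1..k. m j) \<ge> (\<Sum>j=1..k. t j) + 2)
            \<longrightarrow> normal_family_on \<F> D)"
proof -
  have sol: "f p ^ (n + (\<Sum>j=1..k. m j)) = a"
    if f: "f \<in> \<F>" and p: "p \<in> D" "\<not> is_pole f p" "diff_monomial n k m t f p = b" for f p
  proof -
    have "f analytic_on {p}" using nicely_meromorphic_on_imp_analytic_at[of f D p] assms(4) f p by blast
    then obtain S where S: "open S" "p \<in> S" "f holomorphic_on S" unfolding analytic_at by blast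
    \<comment> \<open>\<open>solutions\<close> discards poles of the whole expression, so p must be
      shown not to be one.\<close>
    have "\<not> is_pole (diff_monomial n k m t f) p"
      by (rule not_is_pole_holomorphic[OF S(1,2) holomorphic_diff_monomial[OF S(3,1)]])
    then have "p \<in> solutions D (\<lambda>z. f z ^ n * (\<Prod>j=1..k. (deriv ^^ t j) (\<lambda>w. f w ^ m j) z)) b"
      using p unfolding solutions_def diff_monomial_def[abs_def] by simp
    then have "p \<in> solutions D (\<lambda>z. f z ^ (n + (\<Sum>j=1..k. m j))) a" using assms(9) f by blast
    then show ?thesis by (simp add: solutions_def)
  qed
  \<comment> \<open>The part common to both claims, which differ only in the reason why the limit
    function cannot exist.\<close>
  have key: thesis
    if tm: "\<forall>j\<in>{1..k}. t j \<le> m j" and NT: "n + (\<Sum>j=1..k. m j) > (\<Sum>j=1..k. t j)" and nn: "\<not> normal_family_on \<F> D"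
      and *: "\<And>g d. monomial_yosida n k m t g d \<Longrightarrow> (\<And>z. \<not> is_pole g z \<Longrightarrow> diff_monomial n k m t g z \<noteq> b) \<Longrightarrow>
        ((\<forall>f\<in>\<F>. f holomorphic_on D) \<Longrightarrow> (\<And>z. \<not> is_pole g z)) \<Longrightarrow> thesis" for thesis
  proof -
    interpret monomial n k m t by unfold_locales (use assms tm in auto)
    have NT': "N > T" using NT by (simp add: N_def T_def)
    have mero: "\<And>f. f \<in> \<F> \<Longrightarrow> f nicely_meromorphic_on D" using assms(4) by blast
    show thesis
    proof (rule rescaling_limit[where D = D and \<F> = \<F> and b = b and a = a, OF NT' assms(1-3)])
      show "f nicely_meromorphic_on D" if "f \<in> \<F>" for f by (rule mero[OF that])
      show "b \<noteq> 0" "\<not> normal_family_on \<F> D" by (fact assms(5) nn)+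
      show "f p ^ N = a" if "f \<in> \<F>" "p \<in> D" "\<not> is_pole f p" "P f p = b" for f p
        unfolding N_def by (rule sol[OF that])
      fix g d
      assume A: "monomial_yosida n k m t g d" "\<And>z. \<not> is_pole g z \<Longrightarrow> P g z \<noteq> b"
        "(\<And>f. f \<in> \<F> \<Longrightarrow> f holomorphic_on D) \<Longrightarrow> (\<And>z. \<not> is_pole g z)"
      show thesis by (rule *[OF A(1,2)]) (assumption | rule A(3) | blast)+
    qed
  qed
  show ?thesis
  proof (intro conjI impI)
    assume A: "(\<forall>j\<in>{1..k}. m j \<ge> t j) \<and> n + (\<Sum>j=1..k. m j) \<ge> (\<Sum>j=1..k. t j) + 3"
    show "normal_family_on \<F> D"
    proof (rule ccontr)
      assume nn: "\<not> normal_family_on \<F> D"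
      show False
      proof (rule key[OF _ _ nn])
        fix g d
        assume "monomial_yosida n k m t g d" and om: "\<And>z. \<not> is_pole g z \<Longrightarrow> diff_monomial n k m t g z \<noteq> b"
        then interpret monomial_yosida n k m t g d by simp
        interpret omitted_value n k m t g d b
          by unfold_locales (use om assms(5) A in \<open>auto simp: N_def T_def\<close>)
        show False by (rule no_omitted_value)
      qed (use A in auto)
    qed
  next
    assume A: "(\<forall>f\<in>\<F>. f holomorphic_on D) \<and>
          (k = 1 \<and> n = 0 \<and> m 1 \<ge> t 1 + 1 \<or>
           (n \<ge> 1 \<or> k \<ge> 2) \<and> (\<forall>j\<in>{1..k}. m j \<ge> t j) \<and>
             n + (\<Sum>j=1..k. m j) \<ge> (\<Sum>j=1..k. t j) + 2)"
    then have tm: "\<forall>j\<in>{1..k}. t j \<le> m j" and NT: "n + (\<Sum>j=1..k. m j) > (\<Sum>j=1..k. t j)" by auto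
    \<comment> \<open>For k = 1 and n = 0 the gap is either exactly 1, the borderline case, or at
      least 2, as in the other alternative.\<close>
    have cs: "n + (\<Sum>j=1..k. m j) \<ge> (\<Sum>j=1..k. t j) + 2 \<or> k = 1 \<and> n = 0 \<and> m 1 = t 1 + 1"
      using A by auto
    show "normal_family_on \<F> D"
    proof (rule ccontr)
      assume nn: "\<not> normal_family_on \<F> D"
      show False
      proof (rule key[OF tm NT nn])
        fix g d
        assume "monomial_yosida n k m t g d" and om: "\<And>z. \<not> is_pole g z \<Longrightarrow> diff_monomial n k m t g z \<noteq> b"
          and np: "(\<forall>f\<in>\<F>. f holomorphic_on D) \<Longrightarrow> (\<And>z. \<not> is_pole g z)"
        then interpret monomial_yosida n k m t g d by simp
        have np': "\<And>z. \<not> is_pole g z" using np A by blast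
        have om': "\<And>z. P g z \<noteq> b" using om np' by blast
        from cs show False
        proof
          assume "n + (\<Sum>j=1..k. m j) \<ge> (\<Sum>j=1..k. t j) + 2"
          then show False by (intro entire_picard[OF np' om' assms(5)]) (simp add: N_def T_def)
        next
          assume "k = 1 \<and> n = 0 \<and> m 1 = t 1 + 1"
          then show False by (intro entire_picard_borderline[OF np' om' assms(5)]) auto
        qed
      qed
    qed
  qed
qed

end
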